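(* Let $p>2$, let $\phi$ be a previsible process with values in $\mathbb{R}^{d\times m}$ such that $\int_0^\infty\mathbb{E}|\phi(s)|^p\,\mathrm{d}s<\infty$, and let $K:(0,\infty)\to\mathbb{R}^{d\times d}$ be a completely monotone kernel with measure $\mu$ such that $$M_p:=\left|\int_0^\infty x^{\frac{2-p}{2p}}\,\mu(\mathrm{d}x)\right|<\infty.$$ 1) The following inequality holds: $$\mathbb{E}\left[\sup_{t\in[0,+\infty)}\left|\int_0^t K(t-s)\phi(s)\,\mathrm{d}W_s\right|^p\right]\le C_{p,d,m}\,M_p^p\int_0^\infty\mathbb{E}|\phi(s)|^p\,\mathrm{d}s,$$ where $C_{p,d,m}=d^{\frac{3p-4}{2}}\,m^{p-1}\,\mathbf{b}_p\,\Gamma\left(\frac{p-2}{2p^2}\right)^{p/2}\Gamma\left(\frac{p-2}{2p}\right)^{p-1}$ and $\mathbf{b}_p:=2p^{p/2}$. 2) Furthermore, for $d=1$, the following kernels are completely monotone and their measures satisfy $M_p<\infty$ for the indicated values of $p$: a) $K_{\beta,H}(t)=e^{-\beta t}t^{H-\frac12}$ for all $t>0$, where $\beta>0$ and $H\in(0,\frac12]$, for every $p>1/H$; b) $R_\lambda(t)=\lambda t^{H-\frac12}E_{H+\frac12,H+\frac12}\left(-\lambda t^{H+\frac12}\right)$ for all $t>0$, where $H\in(0,\frac12)$ and $\lambda>0$, for every $p>1/H$.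
   Context: Fix $d,m\in\mathbb{N}$ (positive integers) and a filtered probability space $(\Omega,\mathcal{F},(\mathcal{F}_t)_{t\ge0},\mathbb{P})$ satisfying the usual conditions and carrying an $m$-dimensional Brownian motion $W$. The notation $|\cdot|$ denotes the Euclidean norm on $\mathbb{R}^d$ and the Frobenius norm on $\mathbb{R}^{d\times d}$ and $\mathbb{R}^{d\times m}$. $\Gamma$ is the Gamma function and $E_{\alpha,\beta}(z)=\sum_{n\ge0}\frac{z^n}{\Gamma(\alpha n+\beta)}$ is the Mittag-Leffler function. A kernel $K:(0,\infty)\to\mathbb{R}^{d\times d}$ is called completely monotone (with measure $\mu$) if there exists a non-negative ($\mathbb{R}^{d\times d}$-valued, i.e. each entry is a non-negative measure) measure $\mu$ on $[0,\infty)$ such that $K(t)=\int_0^\infty e^{-xt}\,\mu(\mathrm{d}x)$ for all $t>0$. In the definition of $M_p$ the integral is taken over $[0,\infty)$, entrywise, with the convention $0^{a}=+\infty$ for $a<0$. *)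

theory Defs
  imports "HOL-Probability.Probability"
begin

section \<open>Filtered probability spaces, Brownian motion, previsible processes\<close>

text \<open>Filtrations and processes are indexed by the time set \<open>[0,\<infinity>)\<close>, rendered as a function on
  \<^typ>\<open>real\<close> of which only the restriction to nonnegative times is ever used.\<close>

definition filtered_prob_space :: "'a measure \<Rightarrow> (real \<Rightarrow> 'a measure) \<Rightarrow> bool" where
  "filtered_prob_space M F \<longleftrightarrow>
     prob_space M \<and>
     (\<forall>t\<ge>0. subalgebra M (F t)) \<and>
     (\<forall>s t. 0 \<le> s \<and> s \<le> t \<longrightarrow> sets (F s) \<subseteq> sets (F t))"

definition usual_conditions :: "'a measure \<Rightarrow> (real \<Rightarrow> 'a measure) \<Rightarrow> bool" where
  "usual_conditions M F \<longleftrightarrow>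
     complete_measure M \<and>
     null_sets M \<subseteq> sets (F 0) \<and>
     (\<forall>t\<ge>0. sets (F t) = (\<Inter>u\<in>{t<..}. sets (F u)))"

text \<open>Standard Brownian motion relative to the filtration \<open>F\<close>: the increment \<open>W\<^sub>t - W\<^sub>s\<close> is
  independent of \<open>F\<^sub>s\<close> and has law \<open>N(0, (t - s) I)\<close>, i.e. independent \<open>N(0, t - s)\<close> components.\<close>

definition brownian_motion ::
    "'a measure \<Rightarrow> (real \<Rightarrow> 'a measure) \<Rightarrow> (real \<Rightarrow> 'a \<Rightarrow> real ^ 'm) \<Rightarrow> bool" where
  "brownian_motion M F W \<longleftrightarrow>
     (\<forall>t\<ge>0. W t \<in> borel_measurable (F t)) \<and>
     (AE \<omega> in M. W 0 \<omega> = 0) \<and>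
     (AE \<omega> in M. continuous_on {0..} (\<lambda>t. W t \<omega>)) \<and>
     (\<forall>s t. 0 \<le> s \<and> s < t \<longrightarrow>
        prob_space.indep_set M (sets (F s))
          {(\<lambda>\<omega>. W t \<omega> - W s \<omega>) -` A \<inter> space M | A. A \<in> sets borel} \<and>
        prob_space.indep_vars M (\<lambda>_. borel) (\<lambda>k \<omega>. (W t \<omega> - W s \<omega>) $ k) UNIV \<and>
        (\<forall>k. distributed M lborel (\<lambda>\<omega>. (W t \<omega> - W s \<omega>) $ k) (normal_density 0 (sqrt (t - s)))))"

text \<open>These rectangles generate the same sigma-algebra as the left-continuous adapted processes.\<close>

definition previsible_sigma :: "'a measure \<Rightarrow> (real \<Rightarrow> 'a measure) \<Rightarrow> (real \<times> 'a) measure" where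
  "previsible_sigma M F =
     sigma ({0..} \<times> space M)
       ({{s<..t} \<times> A | s t A. 0 \<le> s \<and> s \<le> t \<and> A \<in> sets (F s)} \<union> {{0} \<times> A | A. A \<in> sets (F 0)})"

definition previsible ::
    "'a measure \<Rightarrow> (real \<Rightarrow> 'a measure) \<Rightarrow> (real \<Rightarrow> 'a \<Rightarrow> 'b::topological_space) \<Rightarrow> bool" where
  "previsible M F H \<longleftrightarrow> (\<lambda>(s, \<omega>). H s \<omega>) \<in> borel_measurable (previsible_sigma M F)"


section \<open>The Ito integral\<close>

text \<open>Elementary integrands \<open>\<Sum>k<n. \<xi>\<^sub>k 1\<^bsub>(\<tau>\<^sub>k, \<tau>\<^sub>k\<^sub>+\<^sub>1]\<^esub>\<close> with deterministic partition points and bounded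
  \<open>F\<^bsub>\<tau>\<^sub>k\<^esub>\<close>-measurable matrix-valued coefficients, and their integral over \<open>[0,T]\<close>.\<close>

definition elementary_integrand ::
    "'a measure \<Rightarrow> (real \<Rightarrow> 'a measure) \<Rightarrow> nat \<Rightarrow> (nat \<Rightarrow> real) \<Rightarrow> (nat \<Rightarrow> 'a \<Rightarrow> real ^ 'm ^ 'd) \<Rightarrow> bool" where
  "elementary_integrand M F n \<tau> \<xi> \<longleftrightarrow>
     0 \<le> \<tau> 0 \<and>
     (\<forall>k<n. \<tau> k \<le> \<tau> (Suc k)) \<and>
     (\<forall>k<n. \<xi> k \<in> borel_measurable (F (\<tau> k)) \<and> (\<exists>B. \<forall>\<omega>\<in>space M. norm (\<xi> k \<omega>) \<le> B))"

definition elementary_process ::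
    "nat \<Rightarrow> (nat \<Rightarrow> real) \<Rightarrow> (nat \<Rightarrow> 'a \<Rightarrow> real ^ 'm ^ 'd) \<Rightarrow> real \<Rightarrow> 'a \<Rightarrow> real ^ 'm ^ 'd" where
  "elementary_process n \<tau> \<xi> s \<omega> = (\<Sum>k<n. indicator {\<tau> k<..\<tau> (Suc k)} s *\<^sub>R \<xi> k \<omega>)"

definition elementary_integral ::
    "(real \<Rightarrow> 'a \<Rightarrow> real ^ 'm) \<Rightarrow> nat \<Rightarrow> (nat \<Rightarrow> real) \<Rightarrow> (nat \<Rightarrow> 'a \<Rightarrow> real ^ 'm ^ 'd) \<Rightarrow> real \<Rightarrow> 'a \<Rightarrow> real ^ 'd" where
  "elementary_integral W n \<tau> \<xi> T \<omega> =
     (\<Sum>k<n. \<xi> k \<omega> *v (W (min (\<tau> (Suc k)) T) \<omega> - W (min (\<tau> k) T) \<omega>))"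

text \<open>\<open>has_ito_integral M F W H T X\<close> says that \<open>X\<close> is (a version of) \<open>\<integral>\<^sub>0\<^sup>T H\<^sub>s dW\<^sub>s\<close>, the
  \<open>L\<^sup>2\<close>-extension of the elementary integral. It entails \<open>E \<integral>\<^sub>0\<^sup>T |H\<^sub>s|\<^sup>2 ds < \<infinity>\<close> and determines \<open>X\<close> almost
  surely. Only the values of \<open>H\<close> on \<open>[0,T]\<close> matter.\<close>

definition has_ito_integral ::
    "'a measure \<Rightarrow> (real \<Rightarrow> 'a measure) \<Rightarrow> (real \<Rightarrow> 'a \<Rightarrow> real ^ 'm) \<Rightarrow>
     (real \<Rightarrow> 'a \<Rightarrow> real ^ 'm ^ 'd) \<Rightarrow> real \<Rightarrow> ('a \<Rightarrow> real ^ 'd) \<Rightarrow> bool" where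
  "has_ito_integral M F W H T X \<longleftrightarrow>
     previsible M F (\<lambda>s \<omega>. indicator {0..T} s *\<^sub>R H s \<omega>) \<and>
     X \<in> borel_measurable M \<and>
     (\<exists>n \<tau> \<xi>.
        (\<forall>j. elementary_integrand M F (n j) (\<tau> j) (\<xi> j)) \<and>
        (\<lambda>j. \<integral>\<^sup>+ \<omega>. (\<integral>\<^sup>+ s\<in>{0..T}. ennreal ((norm (elementary_process (n j) (\<tau> j) (\<xi> j) s \<omega> - H s \<omega>))\<^sup>2) \<partial>lborel) \<partial>M)
          \<longlonglongrightarrow> 0 \<and>
        (\<lambda>j. \<integral>\<^sup>+ \<omega>. ennreal ((norm (elementary_integral W (n j) (\<tau> j) (\<xi> j) T \<omega> - X \<omega>))\<^sup>2) \<partial>M)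
          \<longlonglongrightarrow> 0)"

text \<open>The random variables \<open>\<integral>\<^sub>0\<^sup>t K(t-s) \<phi>(s) dW\<^sub>s\<close> are defined for each \<open>t\<close> only up to null sets, so that a
  supremum over all \<open>t \<ge> 0\<close> refers to a version with continuous paths; any two such versions are
  indistinguishable. The value of \<open>K\<close> at \<open>0\<close> enters only through the null set \<open>s = t\<close>.\<close>

definition continuous_stoch_convolution ::
    "'a measure \<Rightarrow> (real \<Rightarrow> 'a measure) \<Rightarrow> (real \<Rightarrow> 'a \<Rightarrow> real ^ 'm) \<Rightarrow>
     (real \<Rightarrow> real ^ 'd ^ 'd) \<Rightarrow> (real \<Rightarrow> 'a \<Rightarrow> real ^ 'm ^ 'd) \<Rightarrow> (real \<Rightarrow> 'a \<Rightarrow> real ^ 'd) \<Rightarrow> bool" where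
  "continuous_stoch_convolution M F W K \<phi> X \<longleftrightarrow>
     (\<forall>t\<ge>0. has_ito_integral M F W (\<lambda>s \<omega>. K (t - s) ** \<phi> s \<omega>) t (X t)) \<and>
     (AE \<omega> in M. continuous_on {0..} (\<lambda>t. X t \<omega>))"


section \<open>Completely monotone kernels\<close>

text \<open>The matrix-valued measure is given by its entries; the integral is taken entrywise.\<close>

definition completely_monotone_with ::
    "(real \<Rightarrow> real ^ 'd ^ 'd) \<Rightarrow> ('d \<Rightarrow> 'd \<Rightarrow> real measure) \<Rightarrow> bool" where
  "completely_monotone_with K \<mu> \<longleftrightarrow>
     (\<forall>i j. sets (\<mu> i j) = sets (restrict_space borel {0..})) \<and>
     (\<forall>t>0. \<forall>i j. has_bochner_integral (\<mu> i j) (\<lambda>x. exp (- x * t)) (K t $ i $ j))"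

definition completely_monotone :: "(real \<Rightarrow> real ^ 'd ^ 'd) \<Rightarrow> bool" where
  "completely_monotone K \<longleftrightarrow> (\<exists>\<mu>. completely_monotone_with K \<mu>)"

text \<open>Real powers with the convention \<open>0\<^sup>a = \<infinity>\<close> for \<open>a < 0\<close> (whereas \<open>0 powr a = 0\<close> in the library).\<close>

definition epowr :: "real \<Rightarrow> real \<Rightarrow> ennreal" where
  "epowr x a = (if x = 0 \<and> a < 0 then \<infinity> else ennreal (x powr a))"

definition M_entry :: "real \<Rightarrow> ('d \<Rightarrow> 'd \<Rightarrow> real measure) \<Rightarrow> 'd \<Rightarrow> 'd \<Rightarrow> ennreal" where
  "M_entry p \<mu> i j = (\<integral>\<^sup>+ x. epowr x ((2 - p) / (2 * p)) \<partial>\<mu> i j)"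

text \<open>The norm of \<^typ>\<open>real ^ 'd ^ 'd\<close> is the Frobenius norm; it is infinite as soon as one entry is.\<close>

definition M_const :: "real \<Rightarrow> ('d::finite \<Rightarrow> 'd \<Rightarrow> real measure) \<Rightarrow> ennreal" where
  "M_const p \<mu> =
     (if \<exists>i j. M_entry p \<mu> i j = \<infinity> then \<infinity>
      else ennreal (norm (\<chi> i j. enn2real (M_entry p \<mu> i j))))"


section \<open>Constants and special functions\<close>

definition b_const :: "real \<Rightarrow> real" where
  "b_const p = 2 * p powr (p / 2)"

definition C_const :: "real \<Rightarrow> nat \<Rightarrow> nat \<Rightarrow> real" where
  "C_const p d m =
     real d powr ((3 * p - 4) / 2) * real m powr (p - 1) * b_const p *
     Gamma ((p - 2) / (2 * p\<^sup>2)) powr (p / 2) * Gamma ((p - 2) / (2 * p)) powr (p - 1)"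

definition mittag_leffler :: "real \<Rightarrow> real \<Rightarrow> real \<Rightarrow> real" where
  "mittag_leffler \<alpha> \<beta> z = (\<Sum>n. z ^ n / Gamma (\<alpha> * real n + \<beta>))"

text \<open>For \<open>d = 1\<close>: a scalar kernel as a kernel of \<open>1 \<times> 1\<close> matrices.\<close>

definition scalar_kernel :: "(real \<Rightarrow> real) \<Rightarrow> real \<Rightarrow> real ^ 1 ^ 1" where
  "scalar_kernel k t = (\<chi> i j. k t)"

definition K_gamma :: "real \<Rightarrow> real \<Rightarrow> real \<Rightarrow> real" where
  "K_gamma \<beta> H t = exp (- \<beta> * t) * t powr (H - 1/2)"

definition R_resolvent :: "real \<Rightarrow> real \<Rightarrow> real \<Rightarrow> real" where
  "R_resolvent l H t =
     l * t powr (H - 1/2) * mittag_leffler (H + 1/2) (H + 1/2) (- l * t powr (H + 1/2))"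

end

theory Submission
 imports Defs "HOL-Complex_Analysis.Complex_Analysis" "HOL-Real_Asymp.Real_Asymp"
begin

text \<open>
By Bernstein's representation the convolution is a \<open>\<mu>\<close>-mixture of the Ornstein-Uhlenbeck processes
\<open>Y x t = \<integral> exp (- x * (t - s)) * h s dW s\<close> over \<open>0 < s < t\<close>. The increments of \<open>Y x\<close> have \<open>p\<close>-th moments controlled by
discrete hypercontractivity, and chaining on the time scale \<open>1 / x\<close> bounds the \<open>L p\<close>-norm of \<open>SUP t. abs (Y x t)\<close>
by a constant times \<open>x powr (1/p - 1/2)\<close>. Integrating in \<open>x\<close> against \<open>\<mu>\<close> with Jensen's inequality
gives the maximal inequality for dyadic integrands, and previsible integrands follow by density in \<open>L p\<close>.
The dimensional factors come from estimating entry by entry.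

Finiteness of \<open>M p\<close> depends on the kernel only, because
\<open>\<integral> x powr (- a) d\<mu> = 1 / Gamma a * \<integral> t powr (a - 1) * K t dt\<close> by Tonelli. The representing
measure of the resolvent has as density the jump of \<open>z \<mapsto> l / (z powr (H + 1/2) + l)\<close> across the negative
axis; this is verified by the residue theorem and the uniqueness of Laplace transforms.
\<close>

text \<open>What is chained is \<open>Y x t - exp (- x * (t - s)) * Y x s\<close>, the integral over
  \<open>(s, t]\<close> alone: its \<open>p\<close>-th moments over disjoint blocks add up to at
  most the integral of the \<open>p\<close>-th moment of \<open>h\<close> over the whole half-line,
  and the factor \<open>exp (- x * (t - s))\<close> forgets the past, so that the bound does not
  grow with the time horizon. An Ito integral is fixed only up to a null set depending on
  \<open>x\<close> and \<open>t\<close>, whereas the mixture needs joint measurability in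
  \<open>x\<close> and continuity in \<open>t\<close>; for dyadic integrands it is a finite sum of
  Brownian increments, and everything can be defined path by path. As the bound is claimed for every
  continuous version, uniqueness of the Ito integral has to be established too, whence the
  \<open>L 2\<close> estimates beside those in \<open>L p\<close>. The maximal inequality is proved
  with its own constant \<open>cc p\<close>; only at the end is \<open>cc p powr p\<close> compared
  with the Gamma factors, through log-convexity of Gamma. The numerical estimates there leave little
  room, which dictates the care spent on each constant.\<close>

abbreviation bmeas :: "'a measure => ('a => 'b::topological_space) set"
 where "bmeas M \<equiv> borel_measurable M"

abbreviation product_measure :: "'a measure => 'b measure => ('a \<times> 'b) measure" (infixr "\<Otimes>" 80)
 where "M \<Otimes> N \<equiv> M \<Otimes>\<^sub>M N"

abbreviation lebesgue_nn :: "(real => ennreal) => ennreal" (binder "\<L>" 10)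
 where "lebesgue_nn f \<equiv> integral\<^sup>N lborel f"

abbreviation halfline_nn :: "(real => ennreal) => ennreal" (binder "\<H>" 10)
 where "halfline_nn f \<equiv> \<integral>\<^sup>+x\<in>{0<..}. f x \<partial>lborel"

abbreviation seq_tendsto :: "(nat => 'a::topological_space) => 'a => bool" (infixr "\<leadsto>" 60)
 where "X \<leadsto> l \<equiv> X \<longlonglongrightarrow> l"

context prob_space
begin

abbreviation nn_expectation :: "('a => ennreal) => ennreal" (binder "\<E>" 10)
 where "nn_expectation f \<equiv> integral\<^sup>N M f"

end

section \<open>Convexity inequalities for sums and integrals\<close>

text \<open>The tangent of \<open>u powr p\<close> at \<open>A\<close>, solved for \<open>u\<close>.
  The right-hand side is linear in \<open>u powr p\<close>, so it can be summed or integrated first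
  and \<open>A\<close> optimised afterwards; the weighted inequalities of Hoelder and Jensen below
  are obtained in this way.\<close>

lemma young_tangent: fixes u A p :: real assumes "u >= 0" "A > 0" "p >= 1"
 shows "u <= (1 - 1/p) * A + (1/p) * (A powr (1 - p) * u powr p)" proof (cases "u = 0")
 case True thus ?thesis using assms by (simp add: field_simps)
next case False
 with assms have u: "u > 0" by simp
 let ?A = "A powr (1 - 1/p) * (A powr (1 - p) * u powr p) powr (1/p)"
 have "?A <= (1 - 1/p) * A + (1/p) * (A powr (1 - p) * u powr p)"
  by (rule Youngs_inequality_0) (use assms u in \<open>auto simp: field_simps\<close>)
 moreover have "?A = u"
  using assms u by (simp add: powr_mult powr_powr mult.assoc[symmetric] powr_add[symmetric] diff_divide_distrib)
 ultimately show ?thesis by simp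
qed

text \<open>Hoelder's inequality with free weights \<open>w\<close>, sharp when \<open>u\<close> is
  proportional to \<open>w\<close>. With known bounds on the norms of the \<open>u i\<close> as
  weights it yields the triangle inequality of \<open>L p\<close> at the level of
  \<open>p\<close>-th powers.\<close>

lemma powr_sum_le: fixes u w :: "'i => real" and q :: real
 assumes "q >= 1" "finite I" "!!i. i : I ==> u i >= 0" "!!i. i : I ==> w i > 0"
 shows "(\<Sum>i\<in>I. u i) powr q <= (\<Sum>i\<in>I. w i) powr (q - 1) * (\<Sum>i\<in>I. w i powr (1 - q) * u i powr q)"
proof (cases "(\<Sum>i\<in>I. u i) = 0")
 case True thus ?thesis using assms by (auto intro!: sum_nonneg mult_nonneg_nonneg)
next case False
 define U where "U = (\<Sum>i\<in>I. u i)"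
 define W where "W = (\<Sum>i\<in>I. w i)"
 define Q where "Q = (\<Sum>i\<in>I. w i powr (1 - q) * u i powr q)"
 have U: "U > 0" using False sum_nonneg[of I u] assms unfolding U_def by fastforce
 have "I ~= {}" using False by auto
 hence W: "W > 0" unfolding W_def using assms by (intro sum_pos) auto
 \<comment> \<open>The weighted mean of \<open>u / w\<close> is the optimal point of tangency: the
   constant terms then add up to \<open>(1 - 1/q) * U\<close>.\<close>
 define A where "A = U / W"
 have A: "A > 0" using U W by (simp add: A_def)
 let ?B = "%i. (1 - 1/q) * A * w i + (1/q) * A powr (1 - q) * (w i powr (1 - q) * u i powr q)"
 have "u i <= ?B i" if "i : I" for i proof -
  have w: "w i > 0" using assms that by simp
  let ?A = "A powr (1 - q) * (u i / w i) powr q"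
  have "u i / w i <= (1 - 1/q) * A + (1/q) * ?A"
   using assms(3)[OF that] w A assms(1) by (intro young_tangent) (auto intro!: divide_nonneg_pos)
  hence "u i <= ((1 - 1/q) * A + (1/q) * ?A) * w i" using w by (simp add: pos_divide_le_eq)
  also have "(u i / w i) powr q * w i = w i powr (1 - q) * u i powr q"
   using w assms(3)[OF that] by (simp add: powr_divide powr_diff field_simps)
  hence "((1 - 1/q) * A + (1/q) * ?A) * w i = ?B i" by (simp add: distrib_right mult.assoc)
  finally show ?thesis .
 qed
 hence "U <= (\<Sum>i\<in>I. (1 - 1/q) * A * w i + (1/q) * A powr (1 - q) * (w i powr (1 - q) * u i powr q))"
  unfolding U_def by (rule sum_mono)
 also have "... = (1 - 1/q) * A * W + (1/q) * A powr (1 - q) * Q"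
  unfolding W_def Q_def by (simp add: sum.distrib sum_distrib_left)
 also have "(1 - 1/q) * A * W = (1 - 1/q) * U" using W by (simp add: A_def)
 finally have "(1/q) * U <= (1/q) * (A powr (1 - q) * Q)" by (simp add: algebra_simps)
 hence "U <= A powr (1 - q) * Q" using assms(1) by (simp add: divide_le_cancel)
 hence "A powr (q - 1) * U <= A powr (q - 1) * (A powr (1 - q) * Q)" by (intro mult_left_mono) auto
 also have "... = Q" using A by (simp add: mult.assoc[symmetric] powr_add[symmetric])
 finally have "W powr (q - 1) * (A powr (q - 1) * U) <= W powr (q - 1) * Q" by (intro mult_left_mono) auto
 also have "W powr (q - 1) * (A powr (q - 1) * U) = U powr q"
  using U W by (simp add: A_def powr_divide powr_diff)
 finally show ?thesis unfolding U_def W_def Q_def .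
qed

lemma powr_add_le: fixes u v :: real assumes "q >= 1" "u >= 0" "v >= 0" "0 < l" "l < 1"
 shows "(u + v) powr q <= l powr (1 - q) * u powr q + (1 - l) powr (1 - q) * v powr q"
 using powr_sum_le[of q "UNIV::bool set" "%b. if b then u else v" "%b. if b then l else 1 - l"] assms
 by (simp add: UNIV_bool add.commute split: if_splits)

text \<open>The argument of \<open>powr_sum_le\<close> under an integral. Finiteness of the integral
  of \<open>u\<close> is part of the conclusion, since \<open>enn2real\<close> would turn an
  infinite one into 0.\<close>

lemma jensen_nn_integral: fixes u w :: "'b => real" and q W :: real
 assumes q: "q >= 1" and [measurable]: "u : bmeas N" "w : bmeas N"
  and u: "!!x. x : space N ==> u x >= 0" and w: "!!x. x : space N ==> w x > 0"
  and W: "(\<integral>\<^sup>+x. w x \<partial>N) <= ennreal W" "W > 0"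
  and fin: "(\<integral>\<^sup>+x. ennreal (w x powr (1 - q) * u x powr q) \<partial>N) < \<infinity>"
 shows "(\<integral>\<^sup>+x. u x \<partial>N) < \<infinity>"
  and "ennreal (enn2real (\<integral>\<^sup>+x. u x \<partial>N) powr q) <= ennreal (W powr (q - 1)) * (\<integral>\<^sup>+x. ennreal (w x powr (1 - q) * u x powr q) \<partial>N)"
proof -
 let ?B = "%x. w x powr (1 - q) * u x powr q"
 let ?C = "\<integral>\<^sup>+x. ennreal (?B x) \<partial>N"
 define Q where "Q = enn2real ?C"
 have Q: "?C = ennreal Q" unfolding Q_def using fin by simp
 have Q0: "Q >= 0" unfolding Q_def by simp
 let ?A = "\<integral>\<^sup>+x. u x \<partial>N"
 have main: "?A <= ennreal ((1 - 1/q) * A * W + (1/q) * A powr (1 - q) * Q)" if A: "A > 0" for A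
 proof -
  have "u x <= (1 - 1/q) * A * w x + (1/q) * A powr (1 - q) * (?B x)" if "x : space N" for x proof -
   have w': "w x > 0" using w that by simp
   let ?D = "%A. ((1 - 1/q) * A + (1/q) * (A powr (1 - q) * (u x / w x) powr q)) * w x"
   have "u x / w x <= (1 - 1/q) * A + (1/q) * (A powr (1 - q) * (u x / w x) powr q)"
    using u[OF that] w' A q by (intro young_tangent) (auto intro!: divide_nonneg_pos)
   hence "u x <= ?D A" using w' by (simp add: pos_divide_le_eq)
   also have "(u x / w x) powr q * w x = w x powr (1 - q) * u x powr q"
    using w' u[OF that] by (simp add: powr_divide powr_diff field_simps)
   hence "?D A = (1 - 1/q) * A * w x + (1/q) * A powr (1 - q) * (?B x)"
    by (simp add: distrib_right mult.assoc)
   finally show ?thesis .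
  qed
  hence "?A <= (\<integral>\<^sup>+x. ennreal ((1 - 1/q) * A * w x + (1/q) * A powr (1 - q) * (?B x)) \<partial>N)"
   by (intro nn_integral_mono ennreal_leI)
  also have "... = (\<integral>\<^sup>+x. ennreal ((1 - 1/q) * A) * ennreal (w x) + ennreal ((1/q) * A powr (1 - q)) * ennreal (?B x) \<partial>N)"
  proof (intro nn_integral_cong)
   fix x assume x: "x : space N"
   have c: "(1 - 1/q) * A >= 0" "(1/q) * A powr (1 - q) >= 0" using q A by auto
   show "ennreal ((1 - 1/q) * A * w x + (1/q) * A powr (1 - q) * (?B x)) = ennreal ((1 - 1/q) * A) * ennreal (w x) + ennreal ((1/q) * A powr (1 - q)) * ennreal (?B x)"
    unfolding ennreal_mult'[OF c(1), symmetric] ennreal_mult'[OF c(2), symmetric]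
    by (rule ennreal_plus; rule mult_nonneg_nonneg[OF c(1)] mult_nonneg_nonneg[OF c(2)]) (use w[OF x] in auto)
  qed
  also have "... = ennreal ((1 - 1/q) * A) * (\<integral>\<^sup>+x. w x \<partial>N) + ennreal ((1/q) * A powr (1 - q)) * ennreal Q"
   by (simp add: nn_integral_add nn_integral_cmult Q)
  also have "... <= ennreal ((1 - 1/q) * A) * ennreal W + ennreal ((1/q) * A powr (1 - q)) * ennreal Q"
   by (intro add_right_mono mult_left_mono W) auto
  also have "... = ennreal ((1 - 1/q) * A * W + (1/q) * A powr (1 - q) * Q)" proof -
   have c: "(1 - 1/q) * A >= 0" "(1/q) * A powr (1 - q) >= 0" using q A by auto
   show ?thesis unfolding ennreal_mult'[OF c(1), symmetric] ennreal_mult'[OF c(2), symmetric]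
    by (rule ennreal_plus[symmetric]; rule mult_nonneg_nonneg[OF c(1)] mult_nonneg_nonneg[OF c(2)]) (use W Q0 in auto)
  qed
  finally show ?thesis .
 qed
 \<comment> \<open>Any point of tangency gives finiteness; the sharp one, \<open>U / W\<close>, can
   be formed only after that.\<close>
 show fin': "?A < \<infinity>" using main[of 1] by (simp add: order_le_less_trans)
 define U where "U = enn2real ?A"
 have U0: "U >= 0" by (simp add: U_def)
 have Ueq: "?A = ennreal U" unfolding U_def using fin' by simp
 show "ennreal (enn2real ?A powr q) <= ennreal (W powr (q - 1)) * ?C" proof (cases "U = 0")
  case True thus ?thesis by (simp add: U_def[symmetric])
 next case False
  with U0 have U: "U > 0" by simp
  define A where "A = U / W"
  have A: "A > 0" using U W by (simp add: A_def)
  have "U <= (1 - 1/q) * A * W + (1/q) * A powr (1 - q) * Q"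
   using main[OF A] U0 q A W Q0 unfolding Ueq by (subst (asm) ennreal_le_iff) auto
  also have "(1 - 1/q) * A * W = (1 - 1/q) * U" using W by (simp add: A_def)
  finally have "(1/q) * U <= (1/q) * (A powr (1 - q) * Q)" by (simp add: algebra_simps)
  hence "U <= A powr (1 - q) * Q" using assms(1) by (simp add: divide_le_cancel)
  hence "A powr (q - 1) * U <= A powr (q - 1) * (A powr (1 - q) * Q)" by (intro mult_left_mono) auto
  also have "... = Q" using A by (simp add: mult.assoc[symmetric] powr_add[symmetric])
  finally have "W powr (q - 1) * (A powr (q - 1) * U) <= W powr (q - 1) * Q" by (intro mult_left_mono) auto
  also have "W powr (q - 1) * (A powr (q - 1) * U) = U powr q"
   using U W by (simp add: A_def powr_divide powr_diff)
  finally show ?thesis unfolding Q U_def[symmetric] using Q0 by (simp add: ennreal_mult'[symmetric])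
 qed
qed

section \<open>Two-point inequality and Gaussian moments\<close>

text \<open>With \<open>h\<close> the left-hand side, the claim is that
  \<open>g = h powr (2/p) - (p - 1) * y^2\<close> does not exceed \<open>g 0 = 1\<close>. Here
  \<open>g\<close> has zero derivative at 0 and is concave: in its second derivative the term with
  the square of \<open>h1\<close> has the sign of \<open>2/p - 1\<close>, and the one with
  \<open>h2\<close> is controlled by \<open>h2 <= p * (p - 1) * h powr (1 - 2/p)\<close>.\<close>

lemma two_point_unit: fixes p y :: real assumes p: "p >= 2" and y: "0 <= y" "y < 1"
 shows "((1 + y) powr p + (1 - y) powr p) / 2 <= (1 + (p - 1) * y^2) powr (p / 2)" proof -
 define h where "h = (%y::real. ((1 + y) powr p + (1 - y) powr p) / 2)"
 define h1 where "h1 = (%y::real. p * ((1 + y) powr (p - 1) - (1 - y) powr (p - 1)) / 2)"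
 define h2 where "h2 = (%y::real. p * (p - 1) * ((1 + y) powr (p - 2) + (1 - y) powr (p - 2)) / 2)"
 have dh: "DERIV h x :> h1 x" if "0 <= x" "x < 1" for x unfolding h_def h1_def using that
  by (auto intro!: derivative_eq_intros simp: algebra_simps diff_divide_distrib)
 have dh1: "DERIV h1 x :> h2 x" if "0 <= x" "x < 1" for x unfolding h1_def h2_def using that
  by (auto intro!: derivative_eq_intros simp: algebra_simps diff_divide_distrib add_divide_distrib)
 have hpos: "h x > 0" if "0 <= x" "x < 1" for x
  unfolding h_def using that by (auto intro!: add_pos_nonneg)
 have h2le: "h2 x <= p * (p - 1) * h x powr (1 - 2/p)" if x: "0 <= x" "x < 1" for x proof -
  define t where "t = 1 - 2/p"
  have t: "0 <= t" "t <= 1" using p by (auto simp: t_def field_simps)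
  define m where "m = h x"
  have m: "m > 0" using hpos x by (simp add: m_def)
  \<comment> \<open>Concavity of the power \<open>t\<close>, expressed by its tangent at
    \<open>m\<close>. As \<open>m\<close> is the mean of \<open>u powr p\<close> over
    \<open>u = 1 + x\<close> and \<open>u = 1 - x\<close>, averaging leaves
    \<open>m powr t\<close>.\<close>
  have bern: "(u powr p) powr t <= m powr t * (1 - t + t * (u powr p / m))" if "u > 0" for u proof -
   have "1 powr (1 - t) * (u powr p / m) powr t <= (1 - t) * 1 + t * (u powr p / m)"
    by (rule Youngs_inequality_0) (use t m that in auto)
   hence "m powr t * (u powr p / m) powr t <= m powr t * (1 - t + t * (u powr p / m))"
    by (intro mult_left_mono) auto
   thus ?thesis using m by (simp add: powr_divide)
  qed
  have e: "(u powr p) powr t = u powr (p - 2)" if "u > 0" for u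
   using p by (simp add: powr_powr t_def right_diff_distrib)
  have "(1 + x) powr (p - 2) + (1 - x) powr (p - 2) <= m powr t * (1 - t + t * ((1 + x) powr p / m)) + m powr t * (1 - t + t * ((1 - x) powr p / m))"
   using bern[of "1 + x"] bern[of "1 - x"] e[of "1 + x"] e[of "1 - x"] x by simp
  also have "... = m powr t * (2 * (1 - t) + t * (2 * h x / m))"
   using m by (simp add: h_def field_simps)
  also have "... = 2 * m powr t" using m by (simp add: m_def[symmetric] field_simps)
  finally have "(1 + x) powr (p - 2) + (1 - x) powr (p - 2) <= 2 * h x powr (1 - 2/p)"
   by (simp add: m_def t_def)
  hence "(p * (p - 1) / 2) * ((1 + x) powr (p - 2) + (1 - x) powr (p - 2)) <= (p * (p - 1) / 2) * (2 * h x powr (1 - 2/p))"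
   using p by (intro mult_left_mono) auto
  thus ?thesis by (simp add: h2_def)
 qed
 define g1 where "g1 = (%x. (2/p) * (h x powr (2/p - 1) * h1 x) - 2 * (p - 1) * x)"
 have dg1: "EX z. DERIV g1 x :> z & z <= 0" if x: "0 <= x" "x < 1" for x proof -
  let ?A = "%x. (2/p - 1) * h x powr (2/p - 2) * h1 x * h1 x + h x powr (2/p - 1) * h2 x"
  have "((%x. h x powr (2/p - 1)) has_real_derivative (2/p - 1) * h x powr (2/p - 2) * h1 x) (at x)"
   using DERIV_fun_powr[OF dh[OF x] hpos[OF x], of "2/p - 1"] by (simp add: algebra_simps)
  hence "DERIV g1 x :> (2/p) * (?A x) - 2 * (p - 1)" unfolding g1_def
   by (intro DERIV_diff DERIV_cmult DERIV_cong[OF DERIV_mult[OF _ dh1[OF x]]])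
    (assumption, simp, auto intro!: derivative_eq_intros)
  moreover have "(2/p - 1) * h x powr (2/p - 2) * h1 x * h1 x <= 0" proof -
   have "(2/p - 1) * (h x powr (2/p - 2) * (h1 x * h1 x)) <= 0"
    using p by (intro mult_nonpos_nonneg mult_nonneg_nonneg[OF _ zero_le_square]) auto
   thus ?thesis by (simp add: mult.assoc)
  qed
  moreover have "h x powr (2/p - 1) * h2 x <= h x powr (2/p - 1) * (p * (p - 1) * h x powr (1 - 2/p))"
   by (intro mult_left_mono h2le x) auto
  moreover have "h x powr (2/p - 1) * (p * (p - 1) * h x powr (1 - 2/p)) = p * (p - 1)"
   using hpos[OF x] by (simp add: mult.left_commute powr_add[symmetric])
  ultimately have XY: "(2/p - 1) * h x powr (2/p - 2) * h1 x * h1 x + h x powr (2/p - 1) * h2 x <= p * (p - 1)"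
   and D: "DERIV g1 x :> (2/p) * (?A x) - 2 * (p - 1)" by linarith+
  have "(2/p) * (?A x) <= (2/p) * (p * (p - 1))" using p by (intro mult_left_mono XY) auto
  also have "... = 2 * (p - 1)" using p by simp
  finally show ?thesis using D by (intro exI conjI) auto
 qed
 have g10: "g1 0 = 0" by (simp add: g1_def h1_def)
 have g1le: "g1 x <= 0" if "0 <= x" "x < 1" for x proof -
  have "g1 x <= g1 0" by (rule DERIV_nonpos_imp_nonincreasing[OF that(1)]) (use dg1 that in auto)
  thus ?thesis by (simp add: g10)
 qed
 define g where "g = (%x. h x powr (2/p) - (p - 1) * x^2)"
 have "g y <= g 0" proof (rule DERIV_nonpos_imp_nonincreasing[OF y(1)])
  fix x assume "0 <= x" "x <= y"
  hence x: "0 <= x" "x < 1" using y by auto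
  have "((%x. h x powr (2/p)) has_real_derivative (2/p) * h x powr (2/p - 1) * h1 x) (at x)"
   using DERIV_fun_powr[OF dh[OF x] hpos[OF x], of "2/p"] by (simp add: algebra_simps)
  hence "DERIV g x :> g1 x" unfolding g_def g1_def
   by (intro DERIV_cong[OF DERIV_diff[where E = "(p - 1) * (2 * x)"]])
    (assumption, auto intro!: derivative_eq_intros simp: algebra_simps)
  thus "EX z. DERIV g x :> z & z <= 0" using g1le[OF x] by auto
 qed
 hence "h y powr (2/p) <= 1 + (p - 1) * y^2" by (simp add: g_def h_def)
 hence "(h y powr (2/p)) powr (p/2) <= (1 + (p - 1) * y^2) powr (p/2)"
  using p by (intro powr_mono2) auto
 moreover have "(h y powr (2/p)) powr (p/2) = h y" using p hpos[OF y] by (simp add: powr_powr)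
 ultimately show ?thesis by (simp add: h_def)
qed

text \<open>Two-point hypercontractivity: since the Brownian increments are symmetric, it passes to discrete martingale
 transforms and yields the constant \<open>kap p\<close> below.\<close>

lemma two_point: fixes p a b :: real assumes p: "p >= 2"
 shows "(abs (a + b) powr p + abs (a - b) powr p) / 2 <= (a^2 + (p - 1) * b^2) powr (p / 2)" proof -
 have strict: "(abs (a + b) powr p + abs (a - b) powr p) / 2 <= (a^2 + (p - 1) * b^2) powr (p / 2)"
  if "abs b < abs a" for a b :: real proof -
  define y where "y = abs b / abs a"
  have a: "abs a > 0" using that by auto
  have y: "0 <= y" "y < 1" using that a by (auto simp: y_def)
  have b: "abs b = abs a * y" using a by (simp add: y_def)
  have "abs (a + b) powr p + abs (a - b) powr p = (abs a + abs b) powr p + (abs a - abs b) powr p"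
  proof -
   have "abs (a + b) = abs a + abs b & abs (a - b) = abs a - abs b | abs (a + b) = abs a - abs b & abs (a - b) = abs a + abs b" using that by arith
   thus ?thesis by auto
  qed
  also have "... = abs a powr p * ((1 + y) powr p + (1 - y) powr p)"
   using a y unfolding b by (simp add: powr_mult[symmetric] distrib_left algebra_simps)
  finally have "(abs (a + b) powr p + abs (a - b) powr p) / 2 = abs a powr p * (((1 + y) powr p + (1 - y) powr p) / 2)"
   by simp
  also have "... <= abs a powr p * (1 + (p - 1) * y^2) powr (p / 2)"
   by (intro mult_left_mono two_point_unit p y) auto
  also have "abs a powr p = (abs a^2) powr (p/2)"
   using a by (simp add: powr_powr flip: powr_numeral del: power2_abs)
  also have "(abs a^2) powr (p/2) * (1 + (p - 1) * y^2) powr (p / 2) = (abs a^2 * (1 + (p - 1) * y^2)) powr (p/2)"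
   using p by (simp add: powr_mult)
  also have "abs a^2 * (1 + (p - 1) * y^2) = a^2 + (p - 1) * b^2"
   using a by (simp add: y_def power_divide distrib_left)
  finally show ?thesis .
 qed
 consider "abs b < abs a" | "abs a < abs b" | "abs a = abs b" by linarith
 thus ?thesis proof cases
  case 1 thus ?thesis by (rule strict)
 \<comment> \<open>Exchanging \<open>a\<close> and \<open>b\<close> does not change the left-hand
   side; for \<open>abs a < abs b\<close> and \<open>p >= 2\<close> it can only lower the right-hand
   side.\<close>
 next case 2
  have "(abs (a + b) powr p + abs (a - b) powr p) / 2 <= (b^2 + (p - 1) * a^2) powr (p / 2)"
   using strict[OF 2] by (simp add: add.commute abs_minus_commute)
  also have "... <= (a^2 + (p - 1) * b^2) powr (p / 2)" proof (rule powr_mono2)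
   have "a^2 <= b^2" using 2 by (simp add: abs_le_square_iff[symmetric])
   hence "(p - 2) * a^2 <= (p - 2) * b^2" using p by (intro mult_left_mono) auto
   thus "b^2 + (p - 1) * a^2 <= a^2 + (p - 1) * b^2" by (simp add: algebra_simps)
  qed (use p in auto)
  finally show ?thesis .
 \<comment> \<open>The boundary \<open>y = 1\<close> is outside the range of \<open>strict\<close>.
   There the claim reduces to \<open>2 powr (p - 1) <= p powr (p / 2)\<close>, an equality at
   \<open>p = 2\<close>.\<close>
 next case 3
  have "(abs (a + b) powr p + abs (a - b) powr p) / 2 = (2 * abs a) powr p / 2"
   using 3 p by (auto simp: abs_eq_iff abs_mult)
  also have "... = 2 powr (p - 1) * abs a powr p" by (simp add: powr_mult powr_diff)
  also have "... <= p powr (p / 2) * abs a powr p" proof (intro mult_right_mono)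
   have "(p - 1) * ln 2 <= (p/2) * ln p" proof -
    define f where "f = (%x::real. (x/2) * ln x - (x - 1) * ln 2)"
    have "f 2 <= f p" proof (rule DERIV_nonneg_imp_nondecreasing[OF p])
     fix x :: real assume x: "2 <= x" "x <= p"
     have "DERIV f x :> ln x / 2 + 1/2 - ln 2"
      unfolding f_def using x by (auto intro!: derivative_eq_intros)
     moreover have "ln 2 <= ln x" using x by simp
     moreover have "ln 2 <= (1::real)" using ln_2_less_1 by simp
     ultimately show "EX y. DERIV f x :> y & y >= 0" by (intro exI conjI) auto
    qed
    thus ?thesis by (simp add: f_def)
   qed
   thus "2 powr (p - 1) <= p powr (p/2)" using p by (simp add: powr_def)
  qed auto
  also have "abs a powr p = (a^2) powr (p/2)" proof -
   have "(abs a^2) powr (p/2) = abs a powr p"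
    by (cases "a = 0") (simp_all add: powr_powr flip: powr_numeral del: power2_abs)
   thus ?thesis by simp
  qed
  also have "p powr (p / 2) * (a^2) powr (p/2) = (p * a^2) powr (p/2)"
   using p by (simp add: powr_mult)
  also have "p * a^2 = a^2 + (p - 1) * b^2" proof -
   have "b^2 = a^2" using 3 by (metis power2_abs)
   thus ?thesis by (simp add: algebra_simps)
  qed
  finally show ?thesis .
 qed
qed

text \<open>The exponent \<open>3/8\<close> is chosen for the product with a normal density of
  deviation \<open>s\<close>: what remains is \<open>1/2 - 3/8 = 1/8\<close>, the exponent of a
  normal density of deviation \<open>2 * s\<close>. The constant then follows from
  \<open>8 / 3 <= exp 1\<close>.\<close>

lemma powr_le_exp_square: fixes x s p :: real assumes p: "p > 0" and s: "s > 0"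
 shows "abs x powr p <= (p * s^2 / 2) powr (p/2) * exp (3 * x^2 / (8 * s^2))" proof (cases "x = 0")
 case True thus ?thesis by simp
next case False
 define t where "t = 3 * x^2 / (4 * p * s^2)"
 have t: "t > 0" using p s False by (simp add: t_def)
 have absx: "abs x powr p = (x^2) powr (p/2)" proof -
  have "(abs x^2) powr (p/2) = abs x powr p"
   using False by (simp add: powr_powr flip: powr_numeral del: power2_abs)
  thus ?thesis by simp
 qed
 have "x^2 = (4 * p * s^2 / 3) * t" using p s by (simp add: t_def)
 also have "... <= (4 * p * s^2 / 3) * exp (t - 1)"
  using exp_ge_add_one_self[of "t - 1"] p by (intro mult_left_mono) auto
 also have "... = (4 * p * s^2 / 3) / exp 1 * exp t" by (simp add: exp_diff)
 also have "... <= (p * s^2 / 2) * exp t" proof (intro mult_right_mono)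
  have "8 / 3 <= exp (1::real)" proof -
   have "(\<Sum>n<4. 1 / fact n) <= (\<Sum>n. inverse (fact n) * (1::real) ^ n)"
    using sum_le_suminf[OF summable_exp[of "1::real"], of "{..<4}"] by (simp add: inverse_eq_divide)
   thus ?thesis by (simp add: exp_def eval_nat_numeral scaleR_conv_of_real inverse_eq_divide)
  qed
  hence "4 / 3 / exp (1::real) <= 1 / 2" by (simp add: field_simps)
  hence "(p * s^2) * (4 / 3 / exp 1) <= (p * s^2) * (1 / 2)" using p by (intro mult_left_mono) auto
  thus "4 * p * s^2 / 3 / exp 1 <= p * s^2 / 2" by (simp add: field_simps)
 qed auto
 finally have "x^2 <= (p * s^2 / 2) * exp t" .
 hence "abs x powr p <= ((p * s^2 / 2) * exp t) powr (p/2)"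
  unfolding absx using p by (intro powr_mono2) auto
 also have "... = (p * s^2 / 2) powr (p/2) * exp (t * (p/2))"
  using p by (subst powr_mult) (auto simp: exp_powr_real)
 also have "t * (p/2) = 3 * x^2 / (8 * s^2)" using p by (simp add: t_def field_simps)
 finally show ?thesis .
qed

text \<open>By \<open>powr_le_exp_square\<close> the integrand is at most a multiple of
  \<open>normal_density 0 (2 * s)\<close>, which integrates to 1; the factor 2 is the quotient of
  the normalising constants.\<close>

lemma nn_integral_normal_abs_powr_le: fixes s p :: real assumes p: "p > 0" and s: "s > 0"
 shows "(\<L> x. ennreal (normal_density 0 s x) * ennreal (abs x powr p)) <= ennreal (2 * (p * s^2 / 2) powr (p/2))"
proof -
 let ?B = "ennreal (2 * (p * s^2 / 2) powr (p/2))"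
 let ?C = "%x. ennreal (normal_density 0 (2 * s) x)"
 have "ennreal (normal_density 0 s x) * ennreal (abs x powr p) <= ?B * ?C x" for x proof -
  let ?A = "normal_density 0 s x * ((p * s^2 / 2) powr (p/2) * exp (3 * x^2 / (8 * s^2)))"
  have "normal_density 0 s x * abs x powr p <= ?A"
   by (intro mult_left_mono powr_le_exp_square p s) auto
  also have "normal_density 0 s x * exp (3 * x^2 / (8 * s^2)) = 2 * normal_density 0 (2 * s) x"
  proof -
   have "- (x^2 / (2 * s^2)) + 3 * x^2 / (8 * s^2) = - (x^2 / (2 * (2 * s)^2))"
    using s by (simp add: field_simps)
   moreover have "sqrt (2 * pi * (2 * s)^2) = 2 * sqrt (2 * pi * s^2)" proof -
    have e: "2 * pi * (2 * s)^2 = 2^2 * (2 * pi * s^2)" by (simp add: power_mult_distrib)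
    show ?thesis unfolding e by (simp only: real_sqrt_mult[of "2^2"] real_sqrt_abs)
   qed
   ultimately show ?thesis unfolding normal_density_def by (simp add: mult_exp_exp)
  qed
  hence "?A = 2 * (p * s^2 / 2) powr (p/2) * normal_density 0 (2 * s) x" by (simp add: algebra_simps)
  finally show ?thesis by (simp add: ennreal_mult'[symmetric] ennreal_leI)
 qed
 hence "(\<L> x. ennreal (normal_density 0 s x) * ennreal (abs x powr p)) <= (\<L> x. ?B * ?C x)"
  by (intro nn_integral_mono)
 also have "... = ?B * (\<L> x. ?C x)" by (rule nn_integral_cmult) auto
 also have "(\<L> x. ?C x) = 1" proof -
  interpret prob_space "density lborel (normal_density 0 (2 * s))" by (rule prob_space_normal_density) (use s in simp)
  show ?thesis using emeasure_space_1 by (simp add: emeasure_density)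
 qed
 finally show ?thesis by simp
qed

text \<open>Formulated with bounds \<open>y\<close> and \<open>z\<close> on the norms instead of the
  norms themselves, so that nothing has to be known about their values at the point of use. The
  weight \<open>l = y / (y + z)\<close> is the sharp one in \<open>powr_add_le\<close>.\<close>

lemma minkowski_nn_integral:
 fixes u v :: "'b => real" assumes q: "q >= 1" and [measurable]: "u : bmeas N" "v : bmeas N"
  and u: "!!x. x : space N ==> u x >= 0" and v: "!!x. x : space N ==> v x >= 0"
  and ab: "y >= 0" "z >= 0"
  and U: "(\<integral>\<^sup>+x. ennreal (u x powr q) \<partial>N) <= ennreal (y powr q)"
  and V: "(\<integral>\<^sup>+x. ennreal (v x powr q) \<partial>N) <= ennreal (z powr q)"
 shows "(\<integral>\<^sup>+x. ennreal ((u x + v x) powr q) \<partial>N) <= ennreal ((y + z) powr q)"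
proof -
 have zero: "AE x in N. w x = 0" if [measurable]: "w : bmeas N" and "(\<integral>\<^sup>+x. ennreal (w x powr q) \<partial>N) <= 0" for w :: "'b => real"
 proof -
  have "AE x in N. ennreal (w x powr q) = 0" using that(2) by (subst nn_integral_0_iff_AE[symmetric]) auto
  thus ?thesis by eventually_elim (simp add: ennreal_eq_0_iff)
 qed
 consider "y = 0" | "z = 0" | "y > 0" "z > 0" using ab by linarith
 thus ?thesis proof cases
  case 1 hence "AE x in N. u x = 0" using zero[of u] U by simp
  hence "(\<integral>\<^sup>+x. ennreal ((u x + v x) powr q) \<partial>N) = (\<integral>\<^sup>+x. ennreal (v x powr q) \<partial>N)"
   by (intro nn_integral_cong_AE) auto
  thus ?thesis using V 1 by simp
 next case 2
  hence "AE x in N. v x = 0" using zero[of v] V by simp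
  hence "(\<integral>\<^sup>+x. ennreal ((u x + v x) powr q) \<partial>N) = (\<integral>\<^sup>+x. ennreal (u x powr q) \<partial>N)"
   by (intro nn_integral_cong_AE) auto
  thus ?thesis using U 2 by simp
 next case 3
  define l where "l = y / (y + z)"
  have aux: "(x / t) powr (1 - q) * x powr q = t powr (q - 1) * x" if "x > 0" "t > 0" for x t :: real
   using that by (simp add: powr_divide powr_diff field_simps)
  have l: "0 < l" "l < 1" "1 - l = z / (y + z)" using 3 by (auto simp: l_def field_simps)
  let ?A = "ennreal ((1 - l) powr (1 - q))"
  have "(\<integral>\<^sup>+x. ennreal ((u x + v x) powr q) \<partial>N) <= (\<integral>\<^sup>+x. ennreal (l powr (1 - q)) * ennreal (u x powr q) + ?A * ennreal (v x powr q) \<partial>N)"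
   using powr_add_le[OF q u v l(1,2)]
   by (intro nn_integral_mono) (simp add: ennreal_mult'[symmetric] ennreal_plus[symmetric] ennreal_leI del: ennreal_plus)
  also have "... = ennreal (l powr (1 - q)) * (\<integral>\<^sup>+x. ennreal (u x powr q) \<partial>N) + ?A * (\<integral>\<^sup>+x. ennreal (v x powr q) \<partial>N)"
   by (simp add: nn_integral_add nn_integral_cmult)
  also have "... <= ennreal (l powr (1 - q)) * ennreal (y powr q) + ?A * ennreal (z powr q)"
   by (intro add_mono mult_left_mono U V) auto
  also have "... = ennreal (l powr (1 - q) * y powr q + (1 - l) powr (1 - q) * z powr q)"
   by (simp add: ennreal_mult'[symmetric] ennreal_plus[symmetric] del: ennreal_plus)
  also have "l powr (1 - q) * y powr q = (y + z) powr (q - 1) * y"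
   unfolding l_def using 3 by (intro aux) auto
  also have "(1 - l) powr (1 - q) * z powr q = (y + z) powr (q - 1) * z"
   unfolding l(3) using 3 by (intro aux) auto
  also have "(y + z) powr (q - 1) * y + (y + z) powr (q - 1) * z = (y + z) powr q"
   using powr_add[of "y + z" "q - 1" 1] 3 by (simp add: distrib_left)
  finally show ?thesis .
 qed
qed

text \<open>Independence of \<open>D\<close> from \<open>G\<close> makes the joint law of
  \<open>V\<close> and \<open>D\<close> a product, so \<open>V\<close> may be frozen while
  \<open>D\<close> is integrated out. This takes the place of conditioning on
  \<open>G\<close>.\<close>

lemma (in prob_space) indep_normal_nn_integral:
 assumes G: "subalgebra M G" and V[measurable]: "V : measurable G S"
  and D[measurable]: "D : bmeas M"
  and ind: "indep_set (sets G) {D -` A \<inter> space M | A. A : sets borel}"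
  and nrm: "distributed M lborel D (normal_density 0 s)"
  and f[measurable]: "f : bmeas (S \<Otimes> borel)"
 shows "(\<E> b. f (V b, D b)) = (\<E> b. (\<L> y. ennreal (normal_density 0 s y) * f (V b, y)))"
proof -
 have VM[measurable]: "V : measurable M S" using measurable_from_subalg[OF G V] .
 have sp: "space G = space M" using G by (simp add: subalgebra_def)
 have dD: "distr M borel D = density lborel (normal_density 0 s)"
  using distributed_distr_eq_density[OF nrm] by (metis distr_cong sets_lborel)
 interpret P: prob_space "distr M borel D" by (rule prob_space_distr) simp
 interpret PV: prob_space "distr M S V" by (rule prob_space_distr) simp
 let ?A = "%x. (V x, D x)"
 let ?B = "S \<Otimes> borel"
 have eq: "distr M S V \<Otimes> distr M borel D = distr M ?B ?A" proof (rule pair_measure_eqI)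
  show "sigma_finite_measure (distr M S V)" "sigma_finite_measure (distr M borel D)" by unfold_locales
  show "sets (distr M S V \<Otimes> distr M borel D) = sets (distr M ?B ?A)"
   by (auto cong: sets_pair_measure_cong)
  fix A B assume "A : sets (distr M S V)" "B : sets (distr M borel D)"
  hence A[measurable]: "A : sets S" and B[measurable]: "B : sets borel" by auto
  let ?D = "V -` A \<inter> space M"
  let ?E = "D -` B \<inter> space M"
  have "V -` A \<inter> space M : sets G" using measurable_sets[OF V A] sp by simp
  hence "prob (?D \<inter> ?E) = prob ?D * prob ?E" using B by (intro indep_setD[OF ind]) auto
  moreover have "?A -` (A \<times> B) \<inter> space M = ?D \<inter> ?E" by auto
  ultimately show "emeasure (distr M S V) A * emeasure (distr M borel D) B = emeasure (distr M ?B ?A) (A \<times> B)"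
   by (simp add: emeasure_distr emeasure_eq_measure ennreal_mult'[symmetric])
 qed
 let ?C = "%b. \<L> y. ennreal (normal_density 0 s y) * f (V b, y)"
 have "(\<E> b. f (V b, D b)) = (\<integral>\<^sup>+z. f z \<partial>(distr M ?B ?A))"
  by (subst nn_integral_distr) auto
 also have "... = (\<integral>\<^sup>+v. (\<integral>\<^sup>+y. f (v, y) \<partial>distr M borel D) \<partial>distr M S V)"
  unfolding eq[symmetric] by (subst P.nn_integral_fst[symmetric]) (auto cong: measurable_cong_sets)
 also have "... = (\<E> b. (\<integral>\<^sup>+y. f (V b, y) \<partial>distr M borel D))"
  by (subst nn_integral_distr) (auto intro!: P.borel_measurable_nn_integral cong: measurable_cong_sets)
 also have "... = (\<E> b. (?C b))" proof (intro nn_integral_cong)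
  fix b assume "b : space M"
  hence [measurable]: "(%y. f (V b, y)) : bmeas borel" using measurable_space[OF VM] by measurable
  show "(\<integral>\<^sup>+y. f (V b, y) \<partial>distr M borel D) = (?C b)"
   unfolding dD by (subst nn_integral_density) auto
 qed
 finally show ?thesis .
qed

text \<open>With \<open>X\<close> and \<open>q\<close> frozen, the law of \<open>D\<close> is
  symmetric, so \<open>abs (X + q * D) powr p\<close> may be averaged over the sign of
  \<open>D\<close> and \<open>two_point\<close> applies. The result is a power of the
  \<open>L (p/2)\<close> norm of a sum of squares, where Minkowski's inequality makes squared
  \<open>L p\<close> norms add up.\<close>

lemma (in prob_space) moment_step: fixes X q D :: "'a => real" assumes p: "p >= 2" and s: "s > 0"
  and G: "subalgebra M G" and X: "X : bmeas G" and q: "q : bmeas G" and D[measurable]: "D : bmeas M"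
  and ind: "indep_set (sets G) {D -` A \<inter> space M | A. A : sets borel}"
  and nrm: "distributed M lborel D (normal_density 0 s)"
 shows "(\<E> z. ennreal (abs (X z + q z * D z) powr p)) <= (\<E> z. ennreal (((X z)^2 + (p - 1) * (q z * D z)^2) powr (p/2)))"
  and "(\<E> z. ennreal (abs (q z * D z) powr p)) <= (\<E> z. ennreal (abs (q z) powr p)) * ennreal (2 * (p * s^2 / 2) powr (p/2))"
proof -
 have V: "(%z. (X z, q z)) : measurable G (borel \<Otimes> borel)" using X q by measurable
 note I = indep_normal_nn_integral[OF G V D ind nrm]
 have qM[measurable]: "q : bmeas M" by (rule measurable_from_subalg[OF G q])
 let ?A = "%y. ennreal (normal_density 0 s y)"
 let ?D = "\<E> z. ennreal (abs (X z + q z * D z) powr p)"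
 let ?G = "%z. \<L> y. ?A y * ennreal (((X z)^2 + (p - 1) * (q z * y)^2) powr (p/2))"
 let ?I = "%z. \<L> y. ?A y * ennreal (abs (X z + q z * y) powr p)"
 have "?D = (\<E> z. (?I z))"
  using I[of "%v. ennreal (abs (fst (fst v) + snd (fst v) * snd v) powr p)"] by simp
 also have "... <= (\<E> z. (?G z))" proof (rule nn_integral_mono)
  fix z
  define a b where "a = X z" and "b = q z"
  define J where "J = (%c. \<L> y. ?A y * ennreal (abs (a + c * b * y) powr p))"
  have sym: "J (-1) = J 1" unfolding J_def
   by (subst nn_integral_real_affine[where c = "-1" and t = 0]) (auto simp: normal_density_def)
  let ?J = "%y. a^2 + (p - 1) * (b * y)^2"
  let ?B = "%y. ennreal ((?J y) powr (p/2))"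
  let ?H = "%y. ?A y * ennreal (abs (a + b * y) powr p) + ?A y * ennreal (abs (a - b * y) powr p)"
  have "2 * J 1 = J 1 + J (-1)" by (simp add: sym mult_2)
  also have "... = (\<L> y. ?H y)" unfolding J_def by (subst nn_integral_add[symmetric]) auto
  also have "... <= (\<L> y. 2 * (?A y * ?B y))" proof (rule nn_integral_mono)
   fix y
   have "abs (a + b * y) powr p + abs (a - b * y) powr p <= 2 * (?J y) powr (p/2)"
    using two_point[OF p, of a "b * y"] by simp
   hence "?A y * ennreal (abs (a + b * y) powr p + abs (a - b * y) powr p) <= ?A y * ennreal (2 * (?J y) powr (p/2))"
    by (intro mult_left_mono ennreal_leI) auto
   thus "?H y <= 2 * (?A y * ?B y)" by (simp add: distrib_left ennreal_mult' mult_ac)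
  qed
  also have "... = 2 * (\<L> y. ?A y * ?B y)" by (rule nn_integral_cmult) auto
  finally have "J 1 <= (\<L> y. ?A y * ?B y)" by (subst (asm) ennreal_mult_le_mult_iff) auto
  thus "(?I z) <= (?G z)" by (simp add: J_def a_def b_def)
 qed
 also have "... = (\<E> z. ennreal (((X z)^2 + (p - 1) * (q z * D z)^2) powr (p/2)))"
  using I[of "%v. ennreal (((fst (fst v))^2 + (p - 1) * (snd (fst v) * snd v)^2) powr (p/2))"] by simp
 finally show "?D <= (\<E> z. ennreal (((X z)^2 + (p - 1) * (q z * D z)^2) powr (p/2)))" .
 let ?C = "(\<E> z. ennreal (abs (q z) powr p)) * ennreal (2 * (p * s^2 / 2) powr (p/2))"
 let ?E = "\<E> z. ennreal (abs (q z * D z) powr p)"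
 have "?E = (\<E> z. (\<L> y. ?A y * ennreal (abs (q z * y) powr p)))"
  using I[of "%v. ennreal (abs (snd (fst v) * snd v) powr p)"] by simp
 also have "... = (\<E> z. ennreal (abs (q z) powr p) * (\<L> y. ?A y * ennreal (abs y powr p)))"
  by (intro nn_integral_cong, subst nn_integral_cmult[symmetric])
   (auto simp: abs_mult powr_mult ennreal_mult' mult_ac)
 also have "... <= (\<E> z. ennreal (abs (q z) powr p) * ennreal (2 * (p * s^2 / 2) powr (p/2)))"
  by (intro nn_integral_mono mult_left_mono nn_integral_normal_abs_powr_le) (use p s in auto)
 also have "... = ?C" by (rule nn_integral_multc) auto
 finally show "?E <= ?C" .
qed

section \<open>Moments of discrete stochastic integrals\<close>

text \<open>Per unit of time, a bound on \<open>p - 1\<close> times the squared \<open>L p\<close>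
  norm of a Brownian increment: the constant \<open>2 * (p / 2) powr (p/2)\<close> of the Gaussian
  moment raised to the power \<open>2 / p\<close>, times the factor \<open>p - 1\<close> of the
  two-point inequality.\<close>

definition kap :: "real => real" where
 "kap p = (p - 1) * (p / 2) * 2 powr (2 / p)"

lemma kap_pos: "p > 1 ==> kap p > 0" by (simp add: kap_def)

lemma kap_powr: "p > 1 ==> kap p powr (p/2) = 2 * ((p - 1) * p / 2) powr (p/2)"
 by (simp add: kap_def powr_mult powr_powr powr_divide)

lemma square_powr_half: "(x^2) powr (p/2) = abs (x::real) powr p" proof -
 have "(abs x^2) powr (p/2) = abs x powr p"
  by (cases "x = 0") (simp_all add: powr_powr flip: powr_numeral del: power2_abs)
 thus ?thesis by simp
qed

text \<open>Every path is continuous, not just almost every one, so that the integrals below can be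
  handled pathwise without exceptional sets.\<close>

locale scalar_bm = prob_space M for M :: "'a measure" +
 fixes F :: "real => 'a measure" and w :: "real => 'a => real"
 assumes sub: "!!t. t >= 0 ==> subalgebra M (F t)"
  and F_mono: "!!s t. 0 <= s ==> s <= t ==> sets (F s) \<subseteq> sets (F t)"
  and adapted: "!!t. t >= 0 ==> w t : bmeas (F t)"
  and cont: "!!\<omega>. \<omega> : space M ==> continuous_on {0..} (%t. w t \<omega>)"
  and indep: "!!s t. 0 <= s ==> s < t ==>
   indep_set (sets (F s)) {(%\<omega>. w t \<omega> - w s \<omega>) -` A \<inter> space M | A. A : sets borel}"
  and normal: "!!s t. 0 <= s ==> s < t ==>
   distributed M lborel (%\<omega>. w t \<omega> - w s \<omega>) (normal_density 0 (sqrt (t - s)))"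
begin

lemma space_F: "t >= 0 ==> space (F t) = space M" using sub by (auto simp: subalgebra_def)

lemma F_measurable_mono:
 assumes "0 <= s" "s <= t" "f : measurable (F s) N" shows "f : measurable (F t) N"
 by (rule measurable_from_subalg[OF _ assms(3)])
  (use assms F_mono space_F in \<open>auto simp: subalgebra_def\<close>)

lemma F_measurable_M: "0 <= s ==> f : measurable (F s) N ==> f : measurable M N"
 by (rule measurable_from_subalg[OF sub])

lemma w_measurable[measurable]: "t >= 0 ==> w t : bmeas M" using F_measurable_M adapted by blast

text \<open>Induction on the number of steps: by \<open>moment_step\<close> and Minkowski's
  inequality in \<open>L (p/2)\<close>, a new increment adds to the squared \<open>L p\<close> norm
  \<open>kap p\<close> times its length times the square of \<open>c n\<close>. Measurability of the
  partial sum is carried along because the next step freezes it.\<close>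

lemma increments_moment: fixes v :: "nat => real" and c :: "nat => real"
 assumes p: "p >= 2" and v0: "0 <= v 0" and v: "!!i. i < n ==> v i <= v (Suc i)"
  and y: "!!i. i < n ==> y i : bmeas (F (v i))" and c: "!!i. i < n ==> c i >= 0"
  and yc: "!!i. i < n ==> (\<E> z. ennreal (abs (y i z) powr p)) <= ennreal (c i powr p)"
 shows "0 <= v n & (%z. \<Sum>i<n. y i z * (w (v (Suc i)) z - w (v i) z)) : bmeas (F (v n)) & (\<E> z. ennreal (abs (\<Sum>i<n. y i z * (w (v (Suc i)) z - w (v i) z)) powr p)) <= ennreal ((kap p * (\<Sum>i<n. (v (Suc i) - v i) * (c i)^2)) powr (p/2))"
 using v y c yc proof (induction n)
 case 0 thus ?case using v0 by simp
next case (Suc n)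
 define X where "X = (%z. \<Sum>i<n. y i z * (w (v (Suc i)) z - w (v i) z))"
 define D where "D = (%z. w (v (Suc n)) z - w (v n) z)"
 define S where "S = (\<Sum>i<n. (v (Suc i) - v i) * (c i)^2)"
 have IH: "0 <= v n" "X : bmeas (F (v n))"
  "(\<E> z. ennreal (abs (X z) powr p)) <= ennreal ((kap p * S) powr (p/2))"
  using Suc.IH Suc.prems unfolding X_def S_def by auto
 have le: "v n <= v (Suc n)" using Suc.prems by auto
 have yn: "y n : bmeas (F (v n))" using Suc.prems by auto
 have cn: "c n >= 0" using Suc.prems by auto
 have S0: "S >= 0" unfolding S_def using Suc.prems by (auto intro!: sum_nonneg)
 have XM[measurable]: "X : bmeas M" using F_measurable_M IH by blast
 have yM[measurable]: "y n : bmeas M" using F_measurable_M IH yn by blast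
 have DM[measurable]: "D : bmeas M" unfolding D_def using w_measurable IH(1) le by (intro borel_measurable_diff) auto
 have split: "(\<Sum>i<Suc n. y i z * (w (v (Suc i)) z - w (v i) z)) = X z + y n z * D z" for z
  by (simp add: X_def D_def)
 let ?A = "bmeas (F (v (Suc n)))"
 have "0 <= v (Suc n)" using IH le by simp
 moreover have "(%z. X z + y n z * D z) : ?A" proof -
  have [measurable]: "X : ?A" "y n : ?A"
   "w (v n) : ?A" "w (v (Suc n)) : ?A"
   using F_measurable_mono[OF IH(1) le] IH(2) yn adapted[OF IH(1)] adapted \<open>0 <= v (Suc n)\<close> by auto
  show ?thesis unfolding D_def by measurable
 qed
 moreover have "(\<E> z. ennreal (abs (X z + y n z * D z) powr p)) <= ennreal ((kap p * S + kap p * ((v (Suc n) - v n) * (c n)^2)) powr (p/2))"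
 proof (cases "v n = v (Suc n)")
  case True hence "D z = 0" for z by (simp add: D_def)
  thus ?thesis using IH(3) True by simp
 next case False
  hence lt: "v n < v (Suc n)" using le by simp
  define q where "q = v (Suc n) - v n"
  have q: "q > 0" using lt by (simp add: q_def)
  have nrm: "distributed M lborel D (normal_density 0 (sqrt q))"
   unfolding D_def q_def by (rule normal[OF IH(1) lt])
  have ind: "indep_set (sets (F (v n))) {D -` A \<inter> space M | A. A : sets borel}"
   unfolding D_def by (rule indep[OF IH(1) lt])
  note st = moment_step[OF p _ sub[OF IH(1)] IH(2) yn DM ind nrm]
  let ?D = "q * (c n)^2"
  have "(\<E> z. ennreal (abs (X z + y n z * D z) powr p)) <= (\<E> z. ennreal (((X z)^2 + (p - 1) * (y n z * D z)^2) powr (p/2)))"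
   using st(1) q by simp
  also have "... <= ennreal ((kap p * S + kap p * ?D) powr (p/2))"
  proof (rule minkowski_nn_integral)
   show "(\<E> z. ennreal (((X z)^2) powr (p/2))) <= ennreal ((kap p * S) powr (p/2))"
    using IH(3) by (simp add: square_powr_half)
   let ?B = "\<E> z. ennreal (((p - 1) * (y n z * D z)^2) powr (p/2))"
   let ?C = "ennreal ((p - 1) powr (p/2))"
   let ?E = "ennreal (2 * (p * (sqrt q)^2 / 2) powr (p/2))"
   have "?B = (\<E> z. ?C * ennreal (abs (y n z * D z) powr p))"
    using p by (simp add: powr_mult square_powr_half ennreal_mult')
   also have "... = ?C * (\<E> z. ennreal (abs (y n z * D z) powr p))"
    by (rule nn_integral_cmult) auto
   also have "... <= ?C * ((\<E> z. ennreal (abs (y n z) powr p)) * ?E)"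
    using st(2) q by (intro mult_left_mono) auto
   also have "... <= ?C * (ennreal (c n powr p) * ?E)"
    using Suc.prems(4)[of n] by (intro mult_left_mono mult_right_mono) auto
   also have "... = ennreal ((p - 1) powr (p/2) * (c n powr p * (2 * (p * q / 2) powr (p/2))))"
    using q by (simp add: ennreal_mult')
   also have "(p - 1) powr (p/2) * (c n powr p * (2 * (p * q / 2) powr (p/2))) = (kap p * ?D) powr (p/2)"
    using p q cn square_powr_half[of "c n" p] by (simp add: powr_mult kap_powr powr_divide)
   finally show "?B <= ennreal ((kap p * ?D) powr (p/2))" .
   show "0 <= kap p * S" "0 <= kap p * ?D" using S0 kap_pos[of p] p q by auto
  qed (use p in auto)
  finally show ?thesis by (simp add: q_def)
 qed
 ultimately show ?case unfolding split by (simp add: S_def distrib_left)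
qed

text \<open>Hoelder's inequality over the steps turns the sum of squared norms into an integral in
  time of \<open>p\<close>-th moments, which is additive over intervals; the price is the factor
  \<open>(v n - v 0) powr (p/2 - 1)\<close>.\<close>

lemma increments_moment_holder: fixes v :: "nat => real" and e :: "nat => real"
 assumes p: "p >= 2" and v0: "0 <= v 0" and v: "!!i. i < n ==> v i <= v (Suc i)"
  and y: "!!i. i < n ==> y i : bmeas (F (v i))" and e: "!!i. i < n ==> e i >= 0"
  and yc: "!!i. i < n ==> (\<E> z. ennreal (abs (y i z) powr p)) <= ennreal (e i)"
 shows "(\<E> z. ennreal (abs (\<Sum>i<n. y i z * (w (v (Suc i)) z - w (v i) z)) powr p)) <= ennreal (kap p powr (p/2) * (v n - v 0) powr (p/2 - 1) * (\<Sum>i<n. (v (Suc i) - v i) * e i))"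
proof -
 define q where "q i = v (Suc i) - v i" for i
 have q0: "q i >= 0" if "i < n" for i using v[OF that] by (simp add: q_def)
 \<comment> \<open>Steps of length 0 contribute nothing, but their lengths cannot serve as weights
   in \<open>powr_sum_le\<close>.\<close>
 define I where "I = {i. i < n & q i > 0}"
 have I: "finite I" "I \<subseteq> {..<n}" by (auto simp: I_def)
 have restr: "(\<Sum>i<n. q i * f i) = (\<Sum>i\<in>I. q i * f i)" for f :: "nat => real"
  by (rule sum.mono_neutral_right) (use q0 in \<open>auto simp: I_def not_less intro: antisym\<close>)
 have kp: "kap p > 0" using kap_pos p by simp
 let ?A = "\<Sum>i<n. q i * (e i powr (1/p))^2"
 have "(\<E> z. ennreal (abs (\<Sum>i<n. y i z * (w (v (Suc i)) z - w (v i) z)) powr p)) <= ennreal ((kap p * ?A) powr (p/2))"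
  unfolding q_def
  using increments_moment[of p v n y "%i. e i powr (1/p)"] assms by (simp add: powr_powr)
 also have "(kap p * ?A) powr (p/2) = kap p powr (p/2) * ?A powr (p/2)" by (rule powr_mult)
 also have "... <= kap p powr (p/2) * ((\<Sum>i<n. q i) powr (p/2 - 1) * (\<Sum>i<n. q i * e i))"
 proof (rule mult_left_mono)
  let ?B = "\<Sum>i\<in>I. q i powr (1 - p/2) * (q i * (e i powr (1/p))^2) powr (p/2)"
  have "(\<Sum>i\<in>I. q i * (e i powr (1/p))^2) powr (p/2) <= (\<Sum>i\<in>I. q i) powr (p/2 - 1) * ?B"
   by (rule powr_sum_le) (use p I in \<open>auto simp: I_def\<close>)
  also have "?B = (\<Sum>i\<in>I. q i * e i)" proof (rule sum.cong)
   fix i assume "i : I"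
   hence i: "i < n" "q i > 0" by (auto simp: I_def)
   let ?C = "q i powr (1 - p/2) * (q i * (e i powr (1/p))^2) powr (p/2)"
   have "?C = (q i powr (1 - p/2) * q i powr (p/2)) * ((e i powr (1/p))^2) powr (p/2)"
    using i by (simp add: powr_mult)
   also have "... = q i * e i"
    using i p e[OF i(1)] by (simp add: powr_add[symmetric] square_powr_half powr_powr)
   finally show "?C = q i * e i" .
  qed simp
  finally show "?A powr (p/2) <= (\<Sum>i<n. q i) powr (p/2 - 1) * (\<Sum>i<n. q i * e i)"
   using restr[of "%i. (e i powr (1/p))^2"] restr[of e] restr[of "%_. 1"] by simp
 qed simp
 also have "(\<Sum>i<n. q i) = v n - v 0" unfolding q_def by (rule sum_lessThan_telescope)
 finally show ?thesis by (simp add: q_def mult.assoc ennreal_leI)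
qed

end

section \<open>Dyadic integrands and their integrals\<close>

definition dy :: "nat => nat => real" where
 "dy L i = real i / 2 ^ L"

text \<open>The last grid point strictly below \<open>s\<close>. Strictness matches the cells, which
  are open on the left, and keeps \<open>t - left_dy L s\<close> positive for \<open>s <= t\<close>,
  away from the singularity of the kernel.\<close>

definition left_dy :: "nat => real => real" where
 "left_dy L s = (of_int \<lceil>s * 2 ^ L\<rceil> - 1) / 2 ^ L"

lemma dy_0[simp]: "dy L 0 = 0" by (simp add: dy_def)
lemma dy_nonneg[simp]: "dy L i >= 0" by (simp add: dy_def)
lemma dy_mono: "i <= j ==> dy L i <= dy L j" by (simp add: dy_def divide_right_mono)
lemma dy_less_iff[simp]: "dy L i < dy L j \<longleftrightarrow> i < j" by (simp add: dy_def divide_less_cancel)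
lemma dy_le_iff[simp]: "dy L i <= dy L j \<longleftrightarrow> i <= j" by (simp add: dy_def divide_le_cancel)
lemma dy_Suc: "dy L (Suc i) = dy L i + 1 / 2 ^ L" by (simp add: dy_def add_divide_distrib)
lemma dy_horizon[simp]: "dy L (L * 2 ^ L) = real L" by (simp add: dy_def)
lemma dy_refine: "L <= L' ==> dy L' (i * 2 ^ (L' - L)) = dy L i" proof -
 assume "L <= L'"
 hence "(2::real) ^ L' = 2 ^ L * 2 ^ (L' - L)" by (simp add: power_add[symmetric])
 thus ?thesis by (simp add: dy_def)
qed

lemma left_dy_eq: assumes "dy L i < s" "s <= dy L (Suc i)" shows "left_dy L s = dy L i" proof -
 have "\<lceil>s * 2 ^ L\<rceil> = int i + 1"
  using assms by (intro ceiling_unique) (auto simp: dy_def field_simps)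
 thus ?thesis by (simp add: left_dy_def dy_def)
qed

lemma dy_ex: assumes "s > 0" obtains i where "dy L i < s" "s <= dy L (Suc i)" proof -
 define i where "i = nat (\<lceil>s * 2 ^ L\<rceil> - 1)"
 have c: "\<lceil>s * 2 ^ L\<rceil> >= 1" using assms by simp
 hence i: "real i = of_int \<lceil>s * 2 ^ L\<rceil> - 1" by (simp add: i_def)
 have "real i < s * 2 ^ L" "s * 2 ^ L <= real i + 1"
  unfolding i using ceiling_correct[of "s * 2 ^ L"] by linarith+
 hence "dy L i < s" "s <= dy L (Suc i)" by (auto simp: dy_def field_simps)
 thus ?thesis by (rule that)
qed

lemma dy_unique:
 assumes "dy L i < s" "s <= dy L (Suc i)" "dy L j < s" "s <= dy L (Suc j)" shows "i = j" proof -
 have "dy L i < dy L (Suc j)" "dy L j < dy L (Suc i)" using assms by linarith+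
 thus ?thesis by simp
qed

lemma left_dy_bounds: "left_dy L s < s" "s <= left_dy L s + 1 / 2 ^ L"
 using ceiling_correct[of "s * 2 ^ L"] by (auto simp: left_dy_def field_simps)

context scalar_bm begin

text \<open>Mesh \<open>1 / 2 ^ L\<close> and horizon \<open>L\<close> are tied to one index, so
  that limits and common refinements are a matter of enlarging \<open>L\<close>. The value on a cell
  is read off at its right end and is measurable at its left end.\<close>

definition dyadic :: "nat => (real => 'a => real) => bool" where
 "dyadic L h \<longleftrightarrow>
  (ALL i<L * 2 ^ L. h (dy L (Suc i)) : bmeas (F (dy L i)) &
    (EX B. ALL z:space M. abs (h (dy L (Suc i)) z) <= B)) &
  (ALL i s z. dy L i < s --> s <= dy L (Suc i) --> h s z = h (dy L (Suc i)) z) &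
  (ALL s z. s <= 0 | s > real L --> h s z = 0)"

definition ito :: "nat => (real => 'a => real) => real => 'a => real" where
 "ito L h t z = (\<Sum>i<L * 2 ^ L. h (dy L (Suc i)) z * (w (min (dy L (Suc i)) t) z - w (min (dy L i) t) z))"

lemma dyadicD: assumes "dyadic L h" shows "i < L * 2 ^ L ==> h (dy L (Suc i)) : bmeas (F (dy L i))"
  and "i < L * 2 ^ L ==> EX B. ALL z:space M. abs (h (dy L (Suc i)) z) <= B"
  and "dy L i < s ==> s <= dy L (Suc i) ==> h s z = h (dy L (Suc i)) z"
  and "s <= 0 | s > real L ==> h s z = 0" using assms unfolding dyadic_def by blast+

text \<open>A coarse cell consists of \<open>k\<close> fine ones on which \<open>h\<close> is the
  same, so the increments telescope; fine cells beyond the horizon \<open>L\<close> carry the value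
  0.\<close>

lemma dyadic_refine: assumes h: "dyadic L h" and LL: "L <= L'"
 shows "dyadic L' h" and "ito L' h t y = ito L h t y" proof -
 define k :: nat where "k = 2 ^ (L' - L)"
 have k: "k > 0" by (simp add: k_def)
 have kk: "L * 2 ^ L' = (L * 2 ^ L) * k" using LL by (simp add: k_def mult.assoc power_add[symmetric])
 have dk: "dy L' (m * k) = dy L m" for m unfolding k_def by (rule dy_refine[OF LL])
 have blk: "dy L m <= dy L' i & dy L' (Suc i) <= dy L (Suc m)" if "m = i div k" for i m proof -
  have "m * k <= i" "Suc i <= Suc m * k"
   using that k div_times_less_eq_dividend[of i k] dividend_less_div_times[of k i] by (auto simp: algebra_simps)
  thus ?thesis unfolding dk[symmetric] by simp
 qed
 have lt: "dy L' i < dy L' (Suc i)" for i by simp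
 have val: "h s y = h (dy L (Suc (i div k))) y" if "dy L' i < s" "s <= dy L' (Suc i)" for i s y
  using dyadicD(3)[OF h, of "i div k" s y] blk[OF refl, of i] that by linarith
 show "dyadic L' h" unfolding dyadic_def proof (intro conjI allI impI)
  fix i
  have z: "h (dy L' (Suc i)) = (%_. 0)" if "~ i < L * 2 ^ L * k" proof -
   have "dy L' (Suc i) > dy L' (L * 2 ^ L * k)" using that by simp
   hence "dy L' (Suc i) > real L" unfolding dk by simp
   thus ?thesis using dyadicD(4)[OF h] by auto
  qed
  have nz: "i div k < L * 2 ^ L" if "i < L * 2 ^ L * k"
   using that k by (simp add: div_less_iff_less_mult)
  have e: "h (dy L' (Suc i)) = h (dy L (Suc (i div k)))" using val[OF lt order_refl] by auto
  show "h (dy L' (Suc i)) : bmeas (F (dy L' i))" proof (cases "i < L * 2 ^ L * k")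
   case True show ?thesis unfolding e
    by (rule F_measurable_mono[OF _ _ dyadicD(1)[OF h nz[OF True]]]) (use blk[OF refl, of i] in auto)
  qed (simp add: z)
  show "EX B. ALL y:space M. abs (h (dy L' (Suc i)) y) <= B" proof (cases "i < L * 2 ^ L * k")
   case True show ?thesis unfolding e by (rule dyadicD(2)[OF h nz[OF True]])
  qed (auto simp: z)
  fix s y assume "dy L' i < s" "s <= dy L' (Suc i)"
  thus "h s y = h (dy L' (Suc i)) y" using val[of i s y] val[OF lt order_refl] by simp
 next
  fix s y assume "s <= 0 | real L' < s"
  thus "h s y = 0" using LL by (intro dyadicD(4)[OF h]) auto
 qed
 define g where "g i = w (min (dy L' i) t) y" for i
 have "ito L' h t y = (\<Sum>i<L' * 2 ^ L'. h (dy L' (Suc i)) y * (g (Suc i) - g i))"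
  by (simp add: ito_def g_def)
 also have "... = (\<Sum>i<(L * 2 ^ L) * k. h (dy L' (Suc i)) y * (g (Suc i) - g i))"
 proof (rule sum.mono_neutral_right)
  show "{..<L * 2 ^ L * k} \<subseteq> {..<L' * 2 ^ L'}" unfolding kk[symmetric] using LL by auto
  show "ALL i:{..<L' * 2 ^ L'} - {..<L * 2 ^ L * k}. h (dy L' (Suc i)) y * (g (Suc i) - g i) = 0"
  proof
   fix i assume "i : {..<L' * 2 ^ L'} - {..<L * 2 ^ L * k}"
   hence "dy L' (Suc i) > dy L' (L * 2 ^ L * k)" by simp
   hence "dy L' (Suc i) > real L" unfolding dk by simp
   thus "h (dy L' (Suc i)) y * (g (Suc i) - g i) = 0" using dyadicD(4)[OF h] by auto
  qed
 qed simp
 also have "... = (\<Sum>m<L * 2 ^ L. \<Sum>i\<in>{m * k..<m * k + k}. h (dy L' (Suc i)) y * (g (Suc i) - g i))"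
  by (rule sum.nat_group[symmetric])
 also have "... = (\<Sum>m<L * 2 ^ L. h (dy L (Suc m)) y * (g (Suc m * k) - g (m * k)))"
 proof (rule sum.cong)
  fix m assume "m : {..<L * 2 ^ L}"
  let ?A = "\<Sum>i\<in>{m * k..<m * k + k}. h (dy L' (Suc i)) y * (g (Suc i) - g i)"
  have "?A = (\<Sum>i\<in>{m * k..<m * k + k}. h (dy L (Suc m)) y * (g (Suc i) - g i))"
  proof (rule sum.cong)
   fix i assume "i : {m * k..<m * k + k}"
   hence "i div k = m" by (auto intro!: div_nat_eqI simp: algebra_simps)
   thus "h (dy L' (Suc i)) y * (g (Suc i) - g i) = h (dy L (Suc m)) y * (g (Suc i) - g i)"
    using val[OF lt order_refl, of i y] by simp
  qed simp
  also have "... = h (dy L (Suc m)) y * (g (m * k + k) - g (m * k))"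
   by (simp add: sum_distrib_left[symmetric] sum_Suc_diff')
  finally show "?A = h (dy L (Suc m)) y * (g (Suc m * k) - g (m * k))" by (simp add: add.commute)
 qed simp
 also have "... = ito L h t y" unfolding ito_def g_def dk ..
 finally show "ito L' h t y = ito L h t y" .
qed

lemma dyadic_lincomb: assumes "dyadic L h\<^sub>1" "dyadic L h\<^sub>2"
 shows "dyadic L (%s z. a * h\<^sub>1 s z + b * h\<^sub>2 s z)"
  and "ito L (%s z. a * h\<^sub>1 s z + b * h\<^sub>2 s z) t z = a * ito L h\<^sub>1 t z + b * ito L h\<^sub>2 t z"
proof -
 let ?B = "%s z. a * h\<^sub>1 s z + b * h\<^sub>2 s z"
 show "dyadic L ?B" unfolding dyadic_def proof (intro conjI allI impI)
  fix i assume i: "i < L * 2 ^ L"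
  show "(%z. a * h\<^sub>1 (dy L (Suc i)) z + b * h\<^sub>2 (dy L (Suc i)) z) : bmeas (F (dy L i))"
   using dyadicD(1)[OF assms(1) i] dyadicD(1)[OF assms(2) i] by measurable
  obtain B1 B2 where B: "ALL z:space M. abs (h\<^sub>1 (dy L (Suc i)) z) <= B1" "ALL z:space M. abs (h\<^sub>2 (dy L (Suc i)) z) <= B2"
   using dyadicD(2)[OF assms(1) i] dyadicD(2)[OF assms(2) i] by auto
  show "EX B. ALL z:space M. abs (a * h\<^sub>1 (dy L (Suc i)) z + b * h\<^sub>2 (dy L (Suc i)) z) <= B"
  proof (intro exI ballI)
   fix z assume "z : space M"
   let ?A = "abs (a * h\<^sub>1 (dy L (Suc i)) z + b * h\<^sub>2 (dy L (Suc i)) z)"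
   have "?A <= abs a * abs (h\<^sub>1 (dy L (Suc i)) z) + abs b * abs (h\<^sub>2 (dy L (Suc i)) z)"
    using abs_triangle_ineq[of "a * h\<^sub>1 (dy L (Suc i)) z" "b * h\<^sub>2 (dy L (Suc i)) z"] by (simp add: abs_mult)
   also have "... <= abs a * B1 + abs b * B2" using B \<open>z : space M\<close> by (intro add_mono mult_left_mono) auto
   finally show "?A <= abs a * B1 + abs b * B2" .
  qed
 next
  fix i s z assume "dy L i < s" "s <= dy L (Suc i)"
  thus "a * h\<^sub>1 s z + b * h\<^sub>2 s z = a * h\<^sub>1 (dy L (Suc i)) z + b * h\<^sub>2 (dy L (Suc i)) z"
   using dyadicD(3)[OF assms(1)] dyadicD(3)[OF assms(2)] by metis
 next
  fix s z assume "s <= 0 | s > real L"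
  thus "a * h\<^sub>1 s z + b * h\<^sub>2 s z = 0" using dyadicD(4)[OF assms(1)] dyadicD(4)[OF assms(2)] by simp
 qed
 show "ito L ?B t z = a * ito L h\<^sub>1 t z + b * ito L h\<^sub>2 t z"
  by (simp add: ito_def sum_distrib_left sum.distrib[symmetric] algebra_simps)
qed

text \<open>Both \<open>exp (x * s)\<close> and the kernel \<open>k (t - s)\<close> enter the
  integrands in this form, as deterministic factors sampled at the left ends of the cells.\<close>

lemma dyadic_weight: assumes "dyadic L h" shows "dyadic L (%s z. g (left_dy L s) * h s z)"
 unfolding dyadic_def proof (intro conjI allI impI)
 have l: "left_dy L (dy L (Suc i)) = dy L i" for i by (rule left_dy_eq) auto
 fix i assume i: "i < L * 2 ^ L"
 show "(%z. g (left_dy L (dy L (Suc i))) * h (dy L (Suc i)) z) : bmeas (F (dy L i))"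
  using dyadicD(1)[OF assms(1) i] by measurable
 obtain B where B: "ALL z:space M. abs (h (dy L (Suc i)) z) <= B"
  using dyadicD(2)[OF assms(1) i] by auto
 show "EX B. ALL z:space M. abs (g (left_dy L (dy L (Suc i))) * h (dy L (Suc i)) z) <= B"
  by (intro exI[of _ "abs (g (left_dy L (dy L (Suc i)))) * B"]) (use B in \<open>auto simp: abs_mult intro!: mult_left_mono\<close>)
next
 fix i s z assume s: "dy L i < s" "s <= dy L (Suc i)"
 thus "g (left_dy L s) * h s z = g (left_dy L (dy L (Suc i))) * h (dy L (Suc i)) z"
  using dyadicD(3)[OF assms(1) s] left_dy_eq[OF s] left_dy_eq[of L i "dy L (Suc i)"] by simp
qed (use dyadicD(4)[OF assms] in simp)

lemma ito_measurable: assumes "dyadic L h" "t >= 0" shows "ito L h t : bmeas M" proof -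
 have "h (dy L (Suc i)) : bmeas M" if "i < L * 2 ^ L" for i
  by (rule F_measurable_M[OF dy_nonneg dyadicD(1)[OF assms(1) that]])
 thus ?thesis unfolding ito_def[abs_def] using assms(2)
  by (intro borel_measurable_sum borel_measurable_times borel_measurable_diff w_measurable) auto
qed

lemma ito_continuous: assumes "z : space M" shows "continuous_on {0..} (%t. ito L h t z)" proof -
 have "continuous_on {0..} (%t. w (min c t) z)" if "c >= 0" for c
  by (rule continuous_on_compose2[OF cont[OF assms]]) (use that in \<open>auto intro!: continuous_intros\<close>)
 thus ?thesis unfolding ito_def by (intro continuous_intros) auto
qed

lemma ito_0[simp]: "ito L h 0 z = 0" by (simp add: ito_def min_absorb2)

end

section \<open>Ornstein-Uhlenbeck processes of a dyadic integrand\<close>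

lemma nn_integral_powr_fatou:
 fixes f :: "nat => 'b => real" assumes p: "p > 0" and [measurable]: "!!n. f n : bmeas N"
  and lim: "AE x in N. (%n. f n x) \<leadsto> g x"
  and bnd: "!!n. n >= n0 ==> (\<integral>\<^sup>+x. ennreal (abs (f n x) powr p) \<partial>N) <= C"
 shows "(\<integral>\<^sup>+x. ennreal (abs (g x) powr p) \<partial>N) <= C" proof -
 let ?A = "%n x. ennreal (abs (f n x) powr p)"
 let ?B = "%x. ennreal (abs (g x) powr p)"
 have "(\<integral>\<^sup>+x. ?B x \<partial>N) = (\<integral>\<^sup>+x. liminf (%n. ?A n x) \<partial>N)"
 proof (rule nn_integral_cong_AE)
  show "AE x in N. ?B x = liminf (%n. ?A n x)" using lim proof eventually_elim
   fix x assume "(%n. f n x) \<leadsto> g x"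
   hence "(%n. ?A n x) \<leadsto> ?B x"
    using p by (intro tendsto_ennrealI tendsto_powr' tendsto_rabs tendsto_const) auto
   thus "?B x = liminf (%n. ?A n x)" by (intro lim_imp_Liminf[symmetric]) auto
  qed
 qed
 also have "... <= liminf (%n. \<integral>\<^sup>+x. ?A n x \<partial>N)"
  by (rule nn_integral_liminf) simp
 also have "... <= limsup (%n. \<integral>\<^sup>+x. ?A n x \<partial>N)"
  by (rule Liminf_le_Limsup) simp
 also have "... <= C"
  by (rule Limsup_bounded) (use bnd in \<open>auto simp: eventually_sequentially\<close>)
 finally show ?thesis .
qed

text \<open>Integration by parts for \<open>exp (x * r)\<close> against a merely continuous
  \<open>f\<close>. With \<open>P\<close> the claimed antiderivative, the error on a cell is at most
  the oscillation bound \<open>h\<close> of \<open>f\<close> times the increment of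
  \<open>exp (x * r)\<close>, and these increments telescope.\<close>

lemma exp_stieltjes_limit:
 fixes f :: "real => real" assumes f: "continuous_on {0..} f" and x: "x >= 0" and t: "t >= 0"
 shows "(%l. \<Sum>i<l * 2 ^ l. exp (x * dy l i) * (f (min (dy l (Suc i)) t) - f (min (dy l i) t))) \<leadsto> exp (x * t) * f t - f 0 - integral {0..t} (%r. x * exp (x * r) * f r)"
proof (rule LIMSEQ_I)
 fix q :: real assume q: "q > 0"
 let ?A = "%r. x * exp (x * r) * f r"
 define P where "P u = exp (x * u) * f u - integral {0..u} ?A" for u
 \<comment> \<open>The total error is at most \<open>h * (exp (x * t) - 1)\<close>, which this
   choice keeps below \<open>q\<close>.\<close>
 define h where "h = q / exp (x * t)"
 have h: "h > 0" using q by (simp add: h_def)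
 have ft: "continuous_on {a..b} f" if "0 <= a" for a b
  by (rule continuous_on_subset[OF f]) (use that in auto)
 have int: "?A integrable_on {a..b}" if "0 <= a" for a b
  using ft[OF that] by (intro integrable_continuous_real continuous_intros) auto
 have "uniformly_continuous_on {0..t} f"
  by (rule compact_uniformly_continuous) (use ft[of 0 t] in auto)
 then obtain z where z: "z > 0" "!!u v. u : {0..t} ==> v : {0..t} ==> dist v u < z ==> dist (f v) (f u) < h"
  unfolding uniformly_continuous_on_def using h by metis
 obtain n0 where n0: "(1/2::real) ^ n0 < z" using z(1) real_arch_pow_inv[of z "1/2"] by auto
 obtain n1 :: nat where n1: "t <= real n1" using real_arch_simple by blast
 let ?C = "%l. norm ((\<Sum>i<l * 2 ^ l. exp (x * dy l i) * (f (min (dy l (Suc i)) t) - f (min (dy l i) t))) - (exp (x * t) * f t - f 0 - integral {0..t} ?A))"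
 show "EX no. ALL l>=no. ?C l < q" proof (intro exI allI impI)
  fix l assume l: "l >= max n0 n1"
  have mesh: "1 / 2 ^ l < z" proof -
   have "(1/2::real) ^ l <= (1/2) ^ n0" using l by (intro power_decreasing) auto
   thus ?thesis using n0 by (simp add: power_one_over)
  qed
  define y where "y i = min (dy l i) t" for i
  have y0: "y 0 = 0" using t by (simp add: y_def)
  have yn: "y (l * 2 ^ l) = t" using l n1 by (simp add: y_def min_def)
  have ynn: "0 <= y i" "y i <= t" for i using t by (auto simp: y_def)
  have ym: "y i <= y (Suc i)" for i using dy_mono[of i "Suc i" l] by (auto simp: y_def min_def simp del: dy_le_iff dy_less_iff)
  have summand: "abs (exp (x * dy l i) * (f (y (Suc i)) - f (y i)) - (P (y (Suc i)) - P (y i))) <= h * (exp (x * y (Suc i)) - exp (x * y i))" for i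
  proof (cases "y i = y (Suc i)")
   case False
   define a b where "a = y i" and "b = y (Suc i)"
   have ab: "0 <= a" "a < b" "b <= t" using False ym[of i] ynn by (auto simp: a_def b_def)
   have a: "dy l i = a" using ab dy_mono[of i "Suc i" l] unfolding a_def b_def y_def by (auto simp: min_def simp del: dy_le_iff dy_less_iff split: if_splits)
   have ba: "b - a <= 1 / 2 ^ l" using a unfolding b_def y_def by (simp add: dy_Suc min_def)
   have split: "integral {0..b} ?A = integral {0..a} ?A + integral {a..b} ?A"
    by (rule Henstock_Kurzweil_Integration.integral_combine[symmetric]) (use ab int in auto)
   let ?D = "exp (x * b) - exp (x * a)"
   have E: "((%r. x * exp (x * r)) has_integral ?D) {a..b}"
    by (rule fundamental_theorem_of_calculus)
     (use ab in \<open>auto intro!: derivative_eq_intros simp: has_real_derivative_iff_has_vector_derivative[symmetric]\<close>)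
   have Ef: "((%r. x * exp (x * r) * f b) has_integral (?D * f b)) {a..b}"
    by (rule has_integral_mult_left[OF E])
   let ?B = "%r. x * exp (x * r) * f r - x * exp (x * r) * f b"
   have "exp (x * a) * (f b - f a) - (P b - P a) = integral {a..b} ?A - ?D * f b"
    unfolding P_def split by (simp add: algebra_simps)
   also have "... = integral {a..b} ?B" unfolding integral_unique[OF Ef, symmetric]
    by (rule Henstock_Kurzweil_Integration.integral_diff[symmetric]) (use Ef int[of a b] ab in auto)
   finally have eq: "exp (x * a) * (f b - f a) - (P b - P a) = integral {a..b} ?B" .
   have "norm (integral {a..b} ?B) <= integral {a..b} (%r. h * (x * exp (x * r)))"
   proof (rule integral_norm_bound_integral)
    show "?B integrable_on {a..b}"
     using int[of a b] Ef ab by (intro Henstock_Kurzweil_Integration.integrable_diff) auto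
    show "(%r. h * (x * exp (x * r))) integrable_on {a..b}" using has_integral_mult_right[OF E] by blast
    fix r assume r: "r : {a..b}"
    have "dist r b < z" using r ba mesh by (auto simp: dist_real_def)
    hence "abs (f r - f b) <= h" using z(2)[of b r] r ab by (auto simp: dist_real_def)
    hence "x * exp (x * r) * abs (f r - f b) <= x * exp (x * r) * h" using x by (intro mult_left_mono) auto
    moreover have "norm (x * exp (x * r) * f r - x * exp (x * r) * f b) = x * exp (x * r) * abs (f r - f b)"
     unfolding right_diff_distrib[symmetric] real_norm_def abs_mult using x by simp
    ultimately show "norm (x * exp (x * r) * f r - x * exp (x * r) * f b) <= h * (x * exp (x * r))"
     by (simp only: mult_ac)
   qed
   also have "... = h * ?D" using has_integral_mult_right[OF E] by (rule integral_unique)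
   finally show ?thesis unfolding a using eq by (simp add: a_def b_def)
  qed simp
  have "(\<Sum>i<l * 2 ^ l. P (y (Suc i)) - P (y i)) = P t - P 0"
   by (subst sum_lessThan_telescope) (simp add: y0 yn)
  hence "abs ((\<Sum>i<l * 2 ^ l. exp (x * dy l i) * (f (y (Suc i)) - f (y i))) - (P t - P 0)) = abs (\<Sum>i<l * 2 ^ l. exp (x * dy l i) * (f (y (Suc i)) - f (y i)) - (P (y (Suc i)) - P (y i)))"
   by (simp add: sum_subtractf)
  also have "... <= (\<Sum>i<l * 2 ^ l. h * (exp (x * y (Suc i)) - exp (x * y i)))"
   by (rule order_trans[OF sum_abs]) (intro sum_mono summand)
  also have "... = h * (exp (x * t) - 1)"
   unfolding sum_distrib_left[symmetric] by (subst sum_lessThan_telescope[of "%i. exp (x * y i)"]) (simp add: y0 yn)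
  also have "... < h * exp (x * t)" using h by simp
  also have "... = q" by (simp add: h_def)
  finally show "?C l < q" by (simp add: P_def y_def diff_diff_add add.commute)
 qed
qed

context scalar_bm begin

lemma ito_increment: assumes "s <= t"
 shows "ito L h t z - ito L h s z = (\<Sum>i<L * 2 ^ L. h (dy L (Suc i)) z * (w (max s (min (dy L (Suc i)) t)) z - w (max s (min (dy L i) t)) z))"
proof -
 have "f (min b t) - f (min a t) - (f (min b s) - f (min a s)) = f (max s (min b t)) - f (max s (min a t))"
  for f :: "real => real" and a b proof -
  have "f (min c t) - f (min c s) = f (max s (min c t)) - f s" for c
   using assms by (cases "c <= s") (auto simp: min_def max_def)
  from this[of a] this[of b] show ?thesis by simp
 qed
 from this[of "%r. w r z"] show ?thesis
  unfolding ito_def sum_subtractf[symmetric] right_diff_distrib[symmetric] by simp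
qed

text \<open>Clipping the grid to \<open>[s, t]\<close> turns the increment into a discrete integral
  over \<open>v\<close>, to which \<open>increments_moment_holder\<close> applies. On a cell the
  moment of \<open>h\<close> is constant in time, so the sum obtained is an integral.\<close>

lemma ito_increment_moment: assumes h: "dyadic L h" and p: "p >= 2" and s: "0 <= s" "s <= t"
 shows "(\<E> z. ennreal (abs (ito L h t z - ito L h s z) powr p)) <= ennreal (kap p powr (p/2) * (t - s) powr (p/2 - 1)) * (\<integral>\<^sup>+r\<in>{s<..t}. (\<E> z. ennreal (abs (h r z) powr p)) \<partial>lborel)"
proof -
 define v where "v i = max s (min (dy L i) t)" for i
 define n where "n = L * 2 ^ L"
 let ?A = "%i. \<E> z. ennreal (abs (h (dy L (Suc i)) z) powr p)"
 define e where "e i = enn2real (?A i)" for i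
 have fin: "(?A i) = ennreal (e i)" if i: "i < n" for i proof -
  obtain B where B: "ALL z:space M. abs (h (dy L (Suc i)) z) <= B" using dyadicD(2)[OF h] i unfolding n_def by blast
  have "(?A i) <= (\<E> z. ennreal (B powr p))"
   by (intro nn_integral_mono ennreal_leI powr_mono2) (use B p in auto)
  also have "... < \<infinity>" by (simp add: emeasure_space_1)
  finally show ?thesis unfolding e_def by simp
 qed
 \<comment> \<open>On a cell that clipping shrinks to a point the coefficient need not be measurable
   at time \<open>v i\<close>: beyond \<open>t\<close> one has \<open>v i = t < dy L i\<close>. Such
   terms vanish, so 0 may be put in place of the coefficient.\<close>
 define c where "c i = (if v i < v (Suc i) then h (dy L (Suc i)) else (%_. 0))" for i
 have v0: "0 <= v i" "s <= v i" "v i <= t" for i using s by (auto simp: v_def)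
 have vm: "v i <= v (Suc i)" for i using dy_mono[of i "Suc i" L] by (auto simp: v_def min_def max_def simp del: dy_le_iff dy_less_iff)
 let ?B = "%i z. w (v (Suc i)) z - w (v i) z"
 have "(\<E> z. ennreal (abs (ito L h t z - ito L h s z) powr p)) = (\<E> z. ennreal (abs (\<Sum>i<n. c i z * (?B i z)) powr p))"
 proof -
  have "(\<Sum>i<n. h (dy L (Suc i)) z * (?B i z)) = (\<Sum>i<n. c i z * (?B i z))" for z
  proof (rule sum.cong)
   fix i
   have "v i < v (Suc i) | v (Suc i) = v i" using vm[of i] by linarith
   thus "h (dy L (Suc i)) z * (?B i z) = c i z * (?B i z)" by (auto simp: c_def)
  qed simp
  thus ?thesis unfolding ito_increment[OF s(2)] by (simp add: n_def v_def)
 qed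
 also have "... <= ennreal (kap p powr (p/2) * (v n - v 0) powr (p/2 - 1) * (\<Sum>i<n. (v (Suc i) - v i) * e i))"
 proof (rule increments_moment_holder[of p v n c e])
  fix i assume i: "i < n"
  show "c i : bmeas (F (v i))" proof (cases "v i < v (Suc i)")
   case True
   hence "dy L i <= v i" unfolding v_def using dy_mono[of i "Suc i" L] by (auto simp: min_def max_def simp del: dy_le_iff dy_less_iff split: if_splits)
   thus ?thesis unfolding c_def using True F_measurable_mono[OF dy_nonneg _ dyadicD(1)[OF h]] i by (simp add: n_def)
  qed (simp add: c_def)
  show "(\<E> z. ennreal (abs (c i z) powr p)) <= ennreal (e i)"
   using fin[OF i] by (auto simp: c_def)
  show "v i <= v (Suc i)" by (rule vm)
  show "0 <= e i" by (simp add: e_def)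
 qed (rule p, rule v0(1))
 also have "... <= ennreal (kap p powr (p/2) * (t - s) powr (p/2 - 1)) * ennreal (\<Sum>i<n. (v (Suc i) - v i) * e i)"
 proof -
  define A where "A = kap p powr (p/2) * (v n - v 0) powr (p/2 - 1)"
  define B where "B = kap p powr (p/2) * (t - s) powr (p/2 - 1)"
  define S where "S = (\<Sum>i<n. (v (Suc i) - v i) * e i)"
  have "v 0 <= v n" by (rule lift_Suc_mono_le[of v, OF vm le0])
  hence "(v n - v 0) powr (p/2 - 1) <= (t - s) powr (p/2 - 1)"
   using v0(2)[of 0] v0(3)[of n] p by (intro powr_mono2) simp_all
  hence AB: "A <= B" unfolding A_def B_def by (intro mult_left_mono) simp_all
  have "(v (Suc i) - v i) * e i >= 0" for i using vm[of i] by (simp add: e_def)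
  hence S: "S >= 0" unfolding S_def by (rule sum_nonneg)
  have B: "B >= 0" by (simp add: B_def)
  have "ennreal (A * S) <= ennreal (B * S)" by (intro ennreal_leI mult_right_mono AB S)
  also have "... = ennreal B * ennreal S" by (rule ennreal_mult'[OF B])
  finally show ?thesis unfolding A_def B_def S_def .
 qed
 also have "... <= ennreal (kap p powr (p/2) * (t - s) powr (p/2 - 1)) * (\<integral>\<^sup>+r\<in>{s<..t}. (\<E> z. ennreal (abs (h r z) powr p)) \<partial>lborel)"
 proof (rule mult_left_mono)
  have "ennreal (\<Sum>i<n. (v (Suc i) - v i) * e i) = (\<Sum>i<n. ennreal (e i) * emeasure lborel {v i<..v (Suc i)})"
  proof -
   have "ennreal ((v (Suc i) - v i) * e i) = ennreal (e i) * emeasure lborel {v i<..v (Suc i)}" for i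
   proof -
    have "e i >= 0" by (simp add: e_def)
    thus ?thesis
     unfolding emeasure_lborel_Ioc[OF vm] by (subst ennreal_mult'[symmetric]) (simp_all add: mult.commute)
   qed
   thus ?thesis using vm by (subst sum_ennreal[symmetric]) (simp_all add: e_def)
  qed
  also have "... = (\<L> r. (\<Sum>i<n. ennreal (e i) * indicator {v i<..v (Suc i)} r))"
   by (subst nn_integral_sum) (auto simp: nn_integral_cmult)
  also have "... <= (\<integral>\<^sup>+r\<in>{s<..t}. (\<E> z. ennreal (abs (h r z) powr p)) \<partial>lborel)"
  proof (rule nn_integral_mono)
   fix r
   have in_block: "dy L i < r & r <= dy L (Suc i) & r : {s<..t}" if "r : {v i<..v (Suc i)}" for i
    using that unfolding v_def by (auto simp: min_def max_def split: if_splits)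
   show "(\<Sum>i<n. ennreal (e i) * indicator {v i<..v (Suc i)} r) <= (\<E> z. ennreal (abs (h r z) powr p)) * indicator {s<..t} r"
   proof (cases "EX i<n. r : {v i<..v (Suc i)}")
    case False hence "(\<Sum>i<n. ennreal (e i) * indicator {v i<..v (Suc i)} r) = 0"
     by (intro sum.neutral) (auto simp: indicator_def)
    thus ?thesis by simp
   next case True
    then obtain j where j: "j < n" "r : {v j<..v (Suc j)}" by auto
    note bj = in_block[OF j(2)]
    have "(\<Sum>i<n. ennreal (e i) * indicator {v i<..v (Suc i)} r) = (\<Sum>i<n. if i = j then ennreal (e j) else 0)"
    proof (rule sum.cong)
     fix i assume "i : {..<n}"
     show "ennreal (e i) * indicator {v i<..v (Suc i)} r = (if i = j then ennreal (e j) else 0)"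
     proof (cases "r : {v i<..v (Suc i)}")
      case True have "i = j" by (rule dy_unique[of L i r j]) (use in_block[OF True] bj in auto)
      with True show ?thesis by simp
     next case False
      with j(2) have "i ~= j" by auto
      with False show ?thesis by simp
     qed
    qed simp
    also have "... = ennreal (e j)" using j by simp
    also have "... = (\<E> z. ennreal (abs (h r z) powr p))" proof -
     have "h r z = h (dy L (Suc j)) z" for z by (rule dyadicD(3)[OF h]) (use bj in auto)
     thus ?thesis unfolding fin[OF j(1), symmetric] by presburger
    qed
    finally show ?thesis using bj by simp
   qed
  qed
  finally show "ennreal (\<Sum>i<n. (v (Suc i) - v i) * e i) <= (\<integral>\<^sup>+r\<in>{s<..t}. (\<E> z. ennreal (abs (h r z) powr p)) \<partial>lborel)" .
 qed simp
 finally show ?thesis .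
qed

text \<open>A cell whose left end is at \<open>u\<close> or later is clipped to a point and
  contributes nothing.\<close>

lemma ito_weight_cong: assumes "!!r. r < u ==> g r = h r"
 shows "ito L (%s z. g (left_dy L s) * v s z) u z = ito L (%s z. h (left_dy L s) * v s z) u z"
 unfolding ito_def proof (rule sum.cong)
 fix i
 have l: "left_dy L (dy L (Suc i)) = dy L i" by (rule left_dy_eq) auto
 let ?A = "w (min (dy L (Suc i)) u) z - w (min (dy L i) u) z"
 show "g (left_dy L (dy L (Suc i))) * v (dy L (Suc i)) z * ?A = h (left_dy L (dy L (Suc i))) * v (dy L (Suc i)) z * ?A"
 proof (cases "dy L i < u")
  case True thus ?thesis unfolding l using assms[of "dy L i"] by simp
 next case False
  hence "min (dy L (Suc i)) u = u" "min (dy L i) u = u"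
   using dy_mono[of i "Suc i" L] by (auto simp del: dy_le_iff dy_less_iff)
  thus ?thesis by simp
 qed
qed simp

text \<open>\<open>ou L h x\<close> is \<open>\<integral> exp (- x * (t - s)) * h s dw s\<close>, written pathwise through integration by parts.\<close>

definition ouz :: "nat => (real => 'a => real) => real => real => 'a => real" where
 "ouz L h x t z = exp (x * t) * ito L h t z - integral {0..t} (%r. x * exp (x * r) * ito L h r z)"

definition ou :: "nat => (real => 'a => real) => real => real => 'a => real" where
 "ou L h x t z = exp (- x * t) * ouz L h x t z"

lemma ito_block: assumes i: "i < L * 2 ^ L" and u: "dy L i <= u" "u <= v" "v <= dy L (Suc i)"
 shows "ito L h v z - ito L h u z = h (dy L (Suc i)) z * (w v z - w u z)" proof -
 have "ito L h v z - ito L h u z = (\<Sum>j<L * 2 ^ L. if j = i then h (dy L (Suc i)) z * (w v z - w u z) else 0)"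
  unfolding ito_increment[OF u(2)] proof (rule sum.cong)
  fix j
  show "h (dy L (Suc j)) z * (w (max u (min (dy L (Suc j)) v)) z - w (max u (min (dy L j) v)) z) = (if j = i then h (dy L (Suc i)) z * (w v z - w u z) else 0)"
  proof (cases j i rule: linorder_cases)
   case less hence "dy L (Suc j) <= dy L i" by simp
   moreover have "dy L j <= dy L (Suc j)" by simp
   ultimately have "dy L (Suc j) <= u" "dy L j <= u" using u by linarith+
   thus ?thesis using less u by (auto simp: min_def max_def)
  next case equal
   thus ?thesis using u by (auto simp: min_def max_def)
  next case greater
   hence "dy L (Suc i) <= dy L j" by simp
   moreover have "dy L j <= dy L (Suc j)" by simp
   ultimately have "v <= dy L (Suc j)" "v <= dy L j" using u by linarith+
   thus ?thesis using greater u by (auto simp: min_def max_def)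
  qed
 qed simp
 thus ?thesis using i by simp
qed

text \<open>The pathwise definition agrees with a limit of dyadic integrals of the sampled
  integrand; moment bounds and joint measurability reach \<open>ou\<close> along this limit.\<close>

lemma ouz_limit: assumes h: "dyadic L h" and x: "x >= 0" and t: "t >= 0" and z: "z : space M"
 shows "(%l. ito l (%s z. exp (x * left_dy l s) * h s z) t z) \<leadsto> ouz L h x t z" proof -
 define N where "N t = ito L h t z" for t
 let ?B = "%l i. N (min (dy l (Suc i)) t) - N (min (dy l i) t)"
 let ?C = "%l. \<Sum>i<l * 2 ^ l. exp (x * dy l i) * (?B l i)"
 have "?C \<leadsto> exp (x * t) * N t - N 0 - integral {0..t} (%r. x * exp (x * r) * N r)"
  by (rule exp_stieltjes_limit[OF _ x t]) (simp add: N_def ito_continuous[OF z])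
 hence lim: "?C \<leadsto> ouz L h x t z" by (simp add: N_def ouz_def)
 have "(\<Sum>i<l * 2 ^ l. exp (x * dy l i) * (?B l i)) = ito l (%s z. exp (x * left_dy l s) * h s z) t z" if l: "l >= L" for l
  unfolding ito_def proof (rule sum.cong)
  fix i assume "i : {..<l * 2 ^ l}"
  hence i: "i < l * 2 ^ l" by simp
  have ll: "left_dy l (dy l (Suc i)) = dy l i" by (rule left_dy_eq) auto
  let ?A = "w (min (dy l (Suc i)) t) z - w (min (dy l i) t) z"
  have "N (min (dy l (Suc i)) t) - N (min (dy l i) t) = h (dy l (Suc i)) z * ?A"
  proof (cases "dy l i <= t")
   case True
   have "ito l h (min (dy l (Suc i)) t) z - ito l h (min (dy l i) t) z = h (dy l (Suc i)) z * ?A"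
    by (rule ito_block[OF i]) (use True dy_mono[of i "Suc i" l] in auto)
   thus ?thesis by (simp add: N_def dyadic_refine(2)[OF h l])
  next case False
   hence "min (dy l (Suc i)) t = t" "min (dy l i) t = t" using dy_mono[of i "Suc i" l] by (auto simp del: dy_le_iff dy_less_iff)
   thus ?thesis by simp
  qed
  thus "exp (x * dy l i) * (?B l i) = exp (x * left_dy l (dy l (Suc i))) * h (dy l (Suc i)) z * ?A"
   unfolding ll by simp
 qed simp
 thus ?thesis using lim by (elim Lim_transform_eventually) (auto simp: eventually_sequentially)
qed

end

section \<open>Chaining and the maximal inequality for a fixed rate\<close>

text \<open>On the base grid of mesh \<open>h\<close> the factor \<open>exp (- x * h) = 1/2\<close>
  contracts the past, so the values stay below twice a common bound for the steps. A point of the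
  next grid, finer by 4, is reached from a coarser one by a single step of
  \<open>j = 1, 2, 3\<close> meshes. The largest step of a level is bounded by the
  \<open>l p\<close> norm of all of them, and the levels are combined by \<open>powr_sum_le\<close>.
  Refining by 4 leads to the term \<open>sqrt 3 / (4 powr a - 1)\<close> of \<open>cc\<close>, where
  \<open>a = 1/2 - 1/p\<close>; refining by 2 would lead to the larger
  \<open>1 / (2 powr a - 1)\<close>.\<close>

lemma chaining: fixes y :: "real => real" and z :: "nat => real" and D :: "real => real => real"
 assumes y: "continuous_on {0..} y" and y0: "y 0 = 0" and x: "x > 0" and p: "p >= 1"
  and h: "h = ln 2 / x" and D: "!!s t. D s t = y t - exp (- x * (t - s)) * y s"
  and z: "!!n. z n > 0" and zs: "summable z" and W: "W = 2 * z 0 + (\<Sum>n. z (Suc n))"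
  and t: "t >= 0"
 shows "ennreal (abs (y t) powr p) <= ennreal (W powr (p - 1)) * (ennreal (2 * z 0 powr (1 - p)) * (\<Sum>k. ennreal (abs (D (real k * h) (real (Suc k) * h)) powr p)) + (\<Sum>n. ennreal (z (Suc n) powr (1 - p)) * (\<Sum>k. \<Sum>j\<in>{1,2,3::nat}. ennreal (abs (D (real (4 * k) * (h / 4 ^ Suc n)) (real (4 * k + j) * (h / 4 ^ Suc n))) powr p))))"
  (is "_ <= ennreal (W powr (p - 1)) * ?R") proof -
 let ?D = "\<Sum>k. ennreal (abs (D (real k * h) (real (Suc k) * h)) powr p)"
 define S where "S n = (if n = 0 then ?D else (\<Sum>k. \<Sum>j\<in>{1,2,3::nat}. ennreal (abs (D (real (4 * k) * (h / 4 ^ n)) (real (4 * k + j) * (h / 4 ^ n))) powr p)))" for n :: nat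
 \<comment> \<open>On the base grid the bound is \<open>2 * m 0\<close> and the weight
   \<open>2 * z 0\<close>; of the powers of 2 in
   \<open>(2 * z 0) powr (1 - p) * (2 * m 0) powr p\<close> a single factor is left.\<close>
 define w where "w n = (if n = 0 then 2 * z 0 powr (1 - p) else z n powr (1 - p))" for n :: nat
 let ?A = "\<Sum>n. ennreal (w n) * S n"
 have R: "?R = ?A" proof -
  have "(%n. ennreal (w n) * S n) sums ((\<Sum>n. ennreal (w (Suc n)) * S (Suc n)) + ennreal (w 0) * S 0)"
   by (intro sums_Suc summable_sums summableI)
  from sums_unique[OF this] show ?thesis by (simp add: S_def w_def add.commute)
 qed
 have h0: "h > 0" using x h by simp
 have W0: "W > 0" using z zs unfolding W by (intro add_pos_nonneg suminf_nonneg) (auto simp: summable_Suc_iff intro: less_imp_le)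
 have w0: "w n > 0" for n using z[of n] by (auto simp: w_def)
 show ?thesis proof (cases "?R = \<infinity>")
  case True show ?thesis unfolding True using W0 by (simp add: ennreal_mult_top)
 next case False
  hence Rf: "?A < \<infinity>" unfolding R by (simp add: less_top)
  have summand: "ennreal (w n) * S n <= ?A" for n
   using sum_le_suminf[OF summableI, of "{n}" "%n. ennreal (w n) * S n"] by simp
  have Sf: "S n < \<infinity>" for n proof (rule ccontr)
   assume "~ S n < \<infinity>"
   hence "S n = \<top>" by (simp add: less_top[symmetric])
   hence "ennreal (w n) * S n = \<infinity>" using w0[of n] by (simp add: ennreal_mult_top)
   with summand[of n] Rf show False by simp
  qed
  \<comment> \<open>The \<open>l p\<close> norm of the steps of level \<open>n\<close>, hence a
    bound for each of them.\<close>
  define m where "m n = enn2real (S n) powr (1/p)" for n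
  have m0: "m n >= 0" for n by (simp add: m_def)
  have mp: "ennreal (m n powr p) = S n" for n using Sf[of n] p by (simp add: m_def powr_powr)
  have root: "u <= m n" if "u >= 0" "ennreal (u powr p) <= S n" for u n proof -
   have "u powr p <= m n powr p" using that(2) unfolding mp[symmetric] by simp
   thus ?thesis using powr_less_mono2[of p "m n" u] m0[of n] p by (meson leD leI less_le_trans zero_less_one)
  qed
  have step: "abs (y t) <= exp (- x * (t - s)) * abs (y s) + abs (D s t)" for s t proof -
   have "y t = exp (- x * (t - s)) * y s + D s t" unfolding D by simp
   hence "abs (y t) <= abs (exp (- x * (t - s)) * y s) + abs (D s t)" by (metis abs_triangle_ineq)
   thus ?thesis by (simp add: abs_mult)
  qed
  have single: "f k <= suminf f" for f :: "nat => ennreal" and k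
   using sum_le_suminf[OF summableI, of "{k}" f] by simp
  have S_0: "S 0 = ?D" unfolding S_def by (rule if_P) (rule refl)
  let ?E = "%k n j. ennreal (abs (D (real (4 * k) * (h / 4 ^ Suc n)) (real (4 * k + j) * (h / 4 ^ Suc n))) powr p)"
  have S_Suc: "S (Suc n) = (\<Sum>k. \<Sum>j\<in>{1,2,3::nat}. ?E k n j)" for n
   unfolding S_def by (rule if_not_P) (rule nat.simps)
  have D0: "abs (D (real k * h) (real (Suc k) * h)) <= m 0" for k
   by (rule root[OF abs_ge_zero], unfold S_0, rule single)
  have Dn: "abs (D (real (4 * k) * (h / 4 ^ Suc n)) (real (4 * k + j) * (h / 4 ^ Suc n))) <= m (Suc n)" if j: "j : {1,2,3}" for k j n
  proof (rule root[OF abs_ge_zero])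
   let ?f = "%k j. ?E k n j"
   have "?f k j <= (\<Sum>j\<in>{1,2,3::nat}. ?f k j)" by (rule member_le_sum[OF j]) (rule zero_le, rule finite.intros, rule finite.intros, rule finite.intros, rule finite.intros)
   also have "... <= (\<Sum>k. \<Sum>j\<in>{1,2,3::nat}. ?f k j)" by (rule single)
   finally show "?f k j <= S (Suc n)" unfolding S_Suc .
  qed
  have half: "exp (- x * h) = 1 / 2" using x by (simp add: h exp_minus inverse_eq_divide)
  have lev0: "abs (y (real k * h)) <= 2 * m 0" for k proof (induction k)
   case 0 thus ?case using y0 m0 by simp
  next case (Suc k)
   have "abs (y (real (Suc k) * h)) <= exp (- x * h) * abs (y (real k * h)) + m 0" proof -
    have e: "real (Suc k) * h - real k * h = h" by (simp add: algebra_simps)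
    show ?thesis using step[of "real (Suc k) * h" "real k * h"] D0[of k] unfolding e by linarith
   qed
   thus ?case using Suc unfolding half by simp
  qed
  have lev: "abs (y (real k * (h / 4 ^ n))) <= 2 * m 0 + (\<Sum>i\<in>{1..n}. m i)" for n k
  proof (induction n arbitrary: k)
   case 0 thus ?case using lev0 by simp
  next case (Suc n)
   define q j where "q = k div 4" and "j = k mod 4"
   have k: "k = 4 * q + j" "j < 4" by (auto simp: q_def j_def)
   let ?C = "real (4 * q) * (h / 4 ^ Suc n)"
   have base: "abs (y ?C) <= 2 * m 0 + (\<Sum>i\<in>{1..n}. m i)"
    using Suc[of q] by (simp add: field_simps)
   show ?case proof (cases "j = 0")
    case True thus ?thesis using base k m0[of "Suc n"] by simp
   next case False
    hence j: "j : {1,2,3}" using k by auto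
    let ?G = "exp (- x * (real k * (h / 4 ^ Suc n) - real (4 * q) * (h / 4 ^ Suc n)))"
    have "real (4 * q) * (h / 4 ^ Suc n) <= real k * (h / 4 ^ Suc n)"
     using h0 k by (intro mult_right_mono) auto
    hence "?G <= 1" using x by simp
    hence "?G * abs (y ?C) <= 1 * abs (y ?C)" by (intro mult_right_mono) auto
    hence "abs (y (real k * (h / 4 ^ Suc n))) <= abs (y ?C) + m (Suc n)"
     using step[of "real k * (h / 4 ^ Suc n)" "real (4 * q) * (h / 4 ^ Suc n)"] Dn[OF j, of q n] unfolding k(1)[symmetric] by linarith
    thus ?thesis using base by simp
   qed
  qed
  let ?H = "W powr (p - 1) * enn2real ?A"
  have grid: "abs (y (real k * (h / 4 ^ n))) powr p <= ?H" for n k proof -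
   define u where "u i = (if i = 0 then 2 * m 0 else m i)" for i :: nat
   define b where "b i = (if i = 0 then 2 * z 0 else z i)" for i :: nat
   have b0: "b i > 0" for i using z by (simp add: b_def)
   have split0: "(\<Sum>i\<in>{..n}. f i) = f 0 + (\<Sum>i\<in>{1..n}. f i)" for f :: "nat => real"
    by (simp add: atMost_atLeast0 sum.atLeast_Suc_atMost)
   let ?B = "\<Sum>i\<in>{..n}. b i powr (1 - p) * u i powr p"
   have "abs (y (real k * (h / 4 ^ n))) <= (\<Sum>i\<in>{..n}. u i)"
    using lev[of k n] unfolding split0 by (simp add: u_def)
   hence "abs (y (real k * (h / 4 ^ n))) powr p <= (\<Sum>i\<in>{..n}. u i) powr p"
    using p by (intro powr_mono2) auto
   also have "... <= (\<Sum>i\<in>{..n}. b i) powr (p - 1) * ?B"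
    by (rule powr_sum_le[OF p]) (use m0 b0 in \<open>auto simp: u_def\<close>)
   also have "... <= ?H" proof (rule mult_mono)
    have "(\<Sum>i\<in>{1..n}. z i) = (\<Sum>i<n. z (Suc i))" by (simp add: sum.atLeast1_atMost_eq)
    also have "... <= (\<Sum>i. z (Suc i))"
     using z zs by (intro sum_le_suminf) (auto simp: summable_Suc_iff intro: less_imp_le)
    finally have "(\<Sum>i\<in>{..n}. b i) <= W" unfolding split0 W by (simp add: b_def)
    thus "(\<Sum>i\<in>{..n}. b i) powr (p - 1) <= W powr (p - 1)"
     using p b0 by (intro powr_mono2 sum_nonneg) (auto intro: less_imp_le)
    have bw: "b i powr (1 - p) * u i powr p = w i * m i powr p" for i proof (cases "i = 0")
     case True
     have "(2 * z 0) powr (1 - p) * (2 * m 0) powr p = (2 powr (1 - p) * 2 powr p) * (z 0 powr (1 - p) * m 0 powr p)"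
      by (simp add: powr_mult)
     also have "2 powr (1 - p) * 2 powr p = (2::real)" by (simp add: powr_add[symmetric])
     finally show ?thesis using True by (simp add: b_def u_def w_def)
    qed (simp add: b_def u_def w_def)
    have "ennreal ?B = (\<Sum>i\<in>{..n}. ennreal (w i) * S i)"
     unfolding bw mp[symmetric] using w0 m0
     by (subst sum_ennreal[symmetric]) (auto simp: ennreal_mult' less_imp_le intro!: mult_nonneg_nonneg)
    also have "... <= ?A" by (intro sum_le_suminf summableI) auto
    finally have "ennreal ?B <= ?A" .
    hence "enn2real (ennreal ?B) <= enn2real ?A" by (intro enn2real_mono) (use Rf in auto)
    thus "?B <= enn2real ?A" by (subst (asm) enn2real_ennreal) (auto intro!: sum_nonneg)
   qed (auto intro!: sum_nonneg)
   finally show ?thesis .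
  qed
  have "abs (y t) powr p <= ?H" proof (rule LIMSEQ_le_const2)
   define T where "T n = real (nat \<lfloor>t / (h / 4 ^ n)\<rfloor>) * (h / 4 ^ n)" for n :: nat
   have T: "t - h / 4 ^ n <= T n" "T n <= t" "0 <= T n" for n proof -
    define c where "c = h / 4 ^ n"
    have hn: "c > 0" using h0 by (simp add: c_def)
    have "0 <= \<lfloor>t / c\<rfloor>" using t hn by simp
    hence fl: "real (nat \<lfloor>t / c\<rfloor>) = of_int \<lfloor>t / c\<rfloor>" by (rule of_nat_nat)
    have "(t / c - 1) * c <= T n" "T n <= (t / c) * c"
     unfolding T_def c_def[symmetric] fl using hn floor_correct[of "t / c"] by (intro mult_right_mono; linarith)+
    thus "t - h / 4 ^ n <= T n" "T n <= t" using hn unfolding c_def[symmetric] by (simp_all add: left_diff_distrib)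
    show "0 <= T n" unfolding T_def using h0 by simp
   qed
   have "(%n. t - h * (1/4) ^ n) \<leadsto> t - h * 0" by (intro tendsto_intros) auto
   hence "(%n. t - h / 4 ^ n) \<leadsto> t" by (simp add: power_one_over)
   hence "T \<leadsto> t"
    by (rule tendsto_sandwich[OF _ _ _ tendsto_const, rotated 2]) (use T in auto)
   hence "(%n. y (T n)) \<leadsto> y t"
    using continuous_on_tendsto_compose[OF y, of T t sequentially] t T by simp
   thus "(%n. abs (y (T n)) powr p) \<leadsto> abs (y t) powr p"
    using p by (intro tendsto_powr' tendsto_rabs tendsto_const) auto
   show "EX N. ALL n>=N. abs (y (T n)) powr p <= W powr (p - 1) * enn2real ?A"
    unfolding T_def using grid by blast
  qed
  hence "ennreal (abs (y t) powr p) <= ennreal (W powr (p - 1)) * ennreal (enn2real ?A)"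
   by (subst ennreal_mult'[symmetric]) (auto intro: ennreal_leI)
  thus ?thesis unfolding R using Rf by simp
 qed
qed

text \<open>Put \<open>a = 1/2 - 1/p\<close>. The factor \<open>ln 2 powr a\<close> comes from the
  base mesh \<open>ln 2 / x\<close>, the 2 from the base grid, and
  \<open>sqrt 3 / (4 powr a - 1)\<close> is the geometric series over the refinements, with ratio
  \<open>4 powr (- a)\<close>.\<close>

definition cc :: "real => real" where
 "cc p = sqrt (kap p) * ln 2 powr (1/2 - 1/p) * (2 + sqrt 3 / (4 powr (1/2 - 1/p) - 1))"

lemma cc_pos: "p > 2 ==> cc p > 0" proof -
 assume p: "p > 2"
 hence "1 / p < 1 / 2" by (simp add: field_simps)
 hence "1 < (4::real) powr (1/2 - 1/p)" by simp
 thus ?thesis using kap_pos[of p] p unfolding cc_def by (intro mult_pos_pos add_pos_pos) auto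
qed

lemma continuous_on_halfline: fixes f :: "real => real"
 assumes "!!b. continuous_on {0..b} f" shows "continuous_on {0..} f"
 unfolding continuous_on_eq_continuous_within proof
 fix t :: real assume t: "t : {0..}"
 have "at t within {0..} = at t within {0..t + 1}" by (rule at_within_nhd[of _ "{..<t + 1}"]) auto
 thus "continuous (at t within {0..}) f"
  using assms[of "t + 1"] t unfolding continuous_on_eq_continuous_within continuous_within by auto
qed

text \<open>The blocks are disjoint: infinitely many of them together cost no more than one integral
  over the half-line.\<close>

lemma suminf_nn_integral_blocks_le:
 fixes f :: "real => ennreal" assumes [measurable]: "f : bmeas lborel" and h: "h > 0"
 shows "(\<Sum>k. \<integral>\<^sup>+r\<in>{real k * h<..real (Suc k) * h}. f r \<partial>lborel) <= (\<H> r. f r)"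
proof -
 let ?A = "%r. \<Sum>k. f r * indicator {real k * h<..real (Suc k) * h} r"
 have "(\<Sum>k. \<integral>\<^sup>+r\<in>{real k * h<..real (Suc k) * h}. f r \<partial>lborel) = (\<L> r. (?A r))"
  by (rule nn_integral_suminf[symmetric]) auto
 also have "... <= (\<H> r. f r)" proof (rule nn_integral_mono)
  fix r
  have disj: "disjoint_family (%k. {real k * h<..real (Suc k) * h})"
  proof (unfold disjoint_family_on_def, intro ballI impI)
   fix m n :: nat assume "m ~= n"
   have "False" if "r : {real m * h<..real (Suc m) * h}" "r : {real n * h<..real (Suc n) * h}" for r
   proof -
    have "real m * h < real (Suc n) * h" "real n * h < real (Suc m) * h" using that by auto
    hence "m < Suc n" "n < Suc m" using h by (simp_all only: mult_less_cancel_right_pos of_nat_less_iff)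
    thus False using \<open>m ~= n\<close> by simp
   qed
   thus "{real m * h<..real (Suc m) * h} \<inter> {real n * h<..real (Suc n) * h} = {}" by blast
  qed
  have "(?A r) = f r * (\<Sum>k. indicator {real k * h<..real (Suc k) * h} r)"
   by (rule ennreal_suminf_cmult)
  also have "(\<Sum>k. indicator {real k * h<..real (Suc k) * h} r) = (indicator (\<Union>k. {real k * h<..real (Suc k) * h}) r :: ennreal)"
   by (rule suminf_indicator[OF disj])
  also have "... <= indicator {0<..} r" proof -
   have "(\<Union>k. {real k * h<..real (Suc k) * h}) \<subseteq> {0<..}" proof safe
    fix r k assume "r : {real k * h<..real (Suc k) * h}"
    moreover have "0 <= real k * h" using h by simp
    ultimately show "0 < r" by simp
   qed
   moreover have "(indicator A r :: ennreal) <= indicator B r" if "A \<subseteq> B" for A B :: "real set"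
    using that by (auto simp: indicator_def)
   ultimately show ?thesis by blast
  qed
  finally show "(?A r) <= f r * indicator {0<..} r" by (simp add: mult_left_mono)
 qed
 finally show ?thesis .
qed

context scalar_bm begin

lemma dyadic_borel: assumes "dyadic L h" shows "h r : bmeas M" proof (cases "r <= 0 | r > real L")
 case True hence "h r = (%_. 0)" using dyadicD(4)[OF assms] by auto
 thus ?thesis by simp
next case False
 hence r: "r > 0" "r <= real L" by auto
 obtain i where i: "dy L i < r" "r <= dy L (Suc i)" using dy_ex[OF r(1)] by blast
 have "dy L i < dy L (L * 2 ^ L)" using i r by simp
 hence "i < L * 2 ^ L" unfolding dy_less_iff .
 moreover have "h r = h (dy L (Suc i))" using dyadicD(3)[OF assms i] by auto
 ultimately show ?thesis using F_measurable_M[OF dy_nonneg dyadicD(1)[OF assms]] by simp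
qed

lemma dyadic_joint:
 assumes "dyadic L h" shows "(%(r, y). h r y) : bmeas (lborel \<Otimes> M)" proof -
 have eq: "h r y = (\<Sum>i<L * 2 ^ L. indicator {dy L i<..dy L (Suc i)} r * h (dy L (Suc i)) y)" for r y
 proof (cases "r <= 0 | r > real L")
  case True have "indicator {dy L i<..dy L (Suc i)} r = (0::real)" if "i < L * 2 ^ L" for i proof -
   have "dy L (Suc i) <= dy L (L * 2 ^ L)" using that by (intro dy_mono) simp
   thus ?thesis using True dy_nonneg[of L i] by (auto simp: indicator_def simp del: dy_nonneg)
  qed
  thus ?thesis using dyadicD(4)[OF assms True] by simp
 next case False
  hence r: "r > 0" "r <= real L" by auto
  obtain j where j: "dy L j < r" "r <= dy L (Suc j)" using dy_ex[OF r(1)] by blast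
  have "dy L j < dy L (L * 2 ^ L)" using j r by simp
  hence jl: "j < L * 2 ^ L" unfolding dy_less_iff .
  have "(\<Sum>i<L * 2 ^ L. indicator {dy L i<..dy L (Suc i)} r * h (dy L (Suc i)) y) = (\<Sum>i<L * 2 ^ L. if i = j then h (dy L (Suc j)) y else 0)"
  proof (rule sum.cong)
   fix i
   show "indicator {dy L i<..dy L (Suc i)} r * h (dy L (Suc i)) y = (if i = j then h (dy L (Suc j)) y else 0)"
   proof (cases "r : {dy L i<..dy L (Suc i)}")
    case True have "i = j" by (rule dy_unique[of L i r j]) (use True j in auto)
    thus ?thesis using True by simp
   next case False
    hence "i ~= j" using j by auto
    thus ?thesis using False by simp
   qed
  qed simp
  also have "... = h (dy L (Suc j)) y" using jl by simp
  finally show ?thesis using dyadicD(3)[OF assms j] by simp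
 qed
 have [measurable]: "h (dy L (Suc i)) : bmeas M" for i by (rule dyadic_borel[OF assms])
 let ?A = "%z. \<Sum>i<L * 2 ^ L. indicator {dy L i<..dy L (Suc i)} (fst z) * h (dy L (Suc i)) (snd z)"
 have "(%z. h (fst z) (snd z)) = ?A" by (rule ext) (rule eq)
 moreover have "?A : bmeas (lborel \<Otimes> M)" by measurable
 ultimately show ?thesis by (simp add: case_prod_beta')
qed

lemma dyadic_moment_measurable:
 assumes "dyadic L h" shows "(%r. \<E> z. ennreal (abs (h r z) powr p)) : bmeas lborel" proof -
 have [measurable]: "(%(r, z). h r z) : bmeas (lborel \<Otimes> M)" by (rule dyadic_joint[OF assms])
 show ?thesis by measurable
qed

lemma ito_weight_scale: assumes "!!r. r < u ==> c * g r = h r"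
 shows "c * ito L (%s z. g (left_dy L s) * v s z) u z = ito L (%s z. h (left_dy L s) * v s z) u z"
proof -
 have "c * ito L (%s z. g (left_dy L s) * v s z) u z = ito L (%s z. (c * g (left_dy L s)) * v s z) u z"
  by (simp add: ito_def sum_distrib_left mult.assoc)
 also have "... = ito L (%s z. h (left_dy L s) * v s z) u z" by (rule ito_weight_cong) (rule assms)
 finally show ?thesis .
qed

text \<open>The combination is the integral of \<open>exp (- x * (t - r)) * v r\<close> over
  \<open>(s, t]\<close>. Its weight is at most 1, so the bound of
  \<open>ito_increment_moment\<close> carries over; Fatou's lemma passes from sampled weights to the
  limit.\<close>

lemma ou_increment_moment:
 assumes v: "dyadic L v" and p: "p >= 2" and x: "x >= 0" and s: "0 <= s" "s <= t"
 shows "(\<E> z. ennreal (abs (ou L v x t z - exp (- x * (t - s)) * ou L v x s z) powr p)) <= ennreal (kap p powr (p/2) * (t - s) powr (p/2 - 1)) * (\<integral>\<^sup>+r\<in>{s<..t}. (\<E> z. ennreal (abs (v r z) powr p)) \<partial>lborel)"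
proof -
 \<comment> \<open>The minimum keeps the weight below 1 also at times after \<open>t\<close>, where
   it does not affect the integral.\<close>
 define h where "h r = exp (x * (min r t - t))" for r
 let ?A = "%l. %s z. h (left_dy l s) * v s z"
 define f where "f l z = ito l (?A l) t z - ito l (?A l) s z" for l z
 let ?C = "%l. %s z. exp (x * left_dy l s) * v s z"
 have feq: "f l z = exp (- x * t) * (ito l (?C l) t z - ito l (?C l) s z)" for l z proof -
  have hh: "exp (- x * t) * exp (x * r) = h r" if "r < t" for r
   using that by (simp add: h_def mult_exp_exp algebra_simps)
  have "exp (- x * t) * ito l (?C l) t z = ito l (?A l) t z"
   by (rule ito_weight_scale[of _ _ "%r. exp (x * r)"]) (rule hh)
  moreover have "exp (- x * t) * ito l (?C l) s z = ito l (?A l) s z"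
   by (rule ito_weight_scale[of _ _ "%r. exp (x * r)"]) (rule hh, use s in simp)
  ultimately show ?thesis by (simp add: f_def right_diff_distrib)
 qed
 have lim: "AE z in M. (%l. f l z) \<leadsto> ou L v x t z - exp (- x * (t - s)) * ou L v x s z"
 proof (rule AE_I2)
  fix z assume z: "z : space M"
  let ?E = "ou L v x t z - exp (- x * (t - s)) * ou L v x s z"
  let ?G = "exp (- x * t) * (ouz L v x t z - ouz L v x s z)"
  have "(%l. f l z) \<leadsto> ?G"
   unfolding feq using s by (intro tendsto_intros ouz_limit[OF v x] z) auto
  moreover have "exp (- x * (t - s)) * exp (- x * s) = exp (- x * t)" by (simp add: mult_exp_exp algebra_simps)
  hence "?G = ?E" unfolding ou_def by (simp add: right_diff_distrib mult.assoc[symmetric])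
  ultimately show "(%l. f l z) \<leadsto> ?E" by simp
 qed
 have dl: "dyadic l (?A l)" if "l >= L" for l
  by (rule dyadic_weight[OF dyadic_refine(1)[OF v that]])
 have meas: "f (l + L) : bmeas M" for l
  unfolding f_def[abs_def] using s by (intro borel_measurable_diff ito_measurable dl) auto
 show ?thesis proof (rule nn_integral_powr_fatou[where f = "%l. f (l + L)" and ?n0.0 = 0])
  show "AE z in M. (%l. f (l + L) z) \<leadsto> ou L v x t z - exp (- x * (t - s)) * ou L v x s z"
   using lim by eventually_elim (rule LIMSEQ_ignore_initial_segment)
  fix l
  let ?B = "ennreal (kap p powr (p/2) * (t - s) powr (p/2 - 1)) * (\<integral>\<^sup>+r\<in>{s<..t}. (\<E> z. ennreal (abs (v r z) powr p)) \<partial>lborel)"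
  let ?D = "\<E> z. ennreal (abs (f (l + L) z) powr p)"
  have "?D <= ennreal (kap p powr (p/2) * (t - s) powr (p/2 - 1)) * (\<integral>\<^sup>+r\<in>{s<..t}. (\<E> z. ennreal (abs (h (left_dy (l + L) r) * v r z) powr p)) \<partial>lborel)"
   unfolding f_def by (rule ito_increment_moment[OF dl p s]) simp
  also have "... <= ?B"
  proof (intro mult_left_mono nn_integral_mono mult_right_mono ennreal_leI powr_mono2)
   fix r z
   have "h (left_dy (l + L) r) <= 1" using x by (simp add: h_def mult_nonneg_nonpos)
   moreover have "h (left_dy (l + L) r) >= 0" by (simp add: h_def)
   ultimately show "abs (h (left_dy (l + L) r) * v r z) <= abs (v r z)"
    by (simp add: abs_mult mult_left_le_one_le)
  qed (use p in auto)
  finally show "?D <= ?B" .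
 qed (use p meas in auto)
qed

lemma ou_continuous: assumes z: "z : space M" shows "continuous_on {0..} (%t. ou L h x t z)" proof -
 let ?A = "%t. integral {0..t} (%r. x * exp (x * r) * ito L h r z)"
 have "continuous_on {0..} ?A" proof (rule continuous_on_halfline)
  fix b
  have "continuous_on {0..b} (%t. ito L h t z)" by (rule continuous_on_subset[OF ito_continuous[OF z]]) auto
  thus "continuous_on {0..b} ?A"
   by (intro indefinite_integral_continuous_1 integrable_continuous_real continuous_intros)
 qed
 thus ?thesis unfolding ou_def ouz_def by (intro continuous_intros ito_continuous[OF z])
qed

lemma ou_0[simp]: "ou L h x 0 z = 0" by (simp add: ou_def ouz_def)

text \<open>The approximants of \<open>ouz_limit\<close> are finite sums in which \<open>x\<close>
  occurs only through exponentials; their limit is therefore jointly measurable, as needed for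
  integrating \<open>ou\<close> over \<open>x\<close>.\<close>

lemma ou_joint_measurable: assumes h: "dyadic L h" and t: "t >= 0"
 shows "(%(x, y). ou L h x t y) : bmeas (restrict_space borel {0..} \<Otimes> M)" proof -
 have [measurable]: "h r : bmeas M" for r by (rule dyadic_borel[OF h])
 have [measurable]: "w (min (dy l i) t) : bmeas M" for l i using t by (intro w_measurable) auto
 have [measurable]: "fst : bmeas (restrict_space borel {0::real..} \<Otimes> M)"
  by (rule measurable_compose[OF measurable_fst]) (auto simp: measurable_restrict_space1)
 let ?A = "bmeas (restrict_space borel {0..} \<Otimes> M)"
 have "(%z. ouz L h (fst z) t (snd z)) : ?A" proof (rule borel_measurable_LIMSEQ_real)
  fix z assume "z : space (restrict_space borel {0::real..} \<Otimes> M)"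
  hence "fst z >= 0" "snd z : space M" by (auto simp: space_pair_measure space_restrict_space)
  thus "(%l. ito l (%s y. exp (fst z * left_dy l s) * h s y) t (snd z)) \<leadsto> ouz L h (fst z) t (snd z)"
   using t by (intro ouz_limit[OF h])
 next
  fix l
  show "(%z. ito l (%s y. exp (fst z * left_dy l s) * h s y) t (snd z)) : ?A"
   unfolding ito_def by measurable
 qed
 hence "(%z. exp (- fst z * t) * ouz L h (fst z) t (snd z)) : ?A" by measurable
 thus ?thesis by (simp add: ou_def case_prod_beta')
qed

lemma ou_measurable: assumes h: "dyadic L h" and t: "t >= 0" and x: "x >= 0"
 shows "ou L h x t : bmeas M" proof -
 have "(%z. (%(x, z). ou L h x t z) (x, z)) : bmeas M"
  by (rule measurable_compose[OF _ ou_joint_measurable[OF h t]])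
   (use x in \<open>auto intro!: measurable_Pair measurable_const simp: space_restrict_space\<close>)
 thus ?thesis by simp
qed

text \<open>The numbers \<open>y n\<close> bound the \<open>L p\<close> norms of the steps of level
  \<open>n\<close>. Taken as weights in \<open>chaining\<close> they let level \<open>n\<close>
  contribute \<open>y n powr (1 - p) * y n powr p = y n\<close>, so the levels add up to
  \<open>W\<close> again and the bound is \<open>W powr p\<close>.\<close>

lemma ou_sup: assumes v: "dyadic L v" and p: "p > 2" and x: "x > 0" and B: "B > 0"
  and vB: "(\<H> r. (\<E> z. ennreal (abs (v r z) powr p))) <= ennreal (B powr p)"
 shows "(\<E> z. (SUP t\<in>{0..}. ennreal (abs (ou L v x t z) powr p))) <= ennreal ((cc p * x powr (- (1/2 - 1/p)) * B) powr p)"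
proof -
 define a where "a = 1/2 - 1/p"
 define h where "h = ln 2 / x"
 define q where "q = (4::real) powr (- a)"
 define K where "K = sqrt (kap p) * h powr a * B"
 define y where "y n = (if n = 0 then K else sqrt 3 * K * q ^ n)" for n :: nat
 define W where "W = 2 * y 0 + (\<Sum>n. y (Suc n))"
 define G where "G r = (\<E> z. ennreal (abs (v r z) powr p))" for r
 define D where "D s t z = ou L v x t z - exp (- x * (t - s)) * ou L v x s z" for s t z
 have a: "a > 0" using p by (simp add: a_def field_simps)
 have h: "h > 0" using x by (simp add: h_def)
 have kp: "kap p > 0" using kap_pos p by simp
 have K: "K > 0" using kp h B by (simp add: K_def)
 have q: "0 < q" "q < 1" using a powr_less_mono[of "- a" 0 "4::real"] by (auto simp: q_def)
 have y: "y n > 0" for n using K q by (simp add: y_def)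
 have sums: "(%n. y (Suc n)) sums (sqrt 3 * K * q * (1 / (1 - q)))"
  using sums_mult[OF geometric_sums[of q], of "sqrt 3 * K * q"] q by (simp add: y_def mult.assoc)
 hence ys: "summable y" using sums_summable summable_Suc_iff by blast
 have Weq: "W = cc p * x powr (- a) * B" proof -
  have "W = K * (2 + sqrt 3 * (q / (1 - q)))"
   using sums_unique[OF sums] by (simp add: W_def y_def algebra_simps)
  also have "q / (1 - q) = 1 / (4 powr a - 1)" using q by (simp add: q_def powr_minus field_simps)
  also have "h powr a = ln 2 powr a * x powr (- a)" using x by (simp add: h_def powr_divide powr_minus field_simps)
  hence "K = sqrt (kap p) * ln 2 powr a * x powr (- a) * B" by (simp add: K_def)
  finally show ?thesis by (simp add: cc_def a_def[symmetric])
 qed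
 have W: "W > 0" using cc_pos[OF p] x B by (simp add: Weq)
 have [measurable]: "D s t : bmeas M" if "0 <= s" "0 <= t" for s t
  unfolding D_def[abs_def] using ou_measurable[OF v] that x by (intro borel_measurable_diff borel_measurable_times) auto
 have Dpm: "(%z. ennreal (abs (D s t z) powr p)) : bmeas M" if "0 <= s" "0 <= t" for s t
  using that by measurable
 have Gm[measurable]: "G : bmeas lborel" unfolding G_def[abs_def] by (rule dyadic_moment_measurable[OF v])
 have Dm: "(\<E> z. ennreal (abs (D s t z) powr p)) <= ennreal (kap p powr (p/2) * (t - s) powr (p/2 - 1)) * (\<integral>\<^sup>+r\<in>{s<..t}. G r \<partial>lborel)"
  if "0 <= s" "s <= t" for s t
  unfolding D_def G_def by (rule ou_increment_moment[OF v _ _ that]) (use p x in auto)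
 let ?H = "%k z. ennreal (abs (D (real k * h) (real (Suc k) * h) z) powr p)"
 define S0 where "S0 z = (\<Sum>k. ?H k z)" for z
 define S where "S n z = (\<Sum>k. \<Sum>j\<in>{1,2,3::nat}. ennreal (abs (D (real (4 * k) * (h / 4 ^ Suc n)) (real (4 * k + j) * (h / 4 ^ Suc n)) z) powr p))" for n z
 have S0m[measurable]: "S0 : bmeas M" unfolding S0_def[abs_def]
  by (intro borel_measurable_suminf_order Dpm) (use h in auto)
 have Sm[measurable]: "S n : bmeas M" for n unfolding S_def[abs_def]
  by (intro borel_measurable_suminf_order borel_measurable_sum Dpm) (use h in auto)
 let ?E = "\<E> z. S0 z"
 let ?J = "ennreal (y 0 powr p)"
 have ES0: "?E <= ?J" proof -
  let ?C = "ennreal (kap p powr (p/2) * h powr (p/2 - 1))"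
  let ?N = "%k. \<integral>\<^sup>+r\<in>{real k * h<..real (Suc k) * h}. G r \<partial>lborel"
  have "?E = (\<Sum>k. \<E> z. ?H k z)"
   unfolding S0_def by (intro nn_integral_suminf Dpm) (use h in auto)
  also have "... <= (\<Sum>k. ?C * (?N k))" proof (intro suminf_le summableI)
   fix k
   have e: "real (Suc k) * h - real k * h = h" by (simp add: algebra_simps)
   show "(\<E> z. ?H k z) <= ?C * (?N k)"
    using Dm[of "real k * h" "real (Suc k) * h"] h unfolding e by (simp add: mult_right_mono)
  qed
  also have "... = ?C * (\<Sum>k. \<integral>\<^sup>+r\<in>{real k * h<..real (Suc k) * h}. G r \<partial>lborel)"
   by (rule ennreal_suminf_cmult)
  also have "... <= ?C * ennreal (B powr p)"
   by (intro mult_left_mono order_trans[OF suminf_nn_integral_blocks_le[OF Gm h]]) (use vB in \<open>auto simp: G_def\<close>)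
  also have "... = ?J" proof -
   have "y 0 powr p = (sqrt (kap p)) powr p * (h powr a) powr p * B powr p"
    by (simp add: y_def K_def powr_mult)
   also have "(sqrt (kap p)) powr p = kap p powr (p/2)" using kp by (simp add: powr_half_sqrt[symmetric] powr_powr)
   also have "(h powr a) powr p = h powr (p/2 - 1)" using p by (simp add: powr_powr a_def left_diff_distrib)
   finally show ?thesis by (simp add: ennreal_mult')
  qed
  finally show ?thesis .
 qed
 let ?I = "%n. \<E> z. S n z"
 let ?L = "%n. ennreal (y (Suc n) powr p)"
 \<comment> \<open>Three steps per coarse block, each of length at most \<open>3 * hn\<close>, give
   the factor \<open>3 * 3 powr (p/2 - 1)\<close>, which is \<open>sqrt 3 powr p\<close>.\<close>
 have ES: "(?I n) <= ?L n" for n proof -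
  define hn where "hn = h / 4 ^ Suc n"
  have hn: "hn > 0" using h by (simp add: hn_def)
  define c where "c = kap p powr (p/2) * (3 * hn) powr (p/2 - 1)"
  let ?A = "%k j z. ennreal (abs (D (real (4 * k) * hn) (real (4 * k + j) * hn) z) powr p)"
  let ?K = "%k. \<integral>\<^sup>+r\<in>{real k * (4 * hn)<..real (Suc k) * (4 * hn)}. G r \<partial>lborel"
  have "(?I n) = (\<Sum>k. \<E> z. (\<Sum>j\<in>{1,2,3::nat}. ?A k j z))"
   unfolding S_def hn_def[symmetric]
   by (intro nn_integral_suminf borel_measurable_sum Dpm) (use hn in auto)
  also have "... <= (\<Sum>k. ennreal (3 * c) * (?K k))" proof (intro suminf_le summableI)
   fix k
   define I where "I = (?K k)"
   have one: "(\<E> z. ?A k j z) <= ennreal c * I" if j: "j : {1,2,3}" for j :: nat proof -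
    have e: "real (4 * k + j) * hn - real (4 * k) * hn = real j * hn" by (simp add: algebra_simps)
    have le: "real (4 * k) * hn <= real (4 * k + j) * hn" using hn by (intro mult_right_mono) auto
    let ?P = "%hn j. \<integral>\<^sup>+r\<in>{real (4 * k) * hn<..real (4 * k + j) * hn}. G r \<partial>lborel"
    have "(\<E> z. ?A k j z) <= ennreal (kap p powr (p/2) * (real j * hn) powr (p/2 - 1)) * (?P hn j)"
     using Dm[OF _ le] hn unfolding e by simp
    also have "... <= ennreal c * I" proof (rule mult_mono)
     have "real j * hn <= 3 * hn" using j hn by (intro mult_right_mono) auto
     hence "(real j * hn) powr (p/2 - 1) <= (3 * hn) powr (p/2 - 1)" using p hn by (intro powr_mono2) auto
     thus "ennreal (kap p powr (p/2) * (real j * hn) powr (p/2 - 1)) <= ennreal c"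
      unfolding c_def by (intro ennreal_leI mult_left_mono) auto
     show "(?P hn j) <= I" unfolding I_def proof (intro nn_integral_mono mult_left_mono)
      fix r
      have "real (4 * k + j) * hn <= (real (Suc k) * 4) * hn" using j hn by (intro mult_right_mono) auto
      thus "indicator {real (4 * k) * hn<..real (4 * k + j) * hn} r <= (indicator {real k * (4 * hn)<..real (Suc k) * (4 * hn)} r :: ennreal)"
      proof -
       assume le: "real (4 * k + j) * hn <= (real (Suc k) * 4) * hn"
       have "{real (4 * k) * hn<..real (4 * k + j) * hn} \<subseteq> {real k * (4 * hn)<..real (Suc k) * (4 * hn)}"
        using le by (auto simp: algebra_simps)
       thus ?thesis by (auto simp: indicator_def)
      qed
     qed simp
    qed simp_all
    finally show ?thesis .
   qed
   have "(\<E> z. (\<Sum>j\<in>{1,2,3::nat}. ?A k j z)) = (\<Sum>j\<in>{1,2,3::nat}. \<E> z. ?A k j z)"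
    by (intro nn_integral_sum Dpm) (use hn in auto)
   also have "... <= (\<Sum>j\<in>{1,2,3::nat}. ennreal c * I)" by (rule sum_mono) (rule one)
   also have "... = ennreal (3 * c) * I" proof -
    have "c >= 0" by (simp add: c_def)
    thus ?thesis by (simp add: ennreal_mult' mult.assoc)
   qed
   finally show "(\<E> z. (\<Sum>j\<in>{1,2,3::nat}. ?A k j z)) <= ennreal (3 * c) * I" .
  qed
  also have "... = ennreal (3 * c) * (\<Sum>k. \<integral>\<^sup>+r\<in>{real k * (4 * hn)<..real (Suc k) * (4 * hn)}. G r \<partial>lborel)"
   by (rule ennreal_suminf_cmult)
  also have "... <= ennreal (3 * c) * ennreal (B powr p)"
   by (intro mult_left_mono order_trans[OF suminf_nn_integral_blocks_le[OF Gm]]) (use vB hn in \<open>auto simp: G_def\<close>)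
  also have "... = ?L n" proof -
   have "y (Suc n) powr p = (sqrt 3) powr p * ((sqrt (kap p)) powr p * (h powr a) powr p * B powr p) * (q ^ Suc n) powr p"
    by (simp add: y_def K_def powr_mult mult_ac)
   also have "(sqrt (kap p)) powr p = kap p powr (p/2)" using kp by (simp add: powr_half_sqrt[symmetric] powr_powr)
   also have "(h powr a) powr p = h powr (p/2 - 1)" using p by (simp add: powr_powr a_def left_diff_distrib)
   also have "(sqrt 3) powr p = 3 powr (p/2)" by (simp add: powr_half_sqrt[symmetric] powr_powr)
   also have "(3::real) powr (p/2) = 3 * 3 powr (p/2 - 1)" by (simp add: powr_diff)
   also have "(q ^ Suc n) powr p = (1 / 4 ^ Suc n) powr (p/2 - 1)" proof -
    have "q ^ Suc n = (4 ^ Suc n) powr (- a)"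
     unfolding q_def by (subst powr_realpow[symmetric], simp, subst powr_realpow[symmetric], simp) (simp add: powr_powr mult.commute)
    hence "(q ^ Suc n) powr p = (4 ^ Suc n) powr (- (p/2 - 1))"
     using p by (simp add: powr_powr a_def left_diff_distrib del: power_Suc)
    thus ?thesis by (simp only: powr_minus powr_divide inverse_eq_divide powr_one_eq_one)
   qed
   also have "3 * 3 powr (p/2 - 1) * (kap p powr (p/2) * h powr (p/2 - 1) * B powr p) * (1 / 4 ^ Suc n) powr (p/2 - 1) = 3 * (kap p powr (p/2) * (3 powr (p/2 - 1) * (h powr (p/2 - 1) * (1 / 4 ^ Suc n) powr (p/2 - 1)))) * B powr p"
    by (simp only: mult_ac)
   also have "... = 3 * c * B powr p" unfolding c_def hn_def powr_mult[symmetric] by simp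
   finally show ?thesis by (simp add: ennreal_mult' c_def)
  qed
  finally show ?thesis .
 qed
 have bb: "y n powr (1 - p) * y n powr p = y n" for n using y[of n] by (simp add: powr_add[symmetric])
 let ?B = "ennreal (2 * y 0 powr (1 - p))"
 let ?D = "%n. ennreal (y (Suc n) powr (1 - p))"
 let ?G = "ennreal (W powr (p - 1))"
 have "(\<E> z. (SUP t\<in>{0..}. ennreal (abs (ou L v x t z) powr p))) <= (\<E> z. ?G * (?B * S0 z + (\<Sum>n. ?D n * S n z)))"
 proof (intro nn_integral_mono SUP_least)
  fix z t assume "z : space M" "t : {0::real..}"
  thus "ennreal (abs (ou L v x t z) powr p) <= ?G * (?B * S0 z + (\<Sum>n. ?D n * S n z))"
   unfolding S0_def S_def
   by (intro chaining[OF ou_continuous _ x _ h_def D_def y ys W_def]) (use p in auto)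
 qed
 also have "... = ?G * (?B * ?E + (\<Sum>n. ?D n * (?I n)))"
  by (simp add: nn_integral_cmult nn_integral_add nn_integral_suminf)
 also have "... <= ?G * (?B * ?J + (\<Sum>n. ?D n * ?L n))"
  by (intro mult_left_mono add_mono suminf_le summableI ES0 ES) auto
 also have "... = ?G * ennreal W" proof -
  have "?B * ?J = ennreal (2 * y 0)"
   by (subst ennreal_mult'[symmetric]) (simp_all add: mult.assoc bb)
  moreover have "?D n * ?L n = ennreal (y (Suc n))" for n
   by (subst ennreal_mult'[symmetric]) (simp_all add: bb)
  moreover have "(\<Sum>n. ennreal (y (Suc n))) = ennreal (\<Sum>n. y (Suc n))"
   using y ys by (intro suminf_ennreal2) (auto simp: summable_Suc_iff intro: less_imp_le)
  ultimately show ?thesis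
   using y ys unfolding W_def by (subst ennreal_plus) (auto intro!: suminf_nonneg simp: summable_Suc_iff less_imp_le)
 qed
 also have "... = ennreal (W powr p)" proof -
  have "W powr (p - 1) * W = W powr p" using W by (simp add: powr_diff)
  thus ?thesis by (subst ennreal_mult'[symmetric]) simp_all
 qed
 finally show ?thesis unfolding Weq a_def .
qed

end

section \<open>Mixing over the representing measure\<close>

text \<open>On \<open>[0, n]\<close> the integrable function \<open>exp (- x)\<close> is at least
  \<open>exp (- n)\<close>, so these intervals have finite measure. The total mass may be infinite,
  and Tonelli's theorem will be applied to \<open>z\<close>.\<close>

lemma sigma_finite_laplace: fixes z :: "real measure"
 assumes sets_z: "sets z = sets (restrict_space borel {0..})" and int: "integrable z (%x. exp (- x))"
 shows "sigma_finite_measure z" proof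
 have space_z: "space z = {0..}"
  using sets_eq_imp_space_eq[OF sets_z] by (simp add: space_restrict_space)
 have em: "(%x. exp (- x) :: real) : bmeas z" using int by (rule borel_measurable_integrable)
 have fin: "emeasure z {0..real n} < \<infinity>" for n proof -
  have m: "{0..real n} : sets z" unfolding sets_z by (auto simp: sets_restrict_space intro!: image_eqI[of _ _ "{0..real n}"])
  have "emeasure z {0..real n} = (\<integral>\<^sup>+x. indicator {0..real n} x \<partial>z)" using m by simp
  also have "... <= (\<integral>\<^sup>+x. ennreal (exp (real n)) * ennreal (exp (- x)) \<partial>z)"
  proof (rule nn_integral_mono)
   fix x assume "x : space z"
   have "1 <= exp (real n) * exp (- x)" if "x <= real n" using that by (simp add: mult_exp_exp)
   thus "indicator {0..real n} x <= ennreal (exp (real n)) * ennreal (exp (- x))"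
    by (auto simp: indicator_def ennreal_mult'[symmetric])
  qed
  also have "... = ennreal (exp (real n)) * (\<integral>\<^sup>+x. ennreal (exp (- x)) \<partial>z)" by (intro nn_integral_cmult measurable_compose[OF em measurable_ennreal])
  also have "... < \<infinity>" using int by (auto simp: integrable_iff_bounded ennreal_mult_less_top)
  finally show ?thesis .
 qed
 show "EX A. countable A & A \<subseteq> sets z & \<Union> A = space z & (ALL a:A. emeasure z a ~= \<infinity>)"
 proof (intro exI[of _ "range (%n. {0..real n})"] conjI)
  show "range (%n. {0..real n}) \<subseteq> sets z"
   unfolding sets_z by (auto simp: sets_restrict_space intro!: image_eqI)
  show "\<Union> (range (%n. {0..real n})) = space z" using real_arch_simple by (auto simp: space_z)
  show "ALL a:range (%n. {0..real n}). emeasure z a ~= \<infinity>" using fin by (auto simp: less_top)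
 qed simp
qed

lemma dy_floor_tendsto:
 assumes "t >= 0" shows "(%l. dy l (nat \<lfloor>t * 2 ^ l\<rfloor>)) \<leadsto> t"
proof (rule tendsto_sandwich[OF _ _ _ tendsto_const])
 let ?A = "%l. nat \<lfloor>t * 2 ^ l\<rfloor>"
 have b: "t - (1/2) ^ l <= dy l (?A l) & dy l (?A l) <= t" for l proof -
  have "0 <= \<lfloor>t * 2 ^ l\<rfloor>" using assms by simp
  hence "real (?A l) = of_int \<lfloor>t * 2 ^ l\<rfloor>" by (rule of_nat_nat)
  hence d: "dy l (?A l) = of_int \<lfloor>t * 2 ^ l\<rfloor> / 2 ^ l" by (simp add: dy_def)
  have "(t * 2 ^ l - 1) / 2 ^ l <= dy l (?A l)" "dy l (?A l) <= (t * 2 ^ l) / 2 ^ l"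
   unfolding d by (rule divide_right_mono, linarith, simp)+
  thus ?thesis by (simp add: diff_divide_distrib power_one_over)
 qed
 thus "eventually (%l. t - (1/2) ^ l <= dy l (?A l)) sequentially"
  "eventually (%l. dy l (?A l) <= t) sequentially" by auto
 have "(%l. t - (1/2) ^ l) \<leadsto> t - 0" by (intro tendsto_intros) auto
 thus "(%l. t - (1/2) ^ l) \<leadsto> t" by simp
qed

text \<open>Continuity reduces the supremum to countably many times, which makes it
  measurable.\<close>

lemma SUP_halfline_dyadic:
 fixes f :: "real => real" assumes f: "continuous_on {0..} f" and p: "p > 0"
 shows "(SUP t\<in>{0..}. ennreal (abs (f t) powr p)) = (SUP l. SUP i. ennreal (abs (f (dy l i)) powr p))"
proof (rule antisym)
 let ?A = "SUP l. SUP i. ennreal (abs (f (dy l i)) powr p)"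
 let ?B = "%t. ennreal (abs (f t) powr p)"
 show "(SUP t\<in>{0..}. ?B t) <= ?A" proof (rule SUP_least)
  fix t :: real assume t: "t : {0..}"
  let ?d = "%l. dy l (nat \<lfloor>t * 2 ^ l\<rfloor>)"
  have "(%l. f (?d l)) \<leadsto> f t"
   using continuous_on_tendsto_compose[OF f dy_floor_tendsto] t by simp
  hence "(%l. ennreal (abs (f (?d l)) powr p)) \<leadsto> ?B t"
   using p by (intro tendsto_ennrealI tendsto_powr' tendsto_rabs tendsto_const) auto
  thus "?B t <= ?A" proof (rule LIMSEQ_le_const2, intro exI allI impI)
   fix l
   show "ennreal (abs (f (?d l)) powr p) <= ?A"
    by (rule SUP_upper2[of l], simp, rule SUP_upper2[of "nat \<lfloor>t * 2 ^ l\<rfloor>"]) auto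
  qed
 qed
 show "?A <= (SUP t\<in>{0..}. ?B t)" by (intro SUP_least SUP_upper) auto
qed

text \<open>\<open>A\<close> is a positive upper bound of the integral of
  \<open>x powr (- (1/2 - 1/p))\<close> rather than the integral itself, which may be 0: it will be
  the total mass of a weight.\<close>

locale kernel_conv = scalar_bm M F w for M :: "'a measure" and F :: "real => 'a measure" and w :: "real => 'a => real" +
 fixes \<nu> :: "real measure" and k :: "real => real" and p A :: real
 assumes sets_\<nu>: "sets \<nu> = sets (restrict_space borel {0..})"
  and k: "!!t. t > 0 ==> has_bochner_integral \<nu> (%x. exp (- x * t)) (k t)" and p: "p > 2"
  and A: "A > 0" "(\<integral>\<^sup>+x. epowr x (- (1/2 - 1/p)) \<partial>\<nu>) <= ennreal A"
begin

abbreviation kernel_nn :: "(real => ennreal) => ennreal" (binder "\<N>" 10)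
 where "kernel_nn f \<equiv> integral\<^sup>N \<nu> f"

definition a where "a = 1/2 - 1/p"

lemma a: "0 < a" "a < 1/2" using p by (auto simp: a_def field_simps)

lemma space_\<nu>: "space \<nu> = {0..}"
 using sets_eq_imp_space_eq[OF sets_\<nu>] by (simp add: space_restrict_space)

lemma id_meas[measurable]: "(%x. x) : bmeas \<nu>"
 unfolding measurable_cong_sets[OF sets_\<nu> refl] by (auto simp: measurable_restrict_space1)

text \<open>By the convention \<open>epowr 0 (- a) = \<infinity>\<close>, an atom at 0 would make
  the integral infinite.\<close>

lemma AE_pos: "AE x in \<nu>. x > 0" proof -
 have [measurable]: "(%x. epowr x (- a)) : bmeas \<nu>" unfolding epowr_def by measurable
 have "(\<N> x. epowr x (- a)) ~= \<infinity>" using A(2) unfolding a_def by (auto simp: top_unique)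
 hence "AE x in \<nu>. epowr x (- a) ~= \<infinity>" by (intro nn_integral_PInf_AE) auto
 moreover have "AE x in \<nu>. x : space \<nu>" by (rule AE_space)
 ultimately show ?thesis
  by eventually_elim (use a in \<open>auto simp: epowr_def space_\<nu> split: if_splits\<close>)
qed

sublocale \<nu>: sigma_finite_measure \<nu>
 using k[of 1] by (intro sigma_finite_laplace sets_\<nu>) (simp add: has_bochner_integral_iff)

sublocale \<nu>M: pair_sigma_finite \<nu> M ..

text \<open>Integrating \<open>exp (- x * (t - s))\<close> over \<open>x\<close> gives
  \<open>k (t - s)\<close>, so this is meant to be the convolution with \<open>k\<close>. A Bochner
  integral is 0 where it diverges; \<open>conv_sup\<close> shows that this happens on a null set
  only, the same for all \<open>t\<close>.\<close>

definition conv :: "nat => (real => 'a => real) => real => 'a => real" where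
 "conv L h t z = (\<integral>x. ou L h x t z \<partial>\<nu>)"

lemma ou_meas: assumes "dyadic L h" "t >= 0"
 shows "(%(x, z). ou L h x t z) : bmeas (\<nu> \<Otimes> M)"
 using ou_joint_measurable[OF assms] by (simp cong: measurable_cong_sets sets_pair_measure_cong add: sets_\<nu>)

lemma ou_meas_x: assumes "dyadic L h" "t >= 0" "z : space M"
 shows "(%x. ou L h x t z) : bmeas \<nu>"
 using measurable_compose[OF measurable_Pair[OF measurable_ident measurable_const[OF assms(3)]] ou_meas[OF assms(1,2)]]
 by (simp add: id_def)

lemma conv_measurable: assumes "dyadic L h" "t >= 0" shows "conv L h t : bmeas M" proof -
 have "(%(z, x). ou L h x t z) : bmeas (M \<Otimes> \<nu>)"
  using measurable_compose[OF measurable_pair_swap' ou_meas[OF assms]] by (simp add: case_prod_beta')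
 thus ?thesis unfolding conv_def[abs_def] by (rule \<nu>.borel_measurable_lebesgue_integral)
qed

definition supou :: "nat => (real => 'a => real) => real => 'a => ennreal" where
 "supou L h x z = (SUP t\<in>{0..}. ennreal (abs (ou L h x t z) powr p))"

lemma supou_meas: assumes "dyadic L h" shows "(%(x, y). supou L h x y) : bmeas (\<nu> \<Otimes> M)"
proof -
 let ?A = "bmeas (\<nu> \<Otimes> M)"
 have [measurable]: "(%z. ou L h (fst z) (dy l i) (snd z)) : ?A" for l i
  using ou_meas[OF assms dy_nonneg, of l i] by (simp add: case_prod_beta')
 have "(%z. SUP l. SUP i. ennreal (abs (ou L h (fst z) (dy l i) (snd z)) powr p)) : ?A"
  by measurable
 also have "?this \<longleftrightarrow> (%z. supou L h (fst z) (snd z)) : ?A" unfolding supou_def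
  by (rule measurable_cong, rule SUP_halfline_dyadic[symmetric]) (use p in \<open>auto simp: space_pair_measure intro!: ou_continuous\<close>)
 finally show ?thesis by (simp add: case_prod_beta')
qed

text \<open>For \<open>x > 0\<close> this is the bound of \<open>ou_sup\<close> on the
  \<open>L p\<close> norm of the supremum; the value 1 elsewhere secures positivity on what is a
  null set.\<close>

definition wt :: "real => real => real" where
 "wt B x = (if x > 0 then cc p * x powr (- a) * B else 1)"

lemma wt_pos: "B > 0 ==> wt B x > 0" using cc_pos[OF p] by (simp add: wt_def)

lemma wt_meas[measurable]: "wt B : bmeas \<nu>" unfolding wt_def[abs_def] by measurable

lemma wt_int:
 assumes "B > 0" shows "(\<N> x. wt B x) <= ennreal (cc p * A * B)"
proof -
 have [measurable]: "(%x. epowr x (- a)) : bmeas \<nu>" unfolding epowr_def by measurable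
 have "(\<N> x. wt B x) = (\<N> x. ennreal (cc p * B) * epowr x (- a))"
 proof (rule nn_integral_cong_AE)
  show "AE x in \<nu>. ennreal (wt B x) = ennreal (cc p * B) * epowr x (- a)" using AE_pos
  proof eventually_elim
   fix x :: real assume "0 < x"
   moreover have "0 <= cc p * B" using cc_pos[OF p] assms by simp
   ultimately show "ennreal (wt B x) = ennreal (cc p * B) * epowr x (- a)"
    by (simp add: wt_def epowr_def ennreal_mult'[symmetric] mult_ac)
  qed
 qed
 also have "... = ennreal (cc p * B) * (\<N> x. epowr x (- a))" by (rule nn_integral_cmult) simp
 also have "... <= ennreal (cc p * B) * ennreal A" by (intro mult_left_mono) (use A in \<open>auto simp: a_def\<close>)
 also have "... = ennreal (cc p * A * B)" proof -
  have "0 <= cc p * B" using cc_pos[OF p] assms by simp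
  thus ?thesis using A by (subst ennreal_mult'[symmetric]) (auto simp: mult_ac)
 qed
 finally show ?thesis .
qed

text \<open>Jensen's inequality with weight \<open>wt\<close> shows that \<open>V\<close>, the
  supremum over time of \<open>abs (ou L h x t z)\<close>, is integrable in \<open>x\<close>. It
  dominates all times at once, so dominated convergence makes this path of the mixture
  continuous.\<close>

lemma conv_dominated: assumes h: "dyadic L h" and B: "B > 0" and z: "z : space M"
  and Q: "(\<N> x. ennreal (wt B x powr (1 - p)) * supou L h x z) < \<infinity>"
 shows "!!t. t >= 0 ==> integrable \<nu> (%x. ou L h x t z)"
  and "continuous_on {0..} (%t. conv L h t z)"
  and "!!t. t >= 0 ==> ennreal (abs (conv L h t z) powr p) <= ennreal ((cc p * A * B) powr (p - 1)) * (\<N> x. ennreal (wt B x powr (1 - p)) * supou L h x z)"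
proof -
 have W: "cc p * A * B > 0" using cc_pos[OF p] A B by simp
 have [measurable]: "(%x. supou L h x z) : bmeas \<nu>"
  using measurable_compose[OF measurable_Pair[OF measurable_ident measurable_const[OF z]] supou_meas[OF h]]
  by (simp add: id_def)
 have [measurable]: "(%x. ou L h x t z) : bmeas \<nu>" if "t >= 0" for t by (rule ou_meas_x[OF h that z])
 have ub: "ennreal (abs (ou L h x t z) powr p) <= supou L h x z" if "t >= 0" for x t
  unfolding supou_def by (rule SUP_upper) (use that in auto)
 let ?E = "%B x. ennreal (wt B x powr (1 - p))"
 have wp: "?E B x > 0" for x using wt_pos[OF B, of x] by simp
 have AEfin: "AE x in \<nu>. supou L h x z ~= \<infinity>" proof -
  have "AE x in \<nu>. ?E B x * supou L h x z ~= \<infinity>"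
   using Q by (intro nn_integral_PInf_AE) auto
  thus ?thesis proof eventually_elim
   fix x assume "?E B x * supou L h x z ~= \<infinity>"
   thus "supou L h x z ~= \<infinity>" using wp[of x] by (auto simp: ennreal_mult_eq_top_iff)
  qed
 qed
 define V where "V x = enn2real (supou L h x z) powr (1/p)" for x
 have [measurable]: "V : bmeas \<nu>" unfolding V_def[abs_def] by measurable
 have Vp: "V x powr p = enn2real (supou L h x z)" for x using p by (simp add: V_def powr_powr)
 let ?A = "\<N> x. ?E B x * supou L h x z"
 let ?C = "\<N> x. ennreal (wt B x powr (1 - p) * V x powr p)"
 have Vle: "?C <= ?A" proof (rule nn_integral_mono)
  fix x
  have "ennreal (enn2real (supou L h x z)) <= supou L h x z" by (cases "supou L h x z") auto
  thus "ennreal (wt B x powr (1 - p) * V x powr p) <= ?E B x * supou L h x z"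
   unfolding Vp by (simp add: ennreal_mult' mult_left_mono)
 qed
 let ?B = "\<N> x. V x"
 let ?D = "ennreal ((cc p * A * B) powr (p - 1))"
 have jV: "?B < \<infinity>"
  "ennreal (enn2real ?B powr p) <= ?D * ?C"
  using jensen_nn_integral[of p V \<nu> "wt B" "cc p * A * B"] p W wt_pos[OF B] wt_int[OF B] order_le_less_trans[OF Vle Q]
  by (auto simp: V_def)
 have Vint: "integrable \<nu> V" using jV(1) by (intro integrableI_bounded) (auto simp: V_def)
 have dom: "AE x in \<nu>. norm (ou L h x t z) <= V x" if t: "t >= 0" for t using AEfin
 proof eventually_elim
  fix x assume "supou L h x z ~= \<infinity>"
  hence "ennreal (abs (ou L h x t z) powr p) <= ennreal (V x powr p)"
   using ub[OF t, of x] unfolding Vp by (simp add: less_top)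
  hence "abs (ou L h x t z) powr p <= V x powr p" by simp
  thus "norm (ou L h x t z) <= V x"
   using powr_less_mono2[of p "V x" "abs (ou L h x t z)"] p by (fastforce simp: V_def not_le[symmetric])
 qed
 show int: "integrable \<nu> (%x. ou L h x t z)" if "t >= 0" for t
  by (rule Bochner_Integration.integrable_bound[OF Vint]) (use dom[OF that] that in \<open>auto simp: V_def\<close>)
 show "continuous_on {0..} (%t. conv L h t z)" unfolding continuous_on_sequentially
 proof (intro allI ballI impI)
  fix T :: "nat => real" and t assume "t : {0..}" "(ALL n. T n : {0..}) & T \<leadsto> t"
  hence t: "t >= 0" "!!n. T n >= 0" "T \<leadsto> t" by auto
  have "(%n. \<integral>x. ou L h x (T n) z \<partial>\<nu>) \<leadsto> (\<integral>x. ou L h x t z \<partial>\<nu>)"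
  proof (rule integral_dominated_convergence[OF _ _ Vint])
   show "AE x in \<nu>. (%n. ou L h x (T n) z) \<leadsto> ou L h x t z"
    using continuous_on_tendsto_compose[OF ou_continuous[OF z], of T t sequentially L h] t by auto
  qed (use t dom in auto)
  thus "((%t. conv L h t z) \<circ> T) \<leadsto> conv L h t z" by (simp add: conv_def o_def)
 qed
 fix t :: real assume t: "t >= 0"
 have "abs (conv L h t z) <= (\<integral>x. abs (ou L h x t z) \<partial>\<nu>)" unfolding conv_def using integral_norm_bound[of \<nu> "%x. ou L h x t z"] by simp
 also have "... <= (\<integral>x. V x \<partial>\<nu>)"
  using int[OF t] Vint dom[OF t] by (intro integral_mono_AE) auto
 also have "... = enn2real ?B" by (intro integral_eq_nn_integral) (auto simp: V_def)
 finally have "abs (conv L h t z) powr p <= enn2real ?B powr p" using p by (intro powr_mono2) auto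
 hence "ennreal (abs (conv L h t z) powr p) <= ennreal (enn2real ?B powr p)" by (rule ennreal_leI)
 also note jV(2)
 also have "?D * ?C <= ?D * ?A" by (rule mult_left_mono[OF Vle]) simp
 finally show "ennreal (abs (conv L h t z) powr p) <= ?D * ?A" .
qed

text \<open>The expectation of \<open>Q\<close> is finite: for fixed \<open>x\<close> its integrand
  has expectation at most \<open>wt B x powr (1 - p) * wt B x powr p = wt B x\<close>, and
  \<open>wt_int\<close> bounds the integral of that. So \<open>conv_dominated\<close> applies to
  almost every path.\<close>

lemma conv_sup: assumes h: "dyadic L h" and B: "B > 0"
  and hB: "(\<H> r. (\<E> z. ennreal (abs (h r z) powr p))) <= ennreal (B powr p)"
 shows "AE z in M. continuous_on {0..} (%t. conv L h t z) & (ALL t>=0. integrable \<nu> (%x. ou L h x t z))"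
  and "(\<E> z. (SUP t\<in>{0..}. ennreal (abs (conv L h t z) powr p))) <= ennreal ((cc p * A * B) powr p)"
proof -
 define W where "W = cc p * A * B"
 have W: "W > 0" using cc_pos[OF p] A B by (simp add: W_def)
 let ?D = "%x. ennreal (wt B x powr (1 - p))"
 define Q where "Q z = (\<N> x. ?D x * supou L h x z)" for z
 have [measurable]: "(%(x, z). supou L h x z) : bmeas (\<nu> \<Otimes> M)" by (rule supou_meas[OF h])
 have joint: "(%(x, z). ?D x * supou L h x z) : bmeas (\<nu> \<Otimes> M)" by measurable
 have Qm[measurable]: "Q : bmeas M" proof -
  have "(%(z, x). ?D x * supou L h x z) : bmeas (M \<Otimes> \<nu>)"
   using measurable_compose[OF measurable_pair_swap' joint] by (simp add: case_prod_beta')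
  thus ?thesis unfolding Q_def[abs_def] by (rule \<nu>.borel_measurable_nn_integral)
 qed
 let ?A = "%x. \<E> z. ?D x * supou L h x z"
 let ?B = "\<E> z. Q z"
 have "?B = (\<N> x. (?A x))"
  unfolding Q_def using \<nu>M.Fubini'[OF joint] by simp
 also have "... <= (\<N> x. wt B x)" proof (rule nn_integral_mono_AE)
  show "AE x in \<nu>. (?A x) <= ennreal (wt B x)" using AE_pos AE_space proof eventually_elim
   fix x assume x: "0 < x" "x : space \<nu>"
   have m: "(%z. supou L h x z) : bmeas M"
    using measurable_compose[OF measurable_Pair[OF measurable_const[OF x(2)] measurable_ident] supou_meas[OF h]]
    by (simp add: id_def)
   have "(?A x) = ?D x * (\<E> z. supou L h x z)" by (rule nn_integral_cmult[OF m])
   also have "... <= ?D x * ennreal (wt B x powr p)"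
    using ou_sup[OF h p x(1) B hB] x by (intro mult_left_mono) (auto simp: supou_def wt_def a_def)
   also have "... = ennreal (wt B x)"
    using wt_pos[OF B, of x] by (subst ennreal_mult'[symmetric]) (auto simp: powr_add[symmetric])
   finally show "(?A x) <= ennreal (wt B x)" .
  qed
 qed
 also have "... <= ennreal W" unfolding W_def by (rule wt_int[OF B])
 finally have EQ: "?B <= ennreal W" .
 have "?B ~= \<infinity>" using EQ by (auto simp: top_unique)
 hence Qfin: "AE z in M. Q z ~= \<infinity>" by (intro nn_integral_PInf_AE) auto
 show "AE z in M. continuous_on {0..} (%t. conv L h t z) & (ALL t>=0. integrable \<nu> (%x. ou L h x t z))"
  using Qfin AE_space proof eventually_elim
  fix z assume "Q z ~= \<infinity>" "z : space M"
  thus "continuous_on {0..} (%t. conv L h t z) & (ALL t>=0. integrable \<nu> (%x. ou L h x t z))"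
   using conv_dominated(1,2)[OF h B, of z] by (simp add: Q_def less_top)
 qed
 let ?C = "%z. SUP t\<in>{0..}. ennreal (abs (conv L h t z) powr p)"
 let ?E = "ennreal (W powr (p - 1))"
 let ?G = "\<E> z. (?C z)"
 have "?G <= (\<E> z. ?E * Q z)" proof (rule nn_integral_mono_AE)
  show "AE z in M. (?C z) <= ?E * Q z" using Qfin AE_space proof eventually_elim
   fix z assume "Q z ~= \<infinity>" "z : space M"
   thus "(?C z) <= ?E * Q z"
    unfolding W_def Q_def by (intro SUP_least conv_dominated(3)[OF h B]) (auto simp: less_top)
  qed
 qed
 also have "... = ?E * ?B" by (rule nn_integral_cmult) simp
 also have "... <= ?E * ennreal W" by (rule mult_left_mono[OF EQ]) simp
 also have "... = ennreal (W powr p)" proof -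
  have "W powr (p - 1) * W = W powr p" using W by (simp add: powr_diff)
  thus ?thesis by (subst ennreal_mult'[symmetric]) simp_all
 qed
 finally show "?G <= ennreal ((cc p * A * B) powr p)" unfolding W_def .
qed

end

section \<open>Mean square approximation by sampled kernels\<close>

text \<open>Interpolation between two bounds. With \<open>u = t\<close> and
  \<open>v = 1 / (2 * x)\<close> it trades powers of \<open>t\<close> for powers of
  \<open>1 / x\<close>.\<close>

lemma min_le_geometric: fixes u v z :: real assumes "u >= 0" "v >= 0" "0 <= z" "z <= 1"
 shows "min u v <= u powr (1 - z) * v powr z" proof (cases "min u v = 0")
 case False hence m: "min u v > 0" using assms by auto
 have "min u v = min u v powr (1 - z) * min u v powr z" using m by (simp add: powr_add[symmetric])
 also have "... <= u powr (1 - z) * v powr z" using assms m by (intro mult_mono powr_mono2) auto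
 finally show ?thesis .
qed (use assms in simp)

lemma nn_integral_exp_le: fixes c t :: real assumes c: "c > 0" and t: "t >= 0"
 shows "(\<integral>\<^sup>+s\<in>{0<..<t}. ennreal (exp (- c * (t - s))) \<partial>lborel) <= ennreal (1 / c)"
  and "(\<integral>\<^sup>+s\<in>{0<..<t}. ennreal (exp (- c * (t - s))) \<partial>lborel) <= ennreal t"
proof -
 let ?A = "%t c. \<integral>\<^sup>+s\<in>{0<..<t}. ennreal (exp (- c * (t - s))) \<partial>lborel"
 have "(?A t c) <= (\<L> s. ennreal (exp (- c * (t - s))) * indicator {0..t} s)"
  by (intro nn_integral_mono mult_left_mono) (auto simp: indicator_def)
 also have "... = ennreal (exp (- c * (t - t)) / c - exp (- c * (t - 0)) / c)"
  by (rule nn_integral_FTC_Icc) (use c t in \<open>auto intro!: derivative_eq_intros\<close>)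
 also have "... <= ennreal (1 / c)" using c by (intro ennreal_leI) simp
 finally show "(?A t c) <= ennreal (1 / c)" .
 have "(?A t c) <= (\<L> s. indicator {0<..<t} s)"
  by (intro nn_integral_mono) (use c in \<open>auto simp: indicator_def\<close>)
 also have "... = ennreal t" using t by simp
 finally show "(?A t c) <= ennreal t" .
qed

lemma left_dy_measurable[measurable]: "left_dy l : bmeas borel"
 unfolding left_dy_def[abs_def] by measurable

context kernel_conv begin

declare id_meas[measurable del]

lemma nu_borel: "f : measurable borel N ==> f : measurable \<nu> N"
 by (rule measurable_compose[OF id_meas])

lemma pair_meas: "(%z. fst z) : bmeas (lborel \<Otimes> \<nu>)" "(%z. snd z) : bmeas (lborel \<Otimes> \<nu>)"
 by (rule measurable_compose[OF measurable_fst], simp, rule measurable_compose[OF measurable_snd id_meas])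

text \<open>The function \<open>x powr (- a)\<close>, made positive everywhere so that it can be a
  weight in \<open>jensen_nn_integral\<close>.\<close>

definition wx :: "real => real" where "wx x = (if x > 0 then x powr (- a) else 1)"

lemma wx_pos: "wx x > 0" by (simp add: wx_def)

lemma wx_meas[measurable]: "wx : bmeas \<nu>" unfolding wx_def[abs_def] by (rule nu_borel) measurable

lemma wx_int: "(\<N> x. wx x) <= ennreal A" proof -
 have "(\<N> x. wx x) = (\<N> x. epowr x (- a))"
  by (rule nn_integral_cong_AE) (use AE_pos in eventually_elim, auto simp: wx_def epowr_def)
 thus ?thesis using A(2) by (simp add: a_def)
qed

text \<open>Cauchy-Schwarz with the weight \<open>wx\<close>, as the case of exponent 2 in Jensen's
  inequality.\<close>

lemma square_integral_le: assumes f: "integrable \<nu> f"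
 shows "ennreal ((\<integral>x. f x \<partial>\<nu>)^2) <= ennreal A * (\<N> x. ennreal ((f x)^2 / wx x))"
proof (cases "(\<N> x. ennreal ((f x)^2 / wx x)) = \<infinity>")
 case True thus ?thesis using A(1) by (simp add: ennreal_mult_top)
next case False
 have [measurable]: "f : bmeas \<nu>" using f by simp
 have e: "wx x powr (1 - 2) * abs (f x) powr 2 = (f x)^2 / wx x" for x
  using wx_pos[of x] by (simp add: powr_minus_divide)
 let ?A = "\<N> x. abs (f x)"
 let ?B = "\<N> x. ennreal (wx x powr (1 - 2) * abs (f x) powr 2)"
 have "ennreal (enn2real ?A powr 2) <= ennreal (A powr (2 - 1)) * ?B"
 proof (rule jensen_nn_integral(2))
  show "?B < \<infinity>"
   unfolding e using False by (simp only: less_top[symmetric] infinity_ennreal_def not_False_eq_True)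
 qed (use A wx_pos wx_int in \<open>simp_all\<close>)
 hence "ennreal ((enn2real ?A)^2) <= ennreal A * (\<N> x. ennreal ((f x)^2 / wx x))"
  unfolding e using A(1) by simp
 moreover have "(\<integral>x. f x \<partial>\<nu>)^2 <= (enn2real ?A)^2" proof -
  have "abs (\<integral>x. f x \<partial>\<nu>) <= (\<integral>x. abs (f x) \<partial>\<nu>)" using integral_norm_bound[of \<nu> f] by simp
  also have "... = enn2real ?A" by (intro integral_eq_nn_integral) auto
  finally show ?thesis by (simp add: abs_le_square_iff[symmetric])
 qed
 ultimately show ?thesis by (meson ennreal_leI order_trans)
qed

lemma R_meas[measurable]: "(%x. ennreal ((min 1 (x / 2 ^ l))^2 * wx x)) : bmeas \<nu>" proof -
 have [measurable]: "(%x. (min 1 (x / 2 ^ l))^2) : bmeas \<nu>" by (rule nu_borel) measurable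
 show ?thesis by measurable
qed

text \<open>Sampling \<open>exp (- x * (t - s))\<close> with mesh \<open>1 / 2 ^ l\<close> makes a
  relative error of at most \<open>min 1 (x / 2 ^ l)\<close>. \<open>R l\<close> collects its square
  over \<open>\<nu>\<close> and tends to 0 by domination with \<open>wx\<close>.\<close>

definition R :: "nat => ennreal" where
 "R l = (\<N> x. ennreal ((min 1 (x / 2 ^ l))^2 * wx x))"

lemma R_tendsto_0: "R \<leadsto> 0" proof -
 let ?A = "%x l. ennreal ((min 1 (x / 2 ^ l))^2 * wx x)"
 have "(%l. \<N> x. ?A x l) \<leadsto> (\<N> x. 0)"
 proof (rule nn_integral_dominated_convergence[where w = "%x. ennreal (wx x)"])
  show "AE x in \<nu>. ?A x l <= ennreal (wx x)" for l using AE_pos proof eventually_elim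
   fix x :: real assume "0 < x"
   hence "(min 1 (x / 2 ^ l))^2 <= 1^2" by (intro power_mono) auto
   thus "?A x l <= ennreal (wx x)"
    using wx_pos[of x] by (intro ennreal_leI mult_left_le_one_le) auto
  qed
  show "(\<N> x. ennreal (wx x)) < \<infinity>" using wx_int by (simp add: order_le_less_trans)
  show "AE x in \<nu>. (%l. ?A x l) \<leadsto> 0" proof (rule AE_I2)
   fix x :: real
   have "(%l. x * (1/2) ^ l) \<leadsto> x * 0" by (intro tendsto_intros) auto
   hence "(%l. x / 2 ^ l) \<leadsto> 0" by (simp add: power_one_over)
   hence "(%l. ?A x l) \<leadsto> ennreal ((min 1 0)^2 * wx x)" by (intro tendsto_intros)
   thus "(%l. ?A x l) \<leadsto> 0" by simp
  qed
 qed auto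
 thus ?thesis unfolding R_def[abs_def] by simp
qed

text \<open>The exponents are such that \<open>x powr (- (2 * a))\<close>, divided by the weight
  \<open>wx x\<close>, leaves one factor \<open>wx x\<close>, which is integrable.\<close>

lemma exp_block_le: assumes x: "x > 0" and t: "t >= 0"
 shows "(\<integral>\<^sup>+s\<in>{0<..<t}. ennreal (exp (- (2 * x) * (t - s))) \<partial>lborel) <= ennreal (t powr (1 - 2 * a) * x powr (- (2 * a)))"
proof -
 have "(\<integral>\<^sup>+s\<in>{0<..<t}. ennreal (exp (- (2 * x) * (t - s))) \<partial>lborel) <= ennreal (min t (1 / (2 * x)))"
  using nn_integral_exp_le[of "2 * x" t] x t by (auto simp: min_def)
 also have "... <= ennreal (t powr (1 - 2 * a) * (1 / (2 * x)) powr (2 * a))"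
  using x t a by (intro ennreal_leI min_le_geometric) auto
 also have "... <= ennreal (t powr (1 - 2 * a) * x powr (- (2 * a)))"
 proof (intro ennreal_leI mult_left_mono)
  have "(1 / (2 * x)) powr (2 * a) <= (1 / x) powr (2 * a)"
   using x a by (intro powr_mono2) (auto simp: field_simps)
  thus "(1 / (2 * x)) powr (2 * a) <= x powr (- (2 * a))" using x by (simp add: powr_minus powr_divide inverse_eq_divide)
 qed simp
 finally show ?thesis .
qed

text \<open>Once \<open>exp (- x * (t - s))\<close> is taken out, both remaining factors lie between
  \<open>1 - min 1 (x * h)\<close> and 1.\<close>

lemma exp_diff_le: fixes x r1 r2 s t h :: real
 assumes x: "x > 0" and r: "r1 < s" "s - r1 <= h" "r2 <= s" "s - r2 <= h" and st: "s <= t"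
 shows "abs (exp (- x * (t - r1)) - exp (- x * (t - r2))) <= min 1 (x * h) * exp (- x * (t - s))"
proof -
 have b: "1 - min 1 (x * h) <= exp (- x * (s - r)) & exp (- x * (s - r)) <= 1" if "r <= s" "s - r <= h" for r
 proof -
  have "1 - x * (s - r) <= exp (- x * (s - r))" using exp_ge_add_one_self[of "- x * (s - r)"] by simp
  moreover have "x * (s - r) <= x * h" using that x by simp
  ultimately have "1 - x * h <= exp (- x * (s - r))" by linarith
  thus ?thesis using that x by (auto simp: min_def)
 qed
 have e: "exp (- x * (t - r)) = exp (- x * (t - s)) * exp (- x * (s - r))" for r
  by (simp add: mult_exp_exp algebra_simps)
 have "abs (exp (- x * (s - r1)) - exp (- x * (s - r2))) <= min 1 (x * h)"
  using b[OF less_imp_le[OF r(1)] r(2)] b[OF r(3,4)] by linarith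
 hence "exp (- x * (t - s)) * abs (exp (- x * (s - r1)) - exp (- x * (s - r2))) <= exp (- x * (t - s)) * min 1 (x * h)"
  by (intro mult_left_mono) auto
 thus ?thesis unfolding e[of r1] e[of r2] right_diff_distrib[symmetric] abs_mult by (simp add: mult.commute)
qed

lemma k_eq: "t > 0 ==> k t = (\<integral>x. exp (- x * t) \<partial>\<nu>)" and k_int: "t > 0 ==> integrable \<nu> (%x. exp (- x * t))"
 using k by (auto simp: has_bochner_integral_iff)

text \<open>Cauchy-Schwarz under \<open>\<nu>\<close>, then Tonelli to integrate over time first,
  where \<open>exp_block_le\<close> applies.\<close>

lemma block_measure_bound: fixes f :: "real => real => real" assumes t: "t >= 0"
  and [measurable]: "(%(s, x). f s x) : bmeas (lborel \<Otimes> \<nu>)"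
  and int: "!!s. 0 < s ==> s < t ==> integrable \<nu> (f s)"
  and bnd: "!!s x. 0 < s ==> s < t ==> x > 0 ==> abs (f s x) <= min 1 (x / 2 ^ l) * exp (- x * (t - s))"
 shows "(\<integral>\<^sup>+s\<in>{0<..<t}. ennreal ((\<integral>x. f s x \<partial>\<nu>)^2) \<partial>lborel) <= ennreal (A * t powr (1 - 2 * a)) * R l"
proof -
 interpret L\<nu>: pair_sigma_finite lborel \<nu> ..
 let ?B = "%x. ennreal ((min 1 (x / 2 ^ l))^2 / wx x)"
 let ?C = "%x s. ennreal (exp (- (2 * x) * (t - s)))"
 let ?G = "bmeas (lborel \<Otimes> \<nu>)"
 have J: "(%(s, x). ?B x * (?C x s * indicator {0<..<t} s)) : ?G" proof -
  note [measurable] = pair_meas measurable_compose[OF measurable_snd wx_meas, of lborel]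
  have [measurable]: "(%z. indicator {0<..<t} (fst z) :: ennreal) : ?G"
   by (rule measurable_compose[OF pair_meas(1)]) simp
  have "(%z. ennreal ((min 1 (snd z / 2 ^ l))^2 / wx (snd z)) * (ennreal (exp (- (2 * snd z) * (t - fst z))) * indicator {0<..<t} (fst z))) : ?G"
   by measurable
  thus ?thesis by (simp add: case_prod_beta')
 qed
 let ?A = "%x s. ?B x * (?C x s * indicator {0<..<t} s)"
 let ?D = "%s. \<N> x. ennreal ((f s x)^2 / wx x)"
 let ?E = "%s. \<N> x. ?A x s"
 have "(\<integral>\<^sup>+s\<in>{0<..<t}. ennreal ((\<integral>x. f s x \<partial>\<nu>)^2) \<partial>lborel) <= (\<integral>\<^sup>+s\<in>{0<..<t}. (ennreal A * (?D s)) \<partial>lborel)"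
  by (intro nn_integral_mono) (auto simp: indicator_def intro!: square_integral_le int)
 also have "... <= (\<L> s. ennreal A * (?E s))" proof (rule nn_integral_mono)
  fix s
  show "ennreal A * (?D s) * indicator {0<..<t} s <= ennreal A * (?E s)"
  proof (cases "s : {0<..<t}")
   case True have "(?D s) <= (\<N> x. ?B x * ?C x s)"
   proof (rule nn_integral_mono_AE)
    show "AE x in \<nu>. ennreal ((f s x)^2 / wx x) <= ?B x * ?C x s" using AE_pos
    proof eventually_elim
     fix x :: real assume x: "x > 0"
     have "(f s x)^2 <= (min 1 (x / 2 ^ l) * exp (- x * (t - s)))^2"
      using bnd[of s x] True x abs_le_square_iff[of "f s x" "min 1 (x / 2 ^ l) * exp (- x * (t - s))"] by auto
     also have "... = (min 1 (x / 2 ^ l))^2 * exp (- (2 * x) * (t - s))"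
      by (simp add: power_mult_distrib exp_double[symmetric] mult.assoc)
     finally have "(f s x)^2 / wx x <= (min 1 (x / 2 ^ l))^2 * exp (- (2 * x) * (t - s)) / wx x"
      using wx_pos[of x] by (intro divide_right_mono) auto
     thus "ennreal ((f s x)^2 / wx x) <= ?B x * ?C x s"
      using wx_pos[of x] by (subst ennreal_mult'[symmetric]) (auto intro!: ennreal_leI)
    qed
   qed
   thus ?thesis using True by (simp add: mult_left_mono)
  qed simp
 qed
 also have "... = ennreal A * (\<L> s. (?E s))"
  by (rule nn_integral_cmult[OF \<nu>.borel_measurable_nn_integral[OF J]])
 also have "(\<L> s. (?E s)) = (\<N> x. (\<L> s. ?A x s))"
  by (rule L\<nu>.Fubini'[symmetric, OF J])
 also have "... <= (\<N> x. ennreal (t powr (1 - 2 * a)) * ennreal ((min 1 (x / 2 ^ l))^2 * wx x))"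
 proof (rule nn_integral_mono_AE)
  show "AE x in \<nu>. (\<L> s. ?A x s) <= ennreal (t powr (1 - 2 * a)) * ennreal ((min 1 (x / 2 ^ l))^2 * wx x)"
   using AE_pos proof eventually_elim
   fix x :: real assume x: "x > 0"
   have "(\<L> s. ?A x s) = ?B x * (\<integral>\<^sup>+s\<in>{0<..<t}. ?C x s \<partial>lborel)"
    by (rule nn_integral_cmult) measurable
   also have "... <= ?B x * ennreal (t powr (1 - 2 * a) * x powr (- (2 * a)))"
    by (rule mult_left_mono[OF exp_block_le[OF x t]]) simp
   also have "... = ennreal (t powr (1 - 2 * a)) * ennreal ((min 1 (x / 2 ^ l))^2 * wx x)" proof -
    have "x powr (- (2 * a)) = wx x * wx x" using x by (simp add: wx_def powr_add[symmetric])
    hence "(min 1 (x / 2 ^ l))^2 / wx x * (t powr (1 - 2 * a) * x powr (- (2 * a))) = t powr (1 - 2 * a) * ((min 1 (x / 2 ^ l))^2 * wx x)"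
     using wx_pos[of x] by simp
    thus ?thesis using wx_pos[of x] by (subst (1 2) ennreal_mult'[symmetric]) auto
   qed
   finally show "(\<L> s. ?A x s) <= ennreal (t powr (1 - 2 * a)) * ennreal ((min 1 (x / 2 ^ l))^2 * wx x)" .
  qed
 qed
 also have "... = ennreal (t powr (1 - 2 * a)) * R l" unfolding R_def by (rule nn_integral_cmult) measurable
 finally show ?thesis using A(1) by (simp add: ennreal_mult' mult.assoc mult_left_mono)
qed

text \<open>Mixing \<open>exp_diff_le\<close> over \<open>\<nu>\<close> gives mean square continuity
  under sampling for a kernel that may be singular at 0.\<close>

lemma kernel_left_approx: assumes t: "t >= 0"
 shows "(\<integral>\<^sup>+s\<in>{0<..<t}. ennreal ((k (t - left_dy l s) - k (t - s))^2) \<partial>lborel) <= ennreal (A * t powr (1 - 2 * a)) * R l"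
proof -
 define f where "f s x = exp (- x * (t - left_dy l s)) - exp (- x * (t - s))" for s x
 have m: "(%(s, x). f s x) : bmeas (lborel \<Otimes> \<nu>)" proof -
  note [measurable] = pair_meas
  have "(%z. exp (- snd z * (t - left_dy l (fst z))) - exp (- snd z * (t - fst z))) : bmeas (lborel \<Otimes> \<nu>)"
   by measurable
  thus ?thesis by (simp add: f_def case_prod_beta')
 qed
 let ?A = "%s. \<integral>x. f s x \<partial>\<nu>"
 have "(\<integral>\<^sup>+s\<in>{0<..<t}. ennreal ((k (t - left_dy l s) - k (t - s))^2) \<partial>lborel) = (\<integral>\<^sup>+s\<in>{0<..<t}. ennreal ((?A s)^2) \<partial>lborel)"
 proof (rule nn_integral_cong)
  fix s
  show "ennreal ((k (t - left_dy l s) - k (t - s))^2) * indicator {0<..<t} s = ennreal ((?A s)^2) * indicator {0<..<t} s"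
  proof (cases "s : {0<..<t}")
   case True
   hence "0 < t - left_dy l s" "0 < t - s" using left_dy_bounds(1)[where L = l and s = s] by auto
   hence "(?A s) = k (t - left_dy l s) - k (t - s)"
    unfolding f_def by (simp only: k_eq Bochner_Integration.integral_diff[OF k_int k_int])
   thus ?thesis by simp
  qed simp
 qed
 also have "... <= ennreal (A * t powr (1 - 2 * a)) * R l" proof (rule block_measure_bound[OF t m])
  fix s assume s: "0 < s" "s < t"
  hence "0 < t - left_dy l s" "0 < t - s" using left_dy_bounds(1)[where L = l and s = s] by auto
  thus "integrable \<nu> (f s)" unfolding f_def by (intro Bochner_Integration.integrable_diff k_int)
  fix x :: real assume "x > 0"
  thus "abs (f s x) <= min 1 (x / 2 ^ l) * exp (- x * (t - s))"
   unfolding f_def using exp_diff_le[of x "left_dy l s" s "1 / 2 ^ l" s t] left_dy_bounds[where L = l and s = s] s by simp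
 qed
 finally show ?thesis .
qed

end

lemma abs_powr_2: "abs (u::real) powr 2 = u^2" by simp

lemma AE_lborel_neq: "AE r in lborel. r ~= (t::real)" by (rule AE_I[of _ _ "{t}"]) auto

context scalar_bm begin

lemma dyadic_bounded: assumes "dyadic L h" shows "EX B>0. ALL r. ALL z:space M. abs (h r z) <= B"
proof -
 have "ALL i:{..<L * 2 ^ L}. EX B. ALL z:space M. abs (h (dy L (Suc i)) z) <= B" using dyadicD(2)[OF assms] by blast
 then obtain B where B: "!!i z. i < L * 2 ^ L ==> z : space M ==> abs (h (dy L (Suc i)) z) <= B i"
  by (metis lessThan_iff)
 define C where "C = 1 + (\<Sum>i<L * 2 ^ L. abs (B i))"
 have C: "C > 0" unfolding C_def by (intro add_pos_nonneg sum_nonneg) auto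
 have "abs (h r z) <= C" if z: "z : space M" for r z proof (cases "r <= 0 | r > real L")
  case True thus ?thesis using dyadicD(4)[OF assms True] C by simp
 next case False
  hence r: "r > 0" "r <= real L" by auto
  obtain i where i: "dy L i < r" "r <= dy L (Suc i)" using dy_ex[OF r(1)] by blast
  have "dy L i < dy L (L * 2 ^ L)" using i r by simp
  hence il: "i < L * 2 ^ L" unfolding dy_less_iff .
  have "abs (h r z) <= abs (B i)" unfolding dyadicD(3)[OF assms i] using B[OF il z] by linarith
  also have "... <= (\<Sum>i<L * 2 ^ L. abs (B i))" by (rule member_le_sum) (use il in auto)
  finally show ?thesis by (simp add: C_def)
 qed
 thus ?thesis using C by blast
qed

lemma dyadic_Lp_finite: assumes h: "dyadic L h" and p: "p > 0"
 shows "EX B>0. (\<H> r. (\<E> z. ennreal (abs (h r z) powr p))) <= ennreal (B powr p)" proof -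
 obtain C where C: "C > 0" "!!r z. z : space M ==> abs (h r z) <= C" using dyadic_bounded[OF h] by blast
 \<comment> \<open>The added 1 keeps \<open>B\<close> positive for the horizon \<open>L = 0\<close>;
   \<open>conv_sup\<close> expects a positive bound.\<close>
 define B where "B = (C powr p * (1 + real L)) powr (1/p)"
 let ?A = "%r. \<E> z. ennreal (abs (h r z) powr p)"
 let ?B = "\<H> r. (?A r)"
 have "?B <= (\<L> r. ennreal (C powr p) * indicator {0..real L} r)" proof (rule nn_integral_mono)
  fix r
  have "(?A r) <= (\<E> z. ennreal (C powr p))"
   by (intro nn_integral_mono ennreal_leI powr_mono2) (use C p in auto)
  hence 1: "(?A r) <= ennreal (C powr p)" by (simp add: emeasure_space_1)
  show "(?A r) * indicator {0<..} r <= ennreal (C powr p) * indicator {0..real L} r"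
  proof (cases "r <= 0 | r > real L")
   case True thus ?thesis using dyadicD(4)[OF h True] by simp
  next case False
   thus ?thesis using 1 by simp
  qed
 qed
 also have "... = ennreal (C powr p * real L)" by (simp add: nn_integral_cmult ennreal_mult')
 also have "... <= ennreal (B powr p)"
  unfolding B_def using p C by (intro ennreal_leI) (simp add: powr_powr distrib_left)
 finally have "?B <= ennreal (B powr p)" .
 moreover have "B > 0" using C by (simp add: B_def)
 ultimately show ?thesis by blast
qed

text \<open>Since \<open>kap 2 = 2\<close>, this is twice the value given by the Ito isometry,
  enough for convergence in mean square.\<close>

lemma ito_L2: assumes h: "dyadic L h" and t: "t >= 0"
 shows "(\<E> z. ennreal ((ito L h t z)^2)) <= 2 * (\<integral>\<^sup>+r\<in>{0<..<t}. (\<E> z. ennreal ((h r z)^2)) \<partial>lborel)"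
proof -
 let ?A = "\<integral>\<^sup>+r\<in>{0<..t}. (\<E> z. ennreal (abs (h r z) powr 2)) \<partial>lborel"
 have "(\<E> z. ennreal (abs (ito L h t z - ito L h 0 z) powr 2)) <= ennreal (kap 2 powr (2/2) * (t - 0) powr (2/2 - 1)) * ?A"
  by (rule ito_increment_moment[OF h]) (use t in auto)
 also have "... <= 2 * ?A" proof (rule mult_right_mono)
  show "ennreal (kap 2 powr (2/2) * (t - 0) powr (2/2 - 1)) <= 2" by (simp add: kap_def powr_def)
 qed simp
 also have "?A = (\<integral>\<^sup>+r\<in>{0<..<t}. (\<E> z. ennreal ((h r z)^2)) \<partial>lborel)"
  by (rule nn_integral_cong_AE) (use AE_lborel_neq[of t] in eventually_elim, auto simp: indicator_def)
 finally show ?thesis by simp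
qed

end

context kernel_conv begin

text \<open>\<open>ou\<close> is the limit of the samplings at levels \<open>n + l\<close>. Each of
  them differs from the sampling at level \<open>l\<close> by an integrand of size at most
  \<open>min 1 (x / 2 ^ l) * exp (- x * (t - s)) * B\<close>, and Fatou's lemma passes to the
  limit.\<close>

lemma ou_L2_approx: assumes h: "dyadic L h" and B: "!!r z. z : space M ==> abs (h r z) <= B"
  and x: "x > 0" and t: "t >= 0" and l: "l >= L"
 shows "(\<E> z. ennreal ((ito l (%s z. exp (- x * (t - left_dy l s)) * h s z) t z - ou L h x t z)^2)) <= ennreal (2 * B^2 * (min 1 (x / 2 ^ l))^2 * (t powr (1 - 2 * a) * x powr (- (2 * a))))"
proof -
 define g where "g r = exp (- x * (t - r))" for r
 let ?A = "%l. %s z. g (left_dy l s) * h s z"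
 define f where "f n z = ito l (?A l) t z - ito (n + l) (%s z. g (left_dy (n + l) s) * h s z) t z" for n z
 have dl: "dyadic m (%s z. g (left_dy m s) * h s z)" if "m >= l" for m
  by (rule dyadic_weight[OF dyadic_refine(1)[OF h]]) (use that l in simp)
 define h' where "h' n s z = 1 * (g (left_dy l s) * h s z) + (- 1) * (g (left_dy (n + l) s) * h s z)" for n s z
 have dl1: "dyadic (n + l) (?A l)" for n by (rule dyadic_refine(1)[OF dl[OF order_refl]]) simp
 have d': "dyadic (n + l) (h' n)" for n unfolding h'_def by (rule dyadic_lincomb(1)[OF dl1 dl]) simp
 have f': "f n z = ito (n + l) (h' n) t z" for n z proof -
  have "ito (n + l) (h' n) t z = 1 * ito (n + l) (?A l) t z + (- 1) * ito (n + l) (%s z. g (left_dy (n + l) s) * h s z) t z"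
   unfolding h'_def by (rule dyadic_lincomb(2)[OF dl1 dl]) simp
  also have "ito (n + l) (?A l) t z = ito l (?A l) t z"
   by (rule dyadic_refine(2)[OF dl[OF order_refl]]) simp
  finally show ?thesis by (simp add: f_def)
 qed
 have lim: "AE z in M. (%n. f n z) \<leadsto> ito l (?A l) t z - ou L h x t z" proof (rule AE_I2)
  fix z assume z: "z : space M"
  have "(%n. exp (- x * t) * ito n (%s z. exp (x * left_dy n s) * h s z) t z) \<leadsto> ou L h x t z"
   unfolding ou_def using x by (intro tendsto_intros ouz_limit[OF h _ t z]) auto
  moreover have "exp (- x * t) * ito n (%s z. exp (x * left_dy n s) * h s z) t z = ito n (%s z. g (left_dy n s) * h s z) t z" for n
   by (rule ito_weight_scale[of _ _ "%r. exp (x * r)"]) (simp add: g_def mult_exp_exp algebra_simps)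
  ultimately have "(%n. ito n (%s z. g (left_dy n s) * h s z) t z) \<leadsto> ou L h x t z" by simp
  from LIMSEQ_ignore_initial_segment[OF this, of l]
  show "(%n. f n z) \<leadsto> ito l (?A l) t z - ou L h x t z"
   unfolding f_def by (intro tendsto_intros)
 qed
 let ?E = "t powr (1 - 2 * a) * x powr (- (2 * a))"
 let ?H = "%n. \<E> z. ennreal (abs (f n z) powr 2)"
 let ?I = "ennreal (2 * B^2 * (min 1 (x / 2 ^ l))^2 * ?E)"
 have bound: "(?H n) <= ?I" for n proof -
  let ?B = "ennreal (B^2 * (min 1 (x / 2 ^ l))^2)"
  let ?C = "%r. exp (- (2 * x) * (t - r))"
  let ?D = "%n r. \<E> z. ennreal ((h' n r z)^2)"
  let ?G = "\<L> r. ?B * (ennreal (?C r) * indicator {0<..<t} r)"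
  have "(?H n) = (\<E> z. ennreal ((ito (n + l) (h' n) t z)^2))" unfolding f' abs_powr_2 ..
  also have "... <= 2 * (\<integral>\<^sup>+r\<in>{0<..<t}. (?D n r) \<partial>lborel)"
   by (rule ito_L2[OF d' t])
  also have "... <= 2 * ?G" proof (intro mult_left_mono nn_integral_mono)
   fix r
   show "(?D n r) * indicator {0<..<t} r <= ?B * (ennreal (?C r) * indicator {0<..<t} r)"
   proof (cases "r : {0<..<t}")
    case True
    have gd: "abs (g (left_dy l r) - g (left_dy (n + l) r)) <= min 1 (x * (1 / 2 ^ l)) * exp (- x * (t - r))"
     unfolding g_def proof (rule exp_diff_le[OF x])
     show "left_dy l r < r" "left_dy (n + l) r <= r" using left_dy_bounds(1) by (auto intro: less_imp_le)
     show "r - left_dy l r <= 1 / 2 ^ l" using left_dy_bounds(2)[where L = l and s = r] by simp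
     have "1 / 2 ^ (n + l) <= (1 / 2 ^ l :: real)" by (intro divide_left_mono power_increasing) auto
     thus "r - left_dy (n + l) r <= 1 / 2 ^ l" using left_dy_bounds(2)[where L = "n + l" and s = r] by simp
     show "r <= t" using True by simp
    qed
    have "(?D n r) <= (\<E> z. ennreal (B^2 * (min 1 (x / 2 ^ l))^2 * ?C r))"
    proof (intro nn_integral_mono ennreal_leI)
     fix z assume z: "z : space M"
     have "h' n r z = (g (left_dy l r) - g (left_dy (n + l) r)) * h r z" by (simp add: h'_def left_diff_distrib)
     hence "abs (h' n r z) <= (min 1 (x * (1 / 2 ^ l)) * exp (- x * (t - r))) * B"
      using gd B[OF z, of r] x by (simp only: abs_mult) (intro mult_mono, auto)
     hence "abs (h' n r z)^2 <= ((min 1 (x * (1 / 2 ^ l)) * exp (- x * (t - r))) * B)^2"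
      by (rule power_mono) simp
     also have "... = B^2 * (min 1 (x / 2 ^ l))^2 * ?C r"
      by (simp add: power_mult_distrib exp_double[symmetric] mult.assoc mult.commute mult.left_commute)
     finally show "(h' n r z)^2 <= B^2 * (min 1 (x / 2 ^ l))^2 * ?C r" by simp
    qed
    also have "... = ?B * ennreal (?C r)" by (simp add: emeasure_space_1 ennreal_mult')
    finally show ?thesis using True by simp
   qed simp
  qed simp
  also have "?G = ?B * (\<integral>\<^sup>+r\<in>{0<..<t}. ennreal (?C r) \<partial>lborel)"
   by (rule nn_integral_cmult) measurable
  also have "2 * (?B * (\<integral>\<^sup>+r\<in>{0<..<t}. ennreal (?C r) \<partial>lborel)) <= 2 * (?B * ennreal ?E)"
   by (intro mult_left_mono exp_block_le x t) auto
  also have "... = ennreal (2 * (B^2 * (min 1 (x / 2 ^ l))^2 * ?E))" proof -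
   have n: "0 <= B^2 * (min 1 (x / 2 ^ l))^2" "0 <= (2::real)" by auto
   show ?thesis unfolding ennreal_mult'[OF n(2)] ennreal_mult'[OF n(1)] by simp
  qed
  finally show ?thesis by (simp add: mult.assoc)
 qed
 have "(\<E> z. ennreal (abs (ito l (?A l) t z - ou L h x t z) powr 2)) <= ?I"
 proof (rule nn_integral_powr_fatou[OF _ _ lim bound])
  show "f n : bmeas M" for n using ito_measurable[OF d' t] by (simp add: f'[abs_def])
 qed auto
 thus ?thesis unfolding abs_powr_2 g_def .
qed

text \<open>Cutting off at \<open>r < t\<close> keeps \<open>k\<close> away from arguments that are
  not positive, where nothing is assumed about it.\<close>

definition kk :: "real => real => real" where "kk t r = (if r < t then k (t - r) else 0)"

text \<open>A stochastic Fubini theorem. For a sampled kernel the integral is a finite sum and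
  commutes with integration over \<open>\<nu>\<close>; it remains to compare \<open>I x\<close> with
  \<open>ou\<close> for each \<open>x\<close> and to integrate the squared error with the weight
  \<open>wx\<close>.\<close>

lemma ito_conv_approx: assumes h: "dyadic L h" and B: "!!r y. y : space M ==> abs (h r y) <= B"
  and t: "t >= 0" and l: "l >= L"
 shows "(\<E> y. ennreal ((ito l (%s y. kk t (left_dy l s) * h s y) t y - conv L h t y)^2))
  <= ennreal (2 * B^2 * A * t powr (1 - 2 * a)) * R l" proof -
 define e where "e x r = (if r < t then exp (- x * (t - r)) else 0)" for x r
 define I where "I x y = ito l (%s y. e x (left_dy l s) * h s y) t y" for x y
 have ek: "integrable \<nu> (%x. e x r)" "(\<integral>x. e x r \<partial>\<nu>) = kk t r" for r
  using k_int[of "t - r"] k_eq[of "t - r"] by (cases "r < t"; simp add: e_def kk_def)+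
 have ll: "left_dy l (dy l (Suc i)) = dy l i" for i by (rule left_dy_eq) auto
 have Iint: "integrable \<nu> (%x. I x y)" for y
  unfolding I_def ito_def ll using ek(1) by (intro Bochner_Integration.integrable_sum integrable_mult_left)
 have Ival: "(\<integral>x. I x y \<partial>\<nu>) = ito l (%s y. kk t (left_dy l s) * h s y) t y" for y
 proof -
  have "(\<integral>x. I x y \<partial>\<nu>) = (\<Sum>i<l * 2 ^ l. \<integral>x. e x (dy l i) * h (dy l (Suc i)) y * (w (min (dy l (Suc i)) t) y - w (min (dy l i) t) y) \<partial>\<nu>)"
   unfolding I_def ito_def ll using ek(1) by (intro Bochner_Integration.integral_sum integrable_mult_left)
  also have "... = ito l (%s y. kk t (left_dy l s) * h s y) t y"
   unfolding ito_def ll using ek by (intro sum.cong) auto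
  finally show ?thesis .
 qed
 have Ieq: "I x y = ito l (%s y. exp (- x * (t - left_dy l s)) * h s y) t y" for x y
  unfolding I_def by (rule ito_weight_cong[of _ _ "%r. exp (- x * (t - r))"]) (simp add: e_def)
 have Ijoint: "(%(x, y). I x y) : bmeas (\<nu> \<Otimes> M)" proof -
  have [measurable]: "h r : bmeas M" for r by (rule dyadic_borel[OF h])
  have [measurable]: "w (min (dy l i) t) : bmeas M" for i using t by (intro w_measurable) auto
  have [measurable]: "(%z. e (fst z) r) : bmeas (\<nu> \<Otimes> M)" for r
   by (rule measurable_compose[OF measurable_fst]) (use ek(1)[of r] in auto)
  have "(%z. I (fst z) (snd z)) : bmeas (\<nu> \<Otimes> M)"
   unfolding I_def ito_def ll by measurable
  thus ?thesis by (simp add: case_prod_beta')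
 qed
 obtain B' where B': "B' > 0" "(\<H> r. (\<E> y. ennreal (abs (h r y) powr p))) <= ennreal (B' powr p)"
  using dyadic_Lp_finite[OF h, of p] p by auto
 have J: "(%(x, y). ennreal ((I x y - ou L h x t y)^2 / wx x)) : bmeas (\<nu> \<Otimes> M)"
  using Ijoint ou_meas[OF h t] measurable_compose[OF measurable_fst wx_meas, of M]
  unfolding case_prod_beta' by measurable
 have J': "(%(y, x). ennreal ((I x y - ou L h x t y)^2 / wx x)) : bmeas (M \<Otimes> \<nu>)"
  using measurable_compose[OF measurable_pair_swap' J] by (simp add: case_prod_beta')
 have "(\<E> y. ennreal ((ito l (%s y. kk t (left_dy l s) * h s y) t y - conv L h t y)^2)) <=
   (\<E> y. ennreal A * (\<N> x. ennreal ((I x y - ou L h x t y)^2 / wx x)))"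
 proof (rule nn_integral_mono_AE)
  show "AE y in M. ennreal ((ito l (%s y. kk t (left_dy l s) * h s y) t y - conv L h t y)^2) <=
   ennreal A * (\<N> x. ennreal ((I x y - ou L h x t y)^2 / wx x))"
   using conv_sup(1)[OF h B'] proof eventually_elim
   fix y assume "continuous_on {0..} (%t. conv L h t y) & (ALL t>=0. integrable \<nu> (%x. ou L h x t y))"
   hence o: "integrable \<nu> (%x. ou L h x t y)" using t by blast
   have "ito l (%s y. kk t (left_dy l s) * h s y) t y - conv L h t y = (\<integral>x. I x y - ou L h x t y \<partial>\<nu>)"
    unfolding Ival[symmetric] conv_def by (rule Bochner_Integration.integral_diff[OF Iint o, symmetric])
   thus "ennreal ((ito l (%s y. kk t (left_dy l s) * h s y) t y - conv L h t y)^2) <=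
    ennreal A * (\<N> x. ennreal ((I x y - ou L h x t y)^2 / wx x))"
    using square_integral_le[OF Bochner_Integration.integrable_diff[OF Iint o]] by simp
  qed
 qed
 also have "... = ennreal A * (\<E> y. (\<N> x. ennreal ((I x y - ou L h x t y)^2 / wx x)))"
  by (rule nn_integral_cmult[OF \<nu>.borel_measurable_nn_integral[OF J']])
 also have "(\<E> y. (\<N> x. ennreal ((I x y - ou L h x t y)^2 / wx x))) = (\<N> x. (\<E> y. ennreal ((I x y - ou L h x t y)^2 / wx x)))"
  by (rule \<nu>M.Fubini'[OF J])
 also have "... <= (\<N> x. ennreal (2 * B^2 * t powr (1 - 2 * a)) * ennreal ((min 1 (x / 2 ^ l))^2 * wx x))"
 proof (rule nn_integral_mono_AE)
  show "AE x in \<nu>. (\<E> y. ennreal ((I x y - ou L h x t y)^2 / wx x)) <= ennreal (2 * B^2 * t powr (1 - 2 * a)) * ennreal ((min 1 (x / 2 ^ l))^2 * wx x)"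
   using AE_pos AE_space proof eventually_elim
   fix x assume x: "0 < x" "x : space \<nu>"
   have m: "(%y. ennreal ((I x y - ou L h x t y)^2)) : bmeas M"
    using measurable_compose[OF measurable_Pair[OF measurable_const[OF x(2)] measurable_ident] Ijoint] ou_measurable[OF h t, of x] x
    by (simp add: id_def)
   have "(\<E> y. ennreal ((I x y - ou L h x t y)^2 / wx x)) = (\<E> y. ennreal (1 / wx x) * ennreal ((I x y - ou L h x t y)^2))"
    using wx_pos[of x] by (intro nn_integral_cong, subst ennreal_mult'[symmetric]) auto
   also have "... = ennreal (1 / wx x) * (\<E> y. ennreal ((I x y - ou L h x t y)^2))"
    by (rule nn_integral_cmult[OF m])
   also have "... <= ennreal (1 / wx x) * ennreal (2 * B^2 * (min 1 (x / 2 ^ l))^2 * (t powr (1 - 2 * a) * x powr (- (2 * a))))"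
    unfolding Ieq by (intro mult_left_mono ou_L2_approx[OF h B x(1) t l]) auto
   also have "... = ennreal (2 * B^2 * t powr (1 - 2 * a)) * ennreal ((min 1 (x / 2 ^ l))^2 * wx x)"
   proof -
    have "x powr (- (2 * a)) = wx x * wx x" using x by (simp add: wx_def powr_add[symmetric])
    hence eq: "1 / wx x * (2 * B^2 * (min 1 (x / 2 ^ l))^2 * (t powr (1 - 2 * a) * x powr (- (2 * a)))) = (2 * B^2 * t powr (1 - 2 * a)) * ((min 1 (x / 2 ^ l))^2 * wx x)"
     using wx_pos[of x] by simp
    have n: "0 <= 1 / wx x" "0 <= 2 * B^2 * t powr (1 - 2 * a)" using wx_pos[of x] by auto
    show ?thesis unfolding ennreal_mult'[OF n(1), symmetric] ennreal_mult'[OF n(2), symmetric] eq ..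
   qed
   finally show "(\<E> y. ennreal ((I x y - ou L h x t y)^2 / wx x)) <= ennreal (2 * B^2 * t powr (1 - 2 * a)) * ennreal ((min 1 (x / 2 ^ l))^2 * wx x)" .
  qed
 qed
 also have "... = ennreal (2 * B^2 * t powr (1 - 2 * a)) * R l" unfolding R_def by (rule nn_integral_cmult[OF R_meas])
 finally have fin: "(\<E> y. ennreal ((ito l (%s y. kk t (left_dy l s) * h s y) t y - conv L h t y)^2)) <= ennreal A * (ennreal (2 * B^2 * t powr (1 - 2 * a)) * R l)"
  by (simp add: mult_left_mono)
 have "ennreal (2 * B^2 * A * t powr (1 - 2 * a)) = ennreal A * ennreal (2 * B^2 * t powr (1 - 2 * a))"
  using A(1) by (subst ennreal_mult'[symmetric]) (auto simp: mult_ac)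
 thus ?thesis using fin by (simp add: mult.assoc)
qed

end

lemma (in prob_space) second_moment_powr_le:
 fixes g :: "'a => real" assumes [measurable]: "g : bmeas M" and p: "p >= 2"
  and fin: "(\<E> z. ennreal (abs (g z) powr p)) < \<infinity>"
 shows "(\<E> z. ennreal ((g z)^2)) < \<infinity>"
  and "ennreal (enn2real (\<E> z. ennreal ((g z)^2)) powr (p/2)) <= (\<E> z. ennreal (abs (g z) powr p))"
proof -
 have e: "1 powr (1 - p/2) * ((g z)^2) powr (p/2) = abs (g z) powr p" for z by (simp add: square_powr_half)
 have 1: "p/2 >= 1" "(\<E> z. ennreal 1) <= ennreal 1" using p by (auto simp: emeasure_space_1)
 note j = jensen_nn_integral[OF 1(1) _ _ _ _ 1(2), of "%z. (g z)^2", unfolded e]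
 let ?A = "\<E> z. ennreal ((g z)^2)"
 show "?A < \<infinity>" by (rule j(1)) (use fin in auto)
 let ?B = "\<E> z. ennreal (abs (g z) powr p)"
 have "ennreal (enn2real ?A powr (p/2)) <= ennreal (1 powr (p/2 - 1)) * ?B"
  by (rule j(2)) (use fin in auto)
 thus "ennreal (enn2real ?A powr (p/2)) <= ?B" by simp
qed

context kernel_conv begin

lemma exp_holder: assumes [measurable]: "(%(s, z). g s z) : bmeas (lborel \<Otimes> M)"
  and B: "B > 0" and gB: "(\<H> s. (\<E> z. ennreal (abs (g s z) powr p))) <= ennreal (B powr p)"
  and x: "x > 0" and t: "t >= 0"
 shows "(\<integral>\<^sup>+s\<in>{0<..<t}. (ennreal (exp (- (2 * x) * (t - s))) * (\<E> z. ennreal ((g s z)^2))) \<partial>lborel) <= ennreal ((a / x) powr (2 * a) * B^2)"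
proof -
 define G where "G s = (\<E> z. ennreal ((g s z)^2))" for s
 define P where "P s = (\<E> z. ennreal (abs (g s z) powr p))" for s
 have [measurable]: "G : bmeas borel" "P : bmeas borel" proof -
  have "G : bmeas lborel" "P : bmeas lborel" unfolding G_def[abs_def] P_def[abs_def] by measurable
  thus "G : bmeas borel" "P : bmeas borel" by simp_all
 qed
 define N where "N = restrict_space lborel {0<..<t}"
 have Nm[measurable]: "f : bmeas borel ==> f : bmeas N" for f :: "real => real"
  unfolding N_def by (intro measurable_restrict_space1) simp
 have Nm'[measurable]: "f : bmeas borel ==> f : bmeas N" for f :: "real => ennreal"
  unfolding N_def by (intro measurable_restrict_space1) simp
 have Nint: "(\<integral>\<^sup>+s. f s \<partial>N) = (\<integral>\<^sup>+s\<in>{0<..<t}. f s \<partial>lborel)" for f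
  unfolding N_def by (rule nn_integral_restrict_space) simp
 define q where "q = p / 2"
 have q: "q > 1" using p by (simp add: q_def)
 have PN: "(\<integral>\<^sup>+s. P s \<partial>N) <= ennreal (B powr p)"
  unfolding Nint by (rule order_trans[OF _ gB]) (auto simp: P_def indicator_def intro!: nn_integral_mono)
 hence "(\<integral>\<^sup>+s. P s \<partial>N) ~= \<infinity>" by (auto simp: top_unique)
 hence Pfin: "AE s in N. P s ~= \<infinity>" by (intro nn_integral_PInf_AE) auto
 have gm: "g s : bmeas M" for s by measurable
 have Gfin: "AE s in N. G s = ennreal (enn2real (G s)) & ennreal (enn2real (G s) powr q) <= P s"
  using Pfin proof eventually_elim
  fix s assume "P s ~= \<infinity>"
  thus "G s = ennreal (enn2real (G s)) & ennreal (enn2real (G s) powr q) <= P s"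
   using second_moment_powr_le[OF gm, of p s] p by (simp add: G_def P_def q_def less_top)
 qed
 define u where "u s = exp (- (2 * x) * (t - s)) * enn2real (G s)" for s
 \<comment> \<open>The rate \<open>x / a\<close> is the one for which \<open>ww powr (1 - q)\<close>
   cancels the exponential in \<open>u powr q\<close>, because \<open>q - 1 = 2 * a * q\<close>;
   only the moment of \<open>g\<close> remains.\<close>
 define ww where "ww s = exp (- (x / a) * (t - s))" for s
 have xa: "x / a > 0" using x a by simp
 have W: "(\<integral>\<^sup>+s. ww s \<partial>N) <= ennreal (a / x)"
  unfolding Nint ww_def using nn_integral_exp_le(1)[OF xa t] by simp
 have e: "ww s powr (1 - q) * u s powr q = enn2real (G s) powr q" for s proof -
  have "ww s powr (1 - q) * u s powr q = exp (- (x / a) * (t - s) * (1 - q)) * exp (- (2 * x) * (t - s) * q) * enn2real (G s) powr q"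
   by (simp add: ww_def u_def powr_mult exp_powr_real)
  also have "exp (- (x / a) * (t - s) * (1 - q)) * exp (- (2 * x) * (t - s) * q) = 1" proof -
   have aq: "q - 1 = 2 * a * q" using p by (simp add: a_def q_def field_simps)
   have "- (x / a) * (t - s) * (1 - q) + - (2 * x) * (t - s) * q = (x * (t - s)) * ((q - 1) / a - 2 * q)"
    using a by (simp add: field_simps)
   also have "(q - 1) / a - 2 * q = 0" unfolding aq using a by simp
   finally show ?thesis by (simp add: mult_exp_exp)
  qed
  finally show ?thesis by simp
 qed
 have um: "u : bmeas N" unfolding u_def[abs_def] by measurable
 have wm: "ww : bmeas N" unfolding ww_def[abs_def] by measurable
 let ?B = "\<integral>\<^sup>+s. ennreal (ww s powr (1 - q) * u s powr q) \<partial>N"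
 have uq: "?B <= ennreal (B powr p)"
  unfolding e by (rule order_trans[OF nn_integral_mono_AE PN]) (use Gfin in eventually_elim, auto)
 let ?A = "\<integral>\<^sup>+s. u s \<partial>N"
 have ufin: "?A < \<infinity>"
  and ub: "ennreal (enn2real ?A powr q) <= ennreal ((a / x) powr (q - 1)) * ?B"
  using jensen_nn_integral[OF _ um wm _ _ W, of q] q x a order_le_less_trans[OF uq] by (auto simp: u_def ww_def)
 define U where "U = enn2real ?A"
 have "ennreal (U powr q) <= ennreal ((a / x) powr (q - 1)) * ennreal (B powr p)"
  unfolding U_def by (rule order_trans[OF ub]) (rule mult_left_mono[OF uq], simp)
 hence "U powr q <= (a / x) powr (q - 1) * B powr p" by (simp add: ennreal_mult'[symmetric])
 also have "... = ((a / x) powr (2 * a) * B^2) powr q" proof -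
  have aq: "2 * a * q = q - 1" using p by (simp add: a_def q_def field_simps)
  have "(B^2) powr q = B powr p" using square_powr_half[of B p] B by (simp add: q_def)
  thus ?thesis by (simp add: powr_mult powr_powr aq)
 qed
 finally have "U <= (a / x) powr (2 * a) * B^2"
  using powr_less_mono2[of q "(a / x) powr (2 * a) * B^2" U] q by (meson leD leI less_le_trans mult_nonneg_nonneg powr_ge_zero zero_le_power2 zero_less_one less_trans)
 hence *: "?A <= ennreal ((a / x) powr (2 * a) * B^2)"
  using ufin by (simp add: U_def) (metis ennreal_enn2real ennreal_leI)
 have "(\<integral>\<^sup>+s\<in>{0<..<t}. (ennreal (exp (- (2 * x) * (t - s))) * G s) \<partial>lborel) = (\<integral>\<^sup>+s. ennreal (exp (- (2 * x) * (t - s))) * G s \<partial>N)"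
  unfolding Nint ..
 also have "... = ?A"
  by (rule nn_integral_cong_AE) (use Gfin in eventually_elim, auto simp: u_def ennreal_mult')
 finally show ?thesis using * by (simp add: G_def)
qed

text \<open>Multiplication by the kernel maps \<open>L p\<close> in time into \<open>L 2\<close>,
  uniformly in \<open>t\<close>. So the integrand of the convolution is square integrable, and
  errors measured in \<open>L p\<close> before the multiplication become errors in
  \<open>L 2\<close>. The proof combines \<open>square_integral_le\<close> with
  \<open>exp_holder\<close>.\<close>

lemma kernel_holder: assumes g: "(%(s, y). g s y) : bmeas (lborel \<Otimes> M)"
  and B: "B > 0" and gB: "(\<H> s. (\<E> y. ennreal (abs (g s y) powr p))) <= ennreal (B powr p)"
  and t: "t >= 0"
 shows "(\<integral>\<^sup>+s\<in>{0<..<t}. (ennreal ((k (t - s))^2) * (\<E> y. ennreal ((g s y)^2))) \<partial>lborel) <= ennreal (A^2 * a powr (2 * a) * B^2)"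
proof -
 interpret L\<nu>: pair_sigma_finite lborel \<nu> ..
 define G where "G s = (\<E> y. ennreal ((g s y)^2))" for s
 have Gm[measurable]: "G : bmeas borel" proof -
  note [measurable] = g
  have "G : bmeas lborel" unfolding G_def[abs_def] by measurable
  thus ?thesis by simp
 qed
 define H where "H s = G s * indicator {0<..<t} s" for s
 have Hm: "H : bmeas borel" unfolding H_def[abs_def] by measurable
 let ?D = "%x s. ennreal (exp (- (2 * x) * (t - s)))"
 have J: "(%(s, x). ennreal (1 / wx x) * (?D x s * H s)) : bmeas (lborel \<Otimes> \<nu>)" proof -
  note [measurable] = pair_meas measurable_compose[OF measurable_snd wx_meas, of lborel] measurable_compose[OF pair_meas(1) Hm]
  have "(%z. ennreal (1 / wx (snd z)) * (ennreal (exp (- (2 * snd z) * (t - fst z))) * H (fst z))) : bmeas (lborel \<Otimes> \<nu>)"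
   by measurable
  thus ?thesis by (simp add: case_prod_beta')
 qed
 let ?A = "%x s. ennreal (1 / wx x) * (?D x s * H s)"
 let ?C = "%s. \<N> x. ?A x s"
 let ?E = "%s. ennreal ((k (t - s))^2)"
 have "(\<integral>\<^sup>+s\<in>{0<..<t}. (?E s * G s) \<partial>lborel) <= (\<L> s. ennreal A * (?C s))"
 proof (rule nn_integral_mono)
  fix s
  show "?E s * G s * indicator {0<..<t} s <= ennreal A * (?C s)" proof (cases "s : {0<..<t}")
   case True hence s: "t - s > 0" by simp
   let ?B = "%x. ennreal ((exp (- x * (t - s)))^2 / wx x)"
   have me: "(%x. ?B x) : bmeas \<nu>" using k_int[OF s] by measurable
   have "?E s <= ennreal A * (\<N> x. ?B x)"
    unfolding k_eq[OF s] by (rule square_integral_le[OF k_int[OF s]])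
   hence "?E s * G s <= (ennreal A * (\<N> x. ?B x)) * G s"
    by (rule mult_right_mono) simp
   also have "... = ennreal A * (\<N> x. ?B x * G s)"
    unfolding nn_integral_multc[OF me] mult.assoc ..
   also have "(\<N> x. ?B x * G s) = (?C s)"
   proof (rule nn_integral_cong)
    fix x
    have "(exp (- x * (t - s)))^2 / wx x = 1 / wx x * exp (- (2 * x) * (t - s))"
     by (simp add: exp_double[symmetric] mult.assoc)
    moreover have "0 <= 1 / wx x" using wx_pos[of x] by simp
    ultimately have "?B x = ennreal (1 / wx x) * ?D x s"
     by (simp only: ennreal_mult'[of "1 / wx x"])
    thus "?B x * G s = ?A x s" using True by (simp add: H_def mult.assoc)
   qed
   finally show ?thesis using True by simp
  qed simp
 qed
 also have "... = ennreal A * (\<L> s. (?C s))"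
  by (rule nn_integral_cmult[OF \<nu>.borel_measurable_nn_integral[OF J]])
 also have "(\<L> s. (?C s)) = (\<N> x. (\<L> s. ?A x s))"
  by (rule L\<nu>.Fubini'[symmetric, OF J])
 also have "... <= (\<N> x. ennreal (a powr (2 * a) * B^2) * ennreal (wx x))"
 proof (rule nn_integral_mono_AE)
  show "AE x in \<nu>. (\<L> s. ?A x s) <= ennreal (a powr (2 * a) * B^2) * ennreal (wx x)"
   using AE_pos proof eventually_elim
   fix x :: real assume x: "x > 0"
   have "(\<L> s. ?A x s) = ennreal (1 / wx x) * (\<integral>\<^sup>+s\<in>{0<..<t}. (?D x s * G s) \<partial>lborel)"
    unfolding H_def by (subst nn_integral_cmult) (auto simp: mult.assoc)
   also have "... <= ennreal (1 / wx x) * ennreal ((a / x) powr (2 * a) * B^2)"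
    unfolding G_def by (intro mult_left_mono exp_holder[OF g B gB x t]) simp
   also have "... = ennreal (a powr (2 * a) * B^2) * ennreal (wx x)" proof -
    have "(a / x) powr (2 * a) = a powr (2 * a) * (wx x * wx x)"
     using x by (simp add: wx_def powr_add[symmetric] powr_divide powr_minus field_simps)
    hence eq: "1 / wx x * ((a / x) powr (2 * a) * B^2) = (a powr (2 * a) * B^2) * wx x"
     using wx_pos[of x] by simp
    have n: "0 <= 1 / wx x" "0 <= a powr (2 * a) * B^2" using wx_pos[of x] by auto
    show ?thesis unfolding ennreal_mult'[OF n(1), symmetric] ennreal_mult'[OF n(2), symmetric] eq ..
   qed
   finally show "(\<L> s. ?A x s) <= ennreal (a powr (2 * a) * B^2) * ennreal (wx x)" .
  qed
 qed
 also have "... = ennreal (a powr (2 * a) * B^2) * (\<N> x. wx x)" by (rule nn_integral_cmult) simp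
 also have "ennreal A * ... <= ennreal A * (ennreal (a powr (2 * a) * B^2) * ennreal A)"
  by (intro mult_left_mono wx_int) auto
 also have "... = ennreal (A^2 * a powr (2 * a) * B^2)" proof -
  have n: "0 <= A" "0 <= a powr (2 * a) * B^2" using A(1) by auto
  show ?thesis unfolding ennreal_mult'[OF n(2), symmetric] ennreal_mult'[OF n(1), symmetric]
   by (simp add: power2_eq_square mult_ac)
 qed
 finally show ?thesis by (simp add: G_def mult_left_mono)
qed

end

section \<open>Density of dyadic integrands among previsible processes\<close>

definition previsible_gen :: "'a measure => (real => 'a measure) => (real \<times> 'a) set set" where
 "previsible_gen M F = {{s<..t} \<times> A | s t A. 0 <= s & s <= t & A : sets (F s)} \<union> {{0} \<times> A | A. A : sets (F 0)}"

context scalar_bm begin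

abbreviation "psp \<equiv> previsible_sigma M F"

lemma F_sets_M: "s >= 0 ==> A : sets (F s) ==> A : sets M"
 using sub[of s] by (auto simp: subalgebra_def)

lemma F_sets_mono: "0 <= s ==> s <= t ==> A : sets (F s) ==> A : sets (F t)" using F_mono by blast

lemma gen_Pow: "previsible_gen M F \<subseteq> Pow ({0..} \<times> space M)" proof
 fix X assume "X : previsible_gen M F"
 then consider (rect) s t A where "X = {s<..t} \<times> A" "0 <= s" "A : sets (F s)" | (zero) A where "X = {0} \<times> A" "A : sets (F 0)"
  unfolding previsible_gen_def by blast
 thus "X : Pow ({0..} \<times> space M)" proof cases
  case rect have "A \<subseteq> space M" using sets.sets_into_space[OF F_sets_M[OF rect(2,3)]] .
  thus ?thesis using rect by auto
 next case zero
  have "A \<subseteq> space M" using sets.sets_into_space[OF F_sets_M[OF order_refl zero(2)]] .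
  thus ?thesis using zero by auto
 qed
qed

lemma sets_psp: "sets psp = sigma_sets ({0..} \<times> space M) (previsible_gen M F)"
 and space_psp: "space psp = {0..} \<times> space M" proof -
 have "psp = sigma ({0..} \<times> space M) (previsible_gen M F)"
  by (simp add: previsible_sigma_def previsible_gen_def)
 thus "sets psp = sigma_sets ({0..} \<times> space M) (previsible_gen M F)" "space psp = {0..} \<times> space M"
  using sets_measure_of[OF gen_Pow] space_measure_of[OF gen_Pow] by simp_all
qed

lemma half_sets: "{0::real..} \<times> space M : sets (lborel \<Otimes> M)" "{0::real<..} \<times> space M : sets (lborel \<Otimes> M)"
 by (rule pair_measureI; simp)+

lemma psp_subset: "sets psp \<subseteq> sets (restrict_space (lborel \<Otimes> M) ({0..} \<times> space M))"
proof -
 let ?A = "restrict_space (lborel \<Otimes> M) ({0..} \<times> space M)"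
 have sp: "space ?A = {0..} \<times> space M"
  by (auto simp: space_restrict_space space_pair_measure)
 have "previsible_gen M F \<subseteq> sets ?A" proof
  fix X assume X: "X : previsible_gen M F"
  hence "X : sets (lborel \<Otimes> M)" unfolding previsible_gen_def using F_sets_M by (auto intro!: pair_measureI)
  moreover have "X \<subseteq> {0..} \<times> space M" using gen_Pow X by auto
  ultimately show "X : sets ?A"
   by (subst sets_restrict_space_iff) (auto simp: half_sets space_pair_measure intro: sets.Int)
 qed
 hence "sigma_sets (space ?A) (previsible_gen M F) \<subseteq> sets ?A"
  by (rule sets.sigma_sets_subset)
 thus ?thesis unfolding sp sets_psp .
qed

lemma previsible_joint:
 fixes f :: "real => 'a => 'c :: {real_normed_vector, second_countable_topology}"
 assumes "(%(s, y). f s y) : bmeas psp"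
 shows "(%(s, y). indicator {0..} s *\<^sub>R f s y) : bmeas (lborel \<Otimes> M)" proof -
 let ?A = "restrict_space (lborel \<Otimes> M) ({0..} \<times> space M)"
 let ?B = "%(s, y). f s y"
 have "?B : bmeas ?A" proof (rule measurableI)
  fix X :: "'c set" assume "X : sets borel"
  hence "?B -` X \<inter> space psp : sets psp" by (rule measurable_sets[OF assms])
  thus "?B -` X \<inter> space ?A : sets ?A" proof -
   assume X: "?B -` X \<inter> space psp : sets psp"
   have "space ?A = space psp" by (auto simp: space_psp space_restrict_space space_pair_measure)
   thus ?thesis using subsetD[OF psp_subset X] by (simp only:)
  qed
 qed auto
 hence "(%z. indicator ({0..} \<times> space M) z *\<^sub>R ?B z) : bmeas (lborel \<Otimes> M)"
  using half_sets(1) by (subst (asm) borel_measurable_restrict_space_iff) (auto intro: sets.Int)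
 also have "?this \<longleftrightarrow> ?thesis"
  by (rule measurable_cong) (auto simp: space_pair_measure indicator_def)
 finally show ?thesis .
qed

text \<open>The \<open>p\<close>-th power of the norm of \<open>L p\<close>. Time 0 is left out
  because dyadic processes vanish there whatever they approximate.\<close>

definition lpn :: "real => (real => 'a => real) => ennreal" where
 "lpn p f = (\<H> s. (\<E> z. ennreal (abs (f s z) powr p)))"

definition jm :: "(real => 'a => real) => bool" where
 "jm f \<longleftrightarrow> (%(s, z). f s z) : bmeas (lborel \<Otimes> M)"

lemma jmD: "jm f ==> (%z. f (fst z) (snd z)) : bmeas (lborel \<Otimes> M)"
 by (simp add: jm_def case_prod_beta')

lemma jmI: "(%z. f (fst z) (snd z)) : bmeas (lborel \<Otimes> M) ==> jm f"
 by (simp add: jm_def case_prod_beta')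

lemma jm_moment: assumes "jm f" shows "(%s. \<E> z. ennreal (abs (f s z) powr p)) : bmeas lborel"
 using assms unfolding jm_def by measurable

lemma jm_section: assumes "jm f" shows "f s : bmeas M" using assms unfolding jm_def by measurable

lemma jm_lincomb: assumes "jm f" "jm g" shows "jm (%s z. a * f s z + b * g s z)"
 by (rule jmI, rule borel_measurable_add; rule borel_measurable_times[OF borel_measurable_const], rule jmD, fact)

lemma jm_diff: assumes "jm f" "jm g" shows "jm (%s z. f s z - g s z)"
 by (rule jmI, rule borel_measurable_diff; rule jmD, fact)

lemma dyadic_jm: "dyadic L h ==> jm h" unfolding jm_def by (rule dyadic_joint)

lemma lpn_product: assumes "jm f"
 shows "lpn p f = (\<integral>\<^sup>+z. ennreal (abs (f (fst z) (snd z)) powr p) * indicator {0<..} (fst z) \<partial>(lborel \<Otimes> M))"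
proof -
 have [measurable]: "(%z. f (fst z) (snd z)) : bmeas (lborel \<Otimes> M)" by (rule jmD[OF assms])
 have "(\<integral>\<^sup>+z. ennreal (abs (f (fst z) (snd z)) powr p) * indicator {0<..} (fst z) \<partial>(lborel \<Otimes> M)) = (\<L> s. (\<E> y. ennreal (abs (f (fst (s, y)) (snd (s, y))) powr p) * indicator {0<..} (fst (s, y))))"
  by (rule nn_integral_fst[symmetric]) measurable
 also have "... = lpn p f" unfolding lpn_def by (intro nn_integral_cong) (auto simp: indicator_def)
 finally show ?thesis ..
qed

lemma lpn_cong: "(!!s z. s > 0 ==> z : space M ==> abs (f s z) = abs (g s z)) ==> lpn p f = lpn p g"
 unfolding lpn_def by (intro nn_integral_cong) (auto simp: indicator_def intro!: nn_integral_cong)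

text \<open>A triangle inequality with a constant: sufficient for density arguments, and valid for
  infinite norms as well.\<close>

lemma lpn_add: assumes f: "jm f" and g: "jm g" and p: "p >= 1"
 shows "lpn p (%s y. f s y + g s y) <= ennreal ((1/2) powr (1 - p)) * (lpn p f + lpn p g)" proof -
 define c where "c = (1/2::real) powr (1 - p)"
 have c: "c >= 0" by (simp add: c_def)
 let ?C = "lborel \<Otimes> M"
 have [measurable]: "(%z. f (fst z) (snd z)) : bmeas ?C" "(%z. g (fst z) (snd z)) : bmeas ?C"
  by (rule jmD[OF f], rule jmD[OF g])
 have jfg: "jm (%s y. f s y + g s y)" using jm_lincomb[OF f g, of 1 1] by simp
 let ?A = "%z. ennreal (abs (f (fst z) (snd z)) powr p) * indicator {0<..} (fst z) + ennreal (abs (g (fst z) (snd z)) powr p) * indicator {0<..} (fst z)"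
 have "lpn p (%s y. f s y + g s y) <= (\<integral>\<^sup>+z. ennreal c * (?A z) \<partial>?C)"
  unfolding lpn_product[OF jfg] proof (rule nn_integral_mono)
  fix z
  define u v where "u = abs (f (fst z) (snd z))" and "v = abs (g (fst z) (snd z))"
  let ?B = "ennreal (abs (f (fst z) (snd z) + g (fst z) (snd z)) powr p)"
  have "abs (f (fst z) (snd z) + g (fst z) (snd z)) powr p <= (u + v) powr p"
   using p by (intro powr_mono2) (auto simp: u_def v_def)
  also have "... <= c * u powr p + c * v powr p"
   using powr_add_le[of p u v "1/2"] p by (simp add: c_def u_def v_def)
  finally have "?B <= ennreal (c * u powr p + c * v powr p)" by (rule ennreal_leI)
  also have "... = ennreal c * (ennreal (u powr p) + ennreal (v powr p))"
   by (simp only: distrib_left[symmetric] ennreal_mult'[OF c] ennreal_plus[OF powr_ge_zero powr_ge_zero])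
  finally have main: "?B <= ennreal c * (ennreal (u powr p) + ennreal (v powr p))" .
  show "?B * indicator {0<..} (fst z) <= ennreal c * (?A z)" proof (cases "fst z > 0")
   case True hence "indicator {0<..} (fst z) = (1::ennreal)" by simp
   thus ?thesis using main unfolding u_def v_def by (simp only: mult_1_right)
  qed simp
 qed
 also have "... = ennreal c * (\<integral>\<^sup>+z. (?A z) \<partial>?C)"
  by (rule nn_integral_cmult) measurable
 also have "... = ennreal c * (lpn p f + lpn p g)" unfolding lpn_product[OF f] lpn_product[OF g]
  by (rule arg_cong[where f = "%x. ennreal c * x"], rule nn_integral_add) measurable
 finally show ?thesis unfolding c_def .
qed

lemma lpn_scale: "jm f ==> lpn p (%s z. c * f s z) = ennreal (abs c powr p) * lpn p f" proof -
 assume f: "jm f"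
 have [measurable]: "f s : bmeas M" for s by (rule jm_section[OF f])
 have [measurable]: "(%s. \<E> z. ennreal (abs (f s z) powr p)) : bmeas lborel" by (rule jm_moment[OF f])
 let ?A = "%s. \<E> z. ennreal (abs (f s z) powr p)"
 let ?B = "ennreal (abs c powr p)"
 have "lpn p (%s z. c * f s z) = (\<L> s. ?B * ((?A s) * indicator {0<..} s))" unfolding lpn_def
 proof (rule nn_integral_cong)
  fix s
  let ?C = "\<E> z. ennreal (abs (c * f s z) powr p)"
  have "?C = (\<E> z. ?B * ennreal (abs (f s z) powr p))"
   by (simp add: abs_mult powr_mult ennreal_mult')
  also have "... = ?B * (?A s)" by (rule nn_integral_cmult) measurable
  finally show "?C * indicator {0<..} s = ?B * ((?A s) * indicator {0<..} s)"
   by (simp add: mult.assoc)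
 qed
 also have "... = ?B * lpn p f" unfolding lpn_def by (rule nn_integral_cmult) measurable
 finally show ?thesis .
qed

text \<open>Approximants are demanded at every large level rather than at one, so that those of two
  processes can be taken at a common level and added.\<close>

definition approx :: "real => (real => 'a => real) => bool" where
 "approx p f \<longleftrightarrow> (ALL v>0. EX L0. ALL L>=L0. EX h. dyadic L h & lpn p (%s z. f s z - h s z) <= ennreal v)"

lemma approx_cong: assumes "approx p f" "!!s z. s > 0 ==> z : space M ==> f s z = g s z"
 shows "approx p g" proof -
 have "lpn p (%s z. f s z - h s z) = lpn p (%s z. g s z - h s z)" for h
  by (rule lpn_cong) (simp add: assms(2))
 thus ?thesis using assms(1) by (simp add: approx_def)
qed

lemma approx_limit: assumes f: "jm f" and p: "p >= 1"
  and lim: "!!y. y > 0 ==> EX g. jm g & approx p g & lpn p (%s z. f s z - g s z) <= ennreal y"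
 shows "approx p f" unfolding approx_def proof (intro allI impI)
 fix y :: real assume y: "y > 0"
 define c where "c = (1/2::real) powr (1 - p)"
 have c: "c > 0" by (simp add: c_def)
 define v where "v = y / (2 * c)"
 have v: "v > 0" using y c by (simp add: v_def)
 obtain g where g: "jm g" "approx p g" "lpn p (%s z. f s z - g s z) <= ennreal v" using lim[OF v] by blast
 let ?A = "%h. %s z. g s z - h s z"
 obtain L0 where L0: "!!L. L >= L0 ==> EX h. dyadic L h & lpn p (?A h) <= ennreal v"
  using g(2) v unfolding approx_def by blast
 let ?B = "%h. %s z. f s z - h s z"
 show "EX L0. ALL L>=L0. EX h. dyadic L h & lpn p (?B h) <= ennreal y"
 proof (rule exI[of _ L0], intro allI impI)
  fix L assume "L >= L0"
  then obtain h where h: "dyadic L h" "lpn p (?A h) <= ennreal v" using L0 by blast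
  have "lpn p (?B h) = lpn p (%s z. (f s z - g s z) + (g s z - h s z))" by simp
  also have "... <= ennreal c * (lpn p (%s z. f s z - g s z) + lpn p (?A h))"
   unfolding c_def by (rule lpn_add[OF jm_diff[OF f g(1)] jm_diff[OF g(1) dyadic_jm[OF h(1)]] p])
  also have "... <= ennreal c * (ennreal v + ennreal v)" by (intro mult_left_mono add_mono g h) simp
  also have "... = ennreal (c * (v + v))"
   unfolding ennreal_mult'[OF less_imp_le[OF c]] ennreal_plus[OF less_imp_le[OF v] less_imp_le[OF v]] ..
  also have "c * (v + v) = y" using c by (simp add: v_def)
  finally show "EX h. dyadic L h & lpn p (?B h) <= ennreal y" using h(1) by blast
 qed
qed

lemma approx_lincomb: assumes f: "jm f" "approx p f" and g: "jm g" "approx p g" and p: "p >= 1"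
 shows "approx p (%s z. a * f s z + b * g s z)" unfolding approx_def proof (intro allI impI)
 fix q :: real assume q: "q > 0"
 define c where "c = (1/2::real) powr (1 - p)"
 have c: "c > 0" by (simp add: c_def)
 define C where "C = abs a powr p + abs b powr p + 1"
 have C: "C > 0" "abs a powr p <= C" "abs b powr p <= C" by (auto simp: C_def intro!: add_nonneg_pos add_nonneg_nonneg)
 define y where "y = q / (2 * c * C)"
 have y: "y > 0" using q c C by (simp add: y_def)
 obtain L1 where L1: "!!L. L >= L1 ==> EX h. dyadic L h & lpn p (%s z. f s z - h s z) <= ennreal y"
  using f(2) y unfolding approx_def by blast
 obtain L2 where L2: "!!L. L >= L2 ==> EX h. dyadic L h & lpn p (%s z. g s z - h s z) <= ennreal y"
  using g(2) y unfolding approx_def by blast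
 show "EX L0. ALL L>=L0. EX h. dyadic L h & lpn p (%s z. a * f s z + b * g s z - h s z) <= ennreal q"
 proof (rule exI[of _ "max L1 L2"], intro allI impI)
  fix L assume L: "L >= max L1 L2"
  obtain h1 where h1: "dyadic L h1" "lpn p (%s z. f s z - h1 s z) <= ennreal y" using L1[of L] L by auto
  obtain h2 where h2: "dyadic L h2" "lpn p (%s z. g s z - h2 s z) <= ennreal y" using L2[of L] L by auto
  let ?u = "%s z. f s z - h1 s z" and ?v = "%s z. g s z - h2 s z"
  have u: "jm ?u" and v: "jm ?v" using jm_diff f(1) g(1) dyadic_jm h1(1) h2(1) by blast+
  have au: "jm (%s z. a * ?u s z)" "jm (%s z. b * ?v s z)"
   using jm_lincomb[OF u u, of a 0] jm_lincomb[OF v v, of b 0] by simp_all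
  have "lpn p (%s z. a * f s z + b * g s z - (a * h1 s z + b * h2 s z)) = lpn p (%s z. a * ?u s z + b * ?v s z)"
   by (simp add: algebra_simps)
  also have "... <= ennreal c * (lpn p (%s z. a * ?u s z) + lpn p (%s z. b * ?v s z))"
   unfolding c_def by (rule lpn_add[OF au p])
  also have "... = ennreal c * (ennreal (abs a powr p) * lpn p ?u + ennreal (abs b powr p) * lpn p ?v)"
   unfolding lpn_scale[OF u] lpn_scale[OF v] ..
  also have "... <= ennreal c * (ennreal C * ennreal y + ennreal C * ennreal y)"
   by (intro mult_left_mono add_mono mult_mono h1 h2 ennreal_leI C) auto
  also have "... = ennreal (c * (C * y + C * y))" proof -
   have n: "0 <= C * y" "0 <= c" "0 <= C" using C y c by auto
   show ?thesis unfolding ennreal_mult'[OF n(2)] ennreal_plus[OF n(1) n(1)] ennreal_mult'[OF n(3)] ..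
  qed
  also have "c * (C * y + C * y) = q" using c C by (simp add: y_def)
  finally show "EX h. dyadic L h & lpn p (%s z. a * f s z + b * g s z - h s z) <= ennreal q"
   using dyadic_lincomb(1)[OF h1(1) h2(1), of a b] by blast
 qed
qed

lemma approx_dominated: assumes f: "jm f" and p: "p >= 1"
  and g: "!!m. jm (g m)" "!!m. approx p (g m)"
  and lim: "!!s y. s > 0 ==> y : space M ==> (%m. g m s y) \<leadsto> f s y"
  and h: "jm h" "lpn p h < \<infinity>" "!!m s y. s > 0 ==> y : space M ==> abs (f s y - g m s y) <= abs (h s y)"
 shows "approx p f" proof (rule approx_limit[OF f p])
 let ?B = "lborel \<Otimes> M"
 have [measurable]: "(%z. f (fst z) (snd z)) : bmeas ?B" "(%z. h (fst z) (snd z)) : bmeas ?B"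
  "!!m. (%z. g m (fst z) (snd z)) : bmeas ?B"
  by (rule jmD[OF f], rule jmD[OF h(1)], rule jmD[OF g(1)])
 let ?A = "%z m. ennreal (abs (f (fst z) (snd z) - g m (fst z) (snd z)) powr p)"
 have "(%m. \<integral>\<^sup>+z. ?A z m * indicator {0<..} (fst z) \<partial>?B) \<leadsto> nn_integral ?B (%z :: real \<times> 'a. 0)"
 proof (rule nn_integral_dominated_convergence[where w = "%z. ennreal (abs (h (fst z) (snd z)) powr p) * indicator {0<..} (fst z)"])
  show "(\<integral>\<^sup>+z. ennreal (abs (h (fst z) (snd z)) powr p) * indicator {0<..} (fst z) \<partial>?B) < \<infinity>"
   using h(2) unfolding lpn_product[OF h(1)] .
  show "AE z in lborel \<Otimes> M. ?A z m * indicator {0<..} (fst z) <= ennreal (abs (h (fst z) (snd z)) powr p) * indicator {0<..} (fst z)" for m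
   using p by (intro AE_I2) (auto simp: indicator_def space_pair_measure intro!: ennreal_leI powr_mono2 h(3))
  show "AE z in lborel \<Otimes> M. (%m. ?A z m * indicator {0<..} (fst z)) \<leadsto> 0"
  proof (rule AE_I2)
   fix z :: "real \<times> 'a" assume z: "z : space ?B"
   show "(%m. ?A z m * indicator {0<..} (fst z)) \<leadsto> 0" proof (cases "fst z > 0")
    case True
    have "(%m. f (fst z) (snd z) - g m (fst z) (snd z)) \<leadsto> f (fst z) (snd z) - f (fst z) (snd z)"
     by (intro tendsto_intros lim True) (use z in \<open>auto simp: space_pair_measure\<close>)
    hence "(%m. ?A z m) \<leadsto> ennreal (abs (f (fst z) (snd z) - f (fst z) (snd z)) powr p)"
     using p by (intro tendsto_ennrealI tendsto_powr' tendsto_rabs tendsto_const) auto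
    thus ?thesis using True by simp
   qed simp
  qed
 qed measurable
 hence lim0: "(%m. lpn p (%s y. f s y - g m s y)) \<leadsto> 0"
  unfolding lpn_product[OF jm_diff[OF f g(1)]] by simp
 fix v :: real assume "v > 0"
 hence "eventually (%m. lpn p (%s y. f s y - g m s y) < ennreal v) sequentially"
  using order_tendstoD(2)[OF lim0, of "ennreal v"] by simp
 then obtain m where "lpn p (%s y. f s y - g m s y) < ennreal v"
  by (auto simp: eventually_sequentially)
 thus "EX g. jm g & approx p g & lpn p (%s y. f s y - g s y) <= ennreal v"
  using g by (intro exI[of _ "g m"]) auto
qed

text \<open>A cell is kept when its left end lies in \<open>[a, b)\<close>. The condition
  \<open>a <= left_dy L s\<close> makes \<open>A\<close> measurable at the left end; the mistake is
  confined to one mesh length after \<open>a\<close> and one after \<open>b\<close>.\<close>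

lemma approx_rectangle: assumes p: "p >= 1" and ab: "0 <= a" "a <= b" and A: "A : sets (F a)"
 shows "approx p (%s z. indicator ({a<..b} \<times> A) (s, z))" unfolding approx_def
proof (intro allI impI)
 fix v :: real assume v: "v > 0"
 obtain n1 where n1: "(1/2::real) ^ n1 < v / 2" using real_arch_pow_inv[of "v / 2" "1/2"] v by auto
 obtain n2 :: nat where n2: "b <= real n2" using real_arch_simple by blast
 let ?B = "%h. %s z. indicator ({a<..b} \<times> A) (s, z) - h s z"
 show "EX L0. ALL L>=L0. EX h. dyadic L h & lpn p (?B h) <= ennreal v"
 proof (intro exI[of _ "max n1 n2"] allI impI)
  fix L assume L: "L >= max n1 n2"
  have bL: "b <= real L" using n2 L by linarith
  have mesh: "2 * (1 / 2 ^ L) <= v" proof -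
   have "(1/2::real) ^ L <= (1/2) ^ n1" using L by (intro power_decreasing) auto
   thus ?thesis using n1 by (simp add: power_one_over)
  qed
  define h where "h s z = (if 0 < s & s <= real L & a <= left_dy L s & left_dy L s < b then indicator A z else 0 :: real)" for s z
  have ld: "left_dy L (dy L (Suc i)) = dy L i" for i by (rule left_dy_eq) auto
  have "dyadic L h" unfolding dyadic_def proof (intro conjI allI impI)
   fix i assume i: "i < L * 2 ^ L"
   show "h (dy L (Suc i)) : bmeas (F (dy L i))" proof (cases "a <= dy L i")
    case True hence "A : sets (F (dy L i))" using F_sets_mono[OF ab(1) True A] by simp
    thus ?thesis unfolding h_def[abs_def] ld by measurable
   next case False
    hence "h (dy L (Suc i)) = (%_. 0)" by (auto simp: h_def ld)
    thus ?thesis by simp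
   qed
   show "EX B. ALL z:space M. abs (h (dy L (Suc i)) z) <= B" by (intro exI[of _ 1]) (auto simp: h_def indicator_def)
  next
   fix i s z assume s: "dy L i < s" "s <= dy L (Suc i)"
   have "0 < s" using s dy_nonneg[of L i] by linarith
   moreover have "s <= real L \<longleftrightarrow> dy L (Suc i) <= real L" proof
    assume "s <= real L"
    hence "dy L i < dy L (L * 2 ^ L)" using s by simp
    hence "Suc i <= L * 2 ^ L" unfolding dy_less_iff by simp
    hence "dy L (Suc i) <= dy L (L * 2 ^ L)" by (rule dy_mono)
    thus "dy L (Suc i) <= real L" by simp
   qed (use s in simp)
   moreover have "0 < dy L (Suc i)" by (simp add: dy_def)
   ultimately show "h s z = h (dy L (Suc i)) z" unfolding h_def ld left_dy_eq[OF s] by simp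
  qed (auto simp: h_def)
  moreover have "lpn p (?B h) <= ennreal v" proof -
   let ?A = "%s. indicator {a..a + 1 / 2 ^ L} s + indicator {b..b + 1 / 2 ^ L} s"
   have "lpn p (?B h) <= (\<L> s. ?A s)" unfolding lpn_def proof (rule nn_integral_mono)
    fix s
    have "abs (indicator ({a<..b} \<times> A) (s, z) - h s z) powr p <= ?A s" if "s > 0" for z
    proof (cases "s : {a..a + 1 / 2 ^ L} | s : {b..b + 1 / 2 ^ L}")
     case True
     have "abs (indicator ({a<..b} \<times> A) (s, z) - h s z) <= 1" by (auto simp: h_def indicator_def)
     hence "abs (indicator ({a<..b} \<times> A) (s, z) - h s z) powr p <= 1"
      using powr_mono2[of p "abs (indicator ({a<..b} \<times> A) (s, z) - h s z)" 1] p by simp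
     thus ?thesis using True by (auto simp: indicator_def split: if_splits)
    next case False
     hence "(a < s & s <= b) \<longleftrightarrow> (s <= real L & a <= left_dy L s & left_dy L s < b)"
      using left_dy_bounds[where L = L and s = s] bL by auto
     thus ?thesis using that by (auto simp: h_def indicator_def)
    qed
    hence "ennreal (abs (indicator ({a<..b} \<times> A) (s, z) - h s z) powr p) <= ?A s" if "s > 0" for z
     using ennreal_leI[of "abs (indicator ({a<..b} \<times> A) (s, z) - h s z) powr p" "indicator {a..a + 1 / 2 ^ L} s + indicator {b..b + 1 / 2 ^ L} s"] that
     by (auto simp: indicator_def split: if_splits)
    hence "(\<E> z. ennreal (abs (indicator ({a<..b} \<times> A) (s, z) - h s z) powr p)) <= (\<E> z. ?A s)" if "s > 0"
     using that by (intro nn_integral_mono) auto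
    thus "(\<E> z. ennreal (abs (indicator ({a<..b} \<times> A) (s, z) - h s z) powr p)) * indicator {0<..} s <= ?A s"
     by (cases "s > 0") (auto simp: emeasure_space_1)
   qed
   also have "... = ennreal (1 / 2 ^ L) + ennreal (1 / 2 ^ L)" by (subst nn_integral_add) auto
   also have "... = ennreal (2 * (1 / 2 ^ L))" by (subst ennreal_plus[symmetric]) auto
   also have "... <= ennreal v" by (rule ennreal_leI[OF mesh])
   finally show ?thesis .
  qed
  ultimately show "EX h. dyadic L h & lpn p (?B h) <= ennreal v" by blast
 qed
qed

lemma gen_Int_stable: "Int_stable (previsible_gen M F)" proof (rule Int_stableI)
 fix X Y assume X: "X : previsible_gen M F" and Y: "Y : previsible_gen M F"
 consider (rect) s t A where "X = {s<..t} \<times> A" "0 <= s" "s <= t" "A : sets (F s)" | (zero) A where "X = {0} \<times> A" "A : sets (F 0)"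
  using X unfolding previsible_gen_def by blast
 thus "X \<inter> Y : previsible_gen M F" proof cases
  case rect
  consider (rect') s' t' A' where "Y = {s'<..t'} \<times> A'" "0 <= s'" "s' <= t'" "A' : sets (F s')" | (zero') A' where "Y = {0} \<times> A'" "A' : sets (F 0)"
   using Y unfolding previsible_gen_def by blast
  thus ?thesis proof cases
   case rect'
   define m where "m = max s s'"
   have m: "0 <= m" "s <= m" "s' <= m" using rect rect' by (auto simp: m_def)
   have AA: "A \<inter> A' : sets (F m)"
    by (rule sets.Int[OF F_sets_mono[OF rect(2) m(2) rect(4)] F_sets_mono[OF rect'(2) m(3) rect'(4)]])
   \<comment> \<open>The outer maximum covers disjoint time intervals, since a rectangle of the
     generator has ordered end points.\<close>
   have "X \<inter> Y = {m<..max m (min t t')} \<times> (A \<inter> A')"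
    unfolding rect(1) rect'(1) m_def by (auto simp: max_def min_def split: if_splits)
   thus ?thesis unfolding previsible_gen_def using m(1) AA by (intro UnI1 CollectI exI[of _ m] exI[of _ "max m (min t t')"] exI[of _ "A \<inter> A'"]) simp
  next case zero'
   have "X \<inter> Y = {0} \<times> {}" unfolding rect(1) zero'(1) using rect(2) by auto
   thus ?thesis unfolding previsible_gen_def by blast
  qed
 next case zero
  consider (rect') s' t' A' where "Y = {s'<..t'} \<times> A'" "0 <= s'" "s' <= t'" "A' : sets (F s')" | (zero') A' where "Y = {0} \<times> A'" "A' : sets (F 0)"
   using Y unfolding previsible_gen_def by blast
  thus ?thesis proof cases
   case rect'
   have "X \<inter> Y = {0} \<times> {}" unfolding zero(1) rect'(1) using rect'(2) by auto
   thus ?thesis unfolding previsible_gen_def by blast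
  next case zero'
   have "X \<inter> Y = {0} \<times> (A \<inter> A')" unfolding zero(1) zero'(1) by auto
   moreover have "A \<inter> A' : sets (F 0)" by (rule sets.Int[OF zero(2) zero'(2)])
   ultimately show ?thesis unfolding previsible_gen_def by blast
  qed
 qed
qed

text \<open>A finite horizon gives an indicator finite \<open>lpn\<close>. This provides the
  dominating function in the induction and makes the cut of a complement a difference of two
  cuts.\<close>

definition cut :: "nat => (real \<times> 'a) set => real => 'a => real" where
 "cut n A s z = indicator {0<..real n} s * indicator A (s, z)"

lemma cut_jm: assumes "A : sets psp" shows "jm (cut n A)" proof (rule jmI)
 let ?A = "bmeas (lborel \<Otimes> M)"
 have A: "A : sets (lborel \<Otimes> M)"
  using subsetD[OF psp_subset assms] half_sets(1) by (subst (asm) sets_restrict_space_iff) (auto simp: space_pair_measure intro: sets.Int)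
 hence [measurable]: "(%z. indicator A z :: real) : ?A" by (rule borel_measurable_indicator)
 have "(%z. indicator {0<..real n} (fst z) * indicator A z :: real) : ?A" by measurable
 thus "(%z. cut n A (fst z) (snd z)) : ?A" by (simp add: cut_def)
qed

lemma cut_lpn_fin: assumes "p > 0" shows "lpn p (cut n A) < \<infinity>" proof -
 let ?B = "%s. indicator {0<..real n} s"
 have "lpn p (cut n A) <= (\<L> s. ?B s)" unfolding lpn_def proof (rule nn_integral_mono)
  fix s
  let ?A = "\<E> z. ennreal (abs (cut n A s z) powr p)"
  have "?A <= (\<E> z. ?B s)" by (rule nn_integral_mono) (auto simp: cut_def indicator_def)
  also have "... = ?B s" by (simp add: emeasure_space_1)
  finally show "?A * indicator {0<..} s <= ?B s" by (auto simp: indicator_def split: if_splits)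
 qed
 also have "... = ennreal (real n)" by simp
 finally show ?thesis by (simp add: order_le_less_trans)
qed

lemma approx_zero: "approx p (%s z. 0)" unfolding approx_def proof (intro allI impI)
 fix v :: real assume "v > 0"
 have "dyadic L (%s z. 0)" for L by (auto simp: dyadic_def)
 moreover have "lpn p (%s z. 0 - 0) <= ennreal v" by (simp add: lpn_def)
 ultimately show "EX L0. ALL L>=L0. EX h. dyadic L h & lpn p (%s z. 0 - h s z) <= ennreal v" by fastforce
qed

lemma space_in_gen: "{0<..real n} \<times> space M : previsible_gen M F" proof -
 have "space M : sets (F 0)" using space_F[of 0] sets.top[of "F 0"] by simp
 thus ?thesis unfolding previsible_gen_def by (intro UnI1 CollectI exI[of _ 0] exI[of _ "real n"] exI[of _ "space M"]) simp
qed

text \<open>Dynkin's theorem on the intersection-stable generator: a complement is taken relative to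
  \<open>{0<..real n} \<times> space M\<close>, and a disjoint union is a dominated limit of finite
  sums.\<close>

lemma approx_cut: assumes p: "p >= 1" and A: "A : sets psp" shows "approx p (cut n A)" proof -
 have "A : sigma_sets ({0..} \<times> space M) (previsible_gen M F)" using A sets_psp by simp
 thus ?thesis
 proof (induction rule: sigma_sets_induct_disjoint[OF gen_Int_stable gen_Pow, consumes 1, case_names basic empty compl union])
  case (basic A)
  consider (rect) s t X where "A = {s<..t} \<times> X" "0 <= s" "s <= t" "X : sets (F s)" | (zero) X where "A = {0} \<times> X" "X : sets (F 0)"
   using basic unfolding previsible_gen_def by blast
  thus ?case proof cases
   case rect have "approx p (%u y. indicator ({s<..max s (min t (real n))} \<times> X) (u, y))"
    by (rule approx_rectangle[OF p rect(2) _ rect(4)]) simp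
   thus ?thesis
    by (rule approx_cong) (use rect(2) in \<open>auto simp: cut_def rect(1) indicator_def max_def min_def split: if_splits\<close>)
  next case zero
   show ?thesis by (rule approx_cong[OF approx_zero]) (auto simp: cut_def zero(1) indicator_def)
  qed
 next case empty
  show ?case by (rule approx_cong[OF approx_zero]) (auto simp: cut_def)
 next case (compl A)
  have As: "A : sets psp" using compl(1) sets_psp by simp
  have Ss: "{0<..real n} \<times> space M : sets psp" using space_in_gen unfolding sets_psp by (rule sigma_sets.Basic)
  let ?A = "{0<..real n} \<times> space M"
  have S: "approx p (cut n ?A)" proof -
   have "space M : sets (F 0)" using space_F[of 0] sets.top[of "F 0"] by simp
   hence "approx p (%u y. indicator ?A (u, y))" by (intro approx_rectangle[OF p]) auto
   thus ?thesis by (rule approx_cong) (auto simp: cut_def indicator_def)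
  qed
  have "approx p (%s y. 1 * cut n ?A s y + (- 1) * cut n A s y)"
   by (rule approx_lincomb[OF cut_jm[OF Ss] S cut_jm[OF As] compl(2) p])
  thus ?case by (rule approx_cong) (auto simp: cut_def indicator_def)
 next case (union A)
  have As: "A i : sets psp" for i using union(2) sets_psp by auto
  have Us: "(\<Union>i. A i) : sets psp" by (intro sets.countable_UN) (use As in auto)
  define U where "U m = (\<Union>i<m. A i)" for m
  have Ums: "U m : sets psp" for m unfolding U_def using As by (intro sets.finite_UN) auto
  have Uapp: "approx p (cut n (U m))" for m proof (induction m)
   case 0 show ?case by (rule approx_cong[OF approx_zero]) (auto simp: cut_def U_def)
  next case (Suc m)
   have ap: "approx p (%s y. 1 * cut n (U m) s y + 1 * cut n (A m) s y)"
    by (rule approx_lincomb[OF cut_jm[OF Ums] Suc cut_jm[OF As] union(3) p])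
   have dj: "U m \<inter> A m = {}" proof -
    have "A i \<inter> A m = {}" if "i < m" for i
     using disjoint_family_onD[OF union(1), of i m] that by simp
    thus ?thesis unfolding U_def by blast
   qed
   have "U (Suc m) = U m \<union> A m" by (auto simp: U_def lessThan_Suc)
   hence ind: "indicator (U (Suc m)) z = (indicator (U m) z + indicator (A m) z :: real)" for z
    using dj by (simp add: indicator_add)
   have eq: "1 * cut n (U m) s y + 1 * cut n (A m) s y = cut n (U (Suc m)) s y" for s y
    unfolding cut_def ind by (simp only: distrib_left mult_1)
   show ?case using ap unfolding eq .
  qed
  show ?case proof (rule approx_dominated[OF cut_jm[OF Us] p cut_jm[OF Ums] Uapp])
   show "jm (cut n (\<Union>i. A i))" by (rule cut_jm[OF Us])
   show "lpn p (cut n (\<Union>i. A i)) < \<infinity>" by (rule cut_lpn_fin) (use p in simp)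
   fix s :: real and y assume "s > 0" "y : space M"
   show "(%m. cut n (U m) s y) \<leadsto> cut n (\<Union>i. A i) s y"
   proof (cases "(s, y) : (\<Union>i. A i)")
    case True
    then obtain j where j: "(s, y) : A j" by auto
    have "eventually (%m. cut n (U m) s y = cut n (\<Union>i. A i) s y) sequentially"
     using eventually_gt_at_top[of j] proof eventually_elim
     fix m assume "j < m"
     hence "(s, y) : U m" using j by (auto simp: U_def)
     thus "cut n (U m) s y = cut n (\<Union>i. A i) s y" using True by (simp add: cut_def)
    qed
    thus ?thesis by (rule tendsto_eventually)
   next case False
    hence "(s, y) \<notin> U m" for m by (auto simp: U_def)
    thus ?thesis using False by (simp add: cut_def)
   qed
   fix m
   show "abs (cut n (\<Union>i. A i) s y - cut n (U m) s y) <= abs (cut n (\<Union>i. A i) s y)"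
    by (auto simp: cut_def U_def indicator_def)
  qed
 qed
qed

lemma approx_sum: assumes p: "p >= 1" and "finite Y" "!!y. y : Y ==> jm (f y) & approx p (f y)"
 shows "jm (%s z. \<Sum>y\<in>Y. c y * f y s z) & approx p (%s z. \<Sum>y\<in>Y. c y * f y s z)"
 using assms(2,3) proof (induction Y rule: finite_induct)
 case empty thus ?case using approx_zero by (simp add: jm_def)
next case (insert y Y)
 let ?A = "%s z. \<Sum>y\<in>Y. c y * f y s z"
 have f: "jm (f y)" "approx p (f y)" and IH: "jm ?A" "approx p ?A" using insert by auto
 show ?case
  using jm_lincomb[OF f(1) IH(1), of "c y" 1] approx_lincomb[OF f IH p, of "c y" 1] insert(1,2) by simp
qed

text \<open>Simple functions bounded by \<open>2 * abs f\<close> are cut at growing horizons. The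
  errors are dominated by \<open>3 * abs f\<close>, which is where finiteness of
  \<open>lpn p f\<close> enters.\<close>

theorem approx_previsible:
 assumes p: "p >= 1" and f: "(%(s, \<omega>). f s \<omega>) : bmeas psp" and j: "jm f" and fin: "lpn p f < \<infinity>"
 shows "approx p f" proof -
 define g where "g = (%z. f (fst z) (snd z))"
 have "g : bmeas psp" using f by (simp add: g_def case_prod_beta')
 then obtain S where S: "!!i. simple_function psp (S i)"
   "!!x. x : space psp ==> (%i. S i x) \<leadsto> g x"
   "!!i x. x : space psp ==> dist (S i x) 0 <= 2 * dist (g x) 0"
  using borel_measurable_implies_sequence_metric[of g psp 0] by blast
 define h where "h i s \<omega> = (\<Sum>y\<in>S i ` space psp. y * cut i (S i -` {y} \<inter> space psp) s \<omega>)" for i s \<omega>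
 have level: "S i -` {y} \<inter> space psp : sets psp" for i y
  by (rule measurable_sets[OF measurable_simple_function[OF S(1)]]) simp
 have h: "jm (h i) & approx p (h i)" for i unfolding h_def
  by (rule approx_sum[OF p]) (use S(1) cut_jm[OF level] approx_cut[OF p level] in \<open>auto simp: simple_function_def\<close>)
 have heq: "h i s \<omega> = indicator {0<..real i} s * S i (s, \<omega>)" if "s > 0" "\<omega> : space M" for i s \<omega>
 proof -
  have sp: "(s, \<omega>) : space psp" using that by (simp add: space_psp)
  have fS: "finite (S i ` space psp)" using S(1)[of i] by (simp add: simple_function_def)
  have "h i s \<omega> = (\<Sum>y\<in>S i ` space psp. if y = S i (s, \<omega>) then indicator {0<..real i} s * S i (s, \<omega>) else 0)"
   unfolding h_def cut_def using sp by (intro sum.cong) (auto simp: indicator_def)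
  also have "... = indicator {0<..real i} s * S i (s, \<omega>)" using fS sp by simp
  finally show ?thesis .
 qed
 let ?A = "%s \<omega>. 3 * f s \<omega>"
 have j3: "jm ?A" using jm_lincomb[OF j j, of 3 0] by simp
 show ?thesis proof (rule approx_dominated[OF j p, of h "%s \<omega>. 3 * f s \<omega>"])
  show "jm (h m)" "approx p (h m)" for m using h by auto
  show "jm ?A" by (rule j3)
  show "lpn p ?A < \<infinity>" unfolding lpn_scale[OF j] using fin by (simp add: ennreal_mult_less_top)
  fix s :: real and \<omega> assume s: "s > 0" and \<omega>: "\<omega> : space M"
  have sp: "(s, \<omega>) : space psp" using s \<omega> by (simp add: space_psp)
  obtain n :: nat where n: "s <= real n" using real_arch_simple by blast
  have "eventually (%m. S m (s, \<omega>) = h m s \<omega>) sequentially"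
   using eventually_ge_at_top[of n] proof eventually_elim
   fix m assume "n <= m"
   hence "s <= real m" using n by linarith
   thus "S m (s, \<omega>) = h m s \<omega>" using heq[OF s \<omega>] s by simp
  qed
  moreover have "(%m. S m (s, \<omega>)) \<leadsto> f s \<omega>" using S(2)[OF sp] by (simp add: g_def)
  ultimately show "(%m. h m s \<omega>) \<leadsto> f s \<omega>" by (rule Lim_transform_eventually[rotated])
  fix m
  have "abs (S m (s, \<omega>)) <= 2 * abs (f s \<omega>)" using S(3)[OF sp, of m] by (simp add: g_def dist_real_def)
  thus "abs (f s \<omega> - h m s \<omega>) <= abs (3 * f s \<omega>)"
   unfolding heq[OF s \<omega>] by (cases "s : {0<..real m}") auto
 qed
qed

end

section \<open>Passage to previsible scalar integrands\<close>

lemma square_add_le: "(u + v)^2 <= 2 * u^2 + 2 * (v::real)^2"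
 using sum_squares_bound[of u v] by (simp add: power2_sum)

context scalar_bm begin

text \<open>Unlike \<open>lpn_add\<close> this loses no constant: the bounds \<open>B + v n\<close>
  for the approximants have to tend to \<open>B\<close>.\<close>

lemma lpn_minkowski: assumes f: "jm f" and g: "jm g" and p: "p >= 1" and ab: "b >= 0" "q >= 0"
  and F: "lpn p f <= ennreal (b powr p)" and G: "lpn p g <= ennreal (q powr p)"
 shows "lpn p (%s y. f s y + g s y) <= ennreal ((b + q) powr p)" proof -
 let ?A = "lborel \<Otimes> M"
 have [measurable]: "(%z. f (fst z) (snd z)) : bmeas ?A" "(%z. g (fst z) (snd z)) : bmeas ?A"
  by (rule jmD[OF f], rule jmD[OF g])
 define u where "u z = abs (f (fst z) (snd z)) * indicator {0<..} (fst z)" for z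
 define v where "v z = abs (g (fst z) (snd z)) * indicator {0<..} (fst z)" for z
 have um: "u : bmeas ?A" "v : bmeas ?A" unfolding u_def[abs_def] v_def[abs_def] by measurable
 have jfg: "jm (%s y. f s y + g s y)" using jm_lincomb[OF f g, of 1 1] by simp
 have e: "ennreal (abs h powr p) * indicator {0<..} s = ennreal ((abs h * indicator {0<..} s) powr p)" for h :: real and s :: real
  using p by (simp add: indicator_def)
 have "lpn p (%s y. f s y + g s y) <= (\<integral>\<^sup>+z. ennreal ((u z + v z) powr p) \<partial>?A)"
  unfolding lpn_product[OF jfg] e proof (intro nn_integral_mono ennreal_leI powr_mono2)
  fix z :: "real \<times> 'a"
  show "abs (f (fst z) (snd z) + g (fst z) (snd z)) * indicator {0<..} (fst z) <= u z + v z"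
   by (cases "fst z > 0") (simp_all add: u_def v_def abs_triangle_ineq)
 qed (use p in auto)
 also have "... <= ennreal ((b + q) powr p)" proof (rule minkowski_nn_integral[OF p um _ _ ab])
  show "(\<integral>\<^sup>+z. ennreal (u z powr p) \<partial>?A) <= ennreal (b powr p)"
   using F unfolding lpn_product[OF f] e u_def .
  show "(\<integral>\<^sup>+z. ennreal (v z powr p) \<partial>?A) <= ennreal (q powr p)"
   using G unfolding lpn_product[OF g] e v_def .
 qed (auto simp: u_def v_def)
 finally show ?thesis .
qed

lemma lpn_uminus_diff: "lpn p (%s z. g s z - f s z) = lpn p (%s z. f s z - g s z)"
 by (rule lpn_cong) (rule abs_minus_commute)

lemma ou_refine: assumes "dyadic L h" "L <= L'" shows "ou L' h x t z = ou L h x t z"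
 unfolding ou_def ouz_def dyadic_refine(2)[OF assms] ..

lemma ou_diff: assumes h: "dyadic L h1" "dyadic L h2" and z: "z : space M"
 shows "ou L (%s z. h1 s z - h2 s z) x t z = ou L h1 x t z - ou L h2 x t z" proof -
 have N: "ito L (%s z. h1 s z - h2 s z) r z = ito L h1 r z - ito L h2 r z" for r
  using dyadic_lincomb(2)[OF h, of 1 "-1" r z] by simp
 have c: "(%r. x * exp (x * r) * ito L h r z) integrable_on {0..t}" for h proof -
  have "continuous_on {0..t} (%t. ito L h t z)" by (rule continuous_on_subset[OF ito_continuous[OF z]]) auto
  thus ?thesis by (intro integrable_continuous_real continuous_intros)
 qed
 show ?thesis
  unfolding ou_def ouz_def N right_diff_distrib Henstock_Kurzweil_Integration.integral_diff[OF c c] by simp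
qed

lemma dyadic_diff: assumes "dyadic L h1" "dyadic L h2" shows "dyadic L (%s z. h1 s z - h2 s z)"
 using dyadic_lincomb(1)[OF assms, of 1 "-1"] by simp

end

context kernel_conv begin

text \<open>At the common level the integrands subtract pathwise. The exceptional set comes from
  integrability over \<open>\<nu>\<close> and does not depend on \<open>t\<close>.\<close>

lemma conv_diff: assumes h: "dyadic L1 h1" "dyadic L2 h2"
 shows "AE z in M. ALL t>=0. conv (max L1 L2) (%s z. h1 s z - h2 s z) t z = conv L1 h1 t z - conv L2 h2 t z"
proof -
 have p0: "p > 0" using p by simp
 obtain B1 where B1: "B1 > 0" "(\<H> r. (\<E> z. ennreal (abs (h1 r z) powr p))) <= ennreal (B1 powr p)"
  using dyadic_Lp_finite[OF h(1) p0] by blast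
 obtain B2 where B2: "B2 > 0" "(\<H> r. (\<E> z. ennreal (abs (h2 r z) powr p))) <= ennreal (B2 powr p)"
  using dyadic_Lp_finite[OF h(2) p0] by blast
 have d: "dyadic (max L1 L2) h1" "dyadic (max L1 L2) h2"
  by (rule dyadic_refine(1)[OF h(1)], simp, rule dyadic_refine(1)[OF h(2)], simp)
 show ?thesis using conv_sup(1)[OF h(1) B1] conv_sup(1)[OF h(2) B2] AE_space proof eventually_elim
  case (elim z)
  hence int: "integrable \<nu> (%x. ou L1 h1 x t z)" "integrable \<nu> (%x. ou L2 h2 x t z)" if "t >= 0" for t
   using that by blast+
  have e: "ou (max L1 L2) (%s z. h1 s z - h2 s z) x t z = ou L1 h1 x t z - ou L2 h2 x t z" for x t
   unfolding ou_diff[OF d elim(3)] ou_refine[OF h(1) max.cobounded1] ou_refine[OF h(2) max.cobounded2] ..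
  show ?case unfolding conv_def e using Bochner_Integration.integral_diff[OF int] by blast
 qed
qed

end

lemma powr_le_iff_nonneg: fixes u v q :: real
 assumes "u >= 0" "v >= 0" "q > 0" shows "u powr q <= v powr q \<longleftrightarrow> u <= v"
 using assms powr_mono2[of q u v] powr_less_mono2[of q v u] by (meson leD leI less_imp_le)

context kernel_conv begin

lemma kk_borel: "kk t : bmeas borel" proof -
 let ?A = "%s. \<integral>x. (if s < t then exp (- x * (t - s)) else 0) \<partial>\<nu>"
 have "?A : bmeas lborel" proof (rule \<nu>.borel_measurable_lebesgue_integral)
  note [measurable] = pair_meas
  have "(%z. if fst z < t then exp (- snd z * (t - fst z)) else 0) : bmeas (lborel \<Otimes> \<nu>)" by measurable
  thus "(%(s, x). if s < t then exp (- x * (t - s)) else 0) : bmeas (lborel \<Otimes> \<nu>)" by (simp add: case_prod_beta')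
 qed
 also have "?A = kk t" by (rule ext) (simp add: k_eq kk_def)
 finally show ?thesis by simp
qed

lemma conv_moment_diff: assumes h: "dyadic L1 h1" "dyadic L2 h2" and D: "D > 0"
  and lp: "lpn p (%s z. h1 s z - h2 s z) <= ennreal (D powr p)"
 shows "(\<E> z. (SUP t\<in>{0..}. ennreal (abs (conv L1 h1 t z - conv L2 h2 t z) powr p))) <= ennreal ((cc p * A * D) powr p)"
proof -
 let ?A = "%s z. h1 s z - h2 s z"
 have d: "dyadic (max L1 L2) ?A" by (rule dyadic_diff; rule dyadic_refine(1), rule h, simp)
 have "(\<E> z. (SUP t\<in>{0..}. ennreal (abs (conv L1 h1 t z - conv L2 h2 t z) powr p))) = (\<E> z. (SUP t\<in>{0..}. ennreal (abs (conv (max L1 L2) ?A t z) powr p)))"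
  by (rule nn_integral_cong_AE) (use conv_diff[OF h] in eventually_elim, auto intro!: SUP_cong)
 also have "... <= ennreal ((cc p * A * D) powr p)"
  by (rule conv_sup(2)[OF d D]) (use lp in \<open>simp add: lpn_def\<close>)
 finally show ?thesis .
qed

lemma scalar_convolution: assumes f: "(%(s, z). f s z) : bmeas psp" and j: "jm f" and B: "B > 0"
  and fB: "lpn p f <= ennreal (B powr p)"
 shows "EX X. (ALL t>=0. X t : bmeas M) & (AE z in M. continuous_on {0..} (%t. X t z)) & (\<E> z. (SUP t\<in>{0..}. ennreal (abs (X t z) powr p))) <= ennreal ((cc p * A * B) powr p) & (ALL t>=0. ALL y>0. EX L0. ALL L>=L0. EX b. dyadic L b & (\<integral>\<^sup>+s\<in>{0<..<t}. (\<E> z. ennreal ((b s z - k (t - s) * f s z)^2)) \<partial>lborel) <= ennreal y & (\<E> z. ennreal ((ito L b t z - X t z)^2)) <= ennreal y)"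
proof -
 define c where "c = cc p * A"
 have c: "c > 0" using cc_pos[OF p] A by (simp add: c_def)
 have p1: "p >= 1" "p > 0" "p >= 2" using p by auto
 \<comment> \<open>The moments of successive differences decay like
   \<open>((1/4) ^ n) powr p\<close> and stay summable after multiplication by
   \<open>(2 ^ n) powr p\<close>. Almost surely the paths then differ by at most
   \<open>C * (1/2) ^ n\<close>, uniformly in time.\<close>
 define v where "v n = (1/4::real) ^ n" for n :: nat
 have v: "v n > 0" for n by (simp add: v_def)
 have vm: "v m <= v n" if "n <= m" for m n using that unfolding v_def by (intro power_decreasing) auto
 have "lpn p f < \<infinity>" using fB by (simp add: order_le_less_trans)
 from approx_previsible[OF p1(1) f j this] have ap: "approx p f" .
 let ?T = "%n. ennreal (v n powr p)"
 have "EX L h. dyadic L h & lpn p (%s z. f s z - h s z) <= ?T n" for n proof -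
  have "v n powr p > 0" using v[of n] by simp
  thus ?thesis using ap unfolding approx_def by blast
 qed
 then obtain L h where h: "!!n. dyadic (L n) (h n)" and hf: "!!n. lpn p (%s z. f s z - h n s z) <= ?T n"
  by metis
 have jh: "jm (h n)" for n by (rule dyadic_jm[OF h])
 have lp: "lpn p (%s z. h m s z - h n s z) <= ennreal ((2 * v n) powr p)" if "n <= m" for m n
 proof -
  have "lpn p (%s z. (h m s z - f s z) + (f s z - h n s z)) <= ennreal ((v n + v n) powr p)"
  proof (rule lpn_minkowski[OF jm_diff[OF jh j] jm_diff[OF j jh] p1(1) less_imp_le[OF v] less_imp_le[OF v] _ hf])
   have "lpn p (%s z. h m s z - f s z) <= ennreal (v m powr p)"
    unfolding lpn_uminus_diff[of p "h m"] by (rule hf)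
   also have "... <= ?T n" using vm[OF that] v[of m] p1 by (intro ennreal_leI powr_mono2) auto
   finally show "lpn p (%s z. h m s z - f s z) <= ?T n" .
  qed
  thus ?thesis by simp
 qed
 define X' where "X' n t z = conv (L n) (h n) t z" for n t z
 have X'm: "X' n t : bmeas M" if "t >= 0" for n t
  unfolding X'_def[abs_def] by (rule conv_measurable[OF h that])
 let ?D = "%n. ennreal ((c * (2 * v n)) powr p)"
 let ?V = "%m n. \<E> z. (SUP t\<in>{0..}. ennreal (abs (X' m t z - X' n t z) powr p))"
 have sup_diff: "(?V m n) <= ?D n" if "n <= m" for m n
  unfolding X'_def c_def by (rule conv_moment_diff[OF h h _ lp[OF that]]) (use v[of n] in simp)
 have contAE: "AE z in M. ALL n. continuous_on {0..} (%t. X' n t z)"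
  unfolding AE_all_countable proof
  fix n
  obtain B' where "B' > 0" "(\<H> r. (\<E> z. ennreal (abs (h n r z) powr p))) <= ennreal (B' powr p)"
   using dyadic_Lp_finite[OF h p1(2)] by blast
  from conv_sup(1)[OF h this] show "AE z in M. continuous_on {0..} (%t. X' n t z)"
   unfolding X'_def by eventually_elim blast
 qed
 define S where "S n z = (SUP l. SUP i. ennreal (abs (X' (Suc n) (dy l i) z - X' n (dy l i) z) powr p))" for n z
 have Sm[measurable]: "S n : bmeas M" for n proof -
  have [measurable]: "X' n (dy l i) : bmeas M" for n l i by (rule X'm) simp
  show ?thesis unfolding S_def[abs_def] by measurable
 qed
 let ?H = "%n. \<E> z. S n z"
 have ES: "(?H n) <= ?D n" for n proof -
  have "(?H n) <= (\<E> z. (SUP t\<in>{0..}. ennreal (abs (X' (Suc n) t z - X' n t z) powr p)))"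
   unfolding S_def by (intro nn_integral_mono SUP_least SUP_upper) simp
  also have "... <= ?D n" by (rule sup_diff) simp
  finally show ?thesis .
 qed
 let ?J = "%n. ennreal ((2 ^ n) powr p)"
 define T where "T z = (\<Sum>n. ?J n * S n z)" for z
 have Tm[measurable]: "T : bmeas M" unfolding T_def[abs_def] by measurable
 let ?S = "\<E> z. T z"
 let ?Y = "(2 * c) powr p * (1 / (1 - (1/2) powr p))"
 have "?S <= ennreal ?Y" proof -
  let ?E' = "%n. ennreal ((2 * c) powr p * ((1/2) powr p) ^ n)"
  have "?S = (\<Sum>n. \<E> z. ?J n * S n z)"
   unfolding T_def by (rule nn_integral_suminf) measurable
  also have "... = (\<Sum>n. ?J n * (?H n))" by (intro suminf_cong nn_integral_cmult) measurable
  also have "... <= (\<Sum>n. ?E' n)" proof (intro suminf_le summableI)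
   fix n
   have e: "(2 ^ n) powr p * (c * (2 * v n)) powr p = (2 * c) powr p * ((1/2) powr p) ^ n" proof -
    have "2 ^ n * (c * (2 * v n)) = (2 * c) * (1/2) ^ n" proof -
     have "(2::real) ^ n * (1/4) ^ n = (1/2) ^ n" unfolding power_mult_distrib[symmetric] by simp
     hence "2 * c * (2 ^ n * (1/4) ^ n) = 2 * c * (1/2) ^ n" by (rule arg_cong)
     thus ?thesis unfolding v_def by (simp only: mult_ac)
    qed
    hence "(2 ^ n) powr p * (c * (2 * v n)) powr p = (2 * c) powr p * ((1/2) ^ n) powr p"
     unfolding powr_mult[symmetric] by (simp only:)
    also have "((1/2::real) ^ n) powr p = ((1/2) powr p) ^ n"
     by (simp add: powr_realpow[symmetric] powr_powr mult.commute)
    finally show ?thesis .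
   qed
   have "?J n * (?H n) <= ?J n * ?D n" by (rule mult_left_mono[OF ES]) simp
   also have "... = ?E' n" unfolding e[symmetric] by (rule ennreal_mult'[symmetric]) simp
   finally show "?J n * (?H n) <= ?E' n" .
  qed
  also have "... = ennreal ?Y" proof -
   have q: "(1/2::real) powr p < 1" using p1 powr_less_mono2[of p "1/2" 1] by simp
   have "(%n. (2 * c) powr p * ((1/2) powr p) ^ n) sums ?Y"
    by (intro sums_mult geometric_sums) (use q in simp)
   thus ?thesis by (intro suminf_ennreal_eq) auto
  qed
  finally show ?thesis .
 qed
 hence "?S ~= \<infinity>" by (auto simp: top_unique)
 hence TAE: "AE z in M. T z ~= \<infinity>" by (intro nn_integral_PInf_AE) auto
 define X where "X t z = lim (%n. X' n t z)" for t z
 have Xm: "X t : bmeas M" if "t >= 0" for t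
  unfolding X_def[abs_def] using X'm[OF that] by (rule borel_measurable_lim_metric)
 have unif: "AE z in M. uniform_limit {0..} (%n t. X' n t z) (%t. X t z) sequentially"
  using TAE contAE proof eventually_elim
  fix z assume T: "T z ~= \<infinity>" and ct: "ALL n. continuous_on {0..} (%t. X' n t z)"
  define C where "C = enn2real (T z) powr (1/p)"
  have bound: "norm (X' (Suc n) t z - X' n t z) <= C * (1/2) ^ n" if t: "t : {0..}" for n t proof -
   have cd: "continuous_on {0..} (%t. X' (Suc n) t z - X' n t z)" using ct by (intro continuous_intros) auto
   have "ennreal (abs (X' (Suc n) t z - X' n t z) powr p) <= (SUP t\<in>{0..}. ennreal (abs (X' (Suc n) t z - X' n t z) powr p))"
    by (rule SUP_upper[OF t])
   also have "... = S n z" unfolding S_def by (rule SUP_halfline_dyadic[OF cd p1(2)])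
   finally have "?J n * ennreal (abs (X' (Suc n) t z - X' n t z) powr p) <= ?J n * S n z"
    by (rule mult_left_mono) simp
   also have "... <= T z" unfolding T_def
    using sum_le_suminf[OF summableI, of "{n}" "%n. ?J n * S n z"] by simp
   also have "T z = ennreal (C powr p)" using T p1 by (simp add: C_def powr_powr less_top)
   finally have "ennreal ((2 ^ n * abs (X' (Suc n) t z - X' n t z)) powr p) <= ennreal (C powr p)"
    by (simp add: powr_mult ennreal_mult')
   hence "2 ^ n * abs (X' (Suc n) t z - X' n t z) <= C"
    using powr_le_iff_nonneg[of "2 ^ n * abs (X' (Suc n) t z - X' n t z)" C p] p1 by (simp add: C_def)
   thus ?thesis by (simp add: power_one_over field_simps)
  qed
  let ?Z = "%t. (\<Sum>i. X' (Suc i) t z - X' i t z) + X' 0 t z"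
  let ?G' = "%t. \<Sum>i. X' (Suc i) t z - X' i t z"
  have "summable (%n. C * (1/2::real) ^ n)" by (intro summable_mult summable_geometric) simp
  hence "uniform_limit {0..} (%n t. \<Sum>i<n. X' (Suc i) t z - X' i t z) ?G' sequentially"
   using bound by (intro Weierstrass_m_test[where f = "%i t. X' (Suc i) t z - X' i t z" and M = "%n. C * (1/2) ^ n"]) auto
  hence "uniform_limit {0..} (%n t. X' n t z - X' 0 t z) ?G' sequentially"
   by (simp only: sum_lessThan_telescope[of "%n. X' n t z" for t])
  hence "uniform_limit {0..} (%n t. (X' n t z - X' 0 t z) + X' 0 t z) ?Z sequentially"
   by (intro uniform_limit_add uniform_limit_const)
  hence ul: "uniform_limit {0..} (%n t. X' n t z) ?Z sequentially" by simp
  have "X t z = (\<Sum>i. X' (Suc i) t z - X' i t z) + X' 0 t z" if "t : {0..}" for t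
   unfolding X_def by (rule limI[OF tendsto_uniform_limitI[OF ul that]])
  thus "uniform_limit {0..} (%n t. X' n t z) (%t. X t z) sequentially"
   using ul by (subst uniform_limit_cong'[of _ _ "%n t. X' n t z"]) auto
 qed
 have contX: "AE z in M. continuous_on {0..} (%t. X t z)" using unif contAE
  by eventually_elim (rule uniform_limit_theorem[rotated], assumption, auto)
 have pt: "AE z in M. ALL t>=0. (%n. X' n t z) \<leadsto> X t z"
  using unif by eventually_elim (auto intro: tendsto_uniform_limitI)
 have lph: "lpn p (h n) <= ennreal ((B + v n) powr p)" for n proof -
  have "lpn p (%s z. f s z + (h n s z - f s z)) <= ennreal ((B + v n) powr p)"
   by (rule lpn_minkowski[OF j jm_diff[OF jh j] p1(1) less_imp_le[OF B] less_imp_le[OF v] fB])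
    (unfold lpn_uminus_diff[of p "h n"], rule hf)
  thus ?thesis by simp
 qed
 let ?L = "%t z. ennreal (abs (X t z) powr p)"
 let ?B' = "\<E> z. (SUP t\<in>{0..}. ?L t z)"
 have EX: "?B' <= ennreal ((c * B) powr p)" proof -
  \<comment> \<open>Suprema over dyadic times are measurable, as Fatou's lemma requires; on
    continuous paths they are the suprema over all times.\<close>
  define V where "V n z = (SUP l. SUP i. ennreal (abs (X' n (dy l i) z) powr p))" for n z
  have Vm: "V n : bmeas M" for n proof -
   have [measurable]: "X' n (dy l i) : bmeas M" for n l i by (rule X'm) simp
   show ?thesis unfolding V_def[abs_def] by measurable
  qed
  let ?X = "%n. ennreal ((c * (B + v n)) powr p)"
  have EV: "(\<E> z. V n z) <= ?X n" for n proof -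
   have "(\<E> z. V n z) <= (\<E> z. (SUP t\<in>{0..}. ennreal (abs (X' n t z) powr p)))"
    unfolding V_def by (intro nn_integral_mono SUP_least SUP_upper) simp
   also have "... <= ?X n"
    unfolding X'_def c_def by (rule conv_sup(2)[OF h]) (use lph[of n] B v[of n] in \<open>simp_all add: lpn_def\<close>)
   finally show ?thesis .
  qed
  let ?H' = "%z. liminf (%n. V n z)"
  have "?B' <= (\<E> z. ?H' z)" proof (rule nn_integral_mono_AE)
   show "AE z in M. (SUP t\<in>{0..}. ?L t z) <= ?H' z" using pt contAE proof eventually_elim
    fix z assume pt: "ALL t>=0. (%n. X' n t z) \<leadsto> X t z" and ct: "ALL n. continuous_on {0..} (%t. X' n t z)"
    show "(SUP t\<in>{0..}. ?L t z) <= ?H' z" proof (rule SUP_least)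
     fix t :: real assume t: "t : {0..}"
     let ?J' = "%n. ennreal (abs (X' n t z) powr p)"
     have "?J' \<leadsto> ?L t z"
      using p1 pt t by (intro tendsto_ennrealI tendsto_powr' tendsto_rabs tendsto_const) auto
     hence "?L t z = liminf ?J'" by (intro lim_imp_Liminf[symmetric]) auto
     also have "... <= ?H' z" proof (rule Liminf_mono, rule always_eventually, rule allI)
      fix n
      have "V n z = (SUP t\<in>{0..}. ennreal (abs (X' n t z) powr p))"
       unfolding V_def using ct by (intro SUP_halfline_dyadic[symmetric] p1(2)) auto
      thus "ennreal (abs (X' n t z) powr p) <= V n z" using SUP_upper[OF t] by simp
     qed
     finally show "?L t z <= ?H' z" .
    qed
   qed
  qed
  also have "... <= liminf (%n. \<E> z. V n z)" by (rule nn_integral_liminf[OF Vm])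
  also have "... <= liminf (%n. ?X n)"
   by (rule Liminf_mono, rule always_eventually, rule allI, rule EV)
  also have "... = ennreal ((c * (B + 0)) powr p)" proof (rule lim_imp_Liminf)
   have "v \<leadsto> 0" unfolding v_def[abs_def] by (rule LIMSEQ_power_zero) simp
   thus "(%n. ?X n) \<leadsto> ennreal ((c * (B + 0)) powr p)"
    using c B by (intro tendsto_ennrealI tendsto_powr tendsto_intros) auto
  qed simp
  finally show ?thesis by simp
 qed
 let ?D' = "%n t z. ennreal ((X' n t z - X t z)^2)"
 let ?C = "%n t. \<E> z. ?D' n t z"
 have L2: "(?C n t) <= ennreal ((2 * c * v n)^2)" if t: "t >= 0" for n t proof -
  let ?A' = "%n. \<E> z. ennreal (abs (X' n t z - X t z) powr p)"
  have Lp: "(?A' n) <= ?D n"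
  proof (rule nn_integral_powr_fatou[OF p1(2), where f = "%m z. X' n t z - X' m t z" and ?n0.0 = n])
   show "(%z. X' n t z - X' m t z) : bmeas M" for m
    by (rule borel_measurable_diff[OF X'm[OF t] X'm[OF t]])
   show "AE z in M. (%m. X' n t z - X' m t z) \<leadsto> X' n t z - X t z"
    using pt by eventually_elim (use t in \<open>auto intro!: tendsto_intros\<close>)
   fix m assume m: "n <= m"
   let ?C' = "%n m. \<E> z. ennreal (abs (X' n t z - X' m t z) powr p)"
   have "(?C' n m) <= (?V m n)"
    unfolding abs_minus_commute[of "X' n t _"] using t by (intro nn_integral_mono SUP_upper) auto
   also have "... <= ?D n" by (rule sup_diff[OF m])
   finally show "(?C' n m) <= ?D n" .
  qed
  have gm: "(%z. X' n t z - X t z) : bmeas M" by (rule borel_measurable_diff[OF X'm[OF t] Xm[OF t]])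
  define G where "G = (?C n t)"
  have fin: "(?A' n) < \<infinity>" using Lp by (simp add: order_le_less_trans)
  have "G < \<infinity>" unfolding G_def by (rule second_moment_powr_le(1)[OF gm p1(3) fin])
  have "ennreal (enn2real G powr (p/2)) <= ?D n"
   unfolding G_def by (rule order_trans[OF second_moment_powr_le(2)[OF gm p1(3) fin] Lp])
  hence "enn2real G powr (p/2) <= (c * (2 * v n)) powr p" by simp
  also have "(c * (2 * v n)) powr p = ((2 * c * v n)^2) powr (p/2)"
   unfolding square_powr_half using c v[of n] by (simp add: mult_ac)
  finally have "enn2real G <= (2 * c * v n)^2"
   using powr_le_iff_nonneg[of "enn2real G" "(2 * c * v n)^2" "p/2"] p1 by simp
  hence "ennreal (enn2real G) <= ennreal ((2 * c * v n)^2)" by (rule ennreal_leI)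
  moreover have "ennreal (enn2real G) = G" using \<open>G < \<infinity>\<close> by simp
  ultimately show ?thesis unfolding G_def by (simp only:)
 qed
 let ?A = "%b s t. \<E> z. ennreal ((b s z - k (t - s) * f s z)^2)"
 let ?K = "%t b. \<integral>\<^sup>+s\<in>{0<..<t}. (?A b s t) \<partial>lborel"
 have appr: "EX L0. ALL L>=L0. EX b. dyadic L b & (?K t b) <= ennreal y & (\<E> z. ennreal ((ito L b t z - X t z)^2)) <= ennreal y" if t: "t >= 0" and y: "y > 0" for t y
 proof -
  \<comment> \<open>First \<open>n\<close> is chosen against the two errors of replacing
    \<open>f\<close> by \<open>h n\<close>, in the integrand and in the limit process;
    \<open>K\<close> covers both. Then the level \<open>l\<close> is chosen against the sampling
    error \<open>N * R l\<close>, since \<open>N\<close> depends on the bound \<open>Bn\<close> for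
    \<open>h n\<close>.\<close>
  define K where "K = A^2 * a powr (2 * a) + 4 * c^2"
  have K: "K > 0" using A a c by (simp add: K_def add_nonneg_pos)
  have "(%n. K * (v n)^2) \<leadsto> K * 0^2" proof -
   have "v \<leadsto> 0" unfolding v_def[abs_def] by (rule LIMSEQ_power_zero) simp
   thus ?thesis by (intro tendsto_intros)
  qed
  hence "eventually (%n. K * (v n)^2 < y / 4) sequentially"
   by (rule order_tendstoD(2)) (use y in simp)
  then obtain n where n: "K * (v n)^2 < y / 4" by (auto simp: eventually_sequentially)
  obtain Bn where Bn: "Bn > 0" "!!r z. z : space M ==> abs (h n r z) <= Bn" using dyadic_bounded[OF h, of n] by blast
  define N where "N = 2 * Bn^2 * A * t powr (1 - 2 * a)"
  have N: "N >= 0" using A by (simp add: N_def)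
  let ?E = "ennreal (y / 4)"
  have "(%l. ennreal N * R l) \<leadsto> ennreal N * 0"
   by (rule ennreal_tendsto_cmult[OF _ R_tendsto_0]) simp
  hence "eventually (%l. ennreal N * R l < ?E) sequentially"
   by (intro order_tendstoD(2)) (use y in auto)
  then obtain l0 where l0: "!!l. l >= l0 ==> ennreal N * R l < ?E" by (auto simp: eventually_sequentially)
  show ?thesis proof (rule exI[of _ "max l0 (L n)"], intro allI impI)
   fix l assume "l >= max l0 (L n)"
   hence l: "l >= l0" "l >= L n" by auto
   define b where "b s z = kk t (left_dy l s) * h n s z" for s z
   have db: "dyadic l b" unfolding b_def by (rule dyadic_weight[OF dyadic_refine(1)[OF h l(2)]])
   have "(?K t b) <= ennreal y" proof -
    let ?I' = "%s z. h n s z - f s z"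
    have jg: "jm ?I'" by (rule jm_diff[OF jh j])
    let ?B = "%s z. ennreal ((h n s z - f s z)^2)"
    let ?N = "%s. \<E> z. ?B s z"
    let ?Q = "ennreal (A^2 * a powr (2 * a) * (v n)^2)"
    let ?R = "%s. ennreal ((k (t - s))^2)"
    have kh: "(\<integral>\<^sup>+s\<in>{0<..<t}. (?R s * (?N s)) \<partial>lborel) <= ?Q"
    proof (rule kernel_holder[OF _ v _ t])
     show "(%(s, z). h n s z - f s z) : bmeas (lborel \<Otimes> M)" using jg unfolding jm_def .
     have "lpn p ?I' <= ?T n" unfolding lpn_uminus_diff[of p "h n"] by (rule hf)
     thus "(\<H> s. (\<E> z. ennreal (abs (h n s z - f s z) powr p))) <= ?T n" by (simp add: lpn_def)
    qed
    define Ka where "Ka s = ennreal ((k (t - left_dy l s) - k (t - s))^2) * indicator {0<..<t} s" for s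
    define Kb where "Kb s = ?R s * (?N s) * indicator {0<..<t} s" for s
    have Kam: "Ka : bmeas lborel" proof -
     define k' where "k' = kk t"
     have [measurable]: "k' : bmeas borel" unfolding k'_def by (rule kk_borel)
     have "Ka = (%s. ennreal ((k' (left_dy l s) - k' s)^2) * indicator {0<..<t} s)" proof (rule ext)
      fix s
      show "Ka s = ennreal ((k' (left_dy l s) - k' s)^2) * indicator {0<..<t} s"
       using left_dy_bounds(1)[where L = l and s = s] by (cases "s : {0<..<t}") (auto simp: Ka_def k'_def kk_def)
     qed
     also have "... : bmeas lborel" by measurable
     finally show ?thesis .
    qed
    have Kbm: "Kb : bmeas lborel" proof -
     define k' where "k' = kk t"
     have [measurable]: "k' : bmeas borel" unfolding k'_def by (rule kk_borel)
     have [measurable]: "(%s. \<E> z. ?B s z) : bmeas lborel"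
      using jm_moment[OF jg, of 2] unfolding abs_powr_2 .
     have "Kb = (%s. ennreal ((k' s)^2) * (?N s) * indicator {0<..<t} s)"
      by (rule ext) (auto simp: Kb_def k'_def kk_def indicator_def)
     also have "... : bmeas lborel" by measurable
     finally show ?thesis .
    qed
    let ?I = "ennreal (2 * Bn^2)"
    have "(?K t b) <= (\<L> s. ?I * Ka s + 2 * Kb s)" proof (rule nn_integral_mono)
     fix s
     show "(?A b s t) * indicator {0<..<t} s <= ?I * Ka s + 2 * Kb s" proof (cases "s : {0<..<t}")
      case True hence kk: "kk t (left_dy l s) = k (t - left_dy l s)"
       using left_dy_bounds(1)[where L = l and s = s] by (simp add: kk_def)
      define u where "u = k (t - left_dy l s) - k (t - s)"
      have mm: "(%z. ?B s z) : bmeas M" using jm_section[OF jg, of s] by measurable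
      have "(?A b s t) <= (\<E> z. ?I * ennreal (u^2) + 2 * (?R s * ?B s z))"
      proof (rule nn_integral_mono)
       fix z assume z: "z : space M"
       let ?P = "(k (t - s))^2 * (h n s z - f s z)^2"
       have "b s z - k (t - s) * f s z = u * h n s z + k (t - s) * (h n s z - f s z)"
        by (simp add: b_def kk u_def algebra_simps)
       hence "(b s z - k (t - s) * f s z)^2 <= 2 * (u * h n s z)^2 + 2 * (k (t - s) * (h n s z - f s z))^2"
        using square_add_le by simp
       also have "(u * h n s z)^2 <= u^2 * Bn^2"
        unfolding power_mult_distrib using Bn(2)[OF z, of s] Bn(1) by (intro mult_left_mono) (auto simp: abs_le_square_iff[symmetric])
       finally have "(b s z - k (t - s) * f s z)^2 <= (2 * Bn^2) * u^2 + 2 * ?P"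
        by (simp add: power_mult_distrib mult_ac)
       hence "ennreal ((b s z - k (t - s) * f s z)^2) <= ennreal ((2 * Bn^2) * u^2 + 2 * ?P)" by (rule ennreal_leI)
       also have "... = ?I * ennreal (u^2) + 2 * (?R s * ?B s z)" proof -
        have nn: "0 <= 2 * Bn^2" "0 <= (k (t - s))^2" "0 <= (2::real)" "0 <= (2 * Bn^2) * u^2" "0 <= 2 * ?P" by auto
        show ?thesis unfolding ennreal_plus[OF nn(4,5)] ennreal_mult'[OF nn(1)] ennreal_mult'[OF nn(3)] ennreal_mult'[OF nn(2)] ennreal_numeral ..
       qed
       finally show "ennreal ((b s z - k (t - s) * f s z)^2) <= ?I * ennreal (u^2) + 2 * (?R s * ?B s z)" .
      qed
      also have "... = ?I * ennreal (u^2) + 2 * (?R s * (?N s))"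
       using mm by (simp add: nn_integral_add nn_integral_cmult emeasure_space_1)
      finally show ?thesis using True by (simp add: Ka_def Kb_def u_def)
     qed simp
    qed
    also have "... = ?I * (\<L> s. Ka s) + 2 * (\<L> s. Kb s)"
     using Kam Kbm by (simp add: nn_integral_add nn_integral_cmult)
    also have "... <= ?I * (ennreal (A * t powr (1 - 2 * a)) * R l) + 2 * ?Q"
     using kernel_left_approx[OF t, of l] kh unfolding Ka_def Kb_def by (intro add_mono mult_left_mono) auto
    also have "?I * (ennreal (A * t powr (1 - 2 * a)) * R l) = ennreal N * R l" proof -
     have "0 <= 2 * Bn^2" by simp
     thus ?thesis unfolding mult.assoc[symmetric] N_def by (simp only: ennreal_mult'[symmetric] mult.assoc)
    qed
    also have "ennreal N * R l + 2 * ?Q <= ?E + 2 * ?E"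
    proof (intro add_mono mult_left_mono less_imp_le[OF l0[OF l(1)]] ennreal_leI)
     have "A^2 * a powr (2 * a) * (v n)^2 <= K * (v n)^2" by (intro mult_right_mono) (auto simp: K_def)
     thus "A^2 * a powr (2 * a) * (v n)^2 <= y / 4" using n by linarith
    qed simp
    also have "... <= ennreal y" proof -
     have "?E + 2 * ?E = ennreal (y / 4 + (y / 4 + y / 4))"
      using y by (simp only: mult_2 ennreal_plus[symmetric] less_imp_le divide_nonneg_pos zero_less_numeral add_nonneg_nonneg)
     also have "... <= ennreal y" using y by (intro ennreal_leI) simp
     finally show ?thesis .
    qed
    finally show ?thesis .
   qed
   moreover have "(\<E> z. ennreal ((ito l b t z - X t z)^2)) <= ennreal y" proof -
    let ?G = "%z. ennreal ((ito l b t z - X' n t z)^2)"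
    let ?U = "\<E> z. ?G z"
    have ic: "?U <= ennreal N * R l"
     unfolding X'_def b_def N_def by (rule ito_conv_approx[OF h Bn(2) t l(2)])
    have m1: "(%z. ?G z) : bmeas M" using ito_measurable[OF db t] X'm[OF t, of n] by measurable
    have m2: "(%z. ?D' n t z) : bmeas M" using Xm[OF t] X'm[OF t, of n] by measurable
    have "(\<E> z. ennreal ((ito l b t z - X t z)^2)) <= (\<E> z. 2 * ?G z + 2 * ?D' n t z)"
    proof (rule nn_integral_mono)
     fix z
     have "(ito l b t z - X t z)^2 <= 2 * (ito l b t z - X' n t z)^2 + 2 * (X' n t z - X t z)^2"
      using square_add_le[of "ito l b t z - X' n t z" "X' n t z - X t z"] by simp
     hence "ennreal ((ito l b t z - X t z)^2) <= ennreal (2 * (ito l b t z - X' n t z)^2 + 2 * (X' n t z - X t z)^2)" by (rule ennreal_leI)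
     thus "ennreal ((ito l b t z - X t z)^2) <= 2 * ?G z + 2 * ?D' n t z"
      by (simp add: ennreal_mult')
    qed
    also have "... = 2 * ?U + 2 * (?C n t)"
     using m1 m2 by (simp add: nn_integral_add nn_integral_cmult)
    also have "... <= 2 * ?E + 2 * ?E" proof (intro add_mono mult_left_mono)
     show "?U <= ?E" by (rule order_trans[OF ic less_imp_le[OF l0[OF l(1)]]])
     have "(2 * c * v n)^2 <= y / 4" proof -
      have "(2 * c * v n)^2 = 4 * c^2 * (v n)^2" by (simp add: power_mult_distrib)
      also have "... <= K * (v n)^2" by (intro mult_right_mono) (auto simp: K_def)
      finally show ?thesis using n by linarith
     qed
     thus "(?C n t) <= ?E" using L2[OF t, of n] by (meson ennreal_leI order_trans)
    qed simp_all
    also have "... = ennreal y" proof -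
     have "2 * ?E = ennreal (2 * (y / 4))" by (subst ennreal_mult') (simp, simp only: ennreal_numeral)
     thus ?thesis using y by (simp add: ennreal_plus[symmetric] del: ennreal_plus)
    qed
    finally show ?thesis .
   qed
   ultimately show "EX b. dyadic l b & (?K t b) <= ennreal y & (\<E> z. ennreal ((ito l b t z - X t z)^2)) <= ennreal y" using db by blast
  qed
 qed
 show ?thesis using Xm contX EX appr unfolding c_def by (intro exI[of _ X] conjI) blast+
qed

end

section \<open>Components of a vector Brownian motion\<close>

lemma borel_measurable_vec_iff: fixes f :: "'b => 'c::euclidean_space ^ 'n"
 shows "f : bmeas N \<longleftrightarrow> (ALL i. (%x. f x $ i) : bmeas N)" proof
 assume f: "f : bmeas N"
 show "ALL i. (%x. f x $ i) : bmeas N" proof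
  fix i
  have "(%v::'c ^ 'n. v $ i) : bmeas borel"
   by (intro borel_measurable_continuous_onI continuous_intros)
  from measurable_compose[OF f this] show "(%x. f x $ i) : bmeas N" .
 qed
next
 assume f: "ALL i. (%x. f x $ i) : bmeas N"
 show "f : bmeas N" unfolding borel_measurable_euclidean_space[of f] proof
  fix b :: "'c ^ 'n" assume "b : Basis"
  then obtain i v where b: "b = axis i v" unfolding Basis_vec_def by auto
  have [measurable]: "(%x. f x $ i) : bmeas N" using f by blast
  have "(%x. f x $ i \<bullet> v) : bmeas N" by measurable
  thus "(%x. f x \<bullet> b) : bmeas N" by (simp add: b inner_axis)
 qed
qed

lemma borel_measurable_mat_iff: fixes f :: "'b => real ^ 'n ^ 'k"
 shows "f : bmeas N \<longleftrightarrow> (ALL i j. (%x. f x $ i $ j) : bmeas N)"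
 by (simp add: borel_measurable_vec_iff[of f] borel_measurable_vec_iff[of "%x. f x $ _"])

lemma norm_vec_square: "(norm (v :: real ^ 'n))^2 = (\<Sum>i\<in>UNIV. (v $ i)^2)"
 by (simp add: norm_vec_def L2_set_def sum_nonneg)

lemma norm_mat_square: "(norm (A :: real ^ 'n ^ 'k))^2 = (\<Sum>i\<in>UNIV. \<Sum>j\<in>UNIV. (A $ i $ j)^2)"
 by (simp add: norm_vec_def[of A] L2_set_def sum_nonneg norm_vec_square)

lemma abs_entry_le_norm: "abs ((A :: real ^ 'n ^ 'k) $ i $ j) <= norm A"
 using component_le_norm_cart[of "A $ i" j] Finite_Cartesian_Product.norm_nth_le[of A i] by linarith

lemma square_sum_le: "(\<Sum>i\<in>I. f i)^2 <= real (card I) * (\<Sum>i\<in>I. (f i :: real)^2)"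
 using Cauchy_Schwarz_ineq_sum[of "%_. 1" f I] by simp

lemma nn_integral_square_add_le:
 fixes X Y :: "'a => 'b::euclidean_space" assumes "X : bmeas N" "Y : bmeas N"
 shows "(\<integral>\<^sup>+z. ennreal ((norm (X z + Y z))^2) \<partial>N) <= 2 * (\<integral>\<^sup>+z. ennreal ((norm (X z))^2) \<partial>N) + 2 * (\<integral>\<^sup>+z. ennreal ((norm (Y z))^2) \<partial>N)"
proof -
 have [measurable]: "(%z. norm (X z)) : bmeas N" "(%z. norm (Y z)) : bmeas N"
  using assms by measurable
 let ?A = "%z. ennreal ((norm (X z + Y z))^2)"
 let ?B = "%z. 2 * ennreal ((norm (X z))^2) + 2 * ennreal ((norm (Y z))^2)"
 have "(\<integral>\<^sup>+z. ?A z \<partial>N) <= (\<integral>\<^sup>+z. ?B z \<partial>N)"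
 proof (rule nn_integral_mono)
  fix z
  have "(norm (X z + Y z))^2 <= (norm (X z) + norm (Y z))^2" by (intro power_mono norm_triangle_ineq) simp
  also have "... <= 2 * (norm (X z))^2 + 2 * (norm (Y z))^2" by (rule square_add_le)
  finally have "?A z <= ennreal (2 * (norm (X z))^2 + 2 * (norm (Y z))^2)" by (rule ennreal_leI)
  thus "?A z <= ?B z" by (simp add: ennreal_mult')
 qed
 also have "... = 2 * (\<integral>\<^sup>+z. ennreal ((norm (X z))^2) \<partial>N) + 2 * (\<integral>\<^sup>+z. ennreal ((norm (Y z))^2) \<partial>N)"
  by (simp add: nn_integral_add nn_integral_cmult)
 finally show ?thesis .
qed

locale vector_bm = prob_space M for M :: "'a measure" +
 fixes F :: "real => 'a measure" and W :: "real => 'a => real ^ 'm"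
 assumes filtered: "filtered_prob_space M F" and usual: "usual_conditions M F"
  and bm: "brownian_motion M F W"
begin

lemma subalgebra_F: "t >= 0 ==> subalgebra M (F t)"
 and sets_F_mono: "0 <= s ==> s <= t ==> sets (F s) \<subseteq> sets (F t)"
 using filtered by (auto simp: filtered_prob_space_def)

lemma W_adapted: "t >= 0 ==> (%z. W t z $ k) : bmeas (F t)"
 using bm unfolding brownian_motion_def borel_measurable_vec_iff[of "W _"] by blast

lemma W_measurable: "t >= 0 ==> (%z. W t z $ k) : bmeas M"
 by (rule measurable_from_subalg[OF subalgebra_F W_adapted])

text \<open>A null set containing the discontinuous paths, as supplied by the almost sure
  quantifier. By the usual conditions it belongs to every \<open>F t\<close>.\<close>

definition bad :: "'a set" where
 "bad = (SOME N. N : null_sets M & {z : space M. ~ continuous_on {0..} (%t. W t z)} \<subseteq> N)"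

lemma bad: "bad : null_sets M" "z : space M ==> z \<notin> bad ==> continuous_on {0..} (%t. W t z)"
proof -
 have "AE z in M. continuous_on {0..} (%t. W t z)" using bm by (simp add: brownian_motion_def)
 then obtain N where "{z : space M. ~ continuous_on {0..} (%t. W t z)} \<subseteq> N" "emeasure M N = 0" "N : sets M"
  by (rule AE_E)
 hence "EX N. N : null_sets M & {z : space M. ~ continuous_on {0..} (%t. W t z)} \<subseteq> N" by blast
 from someI_ex[OF this]
 show "bad : null_sets M" "z : space M ==> z \<notin> bad ==> continuous_on {0..} (%t. W t z)"
  unfolding bad_def[symmetric] by blast+
qed

lemma bad_F: "t >= 0 ==> bad : sets (F t)"
 using bad(1) usual sets_F_mono[of 0 t] unfolding usual_conditions_def by blast

text \<open>Completeness of \<open>F 0\<close> allows all paths to be made continuous without losing adaptedness.\<close>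

definition wc :: "'m => real => 'a => real" where
 "wc k t z = (if z : bad then 0 else W t z $ k)"

lemma wc_AE: "AE z in M. ALL k t. wc k t z = W t z $ k"
 using AE_not_in[OF bad(1)] by eventually_elim (simp add: wc_def)

lemma wc_adapted: "t >= 0 ==> wc k t : bmeas (F t)" unfolding wc_def[abs_def]
 by (intro measurable_If_set W_adapted measurable_const)
  (auto intro!: sets.Int_space_eq2[THEN ssubst, of _ "F t" "%A. A : sets (F t)"] bad_F)

lemma wc_measurable: "t >= 0 ==> wc k t : bmeas M"
 by (rule measurable_from_subalg[OF subalgebra_F wc_adapted])

text \<open>Changing paths on a null set alters the events generated by an increment only by null
  sets, so independence and the normal law carry over from \<open>W\<close>.\<close>

lemma scalar_wc: "scalar_bm M F (wc k)" proof
 show "continuous_on {0..} (%t. wc k t z)" if "z : space M" for z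
  using bad(2)[OF that] by (cases "z : bad") (auto simp: wc_def intro!: continuous_intros)
 fix s t :: real assume st: "0 <= s" "s < t"
 hence t: "t >= 0" by simp
 define V where "V = (%z. (W t z - W s z) $ k)"
 let ?A = "%z. wc k t z - wc k s z"
 define w where "w = ?A"
 have Vm: "V : bmeas M" and wm: "w : bmeas M"
  unfolding V_def w_def vector_minus_component using W_measurable wc_measurable st t by (auto intro!: borel_measurable_diff)
 have AE: "AE z in M. w z = V z" using wc_AE by eventually_elim (simp add: w_def V_def)
 have ind: "indep_set (sets (F s)) {(%z. W t z - W s z) -` A \<inter> space M | A. A : sets borel}"
  and dis: "distributed M lborel V (normal_density 0 (sqrt (t - s)))"
  using bm st unfolding brownian_motion_def V_def by blast+
 have Fs: "sets (F s) \<subseteq> events" using subalgebra_F[OF st(1)] by (auto simp: subalgebra_def)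
 show "indep_set (sets (F s)) {?A -` A \<inter> space M | A. A : sets borel}"
  unfolding w_def[symmetric] proof (rule indep_setI[OF Fs])
  show "{w -` A \<inter> space M | A. A : sets borel} \<subseteq> events" using measurable_sets[OF wm] by auto
  fix a b assume a: "a : sets (F s)" and "b : {w -` A \<inter> space M | A. A : sets borel}"
  then obtain A where A: "A : sets borel" and b: "b = w -` A \<inter> space M" by blast
  define b' where "b' = V -` A \<inter> space M"
  have "(%v::real ^ 'm. v $ k) : bmeas borel" by (intro borel_measurable_continuous_onI continuous_intros)
  from measurable_sets[OF this A] have "(%v::real ^ 'm. v $ k) -` A : sets borel" by simp
  moreover have "b' = (%z. W t z - W s z) -` ((%v. v $ k) -` A) \<inter> space M" by (auto simp: b'_def V_def)
  ultimately have "prob (a \<inter> b') = prob a * prob b'" by (intro indep_setD[OF ind a]) blast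
  moreover have sets: "b : events" "b' : events" "a : events"
   unfolding b b'_def using measurable_sets[OF wm A] measurable_sets[OF Vm A] Fs a by auto
  moreover have "prob b = prob b'" using AE sets
   by (intro measure_eq_AE) (auto simp: b b'_def elim: AE_mp)
  moreover have "prob (a \<inter> b) = prob (a \<inter> b')" using AE sets
   by (intro measure_eq_AE) (auto simp: b b'_def elim: AE_mp)
  ultimately show "prob (a \<inter> b) = prob a * prob b" by simp
 qed
 have "distr M lborel w = distr M lborel V" using AE Vm wm by (intro distr_cong_AE) auto
 thus "distributed M lborel ?A (normal_density 0 (sqrt (t - s)))"
  using dis wm unfolding distributed_def w_def by simp
qed (use subalgebra_F sets_F_mono wc_adapted in auto)

end

section \<open>Uniqueness of the Ito integral\<close>

context scalar_bm begin

text \<open>The case \<open>p = 2\<close> of \<open>increments_moment\<close>, with the second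
  moments themselves in place of bounds.\<close>

lemma increments_second_moment:
 fixes v :: "nat => real" assumes v0: "0 <= v 0" and v: "!!i. i < n ==> v i <= v (Suc i)"
  and y: "!!i. i < n ==> y i : bmeas (F (v i))"
  and bd: "!!i. i < n ==> EX B. ALL z:space M. abs (y i z) <= B"
 shows "(\<E> z. ennreal ((\<Sum>i<n. y i z * (w (v (Suc i)) z - w (v i) z))^2)) <= ennreal (kap 2) * (\<E> z. (\<Sum>i<n. ennreal ((v (Suc i) - v i) * (y i z)^2)))"
proof -
 have vnn: "i <= n ==> 0 <= v i" for i
  by (induction i) (use v0 v in \<open>auto intro: order_trans[of _ "v _"]\<close>)
 have m: "y i : bmeas M" if "i < n" for i using F_measurable_M[OF vnn y[OF that]] that by simp
 let ?A = "%i. \<E> z. ennreal ((y i z)^2)"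
 define c where "c i = sqrt (enn2real (?A i))" for i
 have c2: "(?A i) = ennreal ((c i)^2)" if i: "i < n" for i proof -
  obtain B where B: "!!z. z : space M ==> abs (y i z) <= B" using bd[OF i] by blast
  have "(?A i) <= (\<E> z. ennreal (B^2))" proof (rule nn_integral_mono, rule ennreal_leI)
   fix z assume "z : space M"
   thus "(y i z)^2 <= B^2" using power_mono[OF B[of z], of 2] by simp
  qed
  also have "... < \<infinity>" by (simp add: emeasure_space_1)
  finally show ?thesis unfolding c_def by simp
 qed
 have a2: "abs x powr 2 = x^2" for x :: real by (cases "x = 0") simp_all
 let ?C = "%v i. v (Suc i) - v i"
 let ?B = "%v. \<Sum>i<n. (?C v i) * (c i)^2"
 have "(\<E> z. ennreal (abs (\<Sum>i<n. y i z * (w (v (Suc i)) z - w (v i) z)) powr 2)) <= ennreal ((kap 2 * (?B v)) powr (2/2))"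
 proof (rule increments_moment[OF _ v0 v y, THEN conjunct2, THEN conjunct2])
  fix i assume "i < n"
  thus "(\<E> z. ennreal (abs (y i z) powr 2)) <= ennreal (c i powr 2)"
   using c2[of i] a2[of "c i"] by (simp add: a2 c_def)
 qed (simp_all add: c_def)
 also have "... = ennreal (kap 2) * ennreal (?B v)" proof -
  have "0 <= (?B v)" using v by (intro sum_nonneg mult_nonneg_nonneg) auto
  thus ?thesis using kap_pos[of 2] by (simp add: ennreal_mult)
 qed
 also have "ennreal (?B v) = (\<Sum>i<n. ennreal (?C v i) * ennreal ((c i)^2))" proof -
  have "(\<Sum>i<n. ennreal (?C v i) * ennreal ((c i)^2)) = (\<Sum>i<n. ennreal ((?C v i) * (c i)^2))"
   by (rule sum.cong) (auto simp: ennreal_mult'')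
  also have "... = ennreal (?B v)" by (rule sum_ennreal) (use v in auto)
  finally show ?thesis by simp
 qed
 also have "... = (\<Sum>i<n. ennreal (?C v i) * (?A i))" using c2 by (intro sum.cong) auto
 also have "... = (\<Sum>i<n. \<E> z. ennreal ((?C v i) * (y i z)^2))" proof (rule sum.cong)
  fix i assume "i : {..<n}"
  hence [measurable]: "y i : bmeas M" and "v i <= v (Suc i)" using m v by auto
  thus "ennreal (?C v i) * (?A i) = (\<E> z. ennreal ((?C v i) * (y i z)^2))"
   by (simp add: ennreal_mult nn_integral_cmult)
 qed simp
 also have "... = (\<E> z. (\<Sum>i<n. ennreal ((?C v i) * (y i z)^2)))"
 proof (rule nn_integral_sum[symmetric])
  fix i assume "i : {..<n}"
  hence [measurable]: "y i : bmeas M" using m by auto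
  show "(%z. ennreal ((?C v i) * (y i z)^2)) : bmeas M" by measurable
 qed
 finally show ?thesis by (simp add: a2)
qed

end

text \<open>A partition \<open>\<rho> 0 < ... < \<rho> N\<close> of a subset of \<open>[0, T]\<close> that contains all the points \<open>min (\<tau> k) T\<close>,
 of index \<open>\<alpha> k\<close> in \<open>\<rho>\<close>.\<close>

locale refinement =
 fixes n N :: nat and T :: real and \<tau> \<rho> :: "nat => real" and \<alpha> :: "nat => nat"
 assumes \<rho>: "!!i j. i < j ==> j <= N ==> \<rho> i < \<rho> j" and \<rho>T: "!!i. i <= N ==> \<rho> i : {0..T}"
  and \<tau>: "!!k. k < n ==> \<tau> k <= \<tau> (Suc k)"
  and \<alpha>: "!!k. k <= n ==> \<alpha> k <= N & \<rho> (\<alpha> k) = min (\<tau> k) T"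
begin

lemma \<rho>_le: "i <= j ==> j <= N ==> \<rho> i <= \<rho> j"
 using \<rho>[of i j] by (cases "i = j") auto

lemma \<rho>_le_iff: "i <= N ==> j <= N ==> \<rho> i <= \<rho> j \<longleftrightarrow> i <= j"
 using \<rho>[of j i] \<rho>_le[of i j] by fastforce

lemma \<rho>_Suc: "i < N ==> \<rho> i < \<rho> (Suc i)" using \<rho>[of i "Suc i"] by simp

text \<open>Every end point \<open>min (\<tau> k) T\<close> is a point of the refinement, so a cell
  lies inside or outside an interval of the partition as a whole. Points \<open>\<tau> k\<close>
  beyond \<open>T\<close> are harmless because all cells stay below \<open>T\<close>.\<close>

lemma cell_iff: assumes i: "i < N" and s: "\<rho> i < s" "s <= \<rho> (Suc i)" and k: "k < n"
 shows "(\<tau> k < s & s <= \<tau> (Suc k)) \<longleftrightarrow> (\<alpha> k <= i & i < \<alpha> (Suc k))"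
proof -
 have sT: "s <= T" using \<rho>T[of "Suc i"] i s by auto
 let ?A = "\<rho> (\<alpha> (Suc k))"
 have a: "\<alpha> k <= N" "\<rho> (\<alpha> k) = min (\<tau> k) T" "\<alpha> (Suc k) <= N" "?A = min (\<tau> (Suc k)) T"
  using \<alpha>[of k] \<alpha>[of "Suc k"] k by auto
 have "\<tau> k < s \<longleftrightarrow> \<alpha> k <= i" proof
  assume "\<tau> k < s"
  hence "\<rho> (\<alpha> k) < \<rho> (Suc i)" using a(2) sT s by auto
  thus "\<alpha> k <= i" using \<rho>_le[of "Suc i" "\<alpha> k"] a by (meson linorder_not_less not_less_eq_eq)
 next
  assume "\<alpha> k <= i"
  hence "\<rho> (\<alpha> k) <= \<rho> i" using i by (intro \<rho>_le) auto
  thus "\<tau> k < s" using a(2) sT s by (auto simp: min_def split: if_splits)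
 qed
 moreover have "s <= \<tau> (Suc k) \<longleftrightarrow> i < \<alpha> (Suc k)" proof
  assume "s <= \<tau> (Suc k)"
  hence "\<rho> i < ?A" using a(4) sT s by auto
  thus "i < \<alpha> (Suc k)" using \<rho>_le[of "\<alpha> (Suc k)" i] i by (meson linorder_not_less less_imp_le)
 next
  assume "i < \<alpha> (Suc k)"
  hence "\<rho> (Suc i) <= ?A" using a by (intro \<rho>_le) auto
  thus "s <= \<tau> (Suc k)" using a(4) s by auto
 qed
 ultimately show ?thesis by blast
qed

lemma process_cell: assumes "i < N" "\<rho> i < s" "s <= \<rho> (Suc i)"
 shows "elementary_process n \<tau> \<xi> s \<omega> = (\<Sum>k<n. of_bool (\<alpha> k <= i & i < \<alpha> (Suc k)) *\<^sub>R \<xi> k \<omega>)"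
 unfolding elementary_process_def
 by (rule sum.cong) (use cell_iff[OF assms] in \<open>auto simp: indicator_def\<close>)

lemma process_Suc: assumes "i < N"
 shows "elementary_process n \<tau> \<xi> (\<rho> (Suc i)) \<omega> = (\<Sum>k<n. of_bool (\<alpha> k <= i & i < \<alpha> (Suc k)) *\<^sub>R \<xi> k \<omega>)"
 by (rule process_cell[OF assms \<rho>_Suc[OF assms] order_refl])

lemma integral_refine: fixes \<xi> :: "nat => 'a => real ^ 'm ^ 'd"
 shows "elementary_integral W n \<tau> \<xi> T \<omega> = (\<Sum>i<N. elementary_process n \<tau> \<xi> (\<rho> (Suc i)) \<omega> *v (W (\<rho> (Suc i)) \<omega> - W (\<rho> i) \<omega>))"
proof -
 define D where "D i = W (\<rho> (Suc i)) \<omega> - W (\<rho> i) \<omega>" for i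
 have lin: "linear (%B. B *v x)" for x :: "real ^ 'm"
  by (intro linearI) (auto simp: matrix_vector_mult_add_rdistrib scaleR_matrix_vector_assoc)
 let ?A = "%k i. of_bool (\<alpha> k <= i & i < \<alpha> (Suc k))"
 let ?B = "%k. W (min (\<tau> (Suc k)) T) \<omega> - W (min (\<tau> k) T) \<omega>"
 have "(\<Sum>i<N. elementary_process n \<tau> \<xi> (\<rho> (Suc i)) \<omega> *v D i) = (\<Sum>i<N. \<Sum>k<n. ?A k i *\<^sub>R (\<xi> k \<omega> *v D i))"
  by (rule sum.cong) (simp_all add: process_Suc linear_sum[OF lin] linear_scale[OF lin] o_def)
 also have "... = (\<Sum>k<n. \<Sum>i<N. ?A k i *\<^sub>R (\<xi> k \<omega> *v D i))"
  by (rule sum.swap)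
 also have "... = (\<Sum>k<n. \<xi> k \<omega> *v (?B k))" proof (rule sum.cong)
  fix k assume "k : {..<n}"
  hence a: "\<alpha> k <= N" "\<rho> (\<alpha> k) = min (\<tau> k) T" "\<alpha> (Suc k) <= N" "\<rho> (\<alpha> (Suc k)) = min (\<tau> (Suc k)) T" "\<tau> k <= \<tau> (Suc k)"
   using \<alpha>[of k] \<alpha>[of "Suc k"] \<tau>[of k] by auto
  have "\<rho> (\<alpha> k) <= \<rho> (\<alpha> (Suc k))" unfolding a(2,4) using a(5) by auto
  hence le: "\<alpha> k <= \<alpha> (Suc k)" by (rule iffD1[OF \<rho>_le_iff[OF a(1,3)]])
  have "(\<Sum>i<N. ?A k i *\<^sub>R (\<xi> k \<omega> *v D i)) = (\<Sum>i\<in>{\<alpha> k..<\<alpha> (Suc k)}. \<xi> k \<omega> *v D i)"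
   by (rule sum.mono_neutral_cong_right) (use a(3) in auto)
  also have "... = \<xi> k \<omega> *v (\<Sum>i\<in>{\<alpha> k..<\<alpha> (Suc k)}. D i)"
   using linear_sum[OF matrix_vector_mul_linear, of "\<xi> k \<omega>" D "{\<alpha> k..<\<alpha> (Suc k)}"] by simp
  also have "(\<Sum>i\<in>{\<alpha> k..<\<alpha> (Suc k)}. D i) = W (\<rho> (\<alpha> (Suc k))) \<omega> - W (\<rho> (\<alpha> k)) \<omega>"
   unfolding D_def by (rule sum_Suc_diff'[OF le])
  finally show "(\<Sum>i<N. ?A k i *\<^sub>R (\<xi> k \<omega> *v D i)) = \<xi> k \<omega> *v (?B k)" unfolding a .
 qed simp
 finally show ?thesis unfolding elementary_integral_def D_def by simp
qed

end

context vector_bm begin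

lemma F_measurable_mono':
 assumes "0 <= s" "s <= t" "f : measurable (F s) N" shows "f : measurable (F t) N"
 using subalgebra_F[of s] subalgebra_F[of t] sets_F_mono[OF assms(1,2)] assms
 by (intro measurable_from_subalg[OF _ assms(3)]) (auto simp: subalgebra_def)

lemma elementary_nonneg: fixes c :: "nat => 'a => real ^ 'm ^ 'd"
 assumes e: "elementary_integrand M F n T c" and "k <= n" shows "0 <= T k"
 using \<open>k <= n\<close> proof (induction k)
 case 0 thus ?case using e by (simp add: elementary_integrand_def)
next case (Suc k)
 hence "0 <= T k" "T k <= T (Suc k)" using e by (simp_all add: elementary_integrand_def)
 thus ?case by simp
qed

lemma refinement_process: fixes c :: "nat => 'a => real ^ 'm ^ 'd"
 assumes r: "refinement n N T \<tau> \<rho> \<alpha>" and e: "elementary_integrand M F n \<tau> c" and i: "i < N"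
 shows "elementary_process n \<tau> c (\<rho> (Suc i)) : bmeas (F (\<rho> i))"
  and "EX B. ALL z:space M. norm (elementary_process n \<tau> c (\<rho> (Suc i)) z) <= B" proof -
 interpret refinement n N T \<tau> \<rho> \<alpha> by fact
 let ?A = "%k. of_bool (\<alpha> k <= i & i < \<alpha> (Suc k))"
 have eq: "elementary_process n \<tau> c (\<rho> (Suc i)) = (%z. \<Sum>k<n. ?A k *\<^sub>R c k z)"
  by (rule ext) (rule process_Suc[OF i])
 let ?B = "bmeas (F (\<rho> i))"
 show "elementary_process n \<tau> c (\<rho> (Suc i)) : ?B" unfolding eq
 proof (rule borel_measurable_sum)
  fix k assume k: "k : {..<n}"
  show "(%z. ?A k *\<^sub>R c k z) : ?B" proof (cases "\<alpha> k <= i & i < \<alpha> (Suc k)")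
   case True have kn: "k < n" using k by simp
   have 1: "\<tau> k < \<rho> (Suc i)" using cell_iff[OF i \<rho>_Suc[OF i] order_refl kn] True by blast
   have 2: "\<rho> (\<alpha> k) <= \<rho> i" by (rule \<rho>_le) (use True i in simp_all)
   have "\<rho> (Suc i) <= T" using \<rho>T[of "Suc i"] i by simp
   moreover have "\<rho> (\<alpha> k) = min (\<tau> k) T" using \<alpha>[of k] kn by simp
   ultimately have "\<tau> k <= \<rho> i" using 1 2 by linarith
   moreover have "c k : bmeas (F (\<tau> k))" using e kn unfolding elementary_integrand_def by blast
   moreover have "0 <= \<tau> k" using elementary_nonneg[OF e, of k] kn by simp
   ultimately have "c k : ?B" by (intro F_measurable_mono'[of "\<tau> k" "\<rho> i"])
   thus ?thesis by (rule borel_measurable_scaleR[OF borel_measurable_const])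
  next case False
   hence "?A k = (0::real)" by (simp only: of_bool_eq)
   thus ?thesis by (simp only: scaleR_zero_left measurable_const) simp
  qed
 qed
 have "ALL k. EX B. k < n --> (ALL z:space M. norm (c k z) <= B)" using e unfolding elementary_integrand_def by blast
 then obtain B where B: "!!k z. k < n ==> z : space M ==> norm (c k z) <= B k" unfolding choice_iff by blast
 show "EX B. ALL z:space M. norm (elementary_process n \<tau> c (\<rho> (Suc i)) z) <= B"
 proof (intro exI ballI)
  fix z assume "z : space M"
  thus "norm (elementary_process n \<tau> c (\<rho> (Suc i)) z) <= (\<Sum>k<n. abs (B k))"
   unfolding eq proof (intro sum_norm_le)
   fix k assume "k : {..<n}"
   hence "norm (c k z) <= abs (B k)" using B[of k, OF _ \<open>z : space M\<close>] by fastforce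
   thus "norm (?A k *\<^sub>R c k z) <= abs (B k)" by auto
  qed
 qed
qed

lemma common_refinement:
 assumes "elementary_integrand M F n \<tau> (c :: nat => 'a => real ^ 'm ^ 'd)" "elementary_integrand M F n' \<tau>' (c' :: nat => 'a => real ^ 'm ^ 'd)" "T >= 0"
 shows "EX N \<rho> \<alpha> \<alpha>'. refinement n N T \<tau> \<rho> \<alpha> & refinement n' N T \<tau>' \<rho> \<alpha>'"
proof -
 \<comment> \<open>The clipped points of both partitions; sorting them as a set removes repetitions,
   which makes \<open>\<rho>\<close> strictly increasing.\<close>
 define P where "P = (%k. min (\<tau> k) T) ` {..n} \<union> (%k. min (\<tau>' k) T) ` {..n'}"
 define xs where "xs = sorted_list_of_set P"
 define N where "N = length xs - 1"
 have fin: "finite P" by (simp add: P_def)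
 have ne: "P ~= {}" by (auto simp: P_def)
 have xs: "set xs = P" "sorted_wrt (<) xs" using fin by (simp_all add: xs_def)
 have len: "length xs = Suc N" using xs(1) ne by (cases xs) (auto simp: N_def)
 have sub: "P \<subseteq> {0..T}" using elementary_nonneg[OF assms(1)] elementary_nonneg[OF assms(2)] assms(3) by (auto simp: P_def)
 have idx: "EX i. i <= N & xs ! i = x" if "x : P" for x
  using that unfolding xs(1)[symmetric] in_set_conv_nth len less_Suc_eq_le by blast
 have "EX \<alpha>. ALL k. k <= n --> \<alpha> k <= N & xs ! (\<alpha> k) = min (\<tau> k) T"
  by (rule choice) (use idx in \<open>auto simp: P_def\<close>)
 moreover have "EX \<alpha>. ALL k. k <= n' --> \<alpha> k <= N & xs ! (\<alpha> k) = min (\<tau>' k) T"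
  by (rule choice) (use idx in \<open>auto simp: P_def\<close>)
 ultimately obtain \<alpha> \<alpha>' where "ALL k. k <= n --> \<alpha> k <= N & xs ! (\<alpha> k) = min (\<tau> k) T"
  "ALL k. k <= n' --> \<alpha>' k <= N & xs ! (\<alpha>' k) = min (\<tau>' k) T" by blast
 moreover have "xs ! i < xs ! j" if "i < j" "j <= N" for i j
  using sorted_wrt_nth_less[OF xs(2) that(1)] that(2) len by simp
 moreover have "xs ! i : {0..T}" if "i <= N" for i using sub nth_mem[of i xs] that len xs(1) by auto
 ultimately have "refinement n N T \<tau> ((!) xs) \<alpha>" "refinement n' N T \<tau>' ((!) xs) \<alpha>'"
  using assms(1,2) by (auto simp: refinement_def elementary_integrand_def)
 thus ?thesis by blast
qed

text \<open>One direction of the Ito isometry, with a constant. On a common refinement both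
  integrals are sums over the same increments, and each row paired with a component of
  \<open>W\<close> is a scalar problem; \<open>CARD('m)\<close> comes from Cauchy-Schwarz over the
  components.\<close>

lemma elementary_integral_diff_moment: fixes c c' :: "nat => 'a => real ^ 'm ^ 'd"
 assumes e: "elementary_integrand M F n \<tau> c" and e': "elementary_integrand M F n' \<tau>' c'" and T: "T >= 0"
 shows "(\<E> z. ennreal ((norm (elementary_integral W n \<tau> c T z - elementary_integral W n' \<tau>' c' T z))^2)) <= ennreal (real CARD('m) * kap 2) * (\<E> z. (\<integral>\<^sup>+s\<in>{0..T}. ennreal ((norm (elementary_process n \<tau> c s z - elementary_process n' \<tau>' c' s z))^2) \<partial>lborel))"
proof -
 obtain N \<rho> \<alpha> \<alpha>' where r: "refinement n N T \<tau> \<rho> \<alpha>" and r': "refinement n' N T \<tau>' \<rho> \<alpha>'"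
  using common_refinement[OF assms] by blast
 interpret r: refinement n N T \<tau> \<rho> \<alpha> by fact
 interpret r': refinement n' N T \<tau>' \<rho> \<alpha>' by fact
 define E where "E s z = elementary_process n \<tau> c s z - elementary_process n' \<tau>' c' s z" for s z
 define Z where "Z i = E (\<rho> (Suc i))" for i
 define y where "y i = \<rho> (Suc i) - \<rho> i" for i
 have \<rho>Suc: "\<rho> i < \<rho> (Suc i)" if "i < N" for i using r.\<rho>[of i "Suc i"] that by simp
 have \<rho>nn: "0 <= \<rho> i" if "i <= N" for i using r.\<rho>T[OF that] by simp
 have Zm: "Z i : bmeas (F (\<rho> i))" if "i < N" for i
  unfolding Z_def E_def using refinement_process(1)[OF r e that] refinement_process(1)[OF r' e' that] by measurable
 have Zb: "EX B. ALL z:space M. norm (Z i z) <= B" if i: "i < N" for i proof -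
  obtain B B' where "ALL z:space M. norm (elementary_process n \<tau> c (\<rho> (Suc i)) z) <= B"
   "ALL z:space M. norm (elementary_process n' \<tau>' c' (\<rho> (Suc i)) z) <= B'"
   using refinement_process(2)[OF r e i] refinement_process(2)[OF r' e' i] by blast
  hence "ALL z:space M. norm (Z i z) <= B + B'"
   unfolding Z_def E_def by (meson add_mono norm_triangle_ineq4 order_trans)
  thus ?thesis by blast
 qed
 have ZmM: "(%z. Z i z $ q $ k) : bmeas M" if "i < N" for i q k
  using measurable_from_subalg[OF subalgebra_F[OF \<rho>nn] Zm[OF that]] that unfolding borel_measurable_mat_iff[of "Z i"] by auto
 define S where "S q k z = (\<Sum>i<N. Z i z $ q $ k * (wc k (\<rho> (Suc i)) z - wc k (\<rho> i) z))" for q k z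
 have Sm: "S q k : bmeas M" for q k unfolding S_def[abs_def] using ZmM \<rho>nn
  by (intro borel_measurable_sum borel_measurable_times borel_measurable_diff wc_measurable) auto
 let ?D = "%q k. \<E> z. (\<Sum>i<N. ennreal (y i * (Z i z $ q $ k)^2))"
 let ?E = "%q k z. ennreal ((S q k z)^2)"
 have S2: "(\<E> z. ?E q k z) <= ennreal (kap 2) * (?D q k)" for q k proof -
  interpret scalar_bm M F "wc k" by (rule scalar_wc)
  show ?thesis unfolding S_def y_def proof (rule increments_second_moment[OF \<rho>nn])
   fix i assume i: "i < N"
   show "\<rho> i <= \<rho> (Suc i)" using \<rho>Suc[OF i] by simp
   show "(%z. Z i z $ q $ k) : bmeas (F (\<rho> i))"
    using Zm[OF i] unfolding borel_measurable_mat_iff[of "Z i"] by blast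
   show "EX B. ALL z:space M. abs (Z i z $ q $ k) <= B" using Zb[OF i] abs_entry_le_norm by (meson order_trans)
  qed simp
 qed
 have "AE z in M. elementary_integral W n \<tau> c T z - elementary_integral W n' \<tau>' c' T z = (\<chi> q. \<Sum>k\<in>UNIV. S q k z)"
  using wc_AE proof eventually_elim
  fix z assume w: "ALL k t. wc k t z = W t z $ k"
  let ?B = "elementary_integral W n \<tau> c T z - elementary_integral W n' \<tau>' c' T z"
  have "?B = (\<Sum>i<N. Z i z *v (W (\<rho> (Suc i)) z - W (\<rho> i) z))"
   unfolding r.integral_refine r'.integral_refine sum_subtractf[symmetric] Z_def E_def matrix_vector_mult_diff_rdistrib ..
  also have "... = (\<chi> q. \<Sum>k\<in>UNIV. S q k z)"
   unfolding vec_eq_iff sum_component matrix_vector_mult_def S_def by (subst sum.swap) (simp add: w)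
  finally show "?B = (\<chi> q. \<Sum>k\<in>UNIV. S q k z)" .
 qed
 hence "(\<E> z. ennreal ((norm (elementary_integral W n \<tau> c T z - elementary_integral W n' \<tau>' c' T z))^2)) = (\<E> z. ennreal (\<Sum>q\<in>UNIV. (\<Sum>k\<in>UNIV. S q k z)^2))"
  by (intro nn_integral_cong_AE, rule eventually_mono) (auto simp only: norm_vec_square vec_lambda_beta)
 also have "... <= (\<E> z. (\<Sum>q\<in>UNIV. \<Sum>k\<in>UNIV. ennreal (real CARD('m)) * ?E q k z))"
 proof (rule nn_integral_mono)
  fix z
  have "(\<Sum>q\<in>UNIV. (\<Sum>k\<in>UNIV. S q k z)^2) <= (\<Sum>q\<in>UNIV. \<Sum>k\<in>UNIV. real CARD('m) * (S q k z)^2)"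
   by (rule sum_mono) (subst sum_distrib_left[symmetric], rule square_sum_le)
  thus "ennreal (\<Sum>q\<in>UNIV. (\<Sum>k\<in>UNIV. S q k z)^2) <= (\<Sum>q\<in>UNIV. \<Sum>k\<in>UNIV. ennreal (real CARD('m)) * ?E q k z)"
   by (simp add: ennreal_mult[symmetric] sum_ennreal sum_nonneg ennreal_leI)
 qed
 also have "... = (\<Sum>q\<in>UNIV. \<Sum>k\<in>UNIV. ennreal (real CARD('m)) * (\<E> z. ?E q k z))"
 proof -
  have m: "(%z. ?E q k z) : bmeas M" for q k using Sm[of q k] by measurable
  hence m': "(%z. ennreal (real CARD('m)) * ?E q k z) : bmeas M" for q k by measurable
  show ?thesis by (simp only: nn_integral_sum borel_measurable_sum m m' nn_integral_cmult)
 qed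
 also have "... <= (\<Sum>q\<in>UNIV. \<Sum>k\<in>UNIV. ennreal (real CARD('m)) * (ennreal (kap 2) * (?D q k)))"
  by (intro sum_mono mult_left_mono S2) simp
 also have "... = ennreal (real CARD('m) * kap 2) * (\<E> z. (\<Sum>q\<in>UNIV. \<Sum>k\<in>UNIV. \<Sum>i<N. ennreal (y i * (Z i z $ q $ k)^2)))"
 proof -
  have m: "(%z. \<Sum>i<N. ennreal (y i * (Z i z $ q $ k)^2)) : bmeas M" for q k
  proof (rule borel_measurable_sum)
   fix i assume "i : {..<N}"
   hence [measurable]: "(%z. Z i z $ q $ k) : bmeas M" using ZmM by auto
   show "(%z. ennreal (y i * (Z i z $ q $ k)^2)) : bmeas M" by measurable
  qed
  have "(\<E> z. (\<Sum>q\<in>UNIV. \<Sum>k\<in>UNIV. \<Sum>i<N. ennreal (y i * (Z i z $ q $ k)^2))) = (\<Sum>q\<in>UNIV. \<Sum>k\<in>UNIV. \<E> z. (\<Sum>i<N. ennreal (y i * (Z i z $ q $ k)^2)))"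
   using m by (simp only: nn_integral_sum borel_measurable_sum)
  moreover have "ennreal (real CARD('m) * kap 2) = ennreal (real CARD('m)) * ennreal (kap 2)"
   by (rule ennreal_mult') simp
  ultimately show ?thesis by (simp only: sum_distrib_left mult.assoc)
 qed
 also have "... <= ennreal (real CARD('m) * kap 2) * (\<E> z. (\<integral>\<^sup>+s\<in>{0..T}. ennreal ((norm (E s z))^2) \<partial>lborel))"
 proof (intro mult_left_mono nn_integral_mono)
  fix z
  let ?A = "%i. ennreal (y i * (norm (Z i z))^2)"
  have "(\<Sum>q\<in>UNIV. \<Sum>k\<in>UNIV. \<Sum>i<N. ennreal (y i * (Z i z $ q $ k)^2)) = (\<Sum>i<N. ?A i)"
  proof -
   have "(\<Sum>q\<in>UNIV. \<Sum>k\<in>UNIV. \<Sum>i<N. ennreal (y i * (Z i z $ q $ k)^2)) = (\<Sum>i<N. \<Sum>q\<in>UNIV. \<Sum>k\<in>UNIV. ennreal (y i * (Z i z $ q $ k)^2))"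
    by (subst sum.swap[where B = UNIV and A = "{..<N}"], rule sum.cong[OF refl], rule sum.swap)
   also have "... = (\<Sum>i<N. ?A i)" proof (rule sum.cong)
    fix i assume "i : {..<N}"
    hence "0 <= y i" using \<rho>Suc[of i] by (simp add: y_def)
    thus "(\<Sum>q\<in>UNIV. \<Sum>k\<in>UNIV. ennreal (y i * (Z i z $ q $ k)^2)) = ?A i"
     by (simp add: norm_mat_square sum_distrib_left sum_ennreal sum_nonneg)
   qed simp
   finally show ?thesis .
  qed
  also have "... = (\<Sum>i<N. \<L> s. ennreal ((norm (Z i z))^2) * indicator {\<rho> i<..\<rho> (Suc i)} s)"
  proof (rule sum.cong)
   fix i assume "i : {..<N}"
   hence "\<rho> i <= \<rho> (Suc i)" using \<rho>Suc[of i] by simp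
   thus "?A i = (\<L> s. ennreal ((norm (Z i z))^2) * indicator {\<rho> i<..\<rho> (Suc i)} s)"
    by (subst nn_integral_cmult_indicator, simp) (simp add: y_def ennreal_mult'' mult.commute)
  qed simp
  also have "... = (\<L> s. (\<Sum>i<N. ennreal ((norm (Z i z))^2) * indicator {\<rho> i<..\<rho> (Suc i)} s))"
   by (rule nn_integral_sum[symmetric]) measurable
  also have "... <= (\<integral>\<^sup>+s\<in>{0..T}. ennreal ((norm (E s z))^2) \<partial>lborel)"
  proof (rule nn_integral_mono)
   fix s
   show "(\<Sum>i<N. ennreal ((norm (Z i z))^2) * indicator {\<rho> i<..\<rho> (Suc i)} s) <= ennreal ((norm (E s z))^2) * indicator {0..T} s"
   proof (cases "EX i<N. s : {\<rho> i<..\<rho> (Suc i)}")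
    case True
    then obtain i where i: "i < N" "\<rho> i < s" "s <= \<rho> (Suc i)" by auto
    have un: "l = i" if "l < N" "\<rho> l < s" "s <= \<rho> (Suc l)" for l proof (rule ccontr)
     assume "l ~= i"
     hence "Suc l <= i | Suc i <= l" by linarith
     thus False using r.\<rho>_le[of "Suc l" i] r.\<rho>_le[of "Suc i" l] i that by auto
    qed
    let ?C = "%l. ennreal ((norm (Z l z))^2)"
    have "(\<Sum>l<N. ?C l * indicator {\<rho> l<..\<rho> (Suc l)} s) = (\<Sum>l\<in>{i}. ?C l * indicator {\<rho> l<..\<rho> (Suc l)} s)"
    proof (rule sum.mono_neutral_right)
     show "ALL l:{..<N} - {i}. ?C l * indicator {\<rho> l<..\<rho> (Suc l)} s = 0" proof
      fix l assume "l : {..<N} - {i}"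
      hence "s \<notin> {\<rho> l<..\<rho> (Suc l)}" using un[of l] by auto
      thus "?C l * indicator {\<rho> l<..\<rho> (Suc l)} s = 0" by simp
     qed
    qed (use i in auto)
    moreover have "Z i z = E s z"
     unfolding Z_def E_def r.process_cell[OF i] r'.process_cell[OF i] r.process_Suc[OF i(1)] r'.process_Suc[OF i(1)] ..
    moreover have "s : {0..T}" using i r.\<rho>T[of i] r.\<rho>T[of "Suc i"] by auto
    ultimately show ?thesis using i by simp
   next case False
    hence "(\<Sum>i<N. ennreal ((norm (Z i z))^2) * indicator {\<rho> i<..\<rho> (Suc i)} s) = 0"
     by (intro sum.neutral) (auto simp: indicator_def)
    thus ?thesis by simp
   qed
  qed
  finally show "(\<Sum>q\<in>UNIV. \<Sum>k\<in>UNIV. \<Sum>i<N. ennreal (y i * (Z i z $ q $ k)^2)) <= (\<integral>\<^sup>+s\<in>{0..T}. ennreal ((norm (E s z))^2) \<partial>lborel)" .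
 qed simp
 finally show ?thesis unfolding E_def .
qed

lemma elementary_integral_measurable: fixes c :: "nat => 'a => real ^ 'm ^ 'd"
 assumes e: "elementary_integrand M F n v c" and T: "T >= 0"
 shows "elementary_integral W n v c T : bmeas M" proof -
 have c: "(%z. c k z $ i $ j) : bmeas M" if "k < n" for k i j proof -
  have "c k : bmeas (F (v k))" using e that unfolding elementary_integrand_def by blast
  from measurable_from_subalg[OF subalgebra_F[OF elementary_nonneg[OF e]] this] that
  show ?thesis unfolding borel_measurable_mat_iff[of "c k"] by simp
 qed
 have W: "(%z. W (min (v k) T) z $ j) : bmeas M" if "k <= n" for k j
  by (rule W_measurable) (use elementary_nonneg[OF e that] T in simp)
 show ?thesis
  unfolding borel_measurable_vec_iff[of "elementary_integral W n v c T"] elementary_integral_def sum_component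
   matrix_vector_mult_def vec_lambda_beta vector_minus_component
  using c W by (intro allI borel_measurable_sum borel_measurable_times borel_measurable_diff) auto
qed

lemma elementary_process_joint:
 fixes c :: "nat => 'a => real ^ 'm ^ 'd" assumes e: "elementary_integrand M F n T c"
 shows "(%z. elementary_process n T c (fst z) (snd z)) : bmeas (lborel \<Otimes> M)"
 unfolding elementary_process_def proof (rule borel_measurable_sum)
 fix k assume "k : {..<n}"
 hence k: "k < n" by simp
 hence "c k : bmeas (F (T k))" using e unfolding elementary_integrand_def by blast
 from measurable_from_subalg[OF subalgebra_F[OF elementary_nonneg[OF e]] this] k
 have "c k : bmeas M" by simp
 from measurable_compose[OF measurable_snd this]
 have [measurable]: "(%z. c k (snd z)) : bmeas (lborel \<Otimes> M)" .
 show "(%z. indicator {T k<..T (Suc k)} (fst z) *\<^sub>R c k (snd z)) : bmeas ((lborel :: real measure) \<Otimes> M)"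
  by measurable
qed

lemma previsible_joint': fixes H :: "real => 'a => real ^ 'm ^ 'd"
 assumes "previsible M F (%s y. indicator {0..T} s *\<^sub>R H s y)"
 shows "(%z. indicator {0..T} (fst z) *\<^sub>R H (fst z) (snd z)) : bmeas (lborel \<Otimes> M)"
proof -
 \<comment> \<open>Any component will do: its Brownian motion only gives access to facts about the
   filtration.\<close>
 fix k :: 'm
 interpret scalar_bm M F "wc k" by (rule scalar_wc)
 let ?A = "%(s, y). indicator {0..} s *\<^sub>R (indicator {0..T} s *\<^sub>R H s y)"
 have "?A : bmeas (lborel \<Otimes> M)"
  by (rule previsible_joint) (use assms in \<open>simp add: previsible_def\<close>)
 also have "?A = (%z :: real \<times> 'a. indicator {0..T} (fst z) *\<^sub>R H (fst z) (snd z))"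
  by (rule ext) (auto simp: indicator_def)
 finally show ?thesis .
qed

lemma elementary_process_diff_le: fixes c c' H :: "_ => 'a => real ^ 'm ^ 'd"
 assumes e: "elementary_integrand M F n v c" and e': "elementary_integrand M F n' v' c'"
  and H: "previsible M F (%s y. indicator {0..T} s *\<^sub>R H s y)"
 shows "(\<E> y. (\<integral>\<^sup>+s\<in>{0..T}. ennreal ((norm (elementary_process n v c s y - elementary_process n' v' c' s y))^2) \<partial>lborel)) <=
  2 * (\<E> y. (\<integral>\<^sup>+s\<in>{0..T}. ennreal ((norm (elementary_process n v c s y - H s y))^2) \<partial>lborel)) +
  2 * (\<E> y. (\<integral>\<^sup>+s\<in>{0..T}. ennreal ((norm (elementary_process n' v' c' s y - H s y))^2) \<partial>lborel))"
proof -
 define A where "A z = indicator {0..T} (fst z) *\<^sub>R elementary_process n v c (fst z) (snd z)" for z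
 define A' where "A' z = indicator {0..T} (fst z) *\<^sub>R elementary_process n' v' c' (fst z) (snd z)" for z
 define G where "G z = indicator {0..T} (fst z) *\<^sub>R H (fst z) (snd z)" for z
 have ad: "A = (%z. indicator {0..T} (fst z) *\<^sub>R elementary_process n v c (fst z) (snd z))"
  and ad': "A' = (%z. indicator {0..T} (fst z) *\<^sub>R elementary_process n' v' c' (fst z) (snd z))"
  and gd: "G = (%z. indicator {0..T} (fst z) *\<^sub>R H (fst z) (snd z))"
  by (rule ext, simp add: A_def A'_def G_def)+
 have ind: "(%z. indicator {0..T} (fst z) :: real) : bmeas ((lborel :: real measure) \<Otimes> M)" by measurable
 have m[measurable]: "A : bmeas (lborel \<Otimes> M)" "A' : bmeas (lborel \<Otimes> M)" "G : bmeas (lborel \<Otimes> M)"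
  unfolding A_def[abs_def] A'_def[abs_def] G_def[abs_def]
  by (rule borel_measurable_scaleR[OF ind elementary_process_joint[OF e]]
    borel_measurable_scaleR[OF ind elementary_process_joint[OF e']] previsible_joint'[OF H])+
 have eq: "(\<E> y. (\<integral>\<^sup>+s\<in>{0..T}. ennreal ((norm (f s y - g s y))^2) \<partial>lborel)) = (\<integral>\<^sup>+z. ennreal ((norm (B z - C z))^2) \<partial>(lborel \<Otimes> M))"
  if B: "B = (%z. indicator {0..T} (fst z) *\<^sub>R f (fst z) (snd z))" and C: "C = (%z. indicator {0..T} (fst z) *\<^sub>R g (fst z) (snd z))"
   and [measurable]: "B : bmeas (lborel \<Otimes> M)" "C : bmeas (lborel \<Otimes> M)"
  for f g :: "real => 'a => real ^ 'm ^ 'd" and B C proof -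
  interpret pair_sigma_finite "lborel :: real measure" M ..
  have "(\<E> y. (\<integral>\<^sup>+s\<in>{0..T}. ennreal ((norm (f s y - g s y))^2) \<partial>lborel)) = (\<E> y. (\<L> s. ennreal ((norm (B (s, y) - C (s, y)))^2)))"
   by (intro nn_integral_cong) (auto simp: B C indicator_def)
  also have "... = (\<integral>\<^sup>+z. ennreal ((norm (B z - C z))^2) \<partial>(lborel \<Otimes> M))"
   by (rule nn_integral_snd) measurable
  finally show ?thesis .
 qed
 have "(\<integral>\<^sup>+z. ennreal ((norm ((A z - G z) + (G z - A' z)))^2) \<partial>(lborel \<Otimes> M)) <=
   2 * (\<integral>\<^sup>+z. ennreal ((norm (A z - G z))^2) \<partial>(lborel \<Otimes> M)) + 2 * (\<integral>\<^sup>+z. ennreal ((norm (G z - A' z))^2) \<partial>(lborel \<Otimes> M))"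
  by (rule nn_integral_square_add_le) measurable
 hence "(\<integral>\<^sup>+z. ennreal ((norm (A z - A' z))^2) \<partial>(lborel \<Otimes> M)) <=
   2 * (\<integral>\<^sup>+z. ennreal ((norm (A z - G z))^2) \<partial>(lborel \<Otimes> M)) + 2 * (\<integral>\<^sup>+z. ennreal ((norm (A' z - G z))^2) \<partial>(lborel \<Otimes> M))"
  unfolding norm_minus_commute[of "G _" "A' _"] by (simp only: diff_add_cancel add_diff_eq)
 thus ?thesis
  unfolding eq[of A "elementary_process n v c" A' "elementary_process n' v' c'", OF ad ad' m(1,2)]
   eq[of A "elementary_process n v c" G H, OF ad gd m(1,3)]
   eq[of A' "elementary_process n' v' c'" G H, OF ad' gd m(2,3)] .
qed

text \<open>Two approximating sequences of one integrand approach each other, hence so do their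
  integrals by \<open>elementary_integral_diff_moment\<close>. The comparison of \<open>X\<close>
  with \<open>Y\<close> passes through \<open>I\<close> and \<open>J\<close>, and its bound
  \<open>b\<close> tends to 0.\<close>

lemma has_ito_integral_unique: fixes H :: "real => 'a => real ^ 'm ^ 'd"
 assumes X: "has_ito_integral M F W H T X" and Y: "has_ito_integral M F W H T Y" and T: "T >= 0"
 shows "AE z in M. X z = Y z" proof -
 have Xm[measurable]: "X : bmeas M" and Ym[measurable]: "Y : bmeas M"
  and H: "previsible M F (%s z. indicator {0..T} s *\<^sub>R H s z)"
  using X Y unfolding has_ito_integral_def by blast+
 define e where "e n v c = (\<E> z. (\<integral>\<^sup>+s\<in>{0..T}. ennreal ((norm (elementary_process n v c s z - H s z))^2) \<partial>lborel))" for n v and c :: "nat => 'a => real ^ 'm ^ 'd"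
 define d where "d n v c Z = (\<E> z. ennreal ((norm (elementary_integral W n v c T z - Z z))^2))" for n v and c :: "nat => 'a => real ^ 'm ^ 'd" and Z
 obtain n v c where ei: "!!j. elementary_integrand M F (n j) (v j) (c j)" "(%j. e (n j) (v j) (c j)) \<leadsto> 0" "(%j. d (n j) (v j) (c j) X) \<leadsto> 0"
  using X unfolding has_ito_integral_def e_def d_def by blast
 obtain n' v' c' where ei': "!!j. elementary_integrand M F (n' j) (v' j) (c' j)" "(%j. e (n' j) (v' j) (c' j)) \<leadsto> 0" "(%j. d (n' j) (v' j) (c' j) Y) \<leadsto> 0"
  using Y unfolding has_ito_integral_def e_def d_def by blast
 define C where "C = ennreal (real CARD('m) * kap 2)"
 let ?A = "%j. 2 * e (n j) (v j) (c j) + 2 * e (n' j) (v' j) (c' j)"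
 define b where "b j = 2 * d (n j) (v j) (c j) X + 2 * (2 * (C * (?A j)) + 2 * d (n' j) (v' j) (c' j) Y)" for j
 let ?B = "\<E> z. ennreal ((norm (X z - Y z))^2)"
 have le: "?B <= b j" for j proof -
  define I where "I = elementary_integral W (n j) (v j) (c j) T"
  define J where "J = elementary_integral W (n' j) (v' j) (c' j) T"
  have [measurable]: "I : bmeas M" "J : bmeas M"
   unfolding I_def J_def by (rule elementary_integral_measurable[OF ei(1) T] elementary_integral_measurable[OF ei'(1) T])+
  let ?D = "\<E> z. ennreal ((norm (X z - I z))^2)"
  have 1: "?D = d (n j) (v j) (c j) X" unfolding d_def I_def by (simp only: norm_minus_commute)
  let ?E = "\<E> z. ennreal ((norm (J z - Y z))^2)"
  have 2: "?E = d (n' j) (v' j) (c' j) Y" unfolding d_def J_def ..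
  let ?C = "\<E> z. ennreal ((norm (I z - J z))^2)"
  have "?C <= C * (\<E> z. (\<integral>\<^sup>+s\<in>{0..T}. ennreal ((norm (elementary_process (n j) (v j) (c j) s z - elementary_process (n' j) (v' j) (c' j) s z))^2) \<partial>lborel))"
   unfolding I_def J_def C_def by (rule elementary_integral_diff_moment[OF ei(1) ei'(1) T])
  also have "... <= C * (?A j)"
   unfolding e_def by (rule mult_left_mono[OF elementary_process_diff_le[OF ei(1) ei'(1) H]]) simp
  finally have 3: "?C <= C * (?A j)" .
  let ?G = "\<E> z. ennreal ((norm (I z - Y z))^2)"
  have "(\<E> z. ennreal ((norm ((I z - J z) + (J z - Y z)))^2)) <= 2 * ?C + 2 * ?E"
   by (rule nn_integral_square_add_le) measurable
  also have "... <= 2 * (C * (?A j)) + 2 * d (n' j) (v' j) (c' j) Y"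
   unfolding 2 by (rule add_mono[OF mult_left_mono[OF 3] order_refl]) simp
  finally have 4: "?G <= 2 * (C * (?A j)) + 2 * d (n' j) (v' j) (c' j) Y"
   by (simp only: diff_add_cancel add_diff_eq)
  have "(\<E> z. ennreal ((norm ((X z - I z) + (I z - Y z)))^2)) <= 2 * ?D + 2 * ?G"
   by (rule nn_integral_square_add_le) measurable
  also have "... <= b j" unfolding 1 b_def by (rule add_mono[OF order_refl mult_left_mono[OF 4]]) simp
  finally show ?thesis by (simp only: diff_add_cancel add_diff_eq)
 qed
 have "b \<leadsto> 2 * 0 + 2 * (2 * (C * (2 * 0 + 2 * 0)) + 2 * 0)" unfolding b_def[abs_def]
  by (intro tendsto_add ennreal_tendsto_cmult ei(2,3) ei'(2,3)) (simp_all add: C_def)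
 hence "b \<leadsto> 0" by simp
 hence "?B <= 0" by (rule LIMSEQ_le_const) (use le in auto)
 hence "?B = 0" by simp
 hence "AE z in M. ennreal ((norm (X z - Y z))^2) = 0" by (subst (asm) nn_integral_0_iff_AE) measurable
 thus ?thesis by eventually_elim simp
qed

text \<open>Equality holds almost surely at all of the countably many dyadic times, and continuity
  extends it to every time.\<close>

lemma convolution_indistinguishable: fixes K :: "real => real ^ 'd ^ 'd"
 assumes X: "continuous_stoch_convolution M F W K y X" and Y: "continuous_stoch_convolution M F W K y Y"
 shows "AE z in M. ALL t>=0. X t z = Y t z" proof -
 have "AE z in M. X t z = Y t z" if "t >= 0" for t
  using X Y that unfolding continuous_stoch_convolution_def by (intro has_ito_integral_unique) auto
 hence "AE z in M. ALL l i. X (dy l i) z = Y (dy l i) z" unfolding AE_all_countable by simp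
 moreover have "AE z in M. continuous_on {0..} (%t. X t z)" "AE z in M. continuous_on {0..} (%t. Y t z)"
  using X Y unfolding continuous_stoch_convolution_def by auto
 ultimately show ?thesis proof eventually_elim
  fix z assume eq: "ALL l i. X (dy l i) z = Y (dy l i) z"
   and c: "continuous_on {0..} (%t. X t z)" "continuous_on {0..} (%t. Y t z)"
  show "ALL t>=0. X t z = Y t z" proof (intro allI impI)
   fix t :: real assume t: "t >= 0"
   have lim: "(%l. Z (dy l (nat \<lfloor>t * 2 ^ l\<rfloor>)) z) \<leadsto> Z t z" if "continuous_on {0..} (%t. Z t z)" for Z :: "real => 'a => real ^ 'd"
    by (rule continuous_on_tendsto_compose[OF that dy_floor_tendsto[OF t]]) (use t in auto)
   show "X t z = Y t z" using lim[of X, OF c(1)] lim[of Y, OF c(2)] LIMSEQ_unique unfolding eq[rule_format] by blast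
  qed
 qed
qed

end

context scalar_bm begin

text \<open>The form that an \<open>elementary_process\<close> on the grid has, which links the two
  notions of simple integrand.\<close>

lemma dyadic_expand: assumes "dyadic L h"
 shows "h s z = (\<Sum>q<L * 2 ^ L. indicator {dy L q<..dy L (Suc q)} s * h (dy L (Suc q)) z)"
proof (cases "EX q<L * 2 ^ L. dy L q < s & s <= dy L (Suc q)")
 case True
 then obtain q where q: "q < L * 2 ^ L" "dy L q < s" "s <= dy L (Suc q)" by blast
 have "(\<Sum>q<L * 2 ^ L. indicator {dy L q<..dy L (Suc q)} s * h (dy L (Suc q)) z) = (\<Sum>q\<in>{q}. indicator {dy L q<..dy L (Suc q)} s * h (dy L (Suc q)) z)"
 proof (rule sum.mono_neutral_right)
  show "ALL r:{..<L * 2 ^ L} - {q}. indicator {dy L r<..dy L (Suc r)} s * h (dy L (Suc r)) z = 0"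
  proof
   fix r assume "r : {..<L * 2 ^ L} - {q}"
   hence "~ (dy L r < s & s <= dy L (Suc r))" using dy_unique[OF q(2,3), of r] by blast
   thus "indicator {dy L r<..dy L (Suc r)} s * h (dy L (Suc r)) z = 0" by simp
  qed
 qed (use q in auto)
 also have "... = h (dy L (Suc q)) z" using q by simp
 also have "... = h s z" by (rule dyadicD(3)[OF assms q(2,3), symmetric])
 finally show ?thesis ..
next case False
 have "s <= 0 | s > real L" proof (rule ccontr)
  assume "~ (s <= 0 | s > real L)"
  hence s: "s > 0" "s <= real L" by auto
  obtain q where q: "dy L q < s" "s <= dy L (Suc q)" by (rule dy_ex[OF s(1)])
  have "dy L q < dy L (L * 2 ^ L)" using q(1) s(2) by simp
  hence "q < L * 2 ^ L" by (simp only: dy_less_iff)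
  thus False using q False by blast
 qed
 hence "h s z = 0" by (rule dyadicD(4)[OF assms])
 moreover have "(\<Sum>q<L * 2 ^ L. indicator {dy L q<..dy L (Suc q)} s * h (dy L (Suc q)) z) = 0"
  by (rule sum.neutral) (use False in auto)
 ultimately show ?thesis by simp
qed

text \<open>The times after \<open>a\<close> are a countable union of rectangles of the generator.
  Hence every Borel function of time is previsible, in particular a kernel.\<close>

lemma psp_fst: "(%z. fst z) : bmeas psp" unfolding borel_measurable_iff_greater proof
 fix a :: real
 let ?A = "{z : space psp. a < fst z}"
 show "?A : sets psp" proof (cases "a < 0")
  case True hence "?A = space psp" by (auto simp: space_psp)
  thus ?thesis by (simp only: sets.top)
 next case False
  have "{a<..a + real n} \<times> space M : sets psp" for n unfolding sets_psp
  proof (rule sigma_sets.Basic)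
   have "space M : sets (F a)" using sets.top[of "F a"] space_F[of a] False by simp
   thus "{a<..a + real n} \<times> space M : previsible_gen M F" using False unfolding previsible_gen_def by force
  qed
  hence "(\<Union>n. {a<..a + real n} \<times> space M) : sets psp" by blast
  also have "(\<Union>n. {a<..a + real n} \<times> space M) = ?A" proof (rule set_eqI)
   fix z :: "real \<times> 'a"
   have "EX n. fst z <= a + real n" using real_arch_simple[of "fst z - a"] by (auto simp: algebra_simps)
   thus "z : (\<Union>n. {a<..a + real n} \<times> space M) \<longleftrightarrow> z : ?A"
    using False by (cases z) (auto simp: space_psp)
  qed
  finally show ?thesis .
 qed
qed

lemma psp_time: "g : bmeas borel ==> (%(s, z). g s) : bmeas psp"
 using measurable_compose[OF psp_fst] by (simp add: case_prod_beta')

end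

section \<open>Assembling the convolution from its entries\<close>

locale convolution = vector_bm M F W for M :: "'a measure" and F and W :: "real => 'a => real ^ 'm" +
 fixes \<phi> :: "real => 'a => real ^ 'm ^ 'd" and K :: "real => real ^ 'd ^ 'd" and \<mu> :: "'d => 'd => real measure" and p :: real
 assumes p: "p > 2" and prev: "previsible M F \<phi>"
  and fin: "(\<integral>\<^sup>+ s\<in>{0..}. (\<integral>\<^sup>+ \<omega>. ennreal (norm (\<phi> s \<omega>) powr p) \<partial>M) \<partial>lborel) < \<infinity>"
  and cm: "completely_monotone_with K \<mu>" and Mfin: "M_const p \<mu> < \<infinity>"
begin

text \<open>With time 0 removed the process vanishes for all \<open>s <= 0\<close>, as a dyadic one
  does, and is jointly measurable on the whole line.\<close>

definition f :: "'d => 'm => real => 'a => real" where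
 "f j k s z = indicator {0<..} s * \<phi> s z $ j $ k"

definition Am :: "'d => 'd => real" where "Am i j = enn2real (M_entry p \<mu> i j)"

definition Bm :: "'d => 'm => real" where
 "Bm j k = enn2real (scalar_bm.lpn M p (f j k)) powr (1 / p)"

lemma Am_nonneg: "Am i j >= 0" and Bm_nonneg: "Bm j k >= 0" by (simp_all add: Am_def Bm_def)

lemma M_entry_eq: "M_entry p \<mu> i j = ennreal (Am i j)" proof -
 have "M_entry p \<mu> i j ~= \<infinity>" using Mfin unfolding M_const_def by (auto split: if_splits)
 thus ?thesis by (simp add: Am_def less_top)
qed

text \<open>The slack \<open>e\<close> makes the bound positive even when an entry of the measure
  vanishes.\<close>

lemma kernel: "e > 0 ==> kernel_conv M F (wc k) (\<mu> i j) (%t. K t $ i $ j) p (Am i j + e)"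
proof -
 assume e: "e > 0"
 interpret scalar_bm M F "wc k" by (rule scalar_wc)
 show ?thesis proof
  show "sets (\<mu> i j) = sets (restrict_space borel {0..})"
   and "t > 0 ==> has_bochner_integral (\<mu> i j) (%x. exp (- x * t)) (K t $ i $ j)" for t
   using cm unfolding completely_monotone_with_def by blast+
  show "p > 2" by (rule p)
  show "Am i j + e > 0" using Am_nonneg[of i j] e by simp
  have "(2 - p) / (2 * p) = - (1/2 - 1/p)" using p by (simp add: field_simps)
  hence "(\<integral>\<^sup>+x. epowr x (- (1/2 - 1/p)) \<partial>\<mu> i j) = ennreal (Am i j)" using M_entry_eq[of i j] by (simp add: M_entry_def)
  also have "... <= ennreal (Am i j + e)" using e by (intro ennreal_leI) simp
  finally show "(\<integral>\<^sup>+x. epowr x (- (1/2 - 1/p)) \<partial>\<mu> i j) <= ennreal (Am i j + e)" .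
 qed
qed

lemma \<phi>_entry: "(%(s, z). \<phi> s z $ j $ k) : bmeas (previsible_sigma M F)"
 using prev unfolding previsible_def borel_measurable_mat_iff by (simp add: case_prod_beta')

lemma f_psp: "(%(s, y). f j k s y) : bmeas (previsible_sigma M F)" proof -
 interpret scalar_bm M F "wc k" by (rule scalar_wc)
 have "(%(s, y). indicator {0<..} s :: real) : bmeas psp" by (rule psp_time) measurable
 hence "(%z. indicator {0<..} (fst z) * \<phi> (fst z) (snd z) $ j $ k) : bmeas psp"
  using \<phi>_entry[of j k] unfolding case_prod_beta' by (rule borel_measurable_times)
 thus ?thesis by (simp add: f_def case_prod_beta')
qed

lemma f_jm: "scalar_bm.jm M (f j k)" proof -
 interpret scalar_bm M F "wc k" by (rule scalar_wc)
 let ?A = "%(s, z). indicator {0..} s *\<^sub>R f j k s z"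
 have "?A : bmeas (lborel \<Otimes> M)" by (rule previsible_joint[OF f_psp])
 also have "?A = (%(s, z). f j k s z)" by (rule ext) (auto simp: f_def indicator_def)
 finally show ?thesis unfolding jm_def .
qed

lemma lpn_f: "scalar_bm.lpn M p (f j k) = ennreal (Bm j k powr p)" proof -
 interpret scalar_bm M F "wc k" by (rule scalar_wc)
 let ?A = "%s. \<E> z. ennreal (norm (\<phi> s z) powr p)"
 have "lpn p (f j k) <= (\<integral>\<^sup>+ s\<in>{0..}. (?A s) \<partial>lborel)"
  unfolding lpn_def proof (rule nn_integral_mono)
  fix s :: real
  let ?B = "\<E> z. ennreal (abs (f j k s z) powr p)"
  have "?B <= (?A s)"
   using p by (intro nn_integral_mono ennreal_leI powr_mono2) (auto simp: f_def indicator_def abs_entry_le_norm)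
  thus "?B * indicator {0<..} s <= (?A s) * indicator {0..} s" by (auto simp: indicator_def)
 qed
 hence "lpn p (f j k) < \<infinity>" using fin by (rule order_le_less_trans)
 thus ?thesis using p by (simp add: Bm_def powr_powr)
qed

text \<open>The properties of a continuous version of the integral of
  \<open>K (t - s) $ i $ j * f j k s\<close> against component \<open>k\<close>; coordinate
  \<open>i\<close> of the convolution is the sum of these over \<open>j\<close> and
  \<open>k\<close>.\<close>

definition entry :: "real => 'd => 'd => 'm => (real => 'a => real) => bool" where
 "entry e i j k X \<longleftrightarrow> (ALL t>=0. X t : bmeas M) & (AE z in M. continuous_on {0..} (%t. X t z)) &
  (\<E> z. (SUP t\<in>{0..}. ennreal (abs (X t z) powr p))) <= ennreal ((cc p * (Am i j + e) * (Bm j k + e)) powr p) &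
  (ALL t>=0. ALL v>0. EX L0. ALL L>=L0. EX h. scalar_bm.dyadic M F L h &
   (\<integral>\<^sup>+s\<in>{0<..<t}. (\<E> z. ennreal ((h s z - K (t - s) $ i $ j * f j k s z)^2)) \<partial>lborel) <= ennreal v &
   (\<E> z. ennreal ((scalar_bm.ito (wc k) L h t z - X t z)^2)) <= ennreal v)"

lemma entry_exists: "e > 0 ==> EX X. entry e i j k X" proof -
 assume e: "e > 0"
 interpret kernel_conv M F "wc k" "\<mu> i j" "%t. K t $ i $ j" p "Am i j + e" by (rule kernel[OF e])
 have "lpn p (f j k) <= ennreal ((Bm j k + e) powr p)"
  unfolding lpn_f using p e Bm_nonneg[of j k] by (intro ennreal_leI powr_mono2) auto
 thus ?thesis
  unfolding entry_def using e Bm_nonneg[of j k] by (intro scalar_convolution[OF f_psp f_jm]) auto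
qed

definition Xe :: "real => 'd => 'd => 'm => real => 'a => real" where
 "Xe e i j k = (SOME X. entry e i j k X)"

definition X :: "real => real => 'a => real ^ 'd" where
 "X e t z = (\<chi> i. \<Sum>j\<in>UNIV. \<Sum>k\<in>UNIV. Xe e i j k t z)"

lemma entry_Xe: "e > 0 ==> entry e i j k (Xe e i j k)"
 unfolding Xe_def by (rule someI_ex[OF entry_exists])

lemma Xe_measurable: "e > 0 ==> t >= 0 ==> Xe e i j k t : bmeas M"
 and Xe_continuous: "e > 0 ==> AE z in M. continuous_on {0..} (%t. Xe e i j k t z)"
 and Xe_sup: "e > 0 ==> (\<E> z. (SUP t\<in>{0..}. ennreal (abs (Xe e i j k t z) powr p))) <= ennreal ((cc p * (Am i j + e) * (Bm j k + e)) powr p)"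
 using entry_Xe[of e i j k] unfolding entry_def by blast+

lemma X_measurable: "e > 0 ==> t >= 0 ==> X e t : bmeas M"
 unfolding borel_measurable_vec_iff[of "X e t"] X_def vec_lambda_beta
 by (intro allI borel_measurable_sum Xe_measurable)

lemma Xe_continuous_all: "e > 0 ==> AE z in M. ALL i j k. continuous_on {0..} (%t. Xe e i j k t z)"
proof -
 assume e: "e > 0"
 have "AE z in M. ALL i:UNIV. ALL j:UNIV. ALL k:UNIV. continuous_on {0..} (%t. Xe e i j k t z)"
  by (intro AE_finite_allI finite_class.finite_UNIV Xe_continuous e)
 thus ?thesis by simp
qed

lemma X_continuous: "e > 0 ==> AE z in M. continuous_on {0..} (%t. X e t z)"
 by (drule Xe_continuous_all, elim eventually_mono)
  (auto simp: X_def intro!: continuous_on_vec_lambda continuous_on_sum)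

end

lemma norm_mat_le_sum: "norm (A :: real ^ 'n ^ 'k) <= (\<Sum>i\<in>UNIV. \<Sum>j\<in>UNIV. abs (A $ i $ j))"
proof -
 have "norm A <= (\<Sum>i\<in>UNIV. norm (A $ i))" unfolding norm_vec_def[of A] by (rule L2_set_le_sum) simp
 also have "... <= (\<Sum>i\<in>UNIV. \<Sum>j\<in>UNIV. abs (A $ i $ j))" by (intro sum_mono norm_le_l1_cart)
 finally show ?thesis .
qed

context convolution begin

lemma convolution_previsible: assumes t: "t >= 0"
 shows "previsible M F (%s y. indicator {0..t} s *\<^sub>R (K (t - s) ** \<phi> s y))" proof -
 have K: "(%s. indicator {0..t} s * K (t - s) $ i $ j) : bmeas borel" for i j proof -
  fix k :: 'm
  interpret kernel_conv M F "wc k" "\<mu> i j" "%t. K t $ i $ j" p "Am i j + 1" by (rule kernel) simp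
  have [measurable]: "kk t : bmeas borel" by (rule kk_borel)
  \<comment> \<open>The value \<open>K 0\<close>, about which nothing is assumed, enters only at
    \<open>s = t\<close>.\<close>
  have "(%s. indicator {0..t} s * K (t - s) $ i $ j) = (%s. indicator {0..} s * kk t s + indicator {t} s * K 0 $ i $ j)"
   using t by (intro ext) (auto simp: kk_def indicator_def)
  also have "... : bmeas borel" by measurable
  finally show ?thesis .
 qed
 fix k' :: 'm
 interpret scalar_bm M F "wc k'" by (rule scalar_wc)
 have K': "(%z. indicator {0..t} (fst z) * K (t - fst z) $ i $ j) : bmeas psp" for i j
  using psp_time[OF K[of i j]] by (simp add: case_prod_beta')
 have \<phi>': "(%z. \<phi> (fst z) (snd z) $ j $ k) : bmeas psp" for j k
  using \<phi>_entry[of j k] by (simp add: case_prod_beta')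
 have "(%z. (indicator {0..t} (fst z) *\<^sub>R (K (t - fst z) ** \<phi> (fst z) (snd z))) $ i $ k) : bmeas psp" for i k
 proof -
  have "(%z. \<Sum>j\<in>UNIV. (indicator {0..t} (fst z) * K (t - fst z) $ i $ j) * \<phi> (fst z) (snd z) $ j $ k) : bmeas psp"
   by (intro borel_measurable_sum borel_measurable_times K' \<phi>')
  thus ?thesis by (simp add: matrix_matrix_mult_def sum_distrib_left mult.assoc)
 qed
 thus ?thesis unfolding previsible_def borel_measurable_mat_iff case_prod_beta' by blast
qed

definition c\<^sub>0 :: ennreal where "c\<^sub>0 = ennreal (real CARD('d) * real CARD('m))"

lemma card_le: "ennreal (real CARD('d) * x) <= c\<^sub>0 * ennreal x" if "x >= 0" for x proof -
 have "0 < CARD('m)" by (rule zero_less_card_finite)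
 hence "real CARD('d) * 1 <= real CARD('d) * real CARD('m)" by (intro mult_left_mono) (auto simp: Suc_le_eq)
 hence "real CARD('d) * x <= real CARD('d) * real CARD('m) * x" using that by (intro mult_right_mono) auto
 thus ?thesis unfolding c\<^sub>0_def using that by (simp add: ennreal_mult[symmetric] ennreal_leI)
qed

text \<open>The approximants of all triples \<open>(i, j, k)\<close> are taken at one level, so that
  they share a grid and combine into a single matrix-valued elementary integrand. The factor
  \<open>c\<^sub>0\<close> comes from Cauchy-Schwarz over the terms of an entry.\<close>

lemma approx_step: assumes e: "e > 0" and t: "t >= 0" and Y: "Y > 0"
 shows "EX N m v. elementary_integrand M F N m v & (\<E> y. (\<integral>\<^sup>+ s\<in>{0..t}. ennreal ((norm (elementary_process N m v s y - K (t - s) ** \<phi> s y))^2) \<partial>lborel)) <= (\<Sum>i\<in>(UNIV::'d set). \<Sum>j\<in>(UNIV::'d set). \<Sum>k\<in>(UNIV::'m set). c\<^sub>0 * ennreal Y) & (\<E> y. ennreal ((norm (elementary_integral W N m v t y - X e t y))^2)) <= (\<Sum>i\<in>(UNIV::'d set). \<Sum>j\<in>(UNIV::'d set). \<Sum>k\<in>(UNIV::'m set). c\<^sub>0 * ennreal Y)"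
proof -
 fix k\<^sub>0 :: 'm
 interpret b: scalar_bm M F "wc k\<^sub>0" by (rule scalar_wc)
 define good where "good L i j k n \<longleftrightarrow> scalar_bm.dyadic M F L n & (\<integral>\<^sup>+s\<in>{0<..<t}. (\<E> y. ennreal ((n s y - K (t - s) $ i $ j * f j k s y)^2)) \<partial>lborel) <= ennreal Y & (\<E> y. ennreal ((scalar_bm.ito (wc k) L n t y - Xe e i j k t y)^2)) <= ennreal Y" for L i j k n
 have "EX L0. ALL L>=L0. EX n. good L i j k n" for i j k
  unfolding good_def using entry_Xe[OF e, of i j k] t Y unfolding entry_def by blast
 then obtain L0 where L0: "!!i j k L. L >= L0 i j k ==> EX n. good L i j k n" by metis
 \<comment> \<open>A sum serves as common upper bound of finitely many levels.\<close>
 define L where "L = (\<Sum>i\<in>UNIV. \<Sum>j\<in>UNIV. \<Sum>k\<in>UNIV. L0 i j k)"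
 have "L0 i j k <= L" for i j k proof -
  have "L0 i j k <= (\<Sum>k\<in>UNIV. L0 i j k)" by (rule member_le_sum) auto
  also have "... <= (\<Sum>j\<in>UNIV. \<Sum>k\<in>UNIV. L0 i j k)" by (rule member_le_sum) auto
  also have "... <= L" unfolding L_def by (rule member_le_sum) auto
  finally show ?thesis .
 qed
 hence "EX n. good L i j k n" for i j k by (rule L0)
 then obtain n where good: "!!i j k. good L i j k (n i j k)" by metis
 have dn: "b.dyadic L (n i j k)" for i j k using good unfolding good_def by blast
 define N where "N = L * 2 ^ L"
 \<comment> \<open>The inner index \<open>j\<close> of the matrix product is summed out here, since
   the same component \<open>k\<close> of \<open>W\<close> multiplies all its terms.\<close>
 define v where "v q y = (\<chi> i k. \<Sum>j\<in>UNIV. n i j k (dy L (Suc q)) y)" for q y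
 have el: "elementary_integrand M F N (dy L) v" unfolding elementary_integrand_def
 proof (intro conjI allI impI)
  show "0 <= dy L 0" by simp
  fix q assume q: "q < N"
  show "dy L q <= dy L (Suc q)" by (simp add: less_imp_le)
  show "v q : bmeas (F (dy L q))" unfolding borel_measurable_mat_iff[of "v q"] v_def vec_lambda_beta
   by (intro allI borel_measurable_sum b.dyadicD(1)[OF dn] q[unfolded N_def])
  have "EX B>0. ALL r. ALL y:space M. abs (n i j k r y) <= B" for i j k by (rule b.dyadic_bounded[OF dn])
  then obtain B where B: "!!i j k r y. y : space M ==> abs (n i j k r y) <= B i j k" by metis
  show "EX B. ALL y:space M. norm (v q y) <= B" proof (intro exI ballI)
   fix y assume y: "y : space M"
   let ?Q = "\<Sum>i\<in>UNIV. \<Sum>k\<in>UNIV. \<Sum>j\<in>UNIV. B i j k"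
   have "norm (v q y) <= (\<Sum>i\<in>UNIV. \<Sum>k\<in>UNIV. abs (v q y $ i $ k))" by (rule norm_mat_le_sum)
   also have "... <= ?Q"
    unfolding v_def vec_lambda_beta by (intro sum_mono order_trans[OF sum_abs] B[OF y])
   finally show "norm (v q y) <= ?Q" .
  qed
 qed
 have proc: "elementary_process N (dy L) v s y $ i $ k = (\<Sum>j\<in>UNIV. n i j k s y)" for s y i k
 proof -
  have "elementary_process N (dy L) v s y $ i $ k = (\<Sum>q<N. \<Sum>j\<in>UNIV. indicator {dy L q<..dy L (Suc q)} s * n i j k (dy L (Suc q)) y)"
   unfolding elementary_process_def v_def by (simp only: sum_component vector_scaleR_component vec_lambda_beta sum_distrib_left real_scaleR_def)
  also have "... = (\<Sum>j\<in>UNIV. \<Sum>q<N. indicator {dy L q<..dy L (Suc q)} s * n i j k (dy L (Suc q)) y)"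
   by (rule sum.swap)
  also have "... = (\<Sum>j\<in>UNIV. n i j k s y)"
   unfolding N_def by (intro sum.cong refl b.dyadic_expand[OF dn, symmetric])
  finally show ?thesis .
 qed
 let ?L = "%s y. elementary_process N (dy L) v s y - K (t - s) ** \<phi> s y"
 let ?A = "%s y. ennreal ((norm (?L s y))^2)"
 let ?H = "%y. \<integral>\<^sup>+ s\<in>{0..t}. ?A s y \<partial>lborel"
 let ?S = "\<E> y. (?H y)"
 have err: "?S <= (\<Sum>i\<in>(UNIV::'d set). \<Sum>j\<in>(UNIV::'d set). \<Sum>k\<in>(UNIV::'m set). c\<^sub>0 * ennreal Y)"
 proof -
  define g where "g i j k z = (n i j k (fst z) (snd z) - indicator {0<..<t} (fst z) * K (t - fst z) $ i $ j * f j k (fst z) (snd z)) * indicator {0<..<t} (fst z)" for i j k and z :: "real \<times> 'a"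
  let ?J = "%M. bmeas (lborel \<Otimes> M)"
  have gm: "(%z. ennreal ((g i j k z)^2)) : ?J M" for i j k proof -
   interpret kernel_conv M F "wc k" "\<mu> i j" "%t. K t $ i $ j" p "Am i j + 1" by (rule kernel) simp
   have [measurable]: "(%z. n i j k (fst z) (snd z)) : ?J M" by (rule jmD[OF dyadic_jm[OF dn]])
   have [measurable]: "(%z. f j k (fst z) (snd z)) : ?J M" by (rule jmD[OF f_jm])
   have [measurable]: "kk t : bmeas borel" by (rule kk_borel)
   have "(%z. ennreal ((g i j k z)^2)) = (%z. ennreal (((n i j k (fst z) (snd z) - kk t (fst z) * f j k (fst z) (snd z)) * indicator {0<..<t} (fst z))^2))"
    by (rule ext) (auto simp: g_def kk_def indicator_def)
   also have "... : ?J M" by measurable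
   finally show ?thesis .
  qed
  have gs: "(%s. ennreal ((g i j k (s, y))^2)) : bmeas lborel" if "y : space M" for i j k y
   using measurable_compose[OF measurable_Pair2'[OF that, of lborel] gm[of i j k]] by simp
  let ?B = "%s y. \<Sum>i\<in>UNIV. \<Sum>k\<in>UNIV. \<Sum>j\<in>UNIV. c\<^sub>0 * ennreal ((g i j k (s, y))^2)"
  have pt: "?A s y <= (?B s y)" if s: "0 < s" "s < t" for s y proof -
   let ?G = "%i k. \<Sum>j\<in>UNIV. (g i j k (s, y))^2"
   let ?R = "\<Sum>i\<in>UNIV. \<Sum>k\<in>UNIV. real CARD('d) * (?G i k)"
   have "(?L s y) $ i $ k = (\<Sum>j\<in>UNIV. g i j k (s, y))" for i k
    using s by (simp add: proc matrix_matrix_mult_def g_def f_def sum_subtractf)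
   hence "(norm (?L s y))^2 = (\<Sum>i\<in>UNIV. \<Sum>k\<in>UNIV. (\<Sum>j\<in>UNIV. g i j k (s, y))^2)"
    unfolding norm_mat_square by simp
   also have "... <= ?R" by (intro sum_mono square_sum_le)
   finally have "?A s y <= ennreal ?R" by (rule ennreal_leI)
   also have "... = (\<Sum>i\<in>UNIV. \<Sum>k\<in>UNIV. ennreal (real CARD('d) * (?G i k)))"
    by (simp add: sum_ennreal sum_nonneg)
   also have "... <= (\<Sum>i\<in>UNIV. \<Sum>k\<in>UNIV. c\<^sub>0 * ennreal (?G i k))"
    by (intro sum_mono card_le sum_nonneg) simp
   also have "... = (?B s y)" proof -
    have "ennreal (?G i k) = (\<Sum>j\<in>UNIV. ennreal ((g i j k (s, y))^2))" for i k
     by (rule sum_ennreal[symmetric]) simp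
    thus ?thesis by (simp only: sum_distrib_left)
   qed
   finally show ?thesis .
  qed
  let ?D = "%y. \<Sum>i\<in>UNIV. \<Sum>k\<in>UNIV. \<Sum>j\<in>UNIV. c\<^sub>0 * (\<L> s. ennreal ((g i j k (s, y))^2))"
  have "?S <= (\<E> y. (?D y))" proof (rule nn_integral_mono)
   fix y assume y: "y : space M"
   have "(?H y) <= (\<L> s. (?B s y))" proof (rule nn_integral_mono_AE)
    show "AE s in lborel. ?A s y * indicator {0..t} s <= (?B s y)"
     using AE_lborel_neq[of 0] AE_lborel_neq[of t] proof eventually_elim
     fix s :: real assume "s ~= 0" "s ~= t"
     thus "?A s y * indicator {0..t} s <= (?B s y)" using pt[of s y] by (cases "0 < s & s < t") auto
    qed
   qed
   also have "... = (?D y)"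
    by (simp only: nn_integral_sum borel_measurable_sum borel_measurable_times_ennreal borel_measurable_const nn_integral_cmult gs[OF y])
   finally show "(?H y) <= (?D y)" .
  qed
  also have "... = (\<Sum>i\<in>UNIV. \<Sum>k\<in>UNIV. \<Sum>j\<in>UNIV. c\<^sub>0 * (\<E> y. (\<L> s. ennreal ((g i j k (s, y))^2))))"
  proof -
   interpret pair_sigma_finite M "lborel :: real measure" ..
   have gm': "(%z. ennreal ((g i j k (snd z, fst z))^2)) : bmeas (M \<Otimes> lborel)" for i j k
    using measurable_compose[OF measurable_pair_swap' gm[of i j k]] by (simp add: case_prod_beta')
   have "(%y. \<L> s. ennreal ((g i j k (s, y))^2)) : bmeas M" for i j k
    using lborel.borel_measurable_nn_integral_fst[OF gm'[of i j k]] by simp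
   thus ?thesis
    by (simp only: nn_integral_sum borel_measurable_sum borel_measurable_times_ennreal borel_measurable_const nn_integral_cmult)
  qed
  also have "... <= (\<Sum>i\<in>(UNIV::'d set). \<Sum>k\<in>(UNIV::'m set). \<Sum>j\<in>(UNIV::'d set). c\<^sub>0 * ennreal Y)"
  proof (intro sum_mono mult_left_mono)
   fix i j k
   interpret pair_sigma_finite "lborel :: real measure" M ..
   have "(\<E> y. (\<L> s. ennreal ((g i j k (s, y))^2))) = (\<L> s. (\<E> y. ennreal ((g i j k (s, y))^2)))"
    by (rule Fubini[OF gm])
   also have "... = (\<integral>\<^sup>+s\<in>{0<..<t}. (\<E> y. ennreal ((n i j k s y - K (t - s) $ i $ j * f j k s y)^2)) \<partial>lborel)"
    by (rule nn_integral_cong) (auto simp: g_def indicator_def)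
   also have "... <= ennreal Y" using good unfolding good_def by blast
   finally show "(\<E> y. (\<L> s. ennreal ((g i j k (s, y))^2))) <= ennreal Y" .
  qed simp
  also have "... = (\<Sum>i\<in>(UNIV::'d set). \<Sum>j\<in>(UNIV::'d set). \<Sum>k\<in>(UNIV::'m set). c\<^sub>0 * ennreal Y)"
   by (rule sum.cong[OF refl], rule sum.swap)
  finally show ?thesis .
 qed
 let ?N = "%y. elementary_integral W N (dy L) v t y - X e t y"
 let ?C = "%y. ennreal ((norm (?N y))^2)"
 have int: "(\<E> y. ?C y) <= (\<Sum>i\<in>(UNIV::'d set). \<Sum>j\<in>(UNIV::'d set). \<Sum>k\<in>(UNIV::'m set). c\<^sub>0 * ennreal Y)"
 proof -
  define h where "h i j k y = scalar_bm.ito (wc k) L (n i j k) t y - Xe e i j k t y" for i j k y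
  have hm: "(%y. ennreal ((h i j k y)^2)) : bmeas M" for i j k proof -
   interpret scalar_bm M F "wc k" by (rule scalar_wc)
   have [measurable]: "ito L (n i j k) t : bmeas M" by (rule ito_measurable[OF dn t])
   have [measurable]: "Xe e i j k t : bmeas M" by (rule Xe_measurable[OF e t])
   show ?thesis unfolding h_def by measurable
  qed
  let ?E = "%y. \<Sum>i\<in>UNIV. \<Sum>j\<in>UNIV. \<Sum>k\<in>UNIV. c\<^sub>0 * ennreal ((h i j k y)^2)"
  have "(\<E> y. ?C y) <= (\<E> y. (?E y))" proof (rule nn_integral_mono_AE)
   show "AE y in M. ?C y <= (?E y)" using wc_AE proof eventually_elim
    fix y assume w: "ALL k t. wc k t y = W t y $ k"
    let ?P = "%i. \<Sum>j\<in>UNIV. \<Sum>k\<in>UNIV. scalar_bm.ito (wc k) L (n i j k) t y"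
    have "elementary_integral W N (dy L) v t y $ i = (?P i)" for i proof -
     let ?K = "%q k. W (min (dy L (Suc q)) t) y $ k - W (min (dy L q) t) y $ k"
     have ito: "scalar_bm.ito (wc k) L (n i j k) t y = (\<Sum>q<N. n i j k (dy L (Suc q)) y * (?K q k))" for j k
     proof -
      interpret scalar_bm M F "wc k" by (rule scalar_wc)
      show ?thesis by (simp add: ito_def w N_def)
     qed
     have "elementary_integral W N (dy L) v t y $ i = (\<Sum>q<N. \<Sum>k\<in>UNIV. \<Sum>j\<in>UNIV. n i j k (dy L (Suc q)) y * (?K q k))"
      by (simp add: elementary_integral_def matrix_vector_mult_def v_def sum_distrib_right)
     also have "... = (\<Sum>k\<in>UNIV. \<Sum>q<N. \<Sum>j\<in>UNIV. n i j k (dy L (Suc q)) y * (?K q k))"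
      by (rule sum.swap)
     also have "... = (\<Sum>k\<in>UNIV. \<Sum>j\<in>UNIV. scalar_bm.ito (wc k) L (n i j k) t y)"
      unfolding ito by (rule sum.cong[OF refl], rule sum.swap)
     also have "... = (?P i)" by (rule sum.swap)
     finally show ?thesis .
    qed
    hence comp: "(?N y) $ i = (\<Sum>j\<in>UNIV. \<Sum>k\<in>UNIV. h i j k y)" for i
     by (simp add: X_def h_def sum_subtractf)
    let ?T = "real CARD('d) * real CARD('m)"
    let ?I = "\<Sum>i\<in>UNIV. \<Sum>j\<in>UNIV. \<Sum>k\<in>UNIV. ?T * (h i j k y)^2"
    have "(norm (?N y))^2 = (\<Sum>i\<in>UNIV. (\<Sum>j\<in>UNIV. \<Sum>k\<in>UNIV. h i j k y)^2)"
     unfolding norm_vec_square comp ..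
    also have "... <= ?I" proof (rule sum_mono)
     fix i
     let ?U = "(\<Sum>j\<in>UNIV. \<Sum>k\<in>UNIV. h i j k y)^2"
     have "?U <= real CARD('d) * (\<Sum>j\<in>UNIV. (\<Sum>k\<in>UNIV. h i j k y)^2)" by (rule square_sum_le)
     also have "... <= real CARD('d) * (\<Sum>j\<in>UNIV. real CARD('m) * (\<Sum>k\<in>UNIV. (h i j k y)^2))"
      by (intro mult_left_mono sum_mono square_sum_le) simp
     finally show "?U <= (\<Sum>j\<in>UNIV. \<Sum>k\<in>UNIV. ?T * (h i j k y)^2)"
      by (simp add: sum_distrib_left mult.assoc)
    qed
    finally have "?C y <= ennreal ?I" by (rule ennreal_leI)
    also have "... = (?E y)" proof -
     have "c\<^sub>0 * ennreal ((h i j k y)^2) = ennreal (?T * (h i j k y)^2)" for i j k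
      unfolding c\<^sub>0_def by (rule ennreal_mult[symmetric]) auto
     thus ?thesis by (simp only: sum_ennreal sum_nonneg mult_nonneg_nonneg of_nat_0_le_iff zero_le_power2)
    qed
    finally show "?C y <= (?E y)" .
   qed
  qed
  also have "... = (\<Sum>i\<in>UNIV. \<Sum>j\<in>UNIV. \<Sum>k\<in>UNIV. c\<^sub>0 * (\<E> y. ennreal ((h i j k y)^2)))"
   by (simp only: nn_integral_sum borel_measurable_sum borel_measurable_times_ennreal borel_measurable_const nn_integral_cmult hm)
  also have "... <= (\<Sum>i\<in>(UNIV::'d set). \<Sum>j\<in>(UNIV::'d set). \<Sum>k\<in>(UNIV::'m set). c\<^sub>0 * ennreal Y)"
  proof (intro sum_mono mult_left_mono)
   fix i j k
   show "(\<E> y. ennreal ((h i j k y)^2)) <= ennreal Y" using good unfolding good_def h_def by blast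
  qed simp
  finally show ?thesis .
 qed
 show ?thesis using el err int by blast
qed

lemma X_convolution: assumes e: "e > 0" shows "continuous_stoch_convolution M F W K \<phi> (X e)"
 unfolding continuous_stoch_convolution_def proof (intro conjI allI impI X_continuous[OF e])
 fix t :: real assume t: "t >= 0"
 define b where "b n = (\<Sum>i\<in>(UNIV::'d set). \<Sum>j\<in>(UNIV::'d set). \<Sum>k\<in>(UNIV::'m set). c\<^sub>0 * ennreal (1 / real (Suc n)))" for n
 have b: "b \<leadsto> 0" proof -
  have "(%n. ennreal (1 / real (Suc n))) \<leadsto> ennreal 0" by (intro tendsto_ennrealI LIMSEQ_Suc lim_1_over_n)
  hence "(%n. c\<^sub>0 * ennreal (1 / real (Suc n))) \<leadsto> c\<^sub>0 * ennreal 0" by (intro ennreal_tendsto_cmult) (simp add: c\<^sub>0_def)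
  hence "b \<leadsto> (\<Sum>i\<in>(UNIV::'d set). \<Sum>j\<in>(UNIV::'d set). \<Sum>k\<in>(UNIV::'m set). c\<^sub>0 * ennreal 0)"
   unfolding b_def[abs_def] by (intro tendsto_sum)
  thus ?thesis by simp
 qed
 define Q where "Q n N T v \<longleftrightarrow> elementary_integrand M F N T v & (\<E> z. (\<integral>\<^sup>+ s\<in>{0..t}. ennreal ((norm (elementary_process N T v s z - K (t - s) ** \<phi> s z))^2) \<partial>lborel)) <= b n & (\<E> z. ennreal ((norm (elementary_integral W N T v t z - X e t z))^2)) <= b n" for n N T v
 have "EX N T v. Q n N T v" for n unfolding Q_def b_def by (rule approx_step[OF e t]) simp
 then obtain N T v where Q: "!!n. Q n (N n) (T n) (v n)" by metis
 show "has_ito_integral M F W (%s z. K (t - s) ** \<phi> s z) t (X e t)"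
  unfolding has_ito_integral_def
 proof (intro conjI convolution_previsible[OF t] X_measurable[OF e t] exI allI)
  show "elementary_integrand M F (N j) (T j) (v j)" for j using Q unfolding Q_def by blast
  show "(%j. \<E> z. (\<integral>\<^sup>+ s\<in>{0..t}. ennreal ((norm (elementary_process (N j) (T j) (v j) s z - K (t - s) ** \<phi> s z))^2) \<partial>lborel)) \<leadsto> 0"
   by (rule tendsto_sandwich[OF _ _ tendsto_const b]) (use Q in \<open>simp_all add: Q_def\<close>)
  show "(%j. \<E> z. ennreal ((norm (elementary_integral W (N j) (T j) (v j) t z - X e t z))^2)) \<leadsto> 0"
   by (rule tendsto_sandwich[OF _ _ tendsto_const b]) (use Q in \<open>simp_all add: Q_def\<close>)
 qed
qed

end

section \<open>The maximal inequality for matrices\<close>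

text \<open>The norm of \<open>l q\<close> is at most that of \<open>l 1\<close>: each factor
  \<open>u i powr (q - 1)\<close> is bounded by the corresponding power of the whole sum.\<close>

lemma sum_powr_le: fixes u :: "'i => real" assumes "q >= 1" "finite I" "!!i. i : I ==> u i >= 0"
 shows "(\<Sum>i\<in>I. u i powr q) <= (\<Sum>i\<in>I. u i) powr q" proof -
 define S where "S = (\<Sum>i\<in>I. u i)"
 have S: "u i <= S" if "i : I" for i unfolding S_def by (rule member_le_sum[OF that]) (use assms in auto)
 have S0: "S >= 0" unfolding S_def by (rule sum_nonneg) (use assms in auto)
 have split: "x powr q = x * x powr (q - 1)" if "x >= 0" for x :: real
  using that powr_add[of x 1 "q - 1"] by (cases "x = 0") simp_all
 have "(\<Sum>i\<in>I. u i powr q) <= (\<Sum>i\<in>I. u i * S powr (q - 1))" proof (rule sum_mono)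
  fix i assume i: "i : I"
  show "u i powr q <= u i * S powr (q - 1)"
   unfolding split[OF assms(3)[OF i]] using assms i S[OF i] by (intro mult_left_mono powr_mono2) auto
 qed
 also have "... = S powr q" unfolding split[OF S0] by (simp add: S_def sum_distrib_right)
 finally show ?thesis unfolding S_def .
qed

lemma powr_sum_le_card:
 fixes u :: "'i => real" assumes "q >= 1" "finite I" "!!i. i : I ==> u i >= 0"
 shows "(\<Sum>i\<in>I. u i) powr q <= real (card I) powr (q - 1) * (\<Sum>i\<in>I. u i powr q)"
 using powr_sum_le[of q I u "%_. 1"] assms by simp

context convolution begin

definition total :: "real => real" where
 "total e = (\<Sum>i\<in>UNIV. \<Sum>j\<in>UNIV. \<Sum>k\<in>UNIV. cc p * (Am i j + e) * (Bm j k + e))"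

text \<open>The triangle inequality of \<open>L p\<close> over all triples, with the bounds
  \<open>b\<close> as weights in \<open>powr_sum_le\<close>; the suprema are taken over dyadic times
  to be measurable.\<close>

lemma X_sup: assumes e: "e > 0"
 shows "(\<E> y. (SUP t\<in>{0..}. ennreal (norm (X e t y) powr p))) <= ennreal (total e powr p)"
proof -
 define T where "T = (UNIV :: ('d \<times> 'd \<times> 'm) set)"
 define Y where "Y z = Xe e (fst z) (fst (snd z)) (snd (snd z))" for z :: "'d \<times> 'd \<times> 'm"
 define b where "b z = cc p * (Am (fst z) (fst (snd z)) + e) * (Bm (fst (snd z)) (snd (snd z)) + e)" for z :: "'d \<times> 'd \<times> 'm"
 have trip: "(\<Sum>i\<in>UNIV. \<Sum>j\<in>UNIV. \<Sum>k\<in>UNIV. g i j k) = (\<Sum>z\<in>T. g (fst z) (fst (snd z)) (snd (snd z)))" for g :: "'d => 'd => 'm => real"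
  unfolding T_def by (simp add: sum.cartesian_product split_def flip: UNIV_Times_UNIV)
 have T: "finite T" by (simp add: T_def)
 have b: "b z > 0" for z using cc_pos[OF p] Am_nonneg[of "fst z" "fst (snd z)"] Bm_nonneg[of "fst (snd z)" "snd (snd z)"] e by (simp add: b_def)
 have tot: "total e = (\<Sum>z\<in>T. b z)" unfolding total_def trip b_def ..
 have tot0: "total e > 0" unfolding tot using b T by (intro sum_pos) (auto simp: T_def)
 define V where "V z y = (SUP l. SUP i. ennreal (abs (Y z (dy l i) y) powr p))" for z y
 have Vm: "V z : bmeas M" for z proof -
  have [measurable]: "Y z (dy l i) : bmeas M" for l i unfolding Y_def by (rule Xe_measurable[OF e]) simp
  show ?thesis unfolding V_def[abs_def] by measurable
 qed
 let ?B = "%z. \<E> y. V z y"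
 have EV: "(?B z) <= ennreal (b z powr p)" for z proof -
  have "(?B z) <= (\<E> y. (SUP t\<in>{0..}. ennreal (abs (Y z t y) powr p)))"
   unfolding V_def by (intro nn_integral_mono SUP_least SUP_upper) simp
  also have "... <= ennreal (b z powr p)" unfolding Y_def b_def by (rule Xe_sup[OF e])
  finally show ?thesis .
 qed
 define cw where "cw z = total e powr (p - 1) * b z powr (1 - p)" for z
 have cw: "cw z >= 0" for z by (simp add: cw_def)
 let ?A = "%cw y. \<Sum>z\<in>T. ennreal (cw z) * V z y"
 let ?C = "%t y. ennreal (norm (X e t y) powr p)"
 have "(\<E> y. (SUP t\<in>{0..}. ?C t y)) <= (\<E> y. (?A cw y))" proof (rule nn_integral_mono_AE)
  show "AE y in M. (SUP t\<in>{0..}. ?C t y) <= (?A cw y)" using Xe_continuous_all[OF e]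
  proof eventually_elim
   fix y assume c: "ALL i j k. continuous_on {0..} (%t. Xe e i j k t y)"
   show "(SUP t\<in>{0..}. ?C t y) <= (?A cw y)" proof (rule SUP_least)
    fix t :: real assume t: "t : {0..}"
    let ?D = "\<Sum>z\<in>T. cw z * abs (Y z t y) powr p"
    have "norm (X e t y) <= (\<Sum>i\<in>UNIV. abs (X e t y $ i))" by (rule norm_le_l1_cart)
    also have "... <= (\<Sum>i\<in>UNIV. \<Sum>j\<in>UNIV. \<Sum>k\<in>UNIV. abs (Xe e i j k t y))"
     unfolding X_def vec_lambda_beta by (intro sum_mono order_trans[OF sum_abs] sum_abs)
    also have "... = (\<Sum>z\<in>T. abs (Y z t y))" unfolding trip Y_def ..
    finally have "norm (X e t y) powr p <= (\<Sum>z\<in>T. abs (Y z t y)) powr p" using p by (intro powr_mono2) auto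
    also have "... <= (\<Sum>z\<in>T. b z) powr (p - 1) * (\<Sum>z\<in>T. b z powr (1 - p) * abs (Y z t y) powr p)"
     using p T b by (intro powr_sum_le) auto
    also have "... = ?D" unfolding tot[symmetric] cw_def by (simp only: sum_distrib_left mult.assoc)
    finally have "?C t y <= ennreal ?D" by (rule ennreal_leI)
    also have "... = (\<Sum>z\<in>T. ennreal (cw z * abs (Y z t y) powr p))" using cw by (intro sum_ennreal[symmetric]) simp
    also have "... = (\<Sum>z\<in>T. ennreal (cw z) * ennreal (abs (Y z t y) powr p))" using cw by (intro sum.cong refl ennreal_mult) auto
    also have "... <= (?A cw y)" proof (intro sum_mono mult_left_mono)
     fix z
     have "continuous_on {0..} (%t. Y z t y)" using c by (simp add: Y_def)
     hence "V z y = (SUP t\<in>{0..}. ennreal (abs (Y z t y) powr p))"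
      unfolding V_def using p by (intro SUP_halfline_dyadic[symmetric]) auto
     thus "ennreal (abs (Y z t y) powr p) <= V z y" using SUP_upper[OF t] by simp
    qed simp
    finally show "?C t y <= (?A cw y)" .
   qed
  qed
 qed
 also have "... = (\<Sum>z\<in>T. ennreal (cw z) * (?B z))"
  by (simp only: nn_integral_sum borel_measurable_times_ennreal borel_measurable_const nn_integral_cmult Vm)
 also have "... <= (\<Sum>z\<in>T. ennreal (cw z) * ennreal (b z powr p))"
  by (intro sum_mono mult_left_mono EV) simp
 also have "... = (\<Sum>z\<in>T. ennreal (cw z * b z powr p))" using cw by (intro sum.cong refl ennreal_mult[symmetric]) auto
 also have "... = ennreal (\<Sum>z\<in>T. cw z * b z powr p)" using cw by (intro sum_ennreal) simp
 also have "(\<Sum>z\<in>T. cw z * b z powr p) = (\<Sum>z\<in>T. total e powr (p - 1) * b z)"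
 proof (rule sum.cong[OF refl])
  fix z
  have "b z powr (1 - p) * b z powr p = b z" using b[of z] by (simp flip: powr_add)
  thus "cw z * b z powr p = total e powr (p - 1) * b z" by (simp add: cw_def mult.assoc)
 qed
 also have "... = total e powr (p - 1) * total e powr 1" using tot0 by (simp add: tot sum_distrib_left)
 also have "... = total e powr p" using powr_add[of "total e" "p - 1" 1] by simp
 finally show ?thesis .
qed

text \<open>Cauchy-Schwarz over the pairs \<open>(i, j)\<close> produces the Frobenius norm of the
  matrix of the \<open>Am i j\<close> and, after raising to the power \<open>p\<close>, a factor
  \<open>CARD('d) powr (p/2)\<close>. Power means over \<open>j\<close> and \<open>k\<close> give
  the remaining factors \<open>CARD('d) powr (p/2 - 1)\<close> and
  \<open>CARD('m) powr (p - 1)\<close>.\<close>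

lemma total_le:
 "total 0 powr p <= (real CARD('d) powr (p - 1) * real CARD('m) powr (p - 1) * cc p powr p * enn2real (M_const p \<mu>) powr p) * (\<Sum>j\<in>UNIV. \<Sum>k\<in>UNIV. Bm j k powr p)"
proof -
 define A :: "real ^ 'd ^ 'd" where "A = (\<chi> i j. Am i j)"
 define y where "y j = (\<Sum>k\<in>UNIV. Bm j k)" for j
 have y: "y j >= 0" for j unfolding y_def by (intro sum_nonneg Bm_nonneg)
 have Mc: "enn2real (M_const p \<mu>) = norm A" proof -
  have "M_const p \<mu> = ennreal (norm A)" using Mfin by (auto simp: M_const_def A_def Am_def split: if_splits)
  thus ?thesis by simp
 qed
 have dim: "real CARD('d) > 0" by simp
 have cc: "cc p >= 0" using cc_pos[OF p] by simp
 let ?A = "\<Sum>i\<in>UNIV. \<Sum>j\<in>UNIV. Am i j * y j"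
 have t0: "total 0 = cc p * ?A" by (simp add: total_def y_def sum_distrib_left mult.assoc)
 let ?B = "\<Sum>j\<in>UNIV. (y j)^2"
 have "?A^2 = (\<Sum>z\<in>(UNIV :: ('d \<times> 'd) set). Am (fst z) (snd z) * y (snd z))^2"
  by (simp add: sum.cartesian_product split_def flip: UNIV_Times_UNIV)
 also have "... <= (\<Sum>z\<in>UNIV. (Am (fst z) (snd z))^2) * (\<Sum>z\<in>(UNIV :: ('d \<times> 'd) set). (y (snd z))^2)"
  by (rule Cauchy_Schwarz_ineq_sum)
 also have "(\<Sum>z\<in>UNIV. (Am (fst z) (snd z))^2) = (norm A)^2"
  unfolding norm_mat_square A_def by (simp add: sum.cartesian_product split_def flip: UNIV_Times_UNIV)
 also have "(\<Sum>z\<in>(UNIV :: ('d \<times> 'd) set). (y (snd z))^2) = real CARD('d) * ?B"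
 proof -
  have "(\<Sum>i\<in>(UNIV :: 'd set). \<Sum>j\<in>UNIV. (y j)^2) = (\<Sum>z\<in>(UNIV :: 'd set) \<times> UNIV. (y (snd z))^2)"
   by (simp only: sum.cartesian_product split_def)
  thus ?thesis by simp
 qed
 finally have sq: "?A^2 <= (norm A)^2 * (real CARD('d) * ?B)" .
 have nn: "?A >= 0" by (intro sum_nonneg mult_nonneg_nonneg Am_nonneg y)
 let ?C = "\<Sum>j\<in>UNIV. y j powr p"
 have "?A powr p = (?A^2) powr (p/2)" using nn by (simp add: square_powr_half)
 also have "... <= ((norm A)^2 * (real CARD('d) * ?B)) powr (p/2)"
  using sq p by (intro powr_mono2) auto
 also have "... = norm A powr p * (real CARD('d) powr (p/2) * ?B powr (p/2))"
  by (simp add: powr_mult square_powr_half)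
 also have "... <= norm A powr p * (real CARD('d) powr (p/2) * (real CARD('d) powr (p/2 - 1) * ?C))"
 proof -
  have "?B powr (p/2) <= real CARD('d) powr (p/2 - 1) * (\<Sum>j\<in>UNIV. ((y j)^2) powr (p/2))"
   by (rule powr_sum_le_card) (use p in auto)
  also have "(\<Sum>j\<in>UNIV. ((y j)^2) powr (p/2)) = ?C" using y by (simp add: square_powr_half)
  finally show ?thesis by (intro mult_left_mono) auto
 qed
 also have "... = norm A powr p * (real CARD('d) powr (p - 1) * ?C)" proof -
  have "real CARD('d) powr (p/2) * real CARD('d) powr (p/2 - 1) = real CARD('d) powr (p - 1)" by (simp flip: powr_add)
  thus ?thesis by (simp only: mult.assoc[symmetric])
 qed
 also have "... <= norm A powr p * (real CARD('d) powr (p - 1) * (\<Sum>j\<in>UNIV. real CARD('m) powr (p - 1) * (\<Sum>k\<in>UNIV. Bm j k powr p)))"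
  unfolding y_def by (intro mult_left_mono sum_mono powr_sum_le_card) (use p Bm_nonneg in auto)
 finally have "cc p powr p * ?A powr p <= cc p powr p * (norm A powr p * (real CARD('d) powr (p - 1) * (\<Sum>j\<in>UNIV. real CARD('m) powr (p - 1) * (\<Sum>k\<in>UNIV. Bm j k powr p))))"
  by (rule mult_left_mono) simp
 thus ?thesis unfolding t0 Mc powr_mult sum_distrib_left[symmetric] by (simp only: mult_ac)
qed

text \<open>By \<open>sum_powr_le\<close> with exponent \<open>p / 2\<close>, applied to the squares
  of the entries, the \<open>p\<close>-th powers of the entries add up to at most the
  \<open>p\<close>-th power of the Frobenius norm.\<close>

lemma sum_Bm_le:
 "ennreal (\<Sum>j\<in>UNIV. \<Sum>k\<in>UNIV. Bm j k powr p) <= (\<integral>\<^sup>+ s\<in>{0..}. (\<E> y. ennreal (norm (\<phi> s y) powr p)) \<partial>lborel)"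
proof -
 fix k\<^sub>0 :: 'm
 interpret scalar_bm M F "wc k\<^sub>0" by (rule scalar_wc)
 define g where "g j k s y = ennreal (abs (f j k s y) powr p)" for j k s y
 have m1: "g j k s : bmeas M" for j k s
  unfolding g_def[abs_def] using jm_section[OF f_jm, of j k s] by measurable
 have m2: "(%s. (\<E> y. g j k s y) * indicator {0<..} s) : bmeas lborel" for j k
  using jm_moment[OF f_jm[of j k], of p] unfolding g_def by measurable
 let ?A = "%s. \<E> y. ennreal (norm (\<phi> s y) powr p)"
 let ?B = "%s. \<Sum>j\<in>UNIV. \<Sum>k\<in>UNIV. (\<E> y. g j k s y) * indicator {0<..} s"
 have "ennreal (\<Sum>j\<in>UNIV. \<Sum>k\<in>UNIV. Bm j k powr p) = (\<Sum>j\<in>UNIV. \<Sum>k\<in>UNIV. lpn p (f j k))"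
  unfolding lpn_f by (simp add: sum_nonneg)
 also have "... = (\<L> s. (?B s))"
  unfolding lpn_def g_def[symmetric] by (simp only: nn_integral_sum borel_measurable_sum m2)
 also have "... <= (\<integral>\<^sup>+ s\<in>{0..}. (?A s) \<partial>lborel)"
 proof (rule nn_integral_mono)
  fix s :: real
  show "(?B s) <= (?A s) * indicator {0..} s" proof (cases "s > 0")
   case True
   let ?D = "%y. \<Sum>j\<in>UNIV. \<Sum>k\<in>UNIV. g j k s y"
   have "(\<Sum>j\<in>UNIV. \<Sum>k\<in>UNIV. \<E> y. g j k s y) = (\<E> y. (?D y))"
    by (simp only: nn_integral_sum borel_measurable_sum m1)
   also have "... <= (?A s)" proof (rule nn_integral_mono)
    fix y
    define u where "u z = (\<phi> s y $ fst z $ snd z)^2" for z :: "'d \<times> 'm"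
    let ?C = "\<Sum>j\<in>UNIV. \<Sum>k\<in>UNIV. abs (\<phi> s y $ j $ k) powr p"
    have "(?D y) = ennreal ?C" using True by (simp add: g_def f_def sum_nonneg)
    also have "?C = (\<Sum>z\<in>UNIV. u z powr (p/2))"
     by (simp add: u_def square_powr_half sum.cartesian_product split_def flip: UNIV_Times_UNIV)
    also have "ennreal ... <= ennreal ((\<Sum>z\<in>UNIV. u z) powr (p/2))"
     by (intro ennreal_leI sum_powr_le) (use p in \<open>auto simp: u_def\<close>)
    also have "(\<Sum>z\<in>UNIV. u z) = (norm (\<phi> s y))^2"
     unfolding norm_mat_square u_def by (simp add: sum.cartesian_product split_def flip: UNIV_Times_UNIV)
    finally show "(?D y) <= ennreal (norm (\<phi> s y) powr p)" by (simp add: square_powr_half)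
   qed
   finally show ?thesis using True by simp
  qed simp
 qed
 finally show ?thesis .
qed

text \<open>Any continuous version coincides almost surely with \<open>X e\<close>, whatever the
  positive \<open>e\<close>; the slack is then sent to 0.\<close>

lemma moment_bound: assumes Y: "continuous_stoch_convolution M F W K \<phi> Y"
 shows "(\<E> z. (SUP t\<in>{0..}. ennreal (norm (Y t z) powr p))) <= ennreal (real CARD('d) powr (p - 1) * real CARD('m) powr (p - 1) * cc p powr p * enn2real (M_const p \<mu>) powr p) * (\<integral>\<^sup>+ s\<in>{0..}. (\<E> z. ennreal (norm (\<phi> s z) powr p)) \<partial>lborel)"
proof -
 let ?A = "\<E> z. (SUP t\<in>{0..}. ennreal (norm (Y t z) powr p))"
 have le: "?A <= ennreal (total e powr p)" if e: "e > 0" for e proof -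
  have "?A = (\<E> z. (SUP t\<in>{0..}. ennreal (norm (X e t z) powr p)))"
   by (rule nn_integral_cong_AE)
    (use convolution_indistinguishable[OF Y X_convolution[OF e]] in eventually_elim, auto intro!: SUP_cong)
  thus ?thesis using X_sup[OF e] by simp
 qed
 have "(%n. ennreal (total (1 / real (Suc n)) powr p)) \<leadsto> ennreal (total 0 powr p)" proof -
  have "(%n. 1 / real (Suc n)) \<leadsto> 0" by (intro LIMSEQ_Suc lim_1_over_n)
  hence "(%n. total (1 / real (Suc n))) \<leadsto> total 0"
   unfolding total_def[abs_def] by (intro tendsto_intros)
  moreover have "total (1 / real (Suc n)) >= 0" for n
   unfolding total_def using cc_pos[OF p] Am_nonneg Bm_nonneg by (intro sum_nonneg mult_nonneg_nonneg add_nonneg_nonneg) auto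
  ultimately show ?thesis using p by (intro tendsto_ennrealI tendsto_powr2 tendsto_const) auto
 qed
 hence "?A <= ennreal (total 0 powr p)" by (rule LIMSEQ_le_const) (use le in auto)
 also have "... <= ennreal ((real CARD('d) powr (p - 1) * real CARD('m) powr (p - 1) * cc p powr p * enn2real (M_const p \<mu>) powr p) * (\<Sum>j\<in>UNIV. \<Sum>k\<in>UNIV. Bm j k powr p))" by (rule ennreal_leI[OF total_le])
 also have "... = ennreal (real CARD('d) powr (p - 1) * real CARD('m) powr (p - 1) * cc p powr p * enn2real (M_const p \<mu>) powr p) * ennreal (\<Sum>j\<in>UNIV. \<Sum>k\<in>UNIV. Bm j k powr p)" by (rule ennreal_mult) (auto intro!: sum_nonneg)
 also have "... <= ennreal (real CARD('d) powr (p - 1) * real CARD('m) powr (p - 1) * cc p powr p * enn2real (M_const p \<mu>) powr p) * (\<integral>\<^sup>+ s\<in>{0..}. (\<E> z. ennreal (norm (\<phi> s z) powr p)) \<partial>lborel)" by (rule mult_left_mono[OF sum_Bm_le]) simp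
 finally show ?thesis .
qed

end

section \<open>Comparison with the constant of the theorem\<close>

lemma exp_ge_cubic:
 fixes x :: real assumes "x >= 0" shows "1 + x + x^2 / 2 + x ^ 3 / 6 <= exp x" proof -
 have "(\<Sum>n<4. x ^ n /\<^sub>R fact n) <= (\<Sum>n. x ^ n /\<^sub>R fact n)"
  using assms by (intro sum_le_suminf summable_exp_generic) auto
 thus ?thesis by (simp add: exp_def eval_nat_numeral field_simps)
qed

text \<open>Constant term and slope are those of the Taylor series of
  \<open>x / (exp x - 1)\<close>. Enlarging its coefficient \<open>1/12\<close> to
  \<open>1/10\<close> makes the product with the cubic Taylor polynomial of \<open>exp x - 1\<close>
  exceed \<open>x\<close> by exactly \<open>x ^ 3 * (1 - x)^2 / 60\<close>.\<close>

lemma exp_quotient_le: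
 fixes x :: real assumes "x >= 0" shows "x <= (1 - x/2 + x^2/10) * (exp x - 1)" proof -
 have pos: "1 - x/2 + x^2/10 >= 0" proof -
  have "1 - x/2 + x^2/10 = (x - 5/2)^2/10 + 3/8" by (simp add: power2_eq_square field_simps)
  thus ?thesis by simp
 qed
 let ?A = "1 - x/2 + x^2/10"
 have "x + x ^ 3 * (1 - x)^2 / 60 = ?A * (x + x^2 / 2 + x ^ 3 / 6)"
  by (simp add: power2_eq_square power3_eq_cube field_simps)
 also have "... <= ?A * (exp x - 1)"
  using exp_ge_cubic[OF assms] by (intro mult_left_mono pos) linarith
 finally have "x + x ^ 3 * (1 - x)^2 / 60 <= ?A * (exp x - 1)" .
 moreover have "0 <= x ^ 3 * (1 - x)^2 / 60" using assms by simp
 ultimately show ?thesis by linarith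
qed

lemma ln2_ge: "69/100 <= ln (2::real)"
 using ln_approx_bounds[of 2 2, simplified, simplified eval_nat_numeral, simplified] by simp

lemma ln_Gamma_convex: fixes x y t :: real assumes "x > 0" "y > 0" "0 <= t" "t <= 1"
 shows "ln (Gamma ((1 - t) * x + t * y)) <= (1 - t) * ln (Gamma x) + t * ln (Gamma y)"
 using convex_onD[OF log_convex_Gamma_real assms(3,4), of x y] assms by simp

lemma ln_Gamma_half: "ln (Gamma (1/2 :: real)) = ln pi / 2"
 by (simp add: Gamma_one_half_real ln_sqrt)

text \<open>Convexity of \<open>ln (Gamma x)\<close> between \<open>1/2\<close> and
  \<open>1 + y\<close>, at the point 1 where it vanishes; \<open>t\<close> is the weight that hits
  this point.\<close>

lemma ln_Gamma_ge_1: assumes y: "(y::real) >= 0" shows "- y * ln pi <= ln (Gamma (1 + y))" proof -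
 define t where "t = 1 / (1 + 2 * y)"
 have t: "0 < t" "t <= 1" using y by (auto simp: t_def)
 have "t * (1 + 2 * y) = 1" using y by (simp add: t_def)
 hence e: "1 - t = 2 * y * t" and m: "(1 - t) * (1/2) + t * (1 + y) = 1" by (simp_all add: field_simps)
 have "ln (Gamma ((1 - t) * (1/2) + t * (1 + y))) <= (1 - t) * ln (Gamma (1/2)) + t * ln (Gamma (1 + y))"
  by (rule ln_Gamma_convex) (use y t in auto)
 hence "0 <= t * (y * ln pi + ln (Gamma (1 + y)))"
  unfolding m unfolding ln_Gamma_half e by (simp add: algebra_simps)
 hence "0 <= y * ln pi + ln (Gamma (1 + y))" using t by (simp add: zero_le_mult_iff)
 thus ?thesis by simp
qed

text \<open>Convexity again, now at the point \<open>1/2\<close> between \<open>a\<close> and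
  1.\<close>

lemma ln_Gamma_ge_2:
 assumes a: "0 < (a::real)" "a < 1/2" shows "(1 - a) * ln pi <= ln (Gamma a)" proof -
 define t where "t = 1 / (2 * (1 - a))"
 have t: "0 < t" "t <= 1" using a by (auto simp: t_def)
 have "t * (2 * (1 - a)) = 1" using a by (simp add: t_def)
 hence m: "(1 - t) * 1 + t * a = 1/2" by (simp add: algebra_simps)
 have "ln (Gamma ((1 - t) * 1 + t * a)) <= (1 - t) * ln (Gamma 1) + t * ln (Gamma a)"
  by (rule ln_Gamma_convex) (use a t in auto)
 hence "ln pi / 2 <= t * ln (Gamma a)" unfolding m ln_Gamma_half by simp
 thus ?thesis using a by (simp add: t_def field_simps)
qed

text \<open>Convexity at the point \<open>3/2\<close> between \<open>1 + a\<close> and 2, where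
  \<open>Gamma (3/2) = sqrt pi / 2\<close>.\<close>

lemma ln_Gamma_ge_3:
 assumes a: "0 < (a::real)" "a < 1/2" shows "(1 - a) * (ln pi - 2 * ln 2) <= ln (Gamma (1 + a))"
proof -
 define t where "t = 1 / (2 * (1 - a))"
 have t: "0 < t" "t <= 1" using a by (auto simp: t_def)
 have "t * (2 * (1 - a)) = 1" using a by (simp add: t_def)
 hence m: "(1 - t) * 2 + t * (1 + a) = 1/2 + 1" by (simp add: algebra_simps)
 have G2: "Gamma (2::real) = 1" using Gamma_fact[of 1, where 'a = real] by simp
 have "Gamma (1/2 + 1 :: real) = 1/2 * Gamma (1/2)" by (rule Gamma_plus1) (auto elim!: nonpos_Ints_cases)
 hence "Gamma (1/2 + 1 :: real) = sqrt pi / 2" by (simp add: Gamma_one_half_real)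
 hence G3: "ln (Gamma (1/2 + 1 :: real)) = ln pi / 2 - ln 2"
  by (simp only:) (simp add: ln_divide_pos ln_sqrt)
 have "ln (Gamma ((1 - t) * 2 + t * (1 + a))) <= (1 - t) * ln (Gamma 2) + t * ln (Gamma (1 + a))"
  by (rule ln_Gamma_convex) (use a t in auto)
 hence "ln pi / 2 - ln 2 <= t * ln (Gamma (1 + a))" unfolding m G3 G2 by simp
 thus ?thesis using a by (simp add: t_def field_simps)
qed

text \<open>With \<open>x = a * ln 4\<close> the quotient \<open>a / (4 powr a - 1)\<close> is
  \<open>x / (exp x - 1) / ln 4\<close>, and \<open>exp_quotient_le\<close> yields a bound linear in
  \<open>a\<close>. Constant term and slope both come out close to 1.255, hence the form with
  \<open>1 + a\<close>.\<close>

lemma four_powr_quotient_le: assumes a: "0 < (a::real)" "a < 1/2"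
 shows "2 * a + sqrt 3 * (a / (4 powr a - 1)) <= 12554/10000 * (1 + a)" proof -
 define L :: real where "L = 2 * ln 2"
 have L: "138/100 <= L" "L <= 25/18" using ln2_ge ln2_le_25_over_36 by (auto simp: L_def)
 have ln4: "ln (4::real) = L" using ln_realpow[of 2 2] by (simp add: L_def)
 define x where "x = a * L"
 have x: "x > 0" using a L by (simp add: x_def)
 have e: "4 powr a = exp x" by (simp add: powr_def x_def ln4)
 have "exp x > 1" using x by simp
 hence "x / (exp x - 1) <= 1 - x/2 + x^2/10"
  using exp_quotient_le[of x] x by (simp add: divide_le_eq)
 hence "x / (exp x - 1) / L <= (1 - x/2 + x^2/10) / L" using L by (intro divide_right_mono) auto
 moreover have "x / (exp x - 1) / L = a / (4 powr a - 1)" unfolding e using L by (simp add: x_def)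
 moreover have "(1 - x/2 + x^2/10) / L = 1 / L - a/2 + a^2 * L / 10"
  using L by (simp add: x_def power2_eq_square field_simps)
 moreover have "1 / L <= 7247/10000" using L by (simp add: divide_le_eq)
 moreover have "a^2 * L <= a * (1/2) * (25/18)"
  unfolding power2_eq_square using a L by (intro mult_mono) auto
 ultimately have u: "a / (4 powr a - 1) <= 7247/10000 - 4305/10000 * a" using a by linarith
 have s3: "sqrt 3 <= 17321/10000" by (rule real_le_lsqrt) (auto simp: power2_eq_square)
 define z where "z = sqrt 3 * (a / (4 powr a - 1))"
 have "sqrt 3 * (a / (4 powr a - 1)) <= 17321/10000 * (7247/10000 - 4305/10000 * a)"
  using u s3 a by (intro mult_mono) (auto simp: ge_one_powr_ge_zero)
 thus ?thesis using a unfolding z_def[symmetric] by (simp add: algebra_simps)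
qed

text \<open>The left-hand side is \<open>(ln 2 / 2) powr (2 * a)\<close>, convex in \<open>a\<close>
  and therefore below its chord between \<open>a = 0\<close> and \<open>a = 1/2\<close>.\<close>

lemma powr_chord_le: assumes a: "0 <= (a::real)" "a <= 1/2"
 shows "(ln 2) powr (2 * a) * 4 powr (- a) <= 1 - 1305/1000 * a" proof -
 define c :: real where "c = ln 2 / 2"
 have l: "ln (2::real) > 0" by simp
 have c: "0 < c" "c <= 25/72" using ln2_le_25_over_36 by (auto simp: c_def)
 have "(ln 2) powr (2 * a) * 4 powr (- a) = c powr (2 * a)" proof -
  have "ln (4::real) = 2 * ln 2" using ln_realpow[of 2 2] by simp
  hence "4 powr (- a) = (1/2) powr (2 * a)" by (simp add: powr_def ln_div)
  thus ?thesis by (simp only: powr_mult[symmetric] c_def) simp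
 qed
 also have "... <= 1 - 2 * a * (1 - c)" proof -
  have "exp ((1 - 2 * a) *\<^sub>R 0 + (2 * a) *\<^sub>R ln c) <= (1 - 2 * a) * exp 0 + (2 * a) * exp (ln c)"
   using a by (intro convex_onD[OF exp_convex]) auto
  thus ?thesis using c by (simp add: powr_def algebra_simps)
 qed
 also have "... <= 1 - 1305/1000 * a" proof -
  have "2 * a * (1305/2000) <= 2 * a * (1 - c)" using a c by (intro mult_left_mono) auto
  thus ?thesis by simp
 qed
 finally show ?thesis .
qed

text \<open>The left-hand side of \<open>key\<close> in \<open>cc_powr_le\<close>, multiplied by
  \<open>a^2 * 4 powr (- a) / p\<close>; this removes the pole at \<open>a = 0\<close>, and
  \<open>1/2 + a\<close> is \<open>(p - 1) / p\<close>. The bound \<open>71/100\<close> has to stay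
  below \<open>exp (- ln 2 / 8) * (pi / 4)\<close>, about 0.72.\<close>

lemma numeric_bound: assumes a: "0 < (a::real)" "a < 1/2"
 shows "(1/2 + a) / 2 * ((ln 2) powr (2 * a) * 4 powr (- a)) * (2 * a + sqrt 3 * (a / (4 powr a - 1)))^2 <= 71/100"
proof -
 define v where "v = 2 * a + sqrt 3 * (a / (4 powr a - 1))"
 have "v >= 0" using a by (auto simp: v_def ge_one_powr_ge_zero)
 hence v: "v^2 <= (12554/10000 * (1 + a))^2" using four_powr_quotient_le[OF a] unfolding v_def[symmetric] by (intro power_mono)
 have "(1/2 + a) / 2 * ((ln 2) powr (2 * a) * 4 powr (- a)) * v^2 <= (1/2 + a) / 2 * (1 - 1305/1000 * a) * (12554/10000 * (1 + a))^2"
  using powr_chord_le[of a] a by (intro mult_mono v) auto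
 also have "... = (12554/10000)^2 / 2 * ((1/2 + a) * (1 - 1305/1000 * a) * (1 + a)^2)" proof -
  have "h / 2 * q * (c * u)^2 = c^2 / 2 * (h * q * u^2)" for h q c u :: real by (simp add: power_mult_distrib)
  thus ?thesis .
 qed
 also have "(1/2 + a) * (1 - 1305/1000 * a) * (1 + a)^2 <= 9007/10000" proof -
  \<comment> \<open>The tangent of the cube at \<open>445/1000\<close>, close to where
    \<open>1/2 + 13475/10000 * a - 22625/10000 * a ^ 3\<close> is largest.\<close>
  have c3: "a ^ 3 >= 3 * (445/1000)^2 * a - 2 * (445/1000) ^ 3" proof -
   have "0 <= (a - 445/1000)^2 * (a + 2 * (445/1000))" using a by simp
   also have "... = a ^ 3 - (3 * (445/1000)^2 * a - 2 * (445/1000) ^ 3)"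
    by (simp add: power2_eq_square power3_eq_cube field_simps)
   finally show ?thesis by simp
  qed
  have "(1/2 + a) * (1 - 1305/1000 * a) * (1 + a)^2 = 1/2 + 13475/10000 * a - 11/100 * a^2 - 22625/10000 * a ^ 3 - 1305/1000 * a ^ 4"
   by (simp add: power2_eq_square power3_eq_cube power4_eq_xxxx field_simps)
  also have "... <= 1/2 + 13475/10000 * a - 22625/10000 * a ^ 3"
   using zero_le_power[of a 4] zero_le_power[of a 2] a by linarith
  finally show ?thesis using a c3 by (simp add: power2_eq_square power3_eq_cube)
 qed
 finally show ?thesis unfolding v_def by (simp add: power2_eq_square)
qed

text \<open>The factor \<open>2 * p powr (p/2)\<close> of \<open>kap p powr (p/2)\<close> is exactly
  \<open>b_const p\<close>. After cancelling it and taking the power \<open>2 / p\<close>, the claim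
  is \<open>key\<close>, an inequality in the single variable \<open>a\<close> since
  \<open>1 / p = 1/2 - a\<close>.\<close>

lemma cc_powr_le: assumes p: "p > 2"
 shows "cc p powr p <= b_const p * Gamma ((p - 2) / (2 * p^2)) powr (p / 2) * Gamma ((p - 2) / (2 * p)) powr (p - 1)"
proof -
 define a where "a = 1/2 - 1/p"
 have a: "0 < a" "a < 1/2" using p by (auto simp: a_def field_simps)
 have ip: "1/p = 1/2 - a" by (simp add: a_def)
 have e1: "(p - 2) / (2 * p^2) = a / p" and e2: "(p - 2) / (2 * p) = a"
  using p by (auto simp: a_def power2_eq_square field_simps)
 define Q where "Q = 2 + sqrt 3 / (4 powr a - 1)"
 have "4 powr a > 1" using a by simp
 hence Q: "Q > 0" by (simp add: Q_def add_pos_nonneg)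
 define z :: real where "z = ln 2"
 have z: "z > 0" by (simp add: z_def)
 define G1 where "G1 = Gamma (a / p)"
 define G2 where "G2 = Gamma a"
 have G: "G1 > 0" "G2 > 0" using a p by (auto simp: G1_def G2_def intro!: Gamma_real_pos)
 have lpi: "ln pi >= 0" using pi_ge_two by simp
 have key: "(p - 1) / 2 * z powr (2 * a) * Q^2 <= G1 * G2 powr (1 + 2 * a)" proof -
  \<comment> \<open>The pole of Gamma at 0 is split off: \<open>Gamma (a / p)\<close> is
    \<open>Gamma (1 + a / p)\<close> divided by \<open>a / p\<close>. The remaining correction is
    small because \<open>a / p = a * (1/2 - a) <= 1/16\<close>.\<close>
  have l1: "ln G1 >= - ln 2 / 8 - ln (a / p)" proof -
   have pos: "a / p > 0" using a p by simp
   hence "Gamma (a / p + 1) = a / p * G1" unfolding G1_def by (intro Gamma_plus1) (auto elim!: nonpos_Ints_cases)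
   hence "ln (Gamma (1 + a / p)) = ln (a / p * G1)" by (simp only: add.commute)
   also have "... = ln (a / p) + ln G1" by (rule ln_mult_pos) (use pos G in auto)
   finally have "ln (Gamma (1 + a / p)) = ln (a / p) + ln G1" .
   moreover have "- (a / p) * ln pi <= ln (Gamma (1 + a / p))" using pos by (intro ln_Gamma_ge_1) simp
   moreover have "a / p * ln pi <= 1/16 * (2 * ln 2)" proof (rule mult_mono)
    have "a / p = a * (1/2 - a)" by (simp flip: ip)
    also have "... = 1/16 - (a - 1/4)^2" by (simp add: power2_eq_square field_simps)
    finally show "a / p <= 1/16" by simp
    have "ln pi <= ln (2 ^ 2)" using pi_less_4 by simp
    also have "ln (2 ^ 2 :: real) = 2 * ln 2" using ln_realpow[of 2 2] by simp
    finally show "ln pi <= 2 * ln 2" .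
   qed (use pi_ge_two in auto)
   ultimately show ?thesis by simp
  qed
  have "Gamma (a + 1) = a * G2" unfolding G2_def using a by (intro Gamma_plus1) (auto elim!: nonpos_Ints_cases)
  hence "ln (Gamma (1 + a)) = ln a + ln G2" using a G by (simp add: ln_mult add.commute)
  hence l2: "ln G2 >= (1 - a) * (ln pi - 2 * ln 2) - ln a" using ln_Gamma_ge_3[OF a] by simp
  have l3: "2 * a * ln G2 >= 2 * a * ((1 - a) * ln pi)"
   unfolding G2_def using a by (intro mult_left_mono ln_Gamma_ge_2) auto
  let ?B = "exp (- ln 2 / 8 - ln (a / p) - ln a + ln pi - 2 * ln 2 + 2 * a * ln 2)"
  have "0 <= ln pi * (a * (1 - 2 * a))" using a lpi by simp
  moreover have "(1 - a) * (ln pi - 2 * ln 2) + 2 * a * ((1 - a) * ln pi) = ln pi - 2 * ln 2 + 2 * a * ln 2 + ln pi * (a * (1 - 2 * a))"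
   by (simp add: algebra_simps)
  ultimately have "ln G1 + (1 + 2 * a) * ln G2 >= - ln 2 / 8 - ln (a / p) - ln a + ln pi - 2 * ln 2 + 2 * a * ln 2"
   using l1 l2 l3 by (simp only: distrib_right mult_1)
  hence "exp (ln G1 + (1 + 2 * a) * ln G2) >= ?B" by simp
  moreover have "exp (ln G1 + (1 + 2 * a) * ln G2) = G1 * G2 powr (1 + 2 * a)" using G by (simp add: exp_add powr_def)
  moreover have "?B = exp (- ln 2 / 8) * (pi / 4) * 4 powr a * (p / a^2)" proof -
   have "ln (4::real) = 2 * ln 2" using ln_realpow[of 2 2] by simp
   hence "(4::real) powr a = exp (2 * a * ln 2)" by (simp add: powr_def mult_ac)
   moreover have "exp (2 * ln (2::real)) = 4" using exp_of_nat_mult[of 2 "ln (2::real)"] by simp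
   ultimately show ?thesis using a p unfolding exp_add exp_diff by (simp add: power2_eq_square mult_ac)
  qed
  moreover have "exp (- ln 2 / 8) * (pi / 4) >= 71/100" proof -
   have "exp (- ln 2 / 8) >= 1 + (- ln 2 / 8 :: real)" by (rule exp_ge_add_one_self)
   hence "exp (- ln 2 / 8 :: real) >= 913/1000" using ln2_le_25_over_36 by linarith
   moreover have "pi / 4 >= 785/1000" using pi_approx by simp
   ultimately have "exp (- ln 2 / 8) * (pi / 4) >= 913/1000 * (785/1000)" by (intro mult_mono) auto
   thus ?thesis by simp
  qed
  ultimately have big: "G1 * G2 powr (1 + 2 * a) >= 71/100 * (4 powr a * (p / a^2))"
   using a p mult_right_mono[of "71/100" "exp (- ln 2 / 8) * (pi / 4)" "4 powr a * (p / a^2)"] by (simp add: mult.assoc)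
  have aQ: "2 * a + sqrt 3 * (a / (4 powr a - 1)) = a * Q" by (simp add: Q_def algebra_simps)
  let ?A = "(1/2 + a) / 2 * (z powr (2 * a) * 4 powr (- a)) * (a * Q)^2 * (4 powr a * (p / a^2))"
  have "(1/2 + a) / 2 * (z powr (2 * a) * 4 powr (- a)) * (a * Q)^2 <= 71/100"
   using numeric_bound[OF a] unfolding aQ z_def .
  hence "?A <= 71/100 * (4 powr a * (p / a^2))" using a p by (intro mult_right_mono) auto
  also have "?A = (p * (1/2 + a)) / 2 * z powr (2 * a) * Q^2"
   using a by (simp add: powr_minus power_mult_distrib field_simps)
  also have "p * (1/2 + a) = p - 1" using p by (simp add: a_def field_simps)
  finally show ?thesis using big by (rule order_trans)
 qed
 let ?C = "(z powr (2 * a)) powr (p/2) * (Q^2) powr (p/2)"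
 have "cc p powr p = kap p powr (p/2) * ?C" proof -
  have "sqrt (kap p) powr p = kap p powr (p/2)" using kap_pos[of p] p by (simp add: powr_half_sqrt[symmetric] powr_powr)
  moreover have "(z powr a) powr p = (z powr (2 * a)) powr (p/2)" by (simp add: powr_powr)
  ultimately show ?thesis using Q by (simp add: cc_def a_def[symmetric] Q_def[symmetric] z_def[symmetric] powr_mult square_powr_half)
 qed
 also have "kap p powr (p/2) = 2 * (p powr (p/2) * ((p - 1) / 2) powr (p/2))" proof -
  have "(p - 1) * p / 2 = p * ((p - 1) / 2)" by simp
  thus ?thesis using kap_powr[of p] p by (simp only: powr_mult)
 qed
 also have "2 * (p powr (p/2) * ((p - 1) / 2) powr (p/2)) * ?C = b_const p * ((p - 1) / 2 * z powr (2 * a) * Q^2) powr (p/2)"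
  unfolding b_const_def powr_mult by (simp only: mult_ac)
 also have "... <= b_const p * (G1 * G2 powr (1 + 2 * a)) powr (p/2)"
  using key p by (intro mult_left_mono powr_mono2) (auto simp: b_const_def)
 also have "(G1 * G2 powr (1 + 2 * a)) powr (p/2) = G1 powr (p/2) * G2 powr (p - 1)" proof -
  have "(1 + 2 * a) * (p/2) = p - 1" using p by (simp add: a_def field_simps)
  thus ?thesis unfolding powr_mult powr_powr by (simp only:)
 qed
 finally show ?thesis unfolding e1 e2 G1_def G2_def by (simp add: mult.assoc)
qed

text \<open>The entrywise estimate gives the power \<open>p - 1\<close> of the dimension, and
  \<open>p - 1 <= (3 * p - 4) / 2\<close> for \<open>p >= 2\<close>.\<close>

lemma C_const_ge: assumes p: "p > 2"
 shows "real CARD('d::finite) powr (p - 1) * real CARD('m::finite) powr (p - 1) * cc p powr p <= C_const p CARD('d) CARD('m)"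
proof -
 have "real CARD('d) >= 1" by (simp add: Suc_le_eq)
 hence "real CARD('d) powr (p - 1) <= real CARD('d) powr ((3 * p - 4) / 2)" using p by (intro powr_mono) auto
 hence "real CARD('d) powr (p - 1) * real CARD('m) powr (p - 1) * cc p powr p <= real CARD('d) powr ((3 * p - 4) / 2) * real CARD('m) powr (p - 1) * (b_const p * Gamma ((p - 2) / (2 * p^2)) powr (p / 2) * Gamma ((p - 2) / (2 * p)) powr (p - 1))"
  by (intro mult_mono cc_powr_le p) auto
 thus ?thesis by (simp add: C_const_def mult.assoc)
qed

section \<open>Finiteness criterion and the gamma kernels\<close>

lemma laplace_power: fixes x z :: real assumes z: "z > 0" and x: "x > 0"
 shows "(\<H> t. ennreal (t powr (z - 1) * exp (- (x * t)))) = ennreal (Gamma z * x powr (- z))"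
proof -
 let ?C = "%t. ennreal (t powr (z - 1) * exp (- (x * t)))"
 define I where "I = (\<H> t. ?C t)"
 let ?A = "%t. ennreal (indicator {0..} (0 + x * t) * (0 + x * t) powr (z - 1) / exp (0 + x * t))"
 let ?B = "ennreal (x powr (z - 1))"
 have "ennreal (Gamma z) = (\<L> t. ennreal (indicator {0..} t * t powr (z - 1) / exp t))"
  by (rule Gamma_conv_nn_integral_real[OF z])
 also have "... = ennreal (abs x) * (\<L> t. ?A t)" using x by (intro nn_integral_real_affine) auto
 also have "(\<L> t. ?A t) = (\<L> t. ?B * (?C t * indicator {0<..} t))"
 proof (rule nn_integral_cong)
  fix t
  show "?A t = ?B * (?C t * indicator {0<..} t)"
   using x by (cases "t > 0") (auto simp: indicator_def powr_mult exp_minus divide_inverse mult.assoc ennreal_mult' zero_le_mult_iff)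
 qed
 also have "... = ?B * I" unfolding I_def by (rule nn_integral_cmult) measurable
 also have "ennreal (abs x) * (?B * I) = ennreal (x powr z) * I" proof -
  have "ennreal (abs x) * ?B = ennreal (x powr z)"
   using x powr_add[of x 1 "z - 1"] by (simp add: ennreal_mult'[symmetric])
  thus ?thesis by (simp only: mult.assoc[symmetric])
 qed
 finally have eq: "ennreal (Gamma z) = ennreal (x powr z) * I" .
 have "ennreal (Gamma z * x powr (- z)) = ennreal (x powr (- z)) * ennreal (Gamma z)"
  by (subst ennreal_mult'[symmetric]) (simp_all add: mult.commute)
 also have "... = ennreal (x powr (- z)) * ennreal (x powr z) * I" unfolding eq by (simp only: mult.assoc)
 also have "ennreal (x powr (- z)) * ennreal (x powr z) = 1" using x by (simp add: ennreal_mult'[symmetric] powr_minus)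
 finally show ?thesis by (simp add: I_def)
qed

text \<open>At \<open>x = 0\<close> both sides are infinite: by monotonicity the integral dominates
  \<open>Gamma a * y powr (- a)\<close> for every \<open>y > 0\<close>. This covers a possible atom
  of a representing measure at 0.\<close>

lemma laplace_power_ge: fixes x a :: real assumes a: "a > 0" and x: "x >= 0"
 shows "ennreal (Gamma a) * epowr x (- a) <= (\<H> t. ennreal (t powr (a - 1) * exp (- (x * t))))"
proof (cases "x = 0")
 case False thus ?thesis using laplace_power[OF a, of x] x a by (simp add: epowr_def ennreal_mult)
next case True
 define I where "I = (\<H> t. ennreal (t powr (a - 1) * exp (- (0 * t))))"
 have G: "Gamma a > 0" using a by simp
 have le: "ennreal (Gamma a * y powr (- a)) <= I" if "y > 0" for y
  unfolding laplace_power[OF a that, symmetric] I_def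
  by (intro nn_integral_mono) (use that in \<open>auto simp: indicator_def intro!: ennreal_leI mult_left_mono\<close>)
 have "I = \<infinity>" proof (rule ccontr)
  assume "I ~= \<infinity>"
  then obtain r where r: "r >= 0" "I = ennreal r" by (cases I) auto
  \<comment> \<open>The point at which \<open>Gamma a * y powr (- a)\<close> equals
    \<open>r + 1\<close>.\<close>
  define y where "y = ((r + 1) / Gamma a) powr (- 1 / a)"
  have y: "y > 0" using r G by (simp add: y_def)
  have "y powr (- a) = (r + 1) / Gamma a" using a r G by (simp add: y_def powr_powr)
  hence "ennreal (r + 1) <= ennreal r" using le[OF y] G r by simp
  thus False using r by simp
 qed
 thus ?thesis using True by (simp add: I_def)
qed

lemma M_const_finite: fixes k :: "real => real"
 assumes cm: "completely_monotone_with (scalar_kernel k) y" and q: "q > 2"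
  and fin: "(\<H> t. ennreal (t powr ((q - 2) / (2 * q) - 1)) * ennreal (k t)) < \<infinity>"
 shows "M_const q y < \<infinity>" proof -
 define a where "a = (q - 2) / (2 * q)"
 have a: "a > 0" using q by (simp add: a_def)
 have ea: "(2 - q) / (2 * q) = - a" using q by (simp add: a_def field_simps)
 have "M_entry q y i j < \<infinity>" for i j proof -
  have sets: "sets (y i j) = sets (restrict_space borel {0..})"
   and k: "!!t. t > 0 ==> has_bochner_integral (y i j) (%x. exp (- x * t)) (k t)"
   using cm unfolding completely_monotone_with_def scalar_kernel_def vec_lambda_beta by blast+
  have space: "space (y i j) = {0..}"
   using sets_eq_imp_space_eq[OF sets] by (simp add: space_restrict_space)
  have "integrable (y i j) (%x. exp (- x))" using k[of 1] by (simp add: has_bochner_integral_iff)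
  then interpret sigma_finite_measure "y i j" by (rule sigma_finite_laplace[OF sets])
  interpret pair_sigma_finite lborel "y i j" ..
  have [measurable]: "(%x. x) : bmeas (y i j)"
   unfolding measurable_cong_sets[OF sets refl] by (auto simp: measurable_restrict_space1)
  let ?B = "%i j. bmeas (lborel \<Otimes> y i j)"
  have [measurable]: "(%z. snd z) : ?B i j"
   by (rule measurable_compose[OF measurable_snd]) measurable
  have nn: "(\<integral>\<^sup>+x. ennreal (exp (- x * t)) \<partial>y i j) = ennreal (k t)" if "t > 0" for t
   using k[OF that] by (simp add: has_bochner_integral_iff nn_integral_eq_integral)
  have G: "Gamma a > 0" using a by simp
  have em: "(%x. epowr x (- a)) : bmeas (y i j)" unfolding epowr_def by measurable
  let ?A = "%t x. ennreal (t powr (a - 1) * exp (- (x * t)))"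
  have "ennreal (Gamma a) * M_entry q y i j = (\<integral>\<^sup>+x. ennreal (Gamma a) * epowr x (- a) \<partial>y i j)"
   unfolding M_entry_def ea by (rule nn_integral_cmult[OF em, symmetric])
  also have "... <= (\<integral>\<^sup>+x. (\<H> t. ?A t x) \<partial>y i j)"
   by (intro nn_integral_mono laplace_power_ge[OF a]) (simp add: space)
  also have "... = (\<L> t. (\<integral>\<^sup>+x. ?A t x * indicator {0<..} t \<partial>y i j))"
  proof -
   have "(%z. ennreal (fst z powr (a - 1) * exp (- (snd z * fst z))) * indicator {0<..} (fst z)) : ?B i j"
    by measurable
   hence "(%(t, x). ?A t x * indicator {0<..} t) : ?B i j" by (simp add: case_prod_beta')
   from Fubini'[OF this] show ?thesis .
  qed
  also have "... = (\<H> t. ennreal (t powr (a - 1)) * ennreal (k t))" proof (rule nn_integral_cong)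
   fix t :: real
   show "(\<integral>\<^sup>+x. ?A t x * indicator {0<..} t \<partial>y i j) = ennreal (t powr (a - 1)) * ennreal (k t) * indicator {0<..} t"
    using nn[of t] by (cases "t > 0") (simp_all add: ennreal_mult' nn_integral_cmult)
  qed
  also have "... < \<infinity>" using fin by (simp add: a_def)
  finally show ?thesis using G by (auto simp: ennreal_mult_less_top)
 qed
 thus ?thesis unfolding M_const_def by (auto simp: less_top)
qed

lemma completely_monotoneI:
 fixes k :: "real => real" assumes sets: "sets z = sets (restrict_space borel {0..})"
  and k: "!!t. t > 0 ==> (\<integral>\<^sup>+x. ennreal (exp (- x * t)) \<partial>z) = ennreal (k t)" "!!t. t > 0 ==> k t >= 0"
 shows "completely_monotone (scalar_kernel k)"
 unfolding completely_monotone_def completely_monotone_with_def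
proof (intro exI[of _ "%_ _. z"] conjI allI impI sets)
 fix t :: real and i j :: 1 assume t: "t > 0"
 have [measurable]: "(%x. x) : bmeas z"
  unfolding measurable_cong_sets[OF sets refl] by (auto simp: measurable_restrict_space1)
 show "has_bochner_integral z (%x. exp (- x * t)) (scalar_kernel k t $ i $ j)"
  using k[OF t] by (auto simp: scalar_kernel_def intro!: has_bochner_integral_nn_integral)
qed

text \<open>\<open>t powr (H - 1/2)\<close> is the Laplace transform of the density
  \<open>x powr (z - 1) / Gamma z\<close> with \<open>z = 1/2 - H\<close>, and the factor
  \<open>exp (- \<beta> * t)\<close> shifts the measure by \<open>\<beta>\<close>. For
  \<open>H = 1/2\<close> a unit mass at \<open>\<beta>\<close> takes the place of the
  density.\<close>

lemma K_gamma_completely_monotone: assumes \<beta>: "\<beta> > 0" and H: "0 < H" "H <= 1/2"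
 shows "completely_monotone (scalar_kernel (K_gamma \<beta> H))" proof (cases "H = 1/2")
 case True show ?thesis
 proof (rule completely_monotoneI[of "return (restrict_space borel {0..}) \<beta>"])
  fix t :: real assume t: "t > 0"
  let ?A = "\<integral>\<^sup>+x. ennreal (exp (- x * t)) \<partial>return (restrict_space borel {0..}) \<beta>"
  have "?A = ennreal (exp (- \<beta> * t))"
   using \<beta> by (intro nn_integral_return) (auto simp: space_restrict_space intro!: measurable_restrict_space1)
  thus "?A = ennreal (K_gamma \<beta> H t)" using True t by (simp only: K_gamma_def) simp
 qed (simp_all add: K_gamma_def)
next case False
 define z where "z = 1/2 - H"
 have z: "z > 0" using H False by (simp add: z_def)
 have Gz: "Gamma z > 0" using z by simp
 define g where "g x = ennreal ((x - \<beta>) powr (z - 1) / Gamma z) * indicator {\<beta><..} x" for x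
 have [measurable]: "g : bmeas borel" unfolding g_def[abs_def] by measurable
 define y where "y = density (restrict_space lborel {0..}) g"
 show ?thesis proof (rule completely_monotoneI[of y])
  show "sets y = sets (restrict_space borel {0..})" by (simp add: y_def cong: sets_restrict_space_cong)
  show "K_gamma \<beta> H t >= 0" for t by (simp add: K_gamma_def)
  fix t :: real assume t: "t > 0"
  let ?B = "%x. ennreal (exp (- \<beta> * t) / Gamma z) * (ennreal (x powr (z - 1) * exp (- (t * x))) * indicator {0<..} x)"
  let ?C = "\<integral>\<^sup>+x. ennreal (exp (- x * t)) \<partial>y"
  have "?C = (\<integral>\<^sup>+x. g x * ennreal (exp (- x * t)) \<partial>restrict_space lborel {0..})"
   unfolding y_def by (rule nn_integral_density) (auto intro!: measurable_restrict_space1)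
  also have "... = (\<L> x. g x * ennreal (exp (- x * t)) * indicator {0..} x)"
   by (rule nn_integral_restrict_space) simp
  also have "... = (\<L> x. g x * ennreal (exp (- x * t)))"
   using \<beta> by (intro nn_integral_cong) (auto simp: g_def indicator_def)
  also have "... = ennreal (abs (1)) * (\<L> x. g (\<beta> + 1 * x) * ennreal (exp (- (\<beta> + 1 * x) * t)))"
   by (rule nn_integral_real_affine) simp_all
  also have "... = (\<L> x. ?B x)" proof -
   have "g (\<beta> + x) * ennreal (exp (- (\<beta> + x) * t)) = ?B x" for x proof (cases "x > 0")
    case True
    have "x powr (z - 1) / Gamma z * exp (- (\<beta> + x) * t) = exp (- \<beta> * t) / Gamma z * (x powr (z - 1) * exp (- (t * x)))"
     by (simp add: exp_diff exp_add exp_minus field_simps)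
    thus ?thesis using True Gz by (simp add: g_def ennreal_mult'[symmetric])
   qed (simp add: g_def)
   thus ?thesis by simp
  qed
  also have "... = ennreal (exp (- \<beta> * t) / Gamma z) * ennreal (Gamma z * t powr (- z))"
   by (subst nn_integral_cmult) (simp_all add: laplace_power[OF z t])
  also have "... = ennreal (K_gamma \<beta> H t)"
   using Gz by (simp add: ennreal_mult'[symmetric] K_gamma_def z_def)
  finally show "?C = ennreal (K_gamma \<beta> H t)" .
 qed
qed

text \<open>Near 0 the integrand of the criterion behaves like \<open>t powr (z - 1)\<close> with
  \<open>z = H - 1 / q\<close>, which is positive as \<open>q > 1 / H\<close>; at infinity the
  exponential takes over.\<close>

lemma K_gamma_M_const: assumes \<beta>: "\<beta> > 0" and H: "0 < H" "H <= 1/2" and q: "q > 1 / H"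
  and y: "completely_monotone_with (scalar_kernel (K_gamma \<beta> H)) y"
 shows "M_const q y < \<infinity>" proof (rule M_const_finite[OF y])
 have "2 <= 1 / H" using H by (simp add: field_simps)
 thus q2: "q > 2" using q by linarith
 define z where "z = H - 1 / q"
 have z: "z > 0" using H q q2 by (simp add: z_def field_simps)
 have e: "(q - 2) / (2 * q) - 1 + (H - 1/2) = z - 1" using q2 by (simp add: z_def field_simps)
 let ?A = "%\<beta>. \<H> t. ennreal (t powr ((q - 2) / (2 * q) - 1)) * ennreal (K_gamma \<beta> H t)"
 have "(?A \<beta>) = (\<H> t. ennreal (t powr (z - 1) * exp (- (\<beta> * t))))"
 proof (rule nn_integral_cong)
  fix t
  have "t powr ((q - 2) / (2 * q) - 1) * K_gamma \<beta> H t = t powr (z - 1) * exp (- (\<beta> * t))"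
   unfolding e[symmetric] powr_add by (simp add: K_gamma_def)
  thus "ennreal (t powr ((q - 2) / (2 * q) - 1)) * ennreal (K_gamma \<beta> H t) * indicator {0<..} t = ennreal (t powr (z - 1) * exp (- (\<beta> * t))) * indicator {0<..} t"
   by (simp add: ennreal_mult'[symmetric])
 qed
 also have "... < \<infinity>" unfolding laplace_power[OF z \<beta>] by simp
 finally show "(?A \<beta>) < \<infinity>" .
qed

section \<open>A Stieltjes transform by residues\<close>

lemma has_contour_integral_horizontal: assumes "a < b"
 shows "(f has_contour_integral I) (linepath (Complex a c) (Complex b c)) \<longleftrightarrow> ((%x. f (Complex x c)) has_integral I) {a..b}"
proof -
 have p: "linepath (Complex a c) (Complex b c) x = linepath (of_real a) (of_real b) x + Complex 0 c" for x
  by (simp add: linepath_def complex_eq_iff algebra_simps)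
 have d: "Complex b c - Complex a c = of_real b - of_real a" by (simp add: complex_eq_iff)
 have "(f has_contour_integral I) (linepath (Complex a c) (Complex b c)) \<longleftrightarrow> ((%z. f (z + Complex 0 c)) has_contour_integral I) (linepath (of_real a) (of_real b))"
  unfolding has_contour_integral_linepath p d ..
 also have "... \<longleftrightarrow> ((%x. f (of_real x + Complex 0 c)) has_integral I) {a..b}"
  using assms by (subst has_contour_integral_linepath_Reals_iff) auto
 also have "(%x. f (of_real x + Complex 0 c)) = (%x. f (Complex x c))"
  by (rule ext, rule arg_cong[of _ _ f]) (simp add: complex_eq_iff)
 finally show ?thesis .
qed

locale stieltjes_density =
 fixes al l :: real assumes al: "0 < al" "al < 1" and l: "l > 0"
begin

text \<open>The squared modulus of \<open>exp (al * x) * cis (al * pi) + l\<close>, the denominator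
  of \<open>l / (z powr al + l)\<close> on an edge of the cut.\<close>

definition dn :: "real => real" where
 "dn x = (exp (al * x))^2 + 2 * l * exp (al * x) * cos (al * pi) + l^2"

text \<open>The jump across the negative axis of \<open>z \<mapsto> l / (z powr al + l)\<close>, in the coordinate \<open>z = - exp x\<close>.\<close>

definition w :: "real => real" where
 "w x = l * sin (al * pi) / pi * exp (al * x) * exp x / dn x"

lemma theta: "0 < al * pi" "al * pi < pi" using al by auto

lemma sin_pos: "sin (al * pi) > 0" using theta by (rule sin_gt_zero)

lemma cos_bound: "abs (cos (al * pi)) < 1" proof -
 have "(sin (al * pi))^2 > 0" using sin_pos by simp
 hence "(cos (al * pi))^2 < 1^2" using sin_cos_squared_add[of "al * pi"] unfolding power_one by linarith
 thus ?thesis by (simp add: abs_square_less_1)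
qed

lemma dn_ge: "dn x >= (1 - abs (cos (al * pi))) * ((exp (al * x))^2 + l^2)" proof -
 have "2 * l * exp (al * x) <= (exp (al * x))^2 + l^2" using sum_squares_bound[of l "exp (al * x)"] by simp
 hence "abs (2 * l * exp (al * x) * cos (al * pi)) <= ((exp (al * x))^2 + l^2) * abs (cos (al * pi))"
  using l by (simp add: abs_mult mult_right_mono)
 thus ?thesis unfolding dn_def by (simp add: algebra_simps abs_le_iff)
qed

lemma dn_pos: "dn x > 0" proof -
 have "(1 - abs (cos (al * pi))) * ((exp (al * x))^2 + l^2) > 0"
  using cos_bound l by (intro mult_pos_pos add_pos_pos) auto
 thus ?thesis using dn_ge[of x] by linarith
qed

lemma w_nonneg: "w x >= 0" unfolding w_def using dn_pos[of x] sin_pos l by simp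

lemma w_continuous: "continuous_on A w"
 unfolding w_def dn_def using dn_pos[unfolded dn_def] by (intro continuous_intros) (auto simp: less_imp_neq[symmetric])

lemma w_borel[measurable]: "w : bmeas borel"
 using w_continuous[of UNIV] by (rule borel_measurable_continuous_onI)

text \<open>The function \<open>l / (z powr al + l)\<close> in the coordinate
  \<open>z = exp v\<close>: the cut plane becomes the strip \<open>abs (Im v) < pi\<close>, and the
  branch of the power is built in.\<close>

definition F :: "complex => complex" where "F v = of_real l / (exp (of_real al * v) + of_real l)"

text \<open>At a zero \<open>exp (of_real al * v)\<close> is negative, which cannot be while
  \<open>al * Im v\<close> stays strictly between \<open>- pi\<close> and \<open>pi\<close>. As
  \<open>al < 1\<close>, this strip is wider than \<open>abs (Im v) <= pi\<close>, so both edges of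
  the cut are interior to it.\<close>

lemma F_denom: assumes "abs (Im v) < pi / al" shows "exp (of_real al * v) + of_real l ~= 0"
proof
 let ?A = "exp (of_real al * v)"
 assume z: "?A + of_real l = 0"
 have b: "- pi < al * Im v" "al * Im v < pi" using assms al by (auto simp: field_simps abs_less_iff)
 have "Im (?A + of_real l) = 0" "Re (?A + of_real l) = 0" using z by simp_all
 hence s: "sin (al * Im v) = 0" and c: "exp (al * Re v) * cos (al * Im v) + l = 0"
  by (simp_all add: Im_exp Re_exp)
 have "al * Im v = 0" by (rule sin_eq_0_pi[OF b s])
 hence "exp (al * Re v) + l = 0" using c by (simp only: cos_zero mult_1_right)
 thus False using l exp_gt_zero[of "al * Re v"] by linarith
qed

context
 fixes v0 :: real
begin

text \<open>\<open>F\<close> times Cauchy's kernel \<open>dz / (z - exp v0)\<close> in the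
  coordinate \<open>z = exp v\<close>; the residue at \<open>v0\<close> is the value of
  \<open>F\<close> there.\<close>

definition G :: "complex => complex" where "G v = F v / (1 - exp (of_real v0 - v))"

lemma exp_pi: "exp (Complex x pi) = - of_real (exp x)" "exp (Complex x (- pi)) = - of_real (exp x)"
 by (simp_all add: exp_eq_polar complex_eq_iff)

text \<open>On both lines \<open>exp v\<close> is \<open>- exp x\<close>, so the kernel takes the
  same value there and only \<open>F\<close> jumps.\<close>

lemma G_jump: "G (Complex x (- pi)) - G (Complex x pi) = 2 * of_real pi * \<i> * of_real (w x / (exp x + exp v0))"
proof -
 define E where "E = complex_of_real (exp (al * x))"
 define c where "c = cis (al * pi)"
 define c' where "c' = cis (- (al * pi))"
 define L where "L = complex_of_real l"
 have cc: "c * c' = 1" by (simp add: c_def c'_def cis_mult)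
 have sum: "c + c' = 2 * of_real (cos (al * pi))" and diff: "c - c' = 2 * \<i> * of_real (sin (al * pi))"
  by (simp_all add: c_def c'_def complex_eq_iff)
 have e: "exp (of_real al * Complex x pi) = E * c" "exp (of_real al * Complex x (- pi)) = E * c'"
  by (simp_all add: exp_eq_polar E_def c_def c'_def)
 have k: "exp (of_real v0 - Complex x pi) = - of_real (exp v0 / exp x)" "exp (of_real v0 - Complex x (- pi)) = - of_real (exp v0 / exp x)"
  unfolding exp_diff exp_pi by (simp_all add: exp_of_real)
 have "pi < pi / al" using al by (simp add: field_simps)
 hence n: "E * c + L ~= 0" "E * c' + L ~= 0"
  using F_denom[of "Complex x pi"] F_denom[of "Complex x (- pi)"] by (simp_all add: e L_def)
 have D: "(E * c' + L) * (E * c + L) = of_real (dn x)" proof -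
  have "(E * c' + L) * (E * c + L) = E^2 * (c * c') + L * E * (c + c') + L^2" by (simp add: power2_eq_square algebra_simps)
  thus ?thesis unfolding cc sum by (simp add: E_def L_def dn_def)
 qed
 have "L / (E * c' + L) - L / (E * c + L) = L * E * (c - c') / of_real (dn x)"
  unfolding D[symmetric] using n by (simp add: divide_simps) (simp add: algebra_simps)
 hence "(L / (E * c' + L) - L / (E * c + L)) / (1 + of_real (exp v0 / exp x)) = L * E * (c - c') / of_real (dn x) / of_real (1 + exp v0 / exp x)"
  by simp
 also have "... = 2 * of_real pi * \<i> * of_real (w x / (exp x + exp v0))" proof -
  have "w x / (exp x + exp v0) = l * exp (al * x) * sin (al * pi) / pi / dn x / (1 + exp v0 / exp x)"
   using dn_pos[of x] by (simp add: w_def divide_simps)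
  thus ?thesis unfolding diff L_def E_def by simp
 qed
 finally show ?thesis unfolding G_def F_def e k L_def[symmetric] by (simp add: diff_divide_distrib)
qed

text \<open>The bound \<open>pi / al\<close> keeps \<open>F\<close> holomorphic;
  \<open>2 * pi\<close> leaves \<open>v0\<close> as the only zero of
  \<open>1 - exp (v0 - v)\<close>.\<close>

definition S :: "complex set" where "S = {v. abs (Im v) < min (pi / al) (2 * pi)}"

lemma S: "open S" "convex S" proof -
 have eq: "S = {v. Im v < min (pi / al) (2 * pi)} \<inter> {v. Im v > - min (pi / al) (2 * pi)}"
  by (auto simp: S_def abs_less_iff)
 show "open S" unfolding eq by (intro open_Int open_halfspace_Im_lt open_halfspace_Im_gt)
 show "convex S" unfolding eq by (intro convex_Int convex_halfspace_Im_lt convex_halfspace_Im_gt)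
qed

lemma kernel_zero: "v : S ==> 1 - exp (of_real v0 - v) = 0 ==> v = of_real v0" proof -
 assume v: "v : S" and "1 - exp (of_real v0 - v) = 0"
 hence "exp (of_real v0 - v) = 1" by simp
 then obtain n :: int where n: "v0 - Re v = 0" "- Im v = of_int (2 * n) * pi" by (auto simp: exp_eq_1)
 have "abs (of_int (2 * n) * pi) < 2 * pi" using v unfolding n(2)[symmetric] by (simp add: S_def)
 hence "abs (of_int n :: real) < 1" by (simp add: abs_mult)
 hence "n = 0" by linarith
 thus "v = of_real v0" using n by (simp add: complex_eq_iff)
qed

lemma F_holomorphic: "F holomorphic_on S"
 unfolding F_def[abs_def] by (intro holomorphic_intros F_denom) (auto simp: S_def)

lemma G_holomorphic: "G holomorphic_on S - {of_real v0}" unfolding G_def[abs_def]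
 by (intro holomorphic_intros holomorphic_on_subset[OF F_holomorphic]) (use kernel_zero in auto)

lemma v0_S: "of_real v0 : S" using al by (simp add: S_def)

lemma G_residue: "residue G (of_real v0) = of_real (l / (exp (al * v0) + l))" proof -
 have "residue (%v. F v / (1 - exp (of_real v0 - v))) (of_real v0) = F (of_real v0) / 1"
 proof (rule residue_simple_pole_deriv[OF F_holomorphic _ S(1) convex_connected[OF S(2)] v0_S])
  show "(%v. 1 - exp (of_real v0 - v)) holomorphic_on S" by (intro holomorphic_intros)
  show "((%v. 1 - exp (of_real v0 - v)) has_field_derivative 1) (at (of_real v0))"
   by (auto intro!: derivative_eq_intros)
  show "F (of_real v0) ~= 0" using F_denom[of "of_real v0"] l al by (simp add: F_def)
 qed auto
 thus ?thesis by (simp add: G_def[abs_def] F_def exp_of_real[symmetric])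
qed

text \<open>The horizontal sides together give the integral of the jump, the residue gives the main
  term, and the right-hand side bounds the two vertical sides: on the right \<open>F\<close> is
  small, on the left the kernel is.\<close>

lemma rectangle:
 assumes R: "abs v0 < R" and e1: "exp (al * R) > l" "exp R > exp v0" and e2: "exp (- al * R) < l" "exp v0 * exp R > 1"
 shows "abs (integral {-R..R} (%x. w x / (exp x + exp v0)) - l / (exp (al * v0) + l)) <= l / (exp (al * R) - l) / (1 - exp v0 / exp R) + l / (l - exp (- al * R)) / (exp v0 * exp R - 1)"
proof -
 define a1 where "a1 = Complex (- R) (- pi)"
 define a2 where "a2 = Complex R (- pi)"
 define a3 where "a3 = Complex R pi"
 define a4 where "a4 = Complex (- R) pi"
 have R0: "- R < R" using R by linarith
 have rp: "rectpath a1 a3 = linepath a1 a2 +++ linepath a2 a3 +++ linepath a3 a4 +++ linepath a4 a1"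
  by (simp add: rectpath_def Let_def a1_def a2_def a3_def a4_def)
 have "pi < pi / al" using al by (simp add: field_simps)
 hence im: "v : S" if "Im v : {-pi..pi}" for v proof -
  have "abs (Im v) <= pi" using that by auto
  hence "abs (Im v) < pi / al" "abs (Im v) < 2 * pi" using \<open>pi < pi / al\<close> pi_gt_zero by linarith+
  thus ?thesis by (simp add: S_def)
 qed
 let ?C = "path_image (rectpath a1 a3)"
 have img: "?C \<subseteq> S - {of_real v0}" proof
  fix v assume "v : ?C"
  hence "Re v : {- R, R} & Im v : {- pi..pi} | Im v : {- pi, pi} & Re v : {- R..R}"
   using R0 by (subst (asm) path_image_rectpath) (auto simp: a1_def a3_def)
  hence "Im v : {-pi..pi}" "v ~= of_real v0" using R by auto
  thus "v : S - {of_real v0}" using im by blast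
 qed
 have Gc: "continuous_on (?C) G"
  by (rule continuous_on_subset[OF holomorphic_on_imp_continuous_on[OF G_holomorphic] img])
 have pi_eq: "?C = closed_segment a1 a2 \<union> (closed_segment a2 a3 \<union> (closed_segment a3 a4 \<union> closed_segment a4 a1))"
  unfolding rp by (simp add: path_image_join)
 have ci: "G contour_integrable_on linepath a1 a2" "G contour_integrable_on linepath a2 a3" "G contour_integrable_on linepath a3 a4" "G contour_integrable_on linepath a4 a1"
  by (rule contour_integrable_continuous_linepath[OF continuous_on_subset[OF Gc]], simp add: pi_eq, blast?)+
 let ?G = "winding_number (rectpath a1 a3)"
 have wn: "?G (of_real v0) = 1"
  using R by (intro winding_number_rectpath) (auto simp: a1_def a3_def in_box_complex_iff)
 let ?E = "contour_integral (rectpath a1 a3) G"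
 have "?E = 2 * pi * \<i> * (\<Sum>p\<in>{of_real v0}. ?G p * residue G p)"
 proof (rule Residue_theorem[OF S(1) convex_connected[OF S(2)] _ G_holomorphic _ _ img])
  show "ALL z. z \<notin> S --> ?G z = 0"
   using img by (intro allI impI winding_number_zero_outside[OF _ S(2)]) auto
 qed auto
 hence res: "?E = 2 * pi * \<i> * of_real (l / (exp (al * v0) + l))"
  using wn by (simp add: G_residue)
 define Ir where "Ir = contour_integral (linepath a2 a3) G"
 define Il where "Il = contour_integral (linepath a4 a1) G"
 let ?D = "%x. w x / (exp x + exp v0)"
 define J where "J = integral {-R..R} ?D"
 let ?A = "contour_integral (linepath a1 a2)"
 have split: "?E = ?A G + (Ir + (contour_integral (linepath a3 a4) G + Il))"
  unfolding rp Ir_def Il_def using ci by simp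
 let ?B = "contour_integral (linepath a4 a3)"
 have "continuous_on (closed_segment a4 a3) G" by (rule continuous_on_subset[OF Gc]) (auto simp: pi_eq closed_segment_commute)
 hence rev: "contour_integral (linepath a3 a4) G = - ?B G"
  by (metis contour_integral_reverse_linepath minus_minus)
 have ci43: "G contour_integrable_on linepath a4 a3"
  by (rule contour_integrable_continuous_linepath) fact
 have h1: "((%x. G (Complex x (- pi))) has_integral ?A G) {-R..R}"
  using has_contour_integral_integral[OF ci(1)] unfolding a1_def a2_def has_contour_integral_horizontal[OF R0] .
 have h2: "((%x. G (Complex x pi)) has_integral ?B G) {-R..R}"
  using has_contour_integral_integral[OF ci43] unfolding a4_def a3_def has_contour_integral_horizontal[OF R0] .
 have "((%x. G (Complex x (- pi)) - G (Complex x pi)) has_integral ?A G - ?B G) {-R..R}"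
  by (rule has_integral_diff[OF h1 h2])
 moreover have "((%x. G (Complex x (- pi)) - G (Complex x pi)) has_integral 2 * of_real pi * \<i> * of_real J) {-R..R}"
 proof -
  have "continuous_on {-R..R} ?D"
   by (intro continuous_intros w_continuous) (auto simp: add_pos_pos less_imp_neq[symmetric])
  hence "(?D has_integral J) {-R..R}"
   unfolding J_def by (intro integrable_integral integrable_continuous_real)
  thus ?thesis unfolding G_jump by (intro has_integral_mult_right has_integral_of_real)
 qed
 ultimately have "?A G - ?B G = 2 * of_real pi * \<i> * of_real J" by (rule has_integral_unique)
 hence "2 * of_real pi * \<i> * of_real J + (Ir + Il) = 2 * pi * \<i> * of_real (l / (exp (al * v0) + l))"
  using split res rev by (simp add: algebra_simps)
 hence "2 * of_real pi * \<i> * of_real (J - l / (exp (al * v0) + l)) = - (Ir + Il)"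
  by (simp add: algebra_simps)
 hence "norm (2 * of_real pi * \<i> * of_real (J - l / (exp (al * v0) + l))) = norm (Ir + Il)" by (simp only: norm_minus_cancel)
 hence "2 * pi * abs (J - l / (exp (al * v0) + l)) = norm (Ir + Il)"
  by (simp only: norm_mult norm_of_real norm_ii norm_numeral) simp
 also have "... <= norm Ir + norm Il" by (rule norm_triangle_ineq)
 also have "norm Ir <= l / (exp (al * R) - l) / (1 - exp v0 / exp R) * norm (a3 - a2)"
  unfolding Ir_def proof (rule contour_integral_bound_linepath[OF ci(2)])
  have p: "exp (al * R) - l > 0" "1 - exp v0 / exp R > 0" using e1 by auto
  thus "0 <= l / (exp (al * R) - l) / (1 - exp v0 / exp R)" using l by simp
  fix v assume "v : closed_segment a2 a3"
  hence Rv: "Re v = R" using closed_segment_same_Re[of a2 a3] by (auto simp: a2_def a3_def)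
  have n1: "norm (exp (of_real al * v) + of_real l) >= exp (al * R) - l"
   using norm_diff_ineq[of "exp (of_real al * v)" "of_real l"] l Rv by (simp add: norm_exp_eq_Re)
  have n2: "norm (1 - exp (of_real v0 - v)) >= 1 - exp v0 / exp R" proof -
   have "norm (exp (of_real v0 - v)) = exp v0 / exp R" unfolding norm_exp_eq_Re by (simp add: Rv exp_diff)
   thus ?thesis using norm_triangle_ineq2[of 1 "exp (of_real v0 - v)"] by simp
  qed
  show "norm (G v) <= l / (exp (al * R) - l) / (1 - exp v0 / exp R)"
   unfolding G_def F_def norm_divide norm_of_real using l p n1 n2 by (intro frac_le) auto
 qed
 also have "norm Il <= l / (l - exp (- al * R)) / (exp v0 * exp R - 1) * norm (a1 - a4)"
  unfolding Il_def proof (rule contour_integral_bound_linepath[OF ci(4)])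
  have p: "l - exp (- al * R) > 0" "exp v0 * exp R - 1 > 0" using e2 by auto
  thus "0 <= l / (l - exp (- al * R)) / (exp v0 * exp R - 1)" using l by simp
  fix v assume "v : closed_segment a4 a1"
  hence Rv: "Re v = - R" using closed_segment_same_Re[of a4 a1] by (auto simp: a4_def a1_def)
  have n1: "norm (exp (of_real al * v) + of_real l) >= l - exp (- al * R)"
   using norm_diff_ineq[of "of_real l" "exp (of_real al * v)"] l Rv by (simp add: norm_exp_eq_Re add.commute)
  have n2: "norm (1 - exp (of_real v0 - v)) >= exp v0 * exp R - 1" proof -
   have "norm (exp (of_real v0 - v)) = exp v0 * exp R" unfolding norm_exp_eq_Re by (simp add: Rv exp_add)
   thus ?thesis using norm_triangle_ineq2[of "exp (of_real v0 - v)" 1] by (simp add: norm_minus_commute)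
  qed
  show "norm (G v) <= l / (l - exp (- al * R)) / (exp v0 * exp R - 1)"
   unfolding G_def F_def norm_divide norm_of_real using l p n1 n2 by (intro frac_le) auto
 qed
 also have "norm (a3 - a2) = 2 * pi" by (simp add: a3_def a2_def cmod_def real_sqrt_mult)
 also have "norm (a1 - a4) = 2 * pi" by (simp add: a1_def a4_def cmod_def real_sqrt_mult)
 finally have "2 * pi * abs (J - l / (exp (al * v0) + l)) <= 2 * pi * (l / (exp (al * R) - l) / (1 - exp v0 / exp R) + l / (l - exp (- al * R)) / (exp v0 * exp R - 1))"
  by (simp add: algebra_simps)
 thus ?thesis unfolding J_def by simp
qed

end

text \<open>The limit of \<open>rectangle\<close> as \<open>R\<close> grows, with
  \<open>s = exp v0\<close>.\<close>

lemma stieltjes: assumes s: "s > 0"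
 shows "(\<L> x. ennreal (w x / (exp x + s))) = ennreal (l / (s powr al + l))" proof -
 define v0 where "v0 = ln s"
 have s': "s = exp v0" using s by (simp add: v0_def)
 define h where "h x = w x / (exp x + exp v0)" for x
 have h0: "h x >= 0" for x unfolding h_def using w_nonneg[of x] by (simp add: add_nonneg_nonneg)
 have hc: "continuous_on A h" for A
  unfolding h_def by (intro continuous_intros w_continuous) (auto simp: add_pos_pos less_imp_neq[symmetric])
 define J where "J n = integral {-real n..real n} h" for n
 define B where "B R = l / (exp (al * R) - l) / (1 - exp v0 / exp R) + l / (l - exp (- al * R)) / (exp v0 * exp R - 1)" for R :: real
 have a0: "al > 0" by (rule al)
 have B: "(B \<longlongrightarrow> 0) at_top" proof -
  have "((%R. l / (exp (al * R) - l)) \<longlongrightarrow> 0) at_top" using a0 l by real_asymp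
  moreover have "((%R. 1 - s / exp R) \<longlongrightarrow> 1) at_top" by real_asymp
  moreover have "((%R. l / (l - exp (- al * R))) \<longlongrightarrow> 1) at_top" using a0 l by real_asymp
  moreover have "((%R. 1 / (s * exp R - 1)) \<longlongrightarrow> 0) at_top" using s by real_asymp
  ultimately have "((%R. l / (exp (al * R) - l) / (1 - s / exp R) + l / (l - exp (- al * R)) * (1 / (s * exp R - 1))) \<longlongrightarrow> 0 / 1 + 1 * 0) at_top"
   by (intro tendsto_add tendsto_divide tendsto_mult) auto
  thus ?thesis by (simp add: B_def[abs_def] s')
 qed
 let ?B = "%l. exp (al * v0) + l"
 have "eventually (%R. abs v0 < R) at_top" by (rule eventually_gt_at_top)
 moreover have "eventually (%R. exp (al * R) > l) at_top" using a0 by real_asymp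
 moreover have "eventually (%R. exp R > exp v0) at_top" by real_asymp
 moreover have "eventually (%R. exp (- al * R) < l) at_top" using a0 l by real_asymp
 moreover have "eventually (%R. exp v0 * exp R > 1) at_top" by real_asymp
 ultimately have "eventually (%R. abs (integral {-R..R} h - l / (?B l)) <= B R) at_top"
  unfolding B_def h_def by eventually_elim (rule rectangle)
 hence "((%R. integral {-R..R} h - l / (?B l)) \<longlongrightarrow> 0) at_top"
  by (intro Lim_null_comparison[OF _ B]) simp
 hence "((%R. integral {-R..R} h) \<longlongrightarrow> l / (?B l)) at_top" by (rule LIM_zero_cancel)
 hence J: "J \<leadsto> l / (?B l)"
  unfolding J_def by (rule filterlim_compose[OF _ filterlim_real_sequentially])
 have nnJ: "(\<L> x. ennreal (h x) * indicator {-real n..real n} x) = ennreal (J n)" for n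
  unfolding J_def by (rule nn_integral_has_integral_lebesgue'[OF h0 integrable_integral[OF integrable_continuous_real[OF hc]]])
 have [measurable]: "h : bmeas borel" using hc[of UNIV] by (rule borel_measurable_continuous_onI)
 let ?A = "\<L> x. ennreal (h x)"
 have "(%n. \<L> x. ennreal (h x) * indicator {-real n..real n} x) \<leadsto> ?A"
 proof (rule nn_integral_LIMSEQ)
  show "incseq (%n x. ennreal (h x) * indicator {-real n..real n} x)"
   by (auto simp: incseq_def le_fun_def indicator_def)
  show "(%n. ennreal (h x) * indicator {-real n..real n} x) \<leadsto> ennreal (h x)" for x
  proof (rule tendsto_eventually)
   obtain N where "abs x <= real N" using real_arch_simple by blast
   hence "ALL n>=N. ennreal (h x) * indicator {-real n..real n} x = ennreal (h x)" by (auto simp: indicator_def abs_le_iff)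
   thus "eventually (%n. ennreal (h x) * indicator {-real n..real n} x = ennreal (h x)) sequentially"
    unfolding eventually_sequentially by blast
  qed
 qed measurable
 hence "(%n. ennreal (J n)) \<leadsto> ?A" unfolding nnJ .
 moreover have "(%n. ennreal (J n)) \<leadsto> ennreal (l / (?B l))" by (rule tendsto_ennrealI[OF J])
 ultimately have "?A = ennreal (l / (?B l))" by (rule LIMSEQ_unique)
 thus ?thesis using s by (simp add: h_def s' powr_def)
qed

end

section \<open>Uniqueness of Laplace transforms\<close>

text \<open>Lerch's argument. In the variable \<open>exp (- t)\<close> the hypotheses say that
  \<open>H\<close> is orthogonal to all powers, hence, by Weierstrass approximation, to continuous
  functions. If \<open>h\<close> were positive at \<open>t\<^sub>0\<close>, a bump \<open>y\<close>
  supported in the image of a small window around \<open>t\<^sub>0\<close> would give a positive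
  integral.\<close>

lemma laplace_unique_aux: fixes h :: "real => real" assumes h: "continuous_on {0<..} h"
  and int: "!!n::nat. integrable lborel (%t. indicator {0<..} t * (exp (- (s + real n) * t) * h t))"
  and zero: "!!n::nat. (\<integral>t. indicator {0<..} t * (exp (- (s + real n) * t) * h t) \<partial>lborel) = 0"
  and t: "t\<^sub>0 > 0" shows "h t\<^sub>0 <= 0" proof (rule ccontr)
 assume "~ h t\<^sub>0 <= 0"
 hence pos: "h t\<^sub>0 > 0" by simp
 define H where "H t = indicator {0<..} t * (exp (- s * t) * h t)" for t
 have Hint: "integrable lborel H" using int[of 0] by (simp add: H_def[abs_def])
 have H_n: "indicator {0<..} t * (exp (- (s + real n) * t) * h t) = exp (- t) ^ n * H t" for n t
  by (simp add: H_def exp_add[symmetric] exp_of_nat_mult[symmetric] algebra_simps)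
 have pw: "integrable lborel (%t. exp (- t) ^ n * H t)" "(\<integral>t. exp (- t) ^ n * H t \<partial>lborel) = 0" for n
  using int[of n] zero[of n] unfolding H_n by auto
 have poly: "integrable lborel (%t. g (exp (- t)) * H t) & (\<integral>t. g (exp (- t)) * H t \<partial>lborel) = 0" if pg: "real_polynomial_function g" for g :: "real => real"
 proof -
  obtain a n where g: "g = (%x. \<Sum>i\<le>n. a i * x ^ i)" using pg unfolding real_polynomial_function_iff_sum by blast
  have e: "g (exp (- t)) * H t = (\<Sum>i\<le>n. a i * (exp (- t) ^ i * H t))" for t
   by (simp only: g sum_distrib_right mult.assoc)
  show ?thesis unfolding e by (auto intro!: Bochner_Integration.integrable_sum pw(1) simp: Bochner_Integration.integral_sum pw)
 qed
 have cont: "(\<integral>t. y (exp (- t)) * H t \<partial>lborel) = 0" if y: "continuous_on UNIV y" and yi: "integrable lborel (%t. y (exp (- t)) * H t)" for y :: "real => real"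
 proof -
  define C where "C = (\<integral>t. abs (H t) \<partial>lborel)"
  have C: "C >= 0" by (simp add: C_def)
  let ?B = "%y. abs (\<integral>t. y (exp (- t)) * H t \<partial>lborel)"
  have "?B y <= e * C" if e: "e > 0" for e proof -
   have "continuous_on {0..1} y" by (rule continuous_on_subset[OF y]) simp
   then obtain g where g: "real_polynomial_function g" "!!x. x : {0..1} ==> abs (y x - g x) < e"
    using Stone_Weierstrass_real_polynomial_function[of "{0..1}" y e] e by auto
   have "(\<integral>t. y (exp (- t)) * H t \<partial>lborel) = (\<integral>t. y (exp (- t)) * H t - g (exp (- t)) * H t \<partial>lborel)"
    using poly[OF g(1)] yi by simp
   also have "abs (...) <= (\<integral>t. abs (y (exp (- t)) * H t - g (exp (- t)) * H t) \<partial>lborel)"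
    by (rule integral_abs_bound)
   also have "... <= (\<integral>t. e * abs (H t) \<partial>lborel)" proof (rule integral_mono)
    show "integrable lborel (%t. abs (y (exp (- t)) * H t - g (exp (- t)) * H t))" using poly[OF g(1)] yi by simp
    show "integrable lborel (%t. e * abs (H t))" using Hint by simp
    fix t :: real
    show "abs (y (exp (- t)) * H t - g (exp (- t)) * H t) <= e * abs (H t)" proof (cases "t > 0")
     case True
     hence "abs (y (exp (- t)) - g (exp (- t))) <= e" using g(2)[of "exp (- t)"] by (simp add: less_imp_le)
     thus ?thesis unfolding left_diff_distrib[symmetric] abs_mult by (rule mult_right_mono) simp
    qed (simp add: H_def)
   qed
   finally show ?thesis by (simp add: C_def)
  qed
  hence le: "?B y <= e * C" if "e > 0" for e using that by blast
  have "?B y <= 0 + e" if "e > 0" for e proof -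
   have "e / (C + 1) * C <= e" using that C by (simp add: divide_le_eq algebra_simps)
   thus ?thesis using le[of "e / (C + 1)"] that C by simp
  qed
  hence "?B y <= 0" by (rule field_le_epsilon)
  thus ?thesis by simp
 qed
 have "isCont h t\<^sub>0" using h t by (simp add: continuous_on_eq_continuous_at)
 hence "eventually (%t. h t > 0) (at t\<^sub>0)" using pos by (intro order_tendstoD(1)) (auto simp: isCont_def)
 then obtain d where d: "d > 0" "!!t. t ~= t\<^sub>0 ==> dist t t\<^sub>0 < d ==> h t > 0"
  unfolding eventually_at by blast
 \<comment> \<open>The bound by \<open>t\<^sub>0\<close> keeps the window among positive
   times.\<close>
 define v where "v = min d t\<^sub>0"
 have v: "v > 0" "v <= t\<^sub>0" using d t by (auto simp: v_def)
 have hpos: "h t > 0" if "t\<^sub>0 - v < t" "t < t\<^sub>0 + v" for t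
  using d(2)[of t] pos that by (cases "t = t\<^sub>0") (auto simp: dist_real_def v_def)
 let ?A = "%v. exp (- (t\<^sub>0 - v))"
 \<comment> \<open>Positive exactly between the images of the end points of the window under
   \<open>exp (- t)\<close>, which reverses their order.\<close>
 define y where "y u = max 0 ((u - exp (- (t\<^sub>0 + v))) * (?A v - u))" for u :: real
 have yc: "continuous_on UNIV y" unfolding y_def by (intro continuous_intros)
 have y0: "y (exp (- t)) = 0" if "~ (t\<^sub>0 - v < t & t < t\<^sub>0 + v)" for t proof -
  have "t <= t\<^sub>0 - v | t\<^sub>0 + v <= t" using that by linarith
  thus ?thesis proof
   assume "t <= t\<^sub>0 - v"
   hence "0 <= exp (- t) - exp (- (t\<^sub>0 + v))" "?A v - exp (- t) <= 0" using v by auto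
   thus ?thesis unfolding y_def by (intro max_absorb1 mult_nonneg_nonpos)
  next
   assume "t\<^sub>0 + v <= t"
   hence "exp (- t) - exp (- (t\<^sub>0 + v)) <= 0" "0 <= ?A v - exp (- t)" using v by auto
   thus ?thesis unfolding y_def by (intro max_absorb1 mult_nonpos_nonneg)
  qed
 qed
 have ypos: "y (exp (- t)) > 0" if "t\<^sub>0 - v < t" "t < t\<^sub>0 + v" for t
  unfolding y_def using that by (simp add: less_max_iff_disj)
 have nn: "y (exp (- t)) * H t >= 0" for t
  using y0[of t] ypos[of t] hpos[of t] by (cases "t\<^sub>0 - v < t & t < t\<^sub>0 + v") (auto simp: H_def indicator_def less_imp_le)
 have yi: "integrable lborel (%t. y (exp (- t)) * H t)"
 proof (rule Bochner_Integration.integrable_bound[OF integrable_mult_right[OF Hint, of "?A v * ?A v"]])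
  have [measurable]: "y : bmeas borel" using yc by (rule borel_measurable_continuous_onI)
  have [measurable]: "H : bmeas borel" using borel_measurable_integrable[OF Hint] by simp
  show "(%t. y (exp (- t)) * H t) : bmeas lborel" by measurable
  have b: "abs (y (exp (- t))) <= ?A v * ?A v" for t
  proof (cases "t\<^sub>0 - v < t & t < t\<^sub>0 + v")
   case True have "(exp (- t) - exp (- (t\<^sub>0 + v))) * (?A v - exp (- t)) <= ?A v * ?A v"
    using True by (intro mult_mono) (auto intro: order_trans[of _ "exp (- t)"])
   thus ?thesis by (simp add: y_def max_def)
  qed (simp add: y0)
  show "AE t in lborel. norm (y (exp (- t)) * H t) <= norm (?A v * ?A v * H t)" proof (rule AE_I2)
   fix t
   show "norm (y (exp (- t)) * H t) <= norm (?A v * ?A v * H t)"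
    using mult_right_mono[OF b[of t], of "abs (H t)"] by (simp add: abs_mult)
  qed
 qed
 have "AE t in lborel. y (exp (- t)) * H t = 0"
  using integral_nonneg_eq_0_iff_AE[OF yi] nn cont[OF yc yi] by simp
 hence "AE t in lborel. t \<notin> {t\<^sub>0 - v<..<t\<^sub>0 + v}" proof eventually_elim
  fix t assume z: "y (exp (- t)) * H t = 0"
  show "t \<notin> {t\<^sub>0 - v<..<t\<^sub>0 + v}" proof
   assume "t : {t\<^sub>0 - v<..<t\<^sub>0 + v}"
   hence "y (exp (- t)) > 0" "h t > 0" "t > 0" using ypos hpos v by auto
   thus False using z by (simp add: H_def)
  qed
 qed
 hence "{t\<^sub>0 - v<..<t\<^sub>0 + v} : null_sets lborel" by (subst AE_iff_null_sets) auto
 hence "emeasure lborel {t\<^sub>0 - v<..<t\<^sub>0 + v} = 0" by (rule null_setsD1)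
 thus False using v by simp
qed

lemma laplace_unique: fixes h :: "real => real" assumes h: "continuous_on {0<..} h"
  and L: "!!s. s > s\<^sub>0 ==> has_bochner_integral lborel (%t. indicator {0<..} t * (exp (- s * t) * h t)) 0"
  and t: "t > 0" shows "h t = 0" proof (rule antisym)
 have L': "has_bochner_integral lborel (%t. indicator {0<..} t * (exp (- (s\<^sub>0 + 1 + real n) * t) * h t)) 0" for n
  by (rule L) simp
 show "h t <= 0"
  by (rule laplace_unique_aux[OF h _ _ t, of "s\<^sub>0 + 1"]) (use L' in \<open>auto simp: has_bochner_integral_iff\<close>)
 have L'': "has_bochner_integral lborel (%t. indicator {0<..} t * (exp (- (s\<^sub>0 + 1 + real n) * t) * - h t)) 0" for n
  using has_bochner_integral_minus[OF L'[of n]] by simp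
 have "- h t <= 0"
  by (rule laplace_unique_aux[OF continuous_on_minus[OF h] _ _ t, of "s\<^sub>0 + 1"]) (use L'' in \<open>auto simp only: has_bochner_integral_iff\<close>)
 thus "0 <= h t" by simp
qed

section \<open>The Mittag-Leffler resolvent\<close>

lemma nn_integral_exp_halfline:
 assumes "(c::real) > 0" shows "(\<H> t. ennreal (exp (- (c * t)))) = ennreal (1 / c)" proof -
 have "(\<H> t. ennreal (exp (- (c * t)))) = (\<H> t. ennreal (t powr (1 - 1) * exp (- (c * t))))"
  by (intro nn_integral_cong) (auto simp: indicator_def)
 also have "... = ennreal (Gamma 1 * c powr (- 1))" by (rule laplace_power) (use assms in auto)
 finally show ?thesis using assms by (simp add: powr_minus divide_inverse)
qed

context stieltjes_density begin

text \<open>The kernel \<open>R_resolvent l H\<close> with \<open>al = H + 1/2\<close>.\<close>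

definition r :: "real => real" where
 "r t = l * t powr (al - 1) * mittag_leffler al al (- l * t powr al)"

text \<open>The terms of the series of \<open>r\<close>, each a signed multiple of a power of
  \<open>t\<close> with an explicit Laplace transform.\<close>

definition u :: "nat => real => real" where
 "u n t = (- 1) ^ n * (l ^ Suc n / Gamma (al * real (Suc n))) * t powr (al * real (Suc n) - 1)"

lemma Gamma_pos: "Gamma (al * real (Suc n)) > 0"
 using al by (intro Gamma_real_pos mult_pos_pos) auto

lemma abs_u: "abs (u n t) = l ^ Suc n / Gamma (al * real (Suc n)) * t powr (al * real (Suc n) - 1)"
 unfolding u_def abs_mult power_abs using l Gamma_pos[of n] by (simp add: abs_mult)

lemma u_eq: "t > 0 ==> u n t = l * t powr (al - 1) * ((- l * t powr al) ^ n / Gamma (al * real n + al))"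
proof -
 assume t: "t > 0"
 have "t powr (al * real (Suc n) - 1) = t powr (al - 1) * (t powr al) ^ n"
  using t powr_add[of t "al - 1" "al * real n"] by (simp add: powr_powr powr_realpow[symmetric] algebra_simps)
 thus ?thesis
  by (simp add: u_def power_mult_distrib power_minus[of "l * t powr al"] algebra_simps)
qed

lemma u_laplace: assumes s: "s > 0"
 shows "(\<H> t. ennreal (exp (- s * t) * abs (u n t))) = ennreal ((l / s powr al) ^ Suc n)"
proof -
 define z where "z = al * real (Suc n)"
 have z: "z > 0" using al by (simp add: z_def)
 define c where "c = l ^ Suc n / Gamma z"
 have c: "c >= 0" using l Gamma_pos[of n] by (simp add: c_def z_def)
 let ?A = "%t. ennreal c * (ennreal (t powr (z - 1) * exp (- (s * t))) * indicator {0<..} t)"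
 have "(\<H> t. ennreal (exp (- s * t) * abs (u n t))) = (\<L> t. ?A t)"
 proof (rule nn_integral_cong)
  fix t
  have "exp (- s * t) * abs (u n t) = c * (t powr (z - 1) * exp (- (s * t)))" by (simp add: abs_u c_def z_def)
  thus "ennreal (exp (- s * t) * abs (u n t)) * indicator {0<..} t = ?A t"
   using c by (simp add: ennreal_mult' mult_ac)
 qed
 also have "... = ennreal c * ennreal (Gamma z * s powr (- z))"
  by (subst nn_integral_cmult) (simp_all add: laplace_power[OF z s])
 also have "... = ennreal ((l / s powr al) ^ Suc n)" proof -
  have "s powr (- z) = inverse ((s powr al) ^ Suc n)"
   using s powr_realpow[of "s powr al" "Suc n"] by (simp add: z_def powr_minus powr_powr del: power_Suc of_nat_Suc)
  hence "c * (Gamma z * s powr (- z)) = (l / s powr al) ^ Suc n"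
   using Gamma_pos[of n] by (simp add: c_def z_def[symmetric] power_mult_distrib power_inverse divide_inverse del: power_Suc of_nat_Suc)
  thus ?thesis using c by (simp add: ennreal_mult'[symmetric])
 qed
 finally show ?thesis .
qed

text \<open>Beyond this point the Laplace transforms of the terms \<open>abs (u n t)\<close> form a
  convergent geometric series.\<close>

definition s\<^sub>0 :: real where "s\<^sub>0 = l powr (1 / al)"

lemma ratio: assumes "s > s\<^sub>0" shows "s > 0" "0 < l / s powr al" "l / s powr al < 1"
proof -
 have s0: "s\<^sub>0 > 0" using l by (simp add: s\<^sub>0_def)
 show s: "s > 0" using s0 assms by simp
 have "s\<^sub>0 powr al < s powr al" using assms s0 al by (intro powr_less_mono2) auto
 moreover have "s\<^sub>0 powr al = l" using al l by (simp add: s\<^sub>0_def powr_powr)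
 ultimately show "0 < l / s powr al" "l / s powr al < 1" using l s by auto
qed

lemma u_borel[measurable]: "u n : bmeas borel" unfolding u_def[abs_def] by measurable

lemma summable_AE: "AE t in lborel. t > 0 --> summable (%n. abs (u n t))" proof -
 define s where "s = s\<^sub>0 + 1"
 have s: "s > s\<^sub>0" by (simp add: s_def)
 define q where "q = l / s powr al"
 have q: "0 < q" "q < 1" using ratio[OF s] by (auto simp: q_def)
 let ?A = "%t. \<Sum>n. ennreal (exp (- s * t) * abs (u n t)) * indicator {0<..} t"
 have "(\<L> t. (?A t)) = (\<Sum>n. ennreal (q ^ Suc n))"
  unfolding q_def u_laplace[OF ratio(1)[OF s], symmetric] by (rule nn_integral_suminf) measurable
 also have "... < \<infinity>" proof -
  have "summable (%n. q ^ Suc n)" using q by (simp add: summable_geometric summable_mult)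
  thus ?thesis using q by (subst suminf_ennreal2) auto
 qed
 finally have "(\<L> t. (?A t)) ~= \<infinity>" by simp
 hence "AE t in lborel. (?A t) ~= \<infinity>" by (intro nn_integral_PInf_AE) measurable
 thus ?thesis proof eventually_elim
  fix t assume fin: "(?A t) ~= \<infinity>"
  show "t > 0 --> summable (%n. abs (u n t))" proof
   assume "t > 0"
   hence "(\<Sum>n. ennreal (exp (- s * t) * abs (u n t))) ~= \<top>" using fin by simp
   hence "summable (%n. exp (- s * t) * abs (u n t))" by (intro summable_suminf_not_top) auto
   thus "summable (%n. abs (u n t))" by (subst (asm) summable_cmult_iff) simp
  qed
 qed
qed

text \<open>Tonelli's theorem, applied to the geometric series of Laplace transforms, makes the
  series of \<open>r\<close> converge absolutely at almost every time, in particular at some time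
  beyond \<open>T\<close>; a power series that converges absolutely at a large argument does so at
  all smaller ones. This replaces an estimate of the growth of Gamma.\<close>

lemma mittag_leffler_summable: "summable (%n. 1 / Gamma (al * real n + al) * x ^ n)"
proof -
 define T where "T = (abs x / l) powr (1 / al) + 1"
 let ?B = "%t. summable (%n. abs (u n t))"
 have "EX t. t > T & ?B t" proof (rule ccontr)
  assume no: "~ (EX t. t > T & ?B t)"
  have "AE t in lborel. t \<notin> {T<..<T + 1}" using summable_AE proof eventually_elim
   fix t assume "t > 0 --> ?B t"
   moreover have "T > 0" by (simp add: T_def add_nonneg_pos)
   ultimately show "t \<notin> {T<..<T + 1}" using no by auto
  qed
  hence "{T<..<T + 1} : null_sets lborel" by (subst AE_iff_null_sets) auto
  hence "emeasure lborel {T<..<T + 1} = 0" by (rule null_setsD1)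
  thus False by simp
 qed
 then obtain t where t: "t > T" "?B t" by blast
 have T0: "T > 0" by (simp add: T_def add_nonneg_pos)
 hence t0: "t > 0" using t by simp
 have "(abs x / l) powr (1 / al) <= t" using t(1) by (simp add: T_def)
 hence "((abs x / l) powr (1 / al)) powr al <= t powr al" using al by (intro powr_mono2) auto
 moreover have "((abs x / l) powr (1 / al)) powr al = abs x / l" using al l by (simp add: powr_powr)
 ultimately have "abs x / l <= t powr al" by simp
 hence xt: "abs x <= l * t powr al" using l by (simp add: divide_le_eq mult.commute)
 define k where "k = l * t powr (al - 1)"
 have k: "k > 0" using l t0 by (simp add: k_def)
 let ?A = "%n. Gamma (al * real n + al)"
 have g: "?A n > 0" for n using Gamma_pos[of n] by (simp add: algebra_simps)
 have "abs (u n t) = k * (1 / ?A n * (l * t powr al) ^ n)" for n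
  unfolding u_eq[OF t0] k_def using l g[of n] by (simp add: abs_mult power_abs)
 hence "summable (%n. 1 / ?A n * (l * t powr al) ^ n)"
  using t(2) k by (simp only: summable_cmult_iff) simp
 thus ?thesis proof (rule summable_comparison_test')
  fix n :: nat
  show "norm (1 / ?A n * x ^ n) <= 1 / ?A n * (l * t powr al) ^ n"
   using g[of n] xt by (simp add: abs_mult power_abs divide_right_mono power_mono)
 qed
qed

lemma r_sums: assumes "t > 0" shows "(%n. u n t) sums r t" proof -
 have "(%n. 1 / Gamma (al * real n + al) * (- l * t powr al) ^ n) sums mittag_leffler al al (- l * t powr al)"
  using mittag_leffler_summable[of "- l * t powr al"] by (simp add: mittag_leffler_def summable_sums)
 from sums_mult[OF this, of "l * t powr (al - 1)"] show ?thesis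
  by (simp add: u_eq[OF assms] r_def)
qed

lemma r_continuous: "continuous_on {0<..} r" proof -
 have "isCont (%x. \<Sum>n. 1 / Gamma (al * real n + al) * x ^ n) x" for x
  by (rule isCont_powser_converges_everywhere) (rule mittag_leffler_summable)
 hence c: "continuous_on UNIV (mittag_leffler al al)"
  unfolding mittag_leffler_def[abs_def] by (simp add: continuous_on_eq_continuous_at)
 show ?thesis unfolding r_def by (intro continuous_intros continuous_on_compose2[OF c]) auto
qed

text \<open>Termwise integration, legitimate for \<open>s > s\<^sub>0\<close>: the geometric series
  with ratio \<open>- q\<close> sums to \<open>q / (1 + q)\<close>.\<close>

lemma r_laplace: assumes s: "s > s\<^sub>0"
 shows "has_bochner_integral lborel (%t. indicator {0<..} t * (exp (- s * t) * r t)) (l / (s powr al + l))"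
proof -
 define q where "q = l / s powr al"
 have q: "0 < q" "q < 1" and s0: "s > 0" using ratio[OF s] by (auto simp: q_def)
 define f where "f n t = indicator {0<..} t * (exp (- s * t) * u n t)" for n t
 have [measurable]: "f n : bmeas borel" for n unfolding f_def[abs_def] by measurable
 have nf: "(\<L> t. ennreal (abs (f n t))) = ennreal (q ^ Suc n)" for n
  unfolding q_def u_laplace[OF s0, symmetric]
  by (intro nn_integral_cong) (auto simp: f_def abs_mult indicator_def)
 have fi: "integrable lborel (f n)" for n using nf[of n] by (intro integrableI_bounded) auto
 have fn: "(\<integral>t. norm (f n t) \<partial>lborel) = q ^ Suc n" for n
  using nf[of n] q by (subst integral_eq_nn_integral) auto
 have f_int: "(\<integral>t. f n t \<partial>lborel) = (- 1) ^ n * q ^ Suc n" for n proof -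
  have "f n t = (- 1) ^ n * norm (f n t)" for t proof -
   have "u n t = (- 1) ^ n * abs (u n t)" by (subst abs_u) (simp add: u_def)
   hence "f n t = indicator {0<..} t * (exp (- s * t) * ((- 1) ^ n * abs (u n t)))" unfolding f_def by (rule arg_cong)
   moreover have "norm (f n t) = indicator {0<..} t * (exp (- s * t) * abs (u n t))" by (simp add: f_def abs_mult)
   ultimately show ?thesis by (simp only: mult_ac)
  qed
  hence "(\<integral>t. f n t \<partial>lborel) = (\<integral>t. (- 1) ^ n * norm (f n t) \<partial>lborel)" by (intro Bochner_Integration.integral_cong) auto
  thus ?thesis by (simp only: integral_mult_right_zero fn)
 qed
 have AE: "AE t in lborel. summable (%n. norm (f n t))" using summable_AE proof eventually_elim
  fix t assume "t > 0 --> summable (%n. abs (u n t))"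
  thus "summable (%n. norm (f n t))"
   by (cases "t > 0") (auto simp: f_def abs_mult intro: summable_mult)
 qed
 have sum: "summable (%n. \<integral>t. norm (f n t) \<partial>lborel)"
  unfolding fn using q by (simp add: summable_geometric summable_mult)
 have eq: "(\<Sum>n. f n t) = indicator {0<..} t * (exp (- s * t) * r t)" for t
 proof (cases "t > 0")
  case True
  have "(%n. exp (- s * t) * u n t) sums (exp (- s * t) * r t)" by (rule sums_mult[OF r_sums[OF True]])
  thus ?thesis using True by (simp add: f_def sums_iff)
 qed (simp add: f_def)
 have "(%n. (- 1) ^ n * q ^ Suc n) sums (l / (s powr al + l))" proof -
  have "(%n. q * (- q) ^ n) sums (q * (1 / (1 - (- q))))" by (intro sums_mult geometric_sums) (use q in auto)
  moreover have "q * (- q) ^ n = (- 1) ^ n * q ^ Suc n" for n by (subst power_minus) simp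
  moreover have "q * (1 / (1 - (- q))) = l / (s powr al + l)"
   using s0 l by (simp add: q_def divide_simps)
  ultimately show ?thesis by simp
 qed
 moreover have "(%n. (- 1) ^ n * q ^ Suc n) sums (\<integral>t. (\<Sum>n. f n t) \<partial>lborel)"
  using sums_integral[OF fi AE sum] unfolding f_int .
 ultimately have "(\<integral>t. (\<Sum>n. f n t) \<partial>lborel) = l / (s powr al + l)" by (rule sums_unique2[symmetric])
 moreover have "integrable lborel (%t. \<Sum>n. f n t)" by (rule integrable_suminf[OF fi AE sum])
 ultimately show ?thesis unfolding eq has_bochner_integral_iff by simp
qed

text \<open>With \<open>y = exp x\<close>, the factor \<open>exp (- y * t)\<close> is at most a
  multiple of \<open>1 / (y + 1)\<close>, and \<open>w x / (exp x + 1)\<close> is integrable by the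
  case \<open>s = 1\<close> of \<open>stieltjes\<close>.\<close>

lemma w_exp_integrable: assumes t: "t > 0" shows "integrable lborel (%x. exp (- exp x * t) * w x)"
proof (rule integrableI_bounded)
 show "(%x. exp (- exp x * t) * w x) : bmeas lborel" by measurable
 have "exp (- exp x * t) <= (1 / t + 1) / (exp x + 1)" for x :: real proof -
  define y where "y = exp x"
  have y: "y > 0" by (simp add: y_def)
  have "y * t <= exp (y * t)" using exp_ge_add_one_self[of "y * t"] by linarith
  hence "y <= exp (y * t) / t" using t by (simp add: le_divide_eq)
  moreover have "1 <= exp (y * t)" using y t by simp
  moreover have "exp (y * t) * (1 / t + 1) = exp (y * t) / t + exp (y * t)" by (simp add: distrib_left)
  ultimately have "y + 1 <= exp (y * t) * (1 / t + 1)" by linarith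
  hence "(y + 1) * exp (- (y * t)) <= exp (y * t) * (1 / t + 1) * exp (- (y * t))" by (intro mult_right_mono) auto
  also have "... = 1 / t + 1" by (simp add: exp_minus)
  finally have "exp (- (y * t)) <= (1 / t + 1) / (y + 1)" using y by (simp add: le_divide_eq mult.commute)
  thus ?thesis by (simp add: y_def)
 qed
 hence le: "exp (- exp x * t) * w x <= (1 / t + 1) * (w x / (exp x + 1))" for x
  using w_nonneg[of x] mult_right_mono[of "exp (- exp x * t)" "(1 / t + 1) / (exp x + 1)" "w x"] by simp
 let ?A = "%x. ennreal (norm (exp (- exp x * t) * w x))"
 let ?B = "%t x. ennreal (1 / t + 1) * ennreal (w x / (exp x + 1))"
 have "(\<L> x. ?A x) <= (\<L> x. ?B t x)" proof (rule nn_integral_mono)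
  fix x
  show "?A x <= ?B t x" proof -
   have "?A x <= ennreal ((1 / t + 1) * (w x / (exp x + 1)))"
    using le[of x] w_nonneg[of x] by (intro ennreal_leI) (simp add: abs_mult)
   also have "... = ?B t x" by (rule ennreal_mult') (use t in simp)
   finally show ?thesis .
  qed
 qed
 also have "... = ennreal (1 / t + 1) * ennreal (l / (1 powr al + l))"
  by (subst nn_integral_cmult) (simp_all add: stieltjes)
 also have "... < \<infinity>" by (simp add: ennreal_mult_less_top)
 finally show "(\<L> x. ?A x) < \<infinity>" .
qed

text \<open>The Laplace transform of the measure with density \<open>w\<close>, carried over to the
  half-line by \<open>exp\<close>.\<close>

definition g :: "real => real" where "g t = (\<integral>x. exp (- exp x * t) * w x \<partial>lborel)"

lemma g_nn: "t > 0 ==> (\<L> x. ennreal (exp (- exp x * t) * w x)) = ennreal (g t)"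
 unfolding g_def by (rule nn_integral_eq_integral[OF w_exp_integrable]) (simp_all add: w_nonneg)

lemma g_nonneg: "g t >= 0" unfolding g_def by (rule Bochner_Integration.integral_nonneg) (simp add: w_nonneg)

lemma g_continuous: "continuous_on {0<..} g" unfolding continuous_on_sequentially
proof (intro allI ballI impI)
 fix X :: "nat => real" and t assume t: "t : {0<..}" and X: "(ALL n. X n : {0<..}) & X \<leadsto> t"
 have "eventually (%n. X n > t / 2) sequentially" using X t by (intro order_tendstoD(1)[of X t]) auto
 then obtain N where N: "!!n. n >= N ==> X n > t / 2" unfolding eventually_sequentially by blast
 have "(%n. g (X (n + N))) \<leadsto> g t" unfolding g_def
 proof (rule integral_dominated_convergence)
  show "integrable lborel (%x. exp (- exp x * (t / 2)) * w x)" by (rule w_exp_integrable) (use t in simp)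
  show "AE x in lborel. (%n. exp (- exp x * X (n + N)) * w x) \<leadsto> exp (- exp x * t) * w x"
   using X LIMSEQ_ignore_initial_segment[of X t N] by (intro AE_I2 tendsto_intros) auto
  show "AE x in lborel. norm (exp (- exp x * X (n + N)) * w x) <= exp (- exp x * (t / 2)) * w x" for n
   using N[of "n + N"] by (intro AE_I2) (auto simp: abs_mult w_nonneg intro!: mult_right_mono)
 qed measurable
 hence "(%n. g (X n)) \<leadsto> g t" by (rule LIMSEQ_offset)
 thus "(g \<circ> X) \<leadsto> g t" by (simp add: o_def)
qed

text \<open>The Laplace transform of a Laplace transform is a Stieltjes transform: Tonelli's theorem
  reduces the claim to \<open>stieltjes\<close>.\<close>

lemma g_laplace: assumes s: "s > 0"
 shows "has_bochner_integral lborel (%t. indicator {0<..} t * (exp (- s * t) * g t)) (l / (s powr al + l))"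
proof (rule has_bochner_integral_nn_integral)
 have [measurable]: "(%t. \<integral>x. exp (- exp x * t) * w x \<partial>lborel) : bmeas borel" by measurable
 show "(%t. indicator {0<..} t * (exp (- s * t) * g t)) : bmeas lborel"
  unfolding g_def by measurable
 show "AE t in lborel. 0 <= indicator {0<..} t * (exp (- s * t) * g t)" using g_nonneg by simp
 show "0 <= l / (s powr al + l)" using l by (simp add: add_nonneg_nonneg)
 let ?A = "%x t. ennreal (w x) * (ennreal (exp (- ((exp x + s) * t))) * indicator {0<..} t)"
 let ?B = "%t s. ennreal (indicator {0<..} t * (exp (- s * t) * g t))"
 have "(\<L> t. ?B t s) = (\<L> t. (\<L> x. ?A x t))" proof (rule nn_integral_cong)
  fix t :: real
  show "?B t s = (\<L> x. ?A x t)" proof (cases "t > 0")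
   case True
   have "ennreal (exp (- s * t) * g t) = ennreal (exp (- s * t)) * (\<L> x. ennreal (exp (- exp x * t) * w x))"
    unfolding g_nn[OF True] by (rule ennreal_mult') simp
   also have "... = (\<L> x. ennreal (exp (- s * t)) * ennreal (exp (- exp x * t) * w x))"
    by (rule nn_integral_cmult[symmetric]) measurable
   also have "... = (\<L> x. ennreal (w x) * ennreal (exp (- ((exp x + s) * t))))"
   proof (rule nn_integral_cong)
    fix x
    have "exp (- s * t) * (exp (- exp x * t) * w x) = w x * exp (- ((exp x + s) * t))"
     by (simp add: distrib_right exp_add exp_diff exp_minus field_simps)
    thus "ennreal (exp (- s * t)) * ennreal (exp (- exp x * t) * w x) = ennreal (w x) * ennreal (exp (- ((exp x + s) * t)))"
     using w_nonneg[of x] by (simp add: ennreal_mult'[symmetric])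
   qed
   finally show ?thesis using True by simp
  qed simp
 qed
 also have "... = (\<L> x. (\<L> t. ?A x t))" by (rule lborel_pair.Fubini') measurable
 also have "... = (\<L> x. ennreal (w x / (exp x + s)))" proof (rule nn_integral_cong)
  fix x
  have p: "exp x + s > 0" using s by (simp add: add_pos_pos)
  have "(\<L> t. ?A x t) = ennreal (w x) * ennreal (1 / (exp x + s))"
   by (subst nn_integral_cmult) (simp_all add: nn_integral_exp_halfline[OF p])
  also have "... = ennreal (w x / (exp x + s))" using w_nonneg[of x] by (simp add: ennreal_mult'[symmetric])
  finally show "(\<L> t. ?A x t) = ennreal (w x / (exp x + s))" .
 qed
 also have "... = ennreal (l / (s powr al + l))" by (rule stieltjes[OF s])
 finally show "(\<L> t. ?B t s) = ennreal (l / (s powr al + l))" .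
qed

text \<open>Both are continuous and have the Laplace transform \<open>l / (s powr al + l)\<close>
  for \<open>s > s\<^sub>0\<close>.\<close>

lemma r_eq_g: assumes "t > 0" shows "r t = g t" proof -
 have "r t - g t = 0" proof (rule laplace_unique[OF _ _ assms])
  show "continuous_on {0<..} (%t. r t - g t)" by (intro continuous_on_diff r_continuous g_continuous)
  fix s assume s: "s > s\<^sub>0"
  from has_bochner_integral_diff[OF r_laplace[OF s] g_laplace[OF ratio(1)[OF s]]]
  show "has_bochner_integral lborel (%t. indicator {0<..} t * (exp (- s * t) * (r t - g t))) 0"
   by (simp add: algebra_simps)
 qed
 thus ?thesis by simp
qed

lemma r_completely_monotone: "completely_monotone (scalar_kernel r)"
proof (rule completely_monotoneI[of "distr (density lborel w) (restrict_space borel {0..}) exp"])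
 fix t :: real assume t: "t > 0"
 show "r t >= 0" unfolding r_eq_g[OF t] by (rule g_nonneg)
 have [measurable]: "exp : measurable borel (restrict_space borel {0::real..})" by (intro measurable_restrict_space2) auto
 have m: "(%x. ennreal (exp (- x * t))) : bmeas (restrict_space borel {0..})" by (intro measurable_restrict_space1) measurable
 let ?A = "%t. \<integral>\<^sup>+x. ennreal (exp (- x * t)) \<partial>distr (density lborel w) (restrict_space borel {0..}) exp"
 have "(?A t) = (\<integral>\<^sup>+x. ennreal (exp (- exp x * t)) \<partial>density lborel w)"
  using m by (intro nn_integral_distr) simp_all
 also have "... = (\<L> x. ennreal (exp (- exp x * t) * w x))"
  by (subst nn_integral_density) (auto simp: ennreal_mult'[symmetric] mult.commute w_nonneg)
 also have "... = ennreal (r t)" unfolding r_eq_g[OF t] by (rule g_nn[OF t])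
 finally show "(?A t) = ennreal (r t)" .
qed simp

end

lemma nn_integral_exp_abs: assumes c: "(c::real) > 0" shows "(\<L> x. ennreal (exp (- (c * abs x)))) < \<infinity>"
proof -
 define p where "p x = ennreal (exp (- (c * x))) * indicator {0<..} x" for x :: real
 have [measurable]: "p : bmeas borel" unfolding p_def[abs_def] by measurable
 have "(\<L> x. ennreal (exp (- (c * abs x)))) <= (\<L> x. p x + p (0 + (- 1) * x))"
 proof (rule nn_integral_mono_AE)
  have "AE x in lborel. x ~= (0::real)" by (rule AE_I[of _ _ "{0}"]) auto
  thus "AE x in lborel. ennreal (exp (- (c * abs x))) <= p x + p (0 + (- 1) * x)"
   by eventually_elim (auto simp: p_def indicator_def)
 qed
 also have "... = (\<L> x. p x) + (\<L> x. p (0 + (- 1) * x))" by (rule nn_integral_add) measurable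
 also have "(\<L> x. p (0 + (- 1) * x)) = (\<L> x. p x)"
  using nn_integral_real_affine[of p "- 1" 0] by simp
 also have "(\<L> x. p x) = ennreal (1 / c)" unfolding p_def by (rule nn_integral_exp_halfline[OF c])
 also have "ennreal (1 / c) + ennreal (1 / c) < \<infinity>" by simp
 finally show ?thesis .
qed

context stieltjes_density begin

text \<open>The two bounds describe the two ends: towards minus infinity the denominator
  \<open>dn x\<close> is of order \<open>l^2\<close>, towards infinity of order
  \<open>exp (2 * al * x)\<close>.\<close>

lemma w_le: "EX C>=0. ALL x. w x <= C * exp ((1 + al) * x) & w x <= C * exp ((1 - al) * x)"
proof -
 define k where "k = 1 - abs (cos (al * pi))"
 have k: "k > 0" using cos_bound by (simp add: k_def)
 define c where "c = l * sin (al * pi) / pi"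
 have c: "c > 0" using l sin_pos by (simp add: c_def)
 define C where "C = max (c / (k * l^2)) (c / k)"
 let ?A = "%x. exp ((1 + al) * x)"
 let ?B = "%x. exp ((1 - al) * x)"
 have "w x <= C * ?A x & w x <= C * ?B x" for x proof -
  have d1: "dn x >= k * l^2" and d2: "dn x >= k * (exp (al * x))^2"
   using dn_ge[of x] k by (auto simp: k_def[symmetric] distrib_left add_increasing add_increasing2 intro: order_trans[rotated])
  have wx: "w x = c * ?A x / dn x" by (simp add: w_def c_def distrib_right exp_add)
  have "w x <= c * ?A x / (k * l^2)"
   unfolding wx using d1 c k l by (intro divide_left_mono mult_pos_pos) (auto intro: dn_pos)
  also have "... = c / (k * l^2) * ?A x" by simp
  also have "... <= C * ?A x" by (intro mult_right_mono) (auto simp: C_def)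
  finally have 1: "w x <= C * ?A x" .
  have "w x <= c * ?A x / (k * (exp (al * x))^2)"
   unfolding wx using d2 c k by (intro divide_left_mono mult_pos_pos) (auto intro: dn_pos)
  also have "... = c / k * ?B x" proof -
   have "?A x = ?B x * (exp (al * x))^2"
    unfolding exp_double[symmetric] exp_add[symmetric] by (simp add: algebra_simps)
   thus ?thesis by simp
  qed
  also have "... <= C * ?B x" by (intro mult_right_mono) (auto simp: C_def)
  finally show ?thesis using 1 by blast
 qed
 moreover have "C >= 0" using c k by (simp add: C_def max_def)
 ultimately show ?thesis by blast
qed

text \<open>By Tonelli the criterion becomes finiteness of the integral of
  \<open>w x * exp (- (a * x))\<close>. It converges at minus infinity because
  \<open>a < 1 + al\<close>, and at infinity because \<open>1 - al < a\<close>, which is the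
  hypothesis \<open>1 / q < al - 1/2\<close>.\<close>

lemma r_M_const:
 assumes q: "q > 2" "1 / q < al - 1/2" and \<nu>: "completely_monotone_with (scalar_kernel r) \<nu>"
 shows "M_const q \<nu> < \<infinity>" proof (rule M_const_finite[OF \<nu> q(1)])
 define a where "a = (q - 2) / (2 * q)"
 have a_eq: "a = 1/2 - 1/q" using q by (simp add: a_def field_simps)
 have "1 / q > 0" using q by simp
 hence a: "0 < a" "a < 1" "1 - al < a" using q al unfolding a_eq by (simp_all add: field_simps)
 obtain C where C: "C >= 0" "!!x. w x <= C * exp ((1 + al) * x)" "!!x. w x <= C * exp ((1 - al) * x)" using w_le by blast
 \<comment> \<open>The slower of the two rates of decay.\<close>
 define c where "c = min (1 + al - a) (a - (1 - al))"
 have c: "c > 0" using a al by (simp add: c_def)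
 let ?B = "%x. exp (- (c * abs x))"
 have le: "w x * exp (- (a * x)) <= C * ?B x" for x proof (cases "x >= 0")
  case True
  have "w x * exp (- (a * x)) <= C * exp ((1 - al) * x) * exp (- (a * x))" by (intro mult_right_mono C) simp
  also have "... = C * exp (- ((a - (1 - al)) * x))" unfolding mult.assoc exp_add[symmetric] by (simp add: algebra_simps)
  also have "... <= C * ?B x"
   using True C(1) by (intro mult_left_mono) (auto simp: c_def intro!: mult_right_mono)
  finally show ?thesis .
 next case False
  have "w x * exp (- (a * x)) <= C * exp ((1 + al) * x) * exp (- (a * x))" by (intro mult_right_mono C) simp
  also have "... = C * exp (- ((1 + al - a) * abs x))" unfolding mult.assoc exp_add[symmetric] using False by (simp add: algebra_simps)
  also have "... <= C * ?B x"
   using C(1) by (intro mult_left_mono) (auto simp: c_def intro!: mult_right_mono)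
  finally show ?thesis .
 qed
 let ?A = "%x t. ennreal (w x) * (ennreal (t powr (a - 1) * exp (- (exp x * t))) * indicator {0<..} t)"
 let ?C = "%t. ennreal (t powr (a - 1))"
 have "(\<H> t. ?C t * ennreal (r t)) = (\<L> t. (\<L> x. ?A x t))" proof (rule nn_integral_cong)
  fix t :: real
  show "?C t * ennreal (r t) * indicator {0<..} t = (\<L> x. ?A x t)" proof (cases "t > 0")
   case True have "?C t * ennreal (r t) = ?C t * (\<L> x. ennreal (exp (- exp x * t) * w x))"
    unfolding r_eq_g[OF True] g_nn[OF True] ..
   also have "... = (\<L> x. ?C t * ennreal (exp (- exp x * t) * w x))"
    by (rule nn_integral_cmult[symmetric]) measurable
   also have "... = (\<L> x. ennreal (w x) * ennreal (t powr (a - 1) * exp (- (exp x * t))))"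
    by (rule nn_integral_cong) (simp add: ennreal_mult'[symmetric] w_nonneg mult_ac)
   finally show ?thesis using True by simp
  qed simp
 qed
 also have "... = (\<L> x. (\<L> t. ?A x t))" by (rule lborel_pair.Fubini') measurable
 also have "... <= (\<L> x. ennreal (Gamma a * C) * ennreal (?B x))" proof (rule nn_integral_mono)
  fix x :: real
  have G: "Gamma a > 0" using a by simp
  have "(\<L> t. ?A x t) = ennreal (w x) * ennreal (Gamma a * exp x powr (- a))"
   by (subst nn_integral_cmult) (simp_all add: laplace_power[OF a(1)])
  also have "... = ennreal (Gamma a * (w x * exp (- (a * x))))"
   using w_nonneg[of x] by (simp add: ennreal_mult'[symmetric] powr_def mult_ac)
  also have "... <= ennreal (Gamma a * (C * ?B x))"
   using G by (intro ennreal_leI mult_left_mono le) simp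
  also have "... = ennreal (Gamma a * C) * ennreal (?B x)"
   unfolding mult.assoc[symmetric] by (rule ennreal_mult') (use G C(1) in simp)
  finally show "(\<L> t. ?A x t) <= ennreal (Gamma a * C) * ennreal (?B x)" .
 qed
 also have "... = ennreal (Gamma a * C) * (\<L> x. ennreal (?B x))" by (rule nn_integral_cmult) measurable
 also have "... < \<infinity>" using nn_integral_exp_abs[OF c] by (simp add: ennreal_mult_less_top)
 finally show "(\<H> t. ennreal (t powr ((q - 2) / (2 * q) - 1)) * ennreal (r t)) < \<infinity>" unfolding a_def .
qed

end

lemma R_resolvent_completely_monotone: assumes H: "0 < H" "H < 1/2" and l: "l > 0"
 shows "completely_monotone (scalar_kernel (R_resolvent l H))"
  and "q > 1 / H ==> completely_monotone_with (scalar_kernel (R_resolvent l H)) z ==> M_const q z < \<infinity>"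
proof -
 interpret stieltjes_density "H + 1/2" l by unfold_locales (use H l in auto)
 have r: "R_resolvent l H = r" by (rule ext) (simp add: r_def R_resolvent_def)
 show "completely_monotone (scalar_kernel (R_resolvent l H))" unfolding r by (rule r_completely_monotone)
 assume q: "q > 1 / H" and z: "completely_monotone_with (scalar_kernel (R_resolvent l H)) z"
 have "2 < 1 / H" using H by (simp add: field_simps)
 hence q2: "q > 2" using q by linarith
 hence "1 / q < H + 1/2 - 1/2" using q H by (simp add: field_simps)
 thus "M_const q z < \<infinity>" by (rule r_M_const[OF q2 _ z[unfolded r]])
qed

theorem proposition2p5:
  fixes M :: "'a measure" and F :: "real \<Rightarrow> 'a measure"
    and W :: "real \<Rightarrow> 'a \<Rightarrow> real ^ 'm"
    and \<phi> :: "real \<Rightarrow> 'a \<Rightarrow> real ^ 'm ^ 'd"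
    and K :: "real \<Rightarrow> real ^ 'd ^ 'd" and \<mu> :: "'d \<Rightarrow> 'd \<Rightarrow> real measure"
    and p :: real
  shows
    "(filtered_prob_space M F \<and> usual_conditions M F \<and> brownian_motion M F W \<and>
      p > 2 \<and> previsible M F \<phi> \<and>
      (\<integral>\<^sup>+ s\<in>{0..}. (\<integral>\<^sup>+ \<omega>. ennreal (norm (\<phi> s \<omega>) powr p) \<partial>M) \<partial>lborel) < \<infinity> \<and>
      completely_monotone_with K \<mu> \<and> M_const p \<mu> < \<infinity>
      \<longrightarrow>
      (\<exists>X. continuous_stoch_convolution M F W K \<phi> X) \<and>
      (\<forall>X. continuous_stoch_convolution M F W K \<phi> X \<longrightarrow>
         (\<integral>\<^sup>+ \<omega>. (SUP t\<in>{0..}. ennreal (norm (X t \<omega>) powr p)) \<partial>M)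
         \<le> ennreal (C_const p CARD('d) CARD('m) * enn2real (M_const p \<mu>) powr p) *
            (\<integral>\<^sup>+ s\<in>{0..}. (\<integral>\<^sup>+ \<omega>. ennreal (norm (\<phi> s \<omega>) powr p) \<partial>M) \<partial>lborel)))
     \<and>
     (\<forall>\<beta> H. \<beta> > 0 \<and> 0 < H \<and> H \<le> 1/2 \<longrightarrow>
        completely_monotone (scalar_kernel (K_gamma \<beta> H)) \<and>
        (\<forall>\<nu>. completely_monotone_with (scalar_kernel (K_gamma \<beta> H)) \<nu> \<longrightarrow>
           (\<forall>q. q > 1 / H \<longrightarrow> M_const q \<nu> < \<infinity>)))
     \<and>
     (\<forall>H l. 0 < H \<and> H < 1/2 \<and> l > 0 \<longrightarrow>
        completely_monotone (scalar_kernel (R_resolvent l H)) \<and>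
        (\<forall>\<nu>. completely_monotone_with (scalar_kernel (R_resolvent l H)) \<nu> \<longrightarrow>
           (\<forall>q. q > 1 / H \<longrightarrow> M_const q \<nu> < \<infinity>)))"
proof (intro conjI allI impI)
  assume A: "filtered_prob_space M F & usual_conditions M F & brownian_motion M F W \<and>
      p > 2 & previsible M F \<phi> \<and>
      (\<integral>\<^sup>+ s\<in>{0..}. (\<integral>\<^sup>+ \<omega>. ennreal (norm (\<phi> s \<omega>) powr p) \<partial>M) \<partial>lborel) < \<infinity> \<and>
      completely_monotone_with K \<mu> & M_const p \<mu> < \<infinity>"
  then interpret convolution M F W \<phi> K \<mu> p
    by (intro convolution.intro vector_bm.intro vector_bm_axioms.intro convolution_axioms.intro)
       (auto simp: filtered_prob_space_def)
  \<comment> \<open>Any positive slack gives a continuous version; 1 is an arbitrary choice.\<close>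
  show "EX X. continuous_stoch_convolution M F W K \<phi> X" using X_convolution[of 1] by auto
  fix X assume "continuous_stoch_convolution M F W K \<phi> X"
  note moment_bound[OF this]
  moreover have "ennreal (real CARD('d) powr (p - 1) * real CARD('m) powr (p - 1) * cc p powr p * enn2real (M_const p \<mu>) powr p) \<le>
      ennreal (C_const p CARD('d) CARD('m) * enn2real (M_const p \<mu>) powr p)"
    by (intro ennreal_leI mult_right_mono C_const_ge) (use A in auto)
  ultimately show "(\<integral>\<^sup>+ \<omega>. (SUP t\<in>{0..}. ennreal (norm (X t \<omega>) powr p)) \<partial>M)
      \<le> ennreal (C_const p CARD('d) CARD('m) * enn2real (M_const p \<mu>) powr p) *
         (\<integral>\<^sup>+ s\<in>{0..}. (\<integral>\<^sup>+ \<omega>. ennreal (norm (\<phi> s \<omega>) powr p) \<partial>M) \<partial>lborel)"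
    by (rule order_trans[OF _ mult_right_mono]) simp
next
  fix \<beta> H :: real assume H: "\<beta> > 0 & 0 < H & H \<le> 1/2"
  thus "completely_monotone (scalar_kernel (K_gamma \<beta> H))" by (intro K_gamma_completely_monotone) auto
  fix \<nu> q assume "completely_monotone_with (scalar_kernel (K_gamma \<beta> H)) \<nu>" "q > 1 / H"
  thus "M_const q \<nu> < \<infinity>" using H by (intro K_gamma_M_const[of \<beta> H]) auto
next
  fix H l :: real assume H: "0 < H & H < 1/2 & l > 0"
  thus "completely_monotone (scalar_kernel (R_resolvent l H))" by (intro R_resolvent_completely_monotone(1)) auto
  fix \<nu> q assume "completely_monotone_with (scalar_kernel (R_resolvent l H)) \<nu>" "q > 1 / H"
  thus "M_const q \<nu> < \<infinity>" using H by (intro R_resolvent_completely_monotone(2)[of H l]) auto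
qed

end
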